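(* Let $n\ge 1$ and $i\in\{1,2,\ldots,n\}$. (1) There exists a structure of $U_q(\mathfrak{sl}_{n+1})_z$-module on the space $\langle\mathcal{Y}_i(z)\rangle$ such that $$\bar e_j\,a(z)=x_j^+(z)_\bullet a(z),\qquad f_j\,a(z)=x_j^-(z)_\bullet a(z),\qquad \bar k_j\,a(z)=\psi_j(z)_\bullet a(z)$$ for all $j=1,2,\ldots,n$ and all $a(z)\in\langle\mathcal{Y}_i(z)\rangle$. (2) The $U_q(\mathfrak{sl}_{n+1})_z$-modules $L(\lambda_i)_z$ and $\langle\mathcal{Y}_i(z)\rangle$ (the latter with the structure in (1)) are isomorphic.
   Context: **Notation.** $n\ge1$ is an integer, $q$ an indeterminate, $F=\mathbb{C}(q^{1/2})$, $[m]=\frac{q^m-q^{-m}}{q-q^{-1}}$. $(a_{ij})_{i,j=1}^n$ is the Cartan matrix of type $A_n$; $\alpha_1,\ldots,\alpha_n$ and $\lambda_1,\ldots,\lambda_n$ are the simple roots and fundamental weights of $\mathfrak{sl}_{n+1}$; $Q=\bigoplus\mathbb{Z}\alpha_i\subset P=\bigoplus\mathbb{Z}\lambda_i$; $(\cdot,\cdot)$ is the symmetric bilinear form with $(\alpha_i,\alpha_j)=a_{ij}$, $(\lambda_i,\alpha_j)=\delta_{ij}$. **The space $V$.** $K(1)$ is the symmetric algebra over $F$ on the symbols $a_i(-r)$, $1\le i\le n$, $r\in\mathbb{Z}_{>0}$; $a_i(-r)$ acts by multiplication and $a_i(r)$, $r>0$, acts as the derivation annihilating $1$ such that $[a_i(r),a_j(s)]=\delta_{r+s,0}\frac{[a_{ij}r][r]}{r}$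 for all $r,s\in\mathbb{Z}\setminus\{0\}$. $\mathbb{C}\{P\}$ is the (twisted group) algebra, with scalars in $F$, generated by the invertible elements $e^{\alpha_2},\ldots,e^{\alpha_n},e^{\lambda_n}$ with relations $e^{\alpha_i}e^{\alpha_j}=(-1)^{(\alpha_i,\alpha_j)}e^{\alpha_j}e^{\alpha_i}$, $e^{\alpha_i}e^{\lambda_n}=(-1)^{\delta_{in}}e^{\lambda_n}e^{\alpha_i}$ ($2\le i,j\le n$). For $\alpha=m_2\alpha_2+\cdots+m_n\alpha_n+m_{n+1}\lambda_n\in P$ put $e^\alpha=(e^{\alpha_2})^{m_2}\cdots(e^{\alpha_n})^{m_n}(e^{\lambda_n})^{m_{n+1}}$. Let $V=K(1)\otimes\mathbb{C}\{P\}$, $1=1\otimes e^0\in V$. The $e^\alpha$ act by left multiplication on $\mathbb{C}\{P\}$; $z^{\partial_\alpha}e^\beta=z^{(\alpha,\beta)}e^\beta$; $(-1)^{m\partial_\alpha}e^\beta=(-1)^{m(\alpha,\beta)}e^\beta$ with $(-1)^s=e^{\pi\sqrt{-1}s}$; $K_j^{\pm1}$ acts by $K_j^{\pm1}(v\otimes e^\beta)=q^{\pm(\alpha_j,\beta)}v\otimes e^\beta$. **Operators.** For $j=1,\ldots,n$: $$x_j^\pm(z)=\exp\Big(\pm\sum_{r\ge1}\tfrac{q^{\mp r/2}}{[r]}a_j(-r)z^r\Big)\exp\Big(\mp\sum_{r\ge1}\tfrac{q^{\mp r/2}}{[r]}a_j(r)z^{-r}\Big)\otimes e^{\pm\alpha_j}z^{\pm\partial_{\alpha_j}},$$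 $$\psi_j(z)=K_j\exp\Big((q-q^{-1})\sum_{r\ge1}a_j(r)z^{-r}\Big),\qquad \phi_j(z)=K_j^{-1}\exp\Big(-(q-q^{-1})\sum_{r\ge1}a_j(-r)z^{r}\Big),$$ elements of $\mathrm{Hom}(V,V((z)))$. For $l\ne0$ let $a_i^*(l)=\sum_{j=1}^n m_i^{(j)}a_j(l)$ with $m_i^{(j)}=\frac{[jl][(n-i+1)l]}{[(n+1)l][l]}$ if $j\le i$ and $m_i^{(j)}=\frac{[il][(n-j+1)l]}{[(n+1)l][l]}$ if $j>i$. For $i=1,\ldots,n$, $$\mathcal{Y}_i(z)=\exp\Big(\sum_{r\ge1}\tfrac{q^{r/2}}{[r]}a_i^*(-r)z^r\Big)\exp\Big(-\sum_{r\ge1}\tfrac{q^{r/2}}{[r]}a_i^*(r)z^{-r}\Big)\otimes e^{\lambda_i}(-1)^{(1-\delta_{in})i\,\partial_{\lambda_n}}z^{\partial_{\lambda_i}}\in\mathrm{Hom}(V,V((z^{1/(n+1)}))).$$ **Products.** A pair $(a(z),b(z))$, $a(z)\in\mathrm{Hom}(V,V((z)))$, $b(z)\in\mathrm{Hom}(V,V((z^{1/(n+1)})))$, is quasi compatible if there is a nonzero polynomial $p(z_1,z_2)\in F[z_1,z_2]$ with $p(z_1,z_2)a(z_1)b(z_2)\in\mathrm{Hom}(V,V((z_1,z_2^{1/(n+1)})))$. For such a pair, the products $a(z)_rb(z)$, $r\in\mathbb{Z}$, are defined by $$\sum_{r\in\mathbb{Z}}(a(z)_rb(z))z_0^{-r-1}=\iota_{z,z_0}\big(p(z_0+z,z)^{-1}\big)\,\big(p(z_1,z)a(z_1)b(z)\big)\big|_{z_1=z+z_0},$$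 where $\iota_{z,z_0}$ expands in $F((z))((z_0))$ (i.e. in nonnegative powers of $z_0$ up to a finite pole), and $z_1=z+z_0$ is likewise expanded in nonnegative powers of $z_0$; this is independent of $p$. For $c(z)\in\mathrm{Hom}(V,V((z^{1/(n+1)})))$ write $\mathrm{wt}\,c(z)=\alpha\in P$ if $c(z)1=d(z)\otimes e^\alpha$ for some $d(z)\in K(1)((z^{1/(n+1)}))$; e.g. $\mathrm{wt}\,x_j^\pm(z)=\pm\alpha_j$, $\mathrm{wt}\,\psi_j(z)=\mathrm{wt}\,\phi_j(z)=0$, $\mathrm{wt}\,\mathcal{Y}_i(z)=\lambda_i$. For a quasi compatible pair define $$a(z)_\bullet b(z)=\sum_{t\in\frac12\mathbb{Z}}\Big(\frac{1}{zq^t}\Big)^{(\mathrm{wt}\,a(z),\mathrm{wt}\,b(z))+1}q^t\,a(zq^t)_0b(z)$$ (a finite sum; $a(zq^t)_0b(z)$ is the zeroth product of the operators $a(zq^t)$ and $b(z)$), extended linearly in $b(z)$ to sums of operators with different weights. Iterated products are nested from the right: $a_1(z)_\bullet a_2(z)_\bullet b(z)=a_1(z)_\bullet(a_2(z)_\bullet b(z))$. **The space $\langle\mathcal{Y}_i(z)\rangle$.** It is the $F$-span of all $a_1(z)_\bullet\cdots{}_\bullet a_k(z)_\bullet\mathcal{Y}_i(z)$ with $k\ge0$ and each $a_s(z)\in\{x_j^\pm(z),\psi_j(z),\phi_j(z):j=1,\ldots,n\}$. **$U_q(\mathfrak{sl}_{n+1})$.** The associative unital $F$-algebra generated by $e_i,f_i,K_i^{\pm1}$,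 $1\le i\le n$, with relations $K_iK_j=K_jK_i$, $K_iK_i^{-1}=K_i^{-1}K_i=1$, $K_ie_jK_i^{-1}=q^{(\alpha_i,\alpha_j)}e_j$, $K_if_jK_i^{-1}=q^{-(\alpha_i,\alpha_j)}f_j$, $[e_i,f_j]=\delta_{ij}\frac{K_i-K_i^{-1}}{q-q^{-1}}$, and the $q$-Serre relations $\sum_{s=0}^m(-1)^s\frac{[m]!}{[s]![m-s]!}y_i^{m-s}y_jy_i^s=0$ for $i\ne j$, $m=1-a_{ij}$, $y=e$ and $y=f$ (here $[0]!=1$, $[k]!=[k]\cdots[1]$). $L(\lambda_i)$ is the irreducible highest weight module of highest weight $\lambda_i$ (so $K_j v_{\lambda_i}=q^{\delta_{ij}}v_{\lambda_i}$, $e_jv_{\lambda_i}=0$), with highest weight vector $v_{\lambda_i}$. **$U_q(\mathfrak{sl}_{n+1})_z$ and $L(\lambda_i)_z$.** For $j=1,\ldots,n$ let $$L_j=K_1^{n+1-j}K_2^{2(n+1-j)}\cdots K_{j-1}^{(j-1)(n+1-j)}K_j^{j(n+1-j)}K_{j+1}^{j(n-j)}\cdots K_n^{j},$$ and $M_j=q^{-(n+1)^2}$ if $j=1$ or $j=n$, $M_j=q^{-(n+1)^2}L_{j-1}L_{j+1}$ if $1<j<n$. Let $z_1,\ldots,z_n$ be commuting formal variables (commuting with $U_q(\mathfrak{sl}_{n+1})$) and $w_j=\exp((M_j-M_j^{-1})z_j)=\sum_{r\ge0}\frac{(M_j-M_j^{-1})^r}{r!}z_j^r\in U_q(\mathfrak{sl}_{n+1})[[z_1,\ldots,z_n]]$.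 Put $\bar e_j=e_jw_j$, $\bar k_j=(K_j-K_j^{-1})w_j$. $U_q(\mathfrak{sl}_{n+1})_z$ is the $F$-subalgebra of $U_q(\mathfrak{sl}_{n+1})[[z_1,\ldots,z_n]]$ generated by $\bar e_j,f_j,\bar k_j$, $j=1,\ldots,n$. The space $L(\lambda_i)[[z_1,\ldots,z_n]]$ is naturally a $U_q(\mathfrak{sl}_{n+1})[[z_1,\ldots,z_n]]$-module, hence a $U_q(\mathfrak{sl}_{n+1})_z$-module, and $L(\lambda_i)_z=U_q(\mathfrak{sl}_{n+1})_z\,v_{\lambda_i}\subset L(\lambda_i)[[z_1,\ldots,z_n]]$. *)

theory Defs
  imports
    Complex_Main
    "HOL-Library.Cardinality"
    "HOL-Library.Poly_Mapping"
    "HOL-Library.Groups_Big_Fun"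
    "HOL-Library.Function_Algebras"
    "HOL-Computational_Algebra.Computational_Algebra"
begin

section \<open>Scalars\<close>

text \<open>The field \<open>F = \<complex>(q\<^sup>1\<^sup>/\<^sup>2)\<close>; \<open>qh\<close> is \<open>q\<^sup>1\<^sup>/\<^sup>2\<close>.\<close>

type_synonym scal = "complex poly fract"

definition cst :: "complex \<Rightarrow> scal" where
  "cst c = Fract [:c:] 1"

definition qh :: scal where
  "qh = Fract [:0, 1:] 1"

definition qq :: scal where
  "qq = qh ^ 2"

definition qint :: "int \<Rightarrow> scal" where
  "qint m = (qq powi m - qq powi (- m)) / (qq - qq powi (- 1))"

definition qfact :: "nat \<Rightarrow> scal" where
  "qfact m = (\<Prod>k=1..m. qint (int k))"


section \<open>Dynkin diagram and weight lattice of type \<open>A\<^sub>n\<close>\<close>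

text \<open>The Dynkin diagram is a finite linearly ordered type \<open>'n\<close> with \<open>n = CARD('n)\<close>; its elements
  are the indices \<open>1, \<dots>, n\<close>, and \<open>idx\<close> gives the number of an index.\<close>

definition idx :: "'n::{finite,linorder} \<Rightarrow> nat" where
  "idx i = card {..i}"

lemma bij_idx: "bij_betw (idx :: 'n::{finite,linorder} \<Rightarrow> nat) UNIV {1..CARD('n)}"
proof -
  have inj: "inj (idx :: 'n \<Rightarrow> nat)"
  proof (rule linorder_injI)
    fix x y :: 'n assume "x < y"
    then have "{..x} \<subset> {..y}" by auto
    then have "idx x < idx y" unfolding idx_def by (simp add: psubset_card_mono)
    then show "idx x \<noteq> idx y" by simp
  qed
  have sub: "range (idx :: 'n \<Rightarrow> nat) \<subseteq> {1..CARD('n)}"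
    unfolding idx_def by (auto simp: Suc_le_eq card_gt_0_iff intro!: card_mono)
  have "card (range (idx :: 'n \<Rightarrow> nat)) = card {1..CARD('n)}"
    using inj by (simp add: card_image)
  with sub have "range (idx :: 'n \<Rightarrow> nat) = {1..CARD('n)}"
    by (intro card_subset_eq) auto
  with inj show ?thesis by (simp add: bij_betw_def)
qed

lemma idx_inject [simp]: "idx i = idx j \<longleftrightarrow> i = j"
  using bij_idx by (auto simp: bij_betw_def dest: injD)

lemma idx_ge1: "1 \<le> idx i" and idx_le: "idx (i :: 'n::{finite,linorder}) \<le> CARD('n)"
  using bij_idx[where 'n='n] by (auto simp: bij_betw_def)

lemma idx_pos [simp]: "0 < idx i" "idx i \<noteq> 0"
  using idx_ge1[of i] by simp_all

definition cartan :: "nat \<Rightarrow> nat \<Rightarrow> int" where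
  "cartan i j = (if i = j then 2 else if i = Suc j \<or> j = Suc i then - 1 else 0)"

lemma cartan_sym: "cartan i j = cartan j i"
  by (simp add: cartan_def)

text \<open>An element \<open>\<beta>\<close> of \<open>P\<close> is given by its coordinates with respect to the fundamental weights,
  \<open>\<beta> = \<Sum>\<^sub>i \<beta> i \<cdot> \<lambda>\<^sub>i\<close>. Hence \<open>\<alpha>\<^sub>j = \<Sum>\<^sub>k a\<^sub>k\<^sub>j \<lambda>\<^sub>k\<close> and \<open>(\<beta>, \<alpha>\<^sub>j) = \<beta> j\<close>.\<close>

type_synonym 'n wgt = "'n \<Rightarrow> int"

definition lam :: "'n::{finite,linorder} \<Rightarrow> 'n wgt" where
  "lam i = (\<lambda>k. if k = i then 1 else 0)"

definition alpha :: "'n::{finite,linorder} \<Rightarrow> 'n wgt" where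
  "alpha j = (\<lambda>k. cartan (idx k) (idx j))"

definition last_idx :: "'n::{finite,linorder}" where
  "last_idx = Max UNIV"

text \<open>The form with \<open>(\<lambda>\<^sub>i, \<lambda>\<^sub>j)\<close> the entries of the inverse Cartan matrix.\<close>

definition form :: "'n::{finite,linorder} wgt \<Rightarrow> 'n wgt \<Rightarrow> rat" where
  "form \<beta> \<gamma> = (\<Sum>i\<in>UNIV. \<Sum>j\<in>UNIV. of_int (\<beta> i * \<gamma> j) *
     (of_nat (min (idx i) (idx j)) * (of_nat (CARD('n) + 1) - of_nat (max (idx i) (idx j)))
       / of_nat (CARD('n) + 1)))"

lemma sum_cartan:
  fixes g :: "nat \<Rightarrow> 'a::comm_ring_1"
  assumes "g 0 = 0" "g (Suc n) = 0" "1 \<le> j" "j \<le> n"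
  shows "(\<Sum>k=1..n. of_int (cartan k j) * g k) = 2 * g j - g (j - 1) - g (j + 1)"
proof -
  have "(\<Sum>k=1..n. of_int (cartan k j) * g k) = (\<Sum>k=0..Suc n. of_int (cartan k j) * g k)"
    using assms by (intro sum.mono_neutral_left) (auto simp: not_le le_Suc_eq)
  also have "\<dots> = (\<Sum>k\<in>{j, j - 1, j + 1}. of_int (cartan k j) * g k)"
    using assms by (intro sum.mono_neutral_right) (auto simp: cartan_def)
  also have "\<dots> = 2 * g j - g (j - 1) - g (j + 1)"
    using assms by (simp add: cartan_def)
  finally show ?thesis .
qed

lemma form_alpha: "form \<beta> (alpha j) = of_int (\<beta> (j :: 'n::{finite,linorder}))"
proof -
  let ?n = "CARD('n)"
  define h where "h i k = (of_nat (min i k) * (of_nat (?n + 1) - of_nat (max i k)) :: rat)"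
    for i k :: nat
  define g where "g i k = h i k / of_nat (?n + 1)" for i k :: nat
  have *: "(\<Sum>k\<in>UNIV. of_int (alpha j k) * g (idx i) (idx k)) = (if i = j then 1 else 0)" for i :: 'n
  proof -
    have "(\<Sum>k\<in>UNIV. of_int (alpha j k) * g (idx i) (idx k))
        = (\<Sum>k\<in>(UNIV :: 'n set). (\<lambda>k. of_int (cartan k (idx j)) * g (idx i) k) (idx k))"
      by (simp add: alpha_def)
    also have "\<dots> = (\<Sum>k=1..?n. of_int (cartan k (idx j)) * g (idx i) k)"
      by (rule sum.reindex_bij_betw[OF bij_idx])
    also have "\<dots> = 2 * g (idx i) (idx j) - g (idx i) (idx j - 1) - g (idx i) (idx j + 1)"
      using idx_ge1[of j] idx_le[of j] idx_le[of i] by (intro sum_cartan) (auto simp: g_def h_def)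
    also have "\<dots> = (2 * h (idx i) (idx j) - h (idx i) (idx j - 1) - h (idx i) (idx j + 1))
        / of_nat (?n + 1)"
      by (simp add: g_def diff_divide_distrib)
    also have "2 * h (idx i) (idx j) - h (idx i) (idx j - 1) - h (idx i) (idx j + 1)
        = (if idx i = idx j then of_nat (?n + 1) else 0)"
    proof (cases "idx i" "idx j" rule: linorder_cases)
      case greater
      then have "idx i = Suc (idx j) \<or> Suc (idx j) < idx i" by auto
      with greater show ?thesis using idx_ge1[of j]
        by (auto simp: h_def min_def max_def of_nat_diff algebra_simps)
    qed (use idx_ge1[of j] idx_ge1[of i] in
        \<open>auto simp: h_def min_def max_def of_nat_diff algebra_simps\<close>)
    finally show ?thesis by simp
  qed
  have "form \<beta> (alpha j) = (\<Sum>i\<in>UNIV. of_int (\<beta> i) * (\<Sum>k\<in>UNIV. of_int (alpha j k) * g (idx i) (idx k)))"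
    by (simp add: form_def g_def h_def sum_distrib_left mult_ac)
  also have "\<dots> = of_int (\<beta> j)" by (simp add: * if_distrib cong: if_cong)
  finally show ?thesis .
qed

lemma form_alpha_alpha: "form (alpha i) (alpha j) = of_int (cartan (idx i) (idx j))"
  and form_lam_alpha: "form (lam i) (alpha j) = (if i = j then 1 else 0)"
  by (simp_all only: form_alpha) (simp_all add: alpha_def lam_def cartan_def)


section \<open>The twisted group algebra \<open>\<complex>{P}\<close>\<close>

text \<open>\<open>\<alpha>\<^sub>2, \<dots>, \<alpha>\<^sub>n, \<lambda>\<^sub>n\<close> is a basis of \<open>P\<close>. The coordinates with respect to it are numbered
  \<open>2, \<dots>, n + 1\<close>; the formula comes from \<open>\<lambda>\<^sub>i = (n + 1 - i) \<lambda>\<^sub>n - \<Sum>\<^sub>k\<^sub>>\<^sub>i (k - i) \<alpha>\<^sub>k\<close>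
  (note that \<open>k - idx i\<close> is truncated).\<close>

definition mcoord :: "'n::{finite,linorder} wgt \<Rightarrow> nat \<Rightarrow> int" where
  "mcoord \<beta> k = (if k \<le> CARD('n) then - 1 else 1) * (\<Sum>i\<in>UNIV. int (k - idx i) * \<beta> i)"

lemma idx_last: "idx (last_idx :: 'n::{finite,linorder}) = CARD('n)"
proof -
  have "{..(last_idx :: 'n)} = UNIV" by (auto simp: last_idx_def)
  then show ?thesis by (simp add: idx_def)
qed

lemma wgt_mcoord:
  fixes \<beta> :: "'n::{finite,linorder} wgt"
  shows "\<beta> i = (\<Sum>j\<in>{j. 2 \<le> idx j}. mcoord \<beta> (idx j) * alpha j i)
                 + mcoord \<beta> (CARD('n) + 1) * lam last_idx i"
proof -
  let ?n = "CARD('n)"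
  define S where "S k = (\<Sum>j\<in>UNIV. int (k - idx j) * \<beta> j)" for k
  have S0: "S 0 = 0" "S (Suc 0) = 0"
    using idx_ge1 by (auto simp: S_def Suc_le_eq intro!: sum.neutral)
  define g where "g k = (if k \<le> ?n then - S k else 0)" for k
  have "(\<Sum>j\<in>{j. 2 \<le> idx j}. mcoord \<beta> (idx j) * alpha j i)
      = (\<Sum>j\<in>UNIV. mcoord \<beta> (idx j) * alpha j i)"
  proof (rule sum.mono_neutral_left; (intro ballI)?)
    fix j :: 'n assume "j \<in> UNIV - {j. 2 \<le> idx j}"
    with idx_ge1[of j] have "idx j = Suc 0" by auto
    with S0 show "mcoord \<beta> (idx j) * alpha j i = 0" by (simp add: mcoord_def S_def)
  qed auto
  also have "\<dots> = (\<Sum>j\<in>(UNIV :: 'n set). (\<lambda>k. of_int (cartan k (idx i)) * g k) (idx j))"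
    by (intro sum.cong) (simp_all add: mcoord_def S_def g_def alpha_def idx_le cartan_sym mult.commute)
  also have "\<dots> = (\<Sum>k=1..?n. of_int (cartan k (idx i)) * g k)"
    by (rule sum.reindex_bij_betw[OF bij_idx])
  also have "\<dots> = 2 * g (idx i) - g (idx i - 1) - g (idx i + 1)"
    using idx_ge1[of i] idx_le[of i] by (intro sum_cartan) (auto simp: g_def S0)
  also have "\<dots> + mcoord \<beta> (?n + 1) * lam last_idx i
      = S (idx i - 1) + S (idx i + 1) - 2 * S (idx i)"
  proof (cases "i = last_idx")
    case True
    then show ?thesis using idx_last[where 'n='n]
      by (auto simp: g_def lam_def mcoord_def S_def)
  next
    case False
    then have "idx i \<noteq> ?n" by (metis idx_inject idx_last)
    with idx_le[of i] show ?thesis using False by (auto simp: g_def lam_def)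
  qed
  also have "\<dots> = (\<Sum>j\<in>UNIV. (int (idx i - 1 - idx j) + int (idx i + 1 - idx j)
      - 2 * int (idx i - idx j)) * \<beta> j)"
    by (simp add: S_def sum.distrib sum_subtractf sum_distrib_left algebra_simps)
  also have "\<dots> = (\<Sum>j\<in>UNIV. if j = i then \<beta> j else 0)"
  proof (rule sum.cong, simp)
    fix j :: 'n
    show "(int (idx i - 1 - idx j) + int (idx i + 1 - idx j) - 2 * int (idx i - idx j)) * \<beta> j
        = (if j = i then \<beta> j else 0)"
      using idx_ge1[of i] idx_ge1[of j]
      by (cases "idx i" "idx j" rule: linorder_cases) (auto simp: of_nat_diff)
  qed
  finally show ?thesis by simp
qed

lemma mcoord_alpha:
  assumes "2 \<le> idx (j :: 'n::{finite,linorder})" "k \<le> CARD('n) + 1"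
  shows "mcoord (alpha j) k = (if k = idx j then 1 else 0)"
proof -
  let ?n = "CARD('n)"
  define g where "g i = (if i = 0 then 0 else int (k - i))" for i
  have "(\<Sum>i\<in>UNIV. int (k - idx i) * alpha j i)
      = (\<Sum>i\<in>(UNIV :: 'n set). (\<lambda>i. of_int (cartan i (idx j)) * g i) (idx i))"
    by (intro sum.cong) (auto simp: g_def alpha_def idx_pos)
  also have "\<dots> = (\<Sum>i=1..?n. of_int (cartan i (idx j)) * g i)"
    by (rule sum.reindex_bij_betw[OF bij_idx])
  also have "\<dots> = 2 * g (idx j) - g (idx j - 1) - g (idx j + 1)"
    using assms idx_le[of j] by (intro sum_cartan) (auto simp: g_def)
  also have "\<dots> = (if k = idx j then - 1 else 0)"
    using assms by (cases k "idx j" rule: linorder_cases) (auto simp: g_def of_nat_diff)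
  finally show ?thesis using idx_le[of j] by (auto simp: mcoord_def)
qed

lemma mcoord_lam_last:
  assumes "k \<le> CARD('n) + 1"
  shows "mcoord (lam (last_idx :: 'n::{finite,linorder})) k = (if k = CARD('n) + 1 then 1 else 0)"
proof -
  have "(\<Sum>i\<in>UNIV. int (k - idx i) * lam (last_idx :: 'n) i) = int (k - CARD('n))"
    by (simp add: lam_def idx_last if_distrib cong: if_cong)
  then show ?thesis using assms by (auto simp: mcoord_def)
qed

text \<open>The elements \<open>e\<^sup>\<beta>\<close>, being the monomials in \<open>e\<^sup>\<alpha>\<^sup>2, \<dots>, e\<^sup>\<alpha>\<^sup>n, e\<^sup>\<lambda>\<^sup>n\<close> (in this order), form an
  \<open>F\<close>-basis of \<open>\<complex>{P}\<close>. Moving the generators of the second monomial of \<open>e\<^sup>\<gamma> e\<^sup>\<beta>\<close> to the left past the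
  later generators of the first one gives \<open>e\<^sup>\<gamma> e\<^sup>\<beta> = eps \<gamma> \<beta> \<cdot> e\<^sup>\<gamma>\<^sup>+\<^sup>\<beta>\<close>.
  \<open>comm_exp n k l\<close> is the exponent in the commutation relation of the generators \<open>k\<close> and \<open>l\<close>.\<close>

definition comm_exp :: "nat \<Rightarrow> nat \<Rightarrow> nat \<Rightarrow> int" where
  "comm_exp n k l = (if k \<le> n then cartan k l else if l = n then 1 else 0)"

definition eps_exp :: "'n::{finite,linorder} wgt \<Rightarrow> 'n wgt \<Rightarrow> int" where
  "eps_exp \<gamma> \<beta> = (\<Sum>k=2..CARD('n) + 1. \<Sum>l\<in>{2..<k}. comm_exp CARD('n) k l * mcoord \<gamma> k * mcoord \<beta> l)"

definition eps :: "'n::{finite,linorder} wgt \<Rightarrow> 'n wgt \<Rightarrow> int" where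
  "eps \<gamma> \<beta> = (if even (eps_exp \<gamma> \<beta>) then 1 else - 1)"

text \<open>Associativity, the defining relations and the normalisation of \<open>e\<^sup>\<beta>\<close> as an ordered monomial.\<close>

lemma mcoord_add: "mcoord (\<beta> + \<gamma>) k = mcoord \<beta> k + mcoord \<gamma> k"
  by (simp add: mcoord_def sum.distrib distrib_left)

lemma eps_assoc: "eps \<gamma> (\<beta> + \<delta>) * eps \<beta> \<delta> = eps \<gamma> \<beta> * eps (\<gamma> + \<beta>) \<delta>"
proof -
  have "eps_exp \<gamma> (\<beta> + \<delta>) = eps_exp \<gamma> \<beta> + eps_exp \<gamma> \<delta>"
    "eps_exp (\<gamma> + \<beta>) \<delta> = eps_exp \<gamma> \<delta> + eps_exp \<beta> \<delta>"
    by (simp_all add: eps_exp_def mcoord_add sum.distrib algebra_simps)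
  then show ?thesis by (auto simp: eps_def)
qed

lemma eps_exp_gen:
  fixes \<gamma> \<beta> :: "'n::{finite,linorder} wgt"
  assumes "\<And>x. x \<le> CARD('n) + 1 \<Longrightarrow> mcoord \<gamma> x = (if x = k then 1 else 0)"
    "\<And>x. x \<le> CARD('n) + 1 \<Longrightarrow> mcoord \<beta> x = (if x = l then 1 else 0)"
    "2 \<le> k" "k \<le> CARD('n) + 1" "2 \<le> l"
  shows "eps_exp \<gamma> \<beta> = (if l < k then comm_exp CARD('n) k l else 0)"
proof -
  have "eps_exp \<gamma> \<beta> = (\<Sum>x=2..CARD('n) + 1. if x = k then
      (\<Sum>y\<in>{2..<k}. if y = l then comm_exp CARD('n) k l else 0) else 0)"
    unfolding eps_exp_def
  proof (intro sum.cong refl)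
    fix x assume x: "x \<in> {2..CARD('n) + 1}"
    have "(\<Sum>y\<in>{2..<x}. comm_exp CARD('n) x y * mcoord \<gamma> x * mcoord \<beta> y)
        = (\<Sum>y\<in>{2..<x}. if x = k then if y = l then comm_exp CARD('n) k l else 0 else 0)"
      using x assms by (intro sum.cong) auto
    then show "(\<Sum>y\<in>{2..<x}. comm_exp CARD('n) x y * mcoord \<gamma> x * mcoord \<beta> y)
        = (if x = k then \<Sum>y\<in>{2..<k}. if y = l then comm_exp CARD('n) k l else 0 else 0)"
      by auto
  qed
  then show ?thesis using assms by simp
qed

lemma eps_alpha_alpha:
  assumes "2 \<le> idx i" "2 \<le> idx j"
  shows "eps (alpha i) (alpha j)
    = (if even (cartan (idx i) (idx j)) then 1 else - 1) * eps (alpha j) (alpha i)"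
proof -
  have "eps_exp (alpha a) (alpha b) = (if idx b < idx a then cartan (idx a) (idx b) else 0)"
    if "2 \<le> idx a" "2 \<le> idx b" for a b :: 'a
    using that idx_le[of a] idx_le[of b]
    by (subst eps_exp_gen[where k = "idx a" and l = "idx b"]) (auto simp: mcoord_alpha comm_exp_def)
  with assms show ?thesis by (auto simp: eps_def cartan_def)
qed

lemma eps_alpha_lam:
  assumes "2 \<le> idx i"
  shows "eps (alpha i) (lam last_idx) = (if i = last_idx then - 1 else 1) * eps (lam last_idx) (alpha i)"
proof -
  have "eps_exp (alpha i) (lam last_idx) = 0"
    using assms idx_le[of i]
    by (subst eps_exp_gen[where k = "idx i" and l = "CARD('a) + 1"])
      (auto simp: mcoord_alpha mcoord_lam_last)
  moreover have "eps_exp (lam last_idx) (alpha i) = (if i = last_idx then 1 else 0)"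
    using assms idx_le[of i]
    by (subst eps_exp_gen[where k = "CARD('a) + 1" and l = "idx i"])
      (auto simp: mcoord_alpha mcoord_lam_last comm_exp_def simp flip: idx_last)
  ultimately show ?thesis by (auto simp: eps_def)
qed

lemma eps_ordered:
  fixes \<gamma> \<beta> :: "'n::{finite,linorder} wgt"
  assumes "\<And>k l. 2 \<le> l \<Longrightarrow> l < k \<Longrightarrow> k \<le> CARD('n) + 1 \<Longrightarrow> mcoord \<gamma> k = 0 \<or> mcoord \<beta> l = 0"
  shows "eps \<gamma> \<beta> = 1"
proof -
  have "eps_exp \<gamma> \<beta> = 0"
    unfolding eps_exp_def using assms by (intro sum.neutral ballI) (auto; metis)
  then show ?thesis by (simp add: eps_def)
qed


section \<open>The space \<open>V = K(1) \<otimes> \<complex>{P}\<close>\<close>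

text \<open>\<open>K(1)\<close> is the polynomial algebra in the variables \<open>a\<^sub>i(-r)\<close>, \<open>r \<ge> 1\<close>, where \<open>a\<^sub>i(-r)\<close> is the
  variable with index \<open>(i, r - 1)\<close>.\<close>

type_synonym 'n K1 = "(('n \<times> nat) \<Rightarrow>\<^sub>0 nat) \<Rightarrow>\<^sub>0 scal"

definition kconst :: "scal \<Rightarrow> 'n K1" where
  "kconst c = Poly_Mapping.single 0 c"

definition kvar :: "'n \<times> nat \<Rightarrow> 'n K1" where
  "kvar x = Poly_Mapping.single (Poly_Mapping.single x 1) 1"

definition kderiv :: "'n \<times> nat \<Rightarrow> 'n K1 \<Rightarrow> 'n K1" where
  "kderiv x p = (\<Sum>m\<in>Poly_Mapping.keys p. Poly_Mapping.single (m - Poly_Mapping.single x 1)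
     (of_nat (Poly_Mapping.lookup m x) * Poly_Mapping.lookup p m))"

text \<open>The action of \<open>a\<^sub>i(l)\<close>, \<open>l \<noteq> 0\<close>, on \<open>K(1)\<close>.\<close>

definition heisK :: "'n::{finite,linorder} \<Rightarrow> int \<Rightarrow> 'n K1 \<Rightarrow> 'n K1" where
  "heisK i l p =
    (if l < 0 then kvar (i, nat (- l) - 1) * p
     else if l > 0 then
       (\<Sum>j\<in>UNIV. kconst (qint (cartan (idx i) (idx j) * l) * qint l / of_int l) * kderiv (j, nat l - 1) p)
     else 0)"

text \<open>\<open>V\<close> is the direct sum of the spaces \<open>K(1) \<otimes> e\<^sup>\<beta>\<close>, so \<open>single \<beta> p\<close> is \<open>p \<otimes> e\<^sup>\<beta>\<close>.\<close>

type_synonym 'n V = "'n wgt \<Rightarrow>\<^sub>0 'n K1"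

definition vscale :: "scal \<Rightarrow> 'n V \<Rightarrow> 'n V" where
  "vscale c v = Poly_Mapping.map (\<lambda>p. kconst c * p) v"

definition heis :: "'n::{finite,linorder} \<Rightarrow> int \<Rightarrow> 'n V \<Rightarrow> 'n V" where
  "heis i l v = Poly_Mapping.map (heisK i l) v"

definition dual_coeff :: "'n::{finite,linorder} \<Rightarrow> 'n \<Rightarrow> int \<Rightarrow> scal" where
  "dual_coeff i j l =
    (if idx j \<le> idx i
     then qint (int (idx j) * l) * qint (int (CARD('n) + 1 - idx i) * l)
     else qint (int (idx i) * l) * qint (int (CARD('n) + 1 - idx j) * l))
    / (qint (int (CARD('n) + 1) * l) * qint l)"

definition heis_dual :: "'n::{finite,linorder} \<Rightarrow> int \<Rightarrow> 'n V \<Rightarrow> 'n V" where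
  "heis_dual i l v = (\<Sum>j\<in>UNIV. vscale (dual_coeff i j l) (heis j l v))"

definition emul :: "'n::{finite,linorder} wgt \<Rightarrow> 'n V \<Rightarrow> 'n V" where
  "emul \<gamma> v = (\<Sum>\<beta>\<in>Poly_Mapping.keys v.
     Poly_Mapping.single (\<gamma> + \<beta>) (of_int (eps \<gamma> \<beta>) * Poly_Mapping.lookup v \<beta>))"

text \<open>\<open>(-1)\<^sup>m\<^sup>\<partial>\<^sup>\<gamma>\<close> with \<open>(-1)\<^sup>s = exp (\<pi> \<i> s)\<close>.\<close>

definition sgn_del :: "int \<Rightarrow> 'n::{finite,linorder} wgt \<Rightarrow> 'n V \<Rightarrow> 'n V" where
  "sgn_del m \<gamma> v = (\<Sum>\<beta>\<in>Poly_Mapping.keys v. Poly_Mapping.single \<beta>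
     (kconst (cst (exp (\<i> * of_real pi * of_rat (of_int m * form \<gamma> \<beta>)))) * Poly_Mapping.lookup v \<beta>))"

text \<open>\<open>K_op 1 j\<close> is \<open>K\<^sub>j\<close> and \<open>K_op (- 1) j\<close> is its inverse; recall \<open>(\<alpha>\<^sub>j, \<beta>) = \<beta> j\<close>.\<close>

definition K_op :: "int \<Rightarrow> 'n::{finite,linorder} \<Rightarrow> 'n V \<Rightarrow> 'n V" where
  "K_op s j v = (\<Sum>\<beta>\<in>Poly_Mapping.keys v. Poly_Mapping.single \<beta>
     (kconst (qq powi (s * \<beta> j)) * Poly_Mapping.lookup v \<beta>))"


section \<open>Operator-valued formal series\<close>

text \<open>A series \<open>a(z)\<close> in rational powers of \<open>z\<close> with coefficients operators on \<open>V\<close>: \<open>a v s\<close> is the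
  coefficient of \<open>z\<^sup>s\<close> in \<open>a(z)v\<close>. The elements of \<open>Hom(V, V((z\<^sup>1\<^sup>/\<^sup>(\<^sup>n\<^sup>+\<^sup>1\<^sup>))))\<close> are such series.
  Sums over an infinite index set below have only finitely many nonzero terms where they are used.\<close>

type_synonym 'n oper = "'n V \<Rightarrow> rat \<Rightarrow> 'n V"

definition oscale :: "scal \<Rightarrow> 'n oper \<Rightarrow> 'n oper" where
  "oscale c a = (\<lambda>v s. vscale c (a v s))"

lemma lookup_vscale: "Poly_Mapping.lookup (vscale c v) \<beta> = kconst c * Poly_Mapping.lookup v \<beta>"
  by (simp add: vscale_def Poly_Mapping.map.rep_eq when_def)

lemma module_oscale: "module oscale"
  by unfold_locales
    (auto simp: oscale_def fun_eq_iff poly_mapping_eq_iff lookup_vscale lookup_add kconst_def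
      distrib_left distrib_right single_add mult_single mult.assoc[symmetric])

definition ocomp :: "'n oper \<Rightarrow> 'n oper \<Rightarrow> 'n oper"  (infixr \<open>\<star>\<close> 70) where
  "a \<star> b = (\<lambda>v s. Sum_any (\<lambda>r. a (b v (s - r)) r))"

text \<open>\<open>opow h k m\<close> and \<open>opexp h m\<close> are the coefficients of \<open>u\<^sup>m\<close> in the \<open>k\<close>-th power and in the
  exponential of \<open>\<Sum>\<^sub>r\<^sub>\<ge>\<^sub>1 h(r) u\<^sup>r\<close>.\<close>

primrec opow :: "(nat \<Rightarrow> 'n V \<Rightarrow> 'n V) \<Rightarrow> nat \<Rightarrow> nat \<Rightarrow> 'n V \<Rightarrow> 'n V" where
  "opow h 0 m v = (if m = 0 then v else 0)"
| "opow h (Suc k) m v = (\<Sum>r=1..m. h r (opow h k (m - r) v))"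

definition opexp :: "(nat \<Rightarrow> 'n V \<Rightarrow> 'n V) \<Rightarrow> nat \<Rightarrow> 'n V \<Rightarrow> 'n V" where
  "opexp h m v = (\<Sum>k\<le>m. vscale (cst (1 / fact k)) (opow h k m v))"

text \<open>\<open>exp_cre c a = exp (\<Sum>\<^sub>r\<^sub>\<ge>\<^sub>1 c(r) a(-r) z\<^sup>r)\<close> and \<open>exp_ann c a = exp (\<Sum>\<^sub>r\<^sub>\<ge>\<^sub>1 c(r) a(r) z\<^sup>-\<^sup>r)\<close>.\<close>

definition exp_cre :: "(nat \<Rightarrow> scal) \<Rightarrow> (int \<Rightarrow> 'n V \<Rightarrow> 'n V) \<Rightarrow> 'n oper" where
  "exp_cre c a v s =
    (if s \<in> \<nat> then opexp (\<lambda>r w. vscale (c r) (a (- int r) w)) (nat \<lfloor>s\<rfloor>) v else 0)"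

definition exp_ann :: "(nat \<Rightarrow> scal) \<Rightarrow> (int \<Rightarrow> 'n V \<Rightarrow> 'n V) \<Rightarrow> 'n oper" where
  "exp_ann c a v s =
    (if - s \<in> \<nat> then opexp (\<lambda>r w. vscale (c r) (a (int r) w)) (nat \<lfloor>- s\<rfloor>) v else 0)"

text \<open>The operator \<open>z\<^sup>\<partial>\<^sup>\<gamma>\<close>.\<close>

definition z_del :: "'n::{finite,linorder} wgt \<Rightarrow> 'n oper" where
  "z_del \<gamma> v s = (\<Sum>\<beta>\<in>{\<beta> \<in> Poly_Mapping.keys v. form \<gamma> \<beta> = s}.
     Poly_Mapping.single \<beta> (Poly_Mapping.lookup v \<beta>))"

text \<open>\<open>x_op 1 j\<close> is \<open>x\<^sub>j\<^sup>+(z)\<close> and \<open>x_op (- 1) j\<close> is \<open>x\<^sub>j\<^sup>-(z)\<close>.\<close>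

definition x_op :: "int \<Rightarrow> 'n::{finite,linorder} \<Rightarrow> 'n oper" where
  "x_op s j =
     exp_cre (\<lambda>r. of_int s * (qh powi (- s * int r) / qint (int r))) (heis j) \<star>
     exp_ann (\<lambda>r. - of_int s * (qh powi (- s * int r) / qint (int r))) (heis j) \<star>
     (let \<gamma> = (\<lambda>k. s * alpha j k) in (\<lambda>v t. emul \<gamma> (z_del \<gamma> v t)))"

definition psi_op :: "'n::{finite,linorder} \<Rightarrow> 'n oper" where
  "psi_op j = (\<lambda>v s. K_op 1 j (exp_ann (\<lambda>r. qq - qq powi (- 1)) (heis j) v s))"

definition phi_op :: "'n::{finite,linorder} \<Rightarrow> 'n oper" where
  "phi_op j = (\<lambda>v s. K_op (- 1) j (exp_cre (\<lambda>r. - (qq - qq powi (- 1))) (heis j) v s))"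

definition Y_op :: "'n::{finite,linorder} \<Rightarrow> 'n oper" where
  "Y_op i =
     exp_cre (\<lambda>r. qh powi (int r) / qint (int r)) (heis_dual i) \<star>
     exp_ann (\<lambda>r. - (qh powi (int r) / qint (int r))) (heis_dual i) \<star>
     (\<lambda>v s. emul (lam i)
       (sgn_del (if i = last_idx then 0 else int (idx i)) (lam last_idx) (z_del (lam i) v s)))"


section \<open>Products of operators\<close>

text \<open>A polynomial \<open>p(z\<^sub>1, z\<^sub>2)\<close> is an element of \<open>F[z\<^sub>2][z\<^sub>1]\<close>. The series \<open>p(z\<^sub>1, z\<^sub>2) a(z\<^sub>1) b(z\<^sub>2) v\<close> has
  coefficient \<open>poly_prod p a b v r s\<close> at \<open>z\<^sub>1\<^sup>r z\<^sub>2\<^sup>s\<close>.\<close>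

definition poly_prod :: "scal poly poly \<Rightarrow> 'n oper \<Rightarrow> 'n oper \<Rightarrow> 'n V \<Rightarrow> rat \<Rightarrow> rat \<Rightarrow> 'n V" where
  "poly_prod p a b v r s = (\<Sum>i\<le>degree p. \<Sum>j\<le>degree (coeff p i).
     vscale (coeff (coeff p i) j) (a (b v (s - of_nat j)) (r - of_nat i)))"

text \<open>The space \<open>V((z\<^sub>1, z\<^sub>2\<^sup>1\<^sup>/\<^sup>(\<^sup>n\<^sup>+\<^sup>1\<^sup>)))\<close> of series whose exponents of \<open>z\<^sub>1\<close> and of \<open>z\<^sub>2\<close> are (jointly) bounded
  below.\<close>

definition laurent2 :: "(rat \<Rightarrow> rat \<Rightarrow> 'n::{finite,linorder} V) set" where
  "laurent2 = {g. \<exists>N. \<forall>r s. g r s \<noteq> 0 \<longrightarrow>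
     r \<in> \<int> \<and> of_nat (CARD('n) + 1) * s \<in> \<int> \<and> N \<le> r \<and> N \<le> s}"

definition qc_poly :: "scal poly poly \<Rightarrow> 'n::{finite,linorder} oper \<Rightarrow> 'n oper \<Rightarrow> bool" where
  "qc_poly p a b \<longleftrightarrow> p \<noteq> 0 \<and> (\<forall>v. poly_prod p a b v \<in> laurent2)"

text \<open>\<open>p(z\<^sub>0 + z, z)\<close> in the field \<open>F((z))((z\<^sub>0))\<close>: the outer variable is \<open>z\<^sub>0\<close>, the inner one is \<open>z\<close>.
  Its inverse in this field is \<open>\<iota>\<^sub>z\<^sub>,\<^sub>z\<^sub>0 (p(z\<^sub>0 + z, z)\<^sup>-\<^sup>1)\<close>.\<close>

definition poly_shift :: "scal poly poly \<Rightarrow> scal fls fls" where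
  "poly_shift p =
     poly (map_poly (\<lambda>c. fls_const (fps_to_fls (fps_of_poly c))) p) (fls_X + fls_const fls_X)"

text \<open>Coefficient of \<open>z\<^sub>0\<^sup>u z\<^sup>s\<close> in \<open>g(z\<^sub>1, z)\<close> at \<open>z\<^sub>1 = z + z\<^sub>0\<close>, expanded in nonnegative powers of \<open>z\<^sub>0\<close>.\<close>

definition subst_sum :: "(rat \<Rightarrow> rat \<Rightarrow> 'n V) \<Rightarrow> nat \<Rightarrow> rat \<Rightarrow> 'n V" where
  "subst_sum g u s = Sum_any (\<lambda>k::int.
     vscale (cst (of_int k gchoose u)) (g (of_int k) (s - of_int k + of_nat u)))"

text \<open>The \<open>r\<close>-th product \<open>a(z)\<^sub>r b(z)\<close> of a quasi compatible pair, i.e. the coefficient of \<open>z\<^sub>0\<^sup>-\<^sup>r\<^sup>-\<^sup>1\<close>; it does not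
  depend on the choice of \<open>p\<close>.\<close>

definition nth_prod :: "'n::{finite,linorder} oper \<Rightarrow> int \<Rightarrow> 'n oper \<Rightarrow> 'n oper" where
  "nth_prod a r b = (let p = (SOME p. qc_poly p a b); R = inverse (poly_shift p) in
     (\<lambda>v s. Sum_any (\<lambda>u::nat. Sum_any (\<lambda>l::int.
        vscale (fls_nth (fls_nth R (- r - 1 - int u)) l)
          (subst_sum (poly_prod p a b v) u (s - of_int l))))))"

text \<open>Weights. An operator \<open>c(z)\<close> has weight \<open>\<alpha>\<close> if it maps every \<open>K(1) \<otimes> e\<^sup>\<beta>\<close> into series over
  \<open>K(1) \<otimes> e\<^sup>\<alpha>\<^sup>+\<^sup>\<beta>\<close>. For \<open>\<beta> = 0\<close> this contains \<open>c(z)1 = d(z) \<otimes> e\<^sup>\<alpha>\<close>, which by itself does not determine \<open>\<alpha>\<close>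
  when \<open>c(z)1 = 0\<close>; the latter happens for nonzero elements of the span of the iterated products.
  \<open>wt_part b \<beta>\<close> is the component of weight \<open>\<beta>\<close> of a sum \<open>b(z)\<close> of operators with different weights.\<close>

definition has_wt :: "'n::{finite,linorder} oper \<Rightarrow> 'n wgt \<Rightarrow> bool" where
  "has_wt c \<alpha> \<longleftrightarrow> (\<forall>\<beta> p s. Poly_Mapping.keys (c (Poly_Mapping.single \<beta> p) s) \<subseteq> {\<alpha> + \<beta>})"

definition wt :: "'n::{finite,linorder} oper \<Rightarrow> 'n wgt" where
  "wt c = (THE \<alpha>. has_wt c \<alpha>)"

definition wt_part :: "'n::{finite,linorder} oper \<Rightarrow> 'n wgt \<Rightarrow> 'n oper" where
  "wt_part b \<beta> = (\<lambda>v s. \<Sum>\<gamma>\<in>Poly_Mapping.keys v. Poly_Mapping.single (\<beta> + \<gamma>)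
     (Poly_Mapping.lookup (b (Poly_Mapping.single \<gamma> (Poly_Mapping.lookup v \<gamma>)) s) (\<beta> + \<gamma>)))"

text \<open>\<open>a(zq\<^sup>t)\<close> for \<open>t = h/2\<close> and \<open>a(z)\<close> a series in integral powers of \<open>z\<close>.\<close>

definition scale_arg :: "int \<Rightarrow> 'n oper \<Rightarrow> 'n oper" where
  "scale_arg h a = (\<lambda>v s. vscale (qh powi (h * \<lfloor>s\<rfloor>)) (a v s))"

text \<open>The summand \<open>(1/(zq\<^sup>t))\<^sup>m\<^sup>+\<^sup>1 q\<^sup>t a(zq\<^sup>t)\<^sub>0 b(z)\<close>, \<open>t = h/2\<close>, of \<open>a(z)\<^sub>\<bullet> b(z)\<close>, where
  \<open>m = (wt a(z), wt b(z))\<close>. This is an integer since \<open>wt a(z)\<close> lies in the root lattice for all \<open>a(z)\<close>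
  that occur.\<close>

definition bullet_term :: "int \<Rightarrow> 'n::{finite,linorder} oper \<Rightarrow> 'n oper \<Rightarrow> int \<Rightarrow> 'n oper" where
  "bullet_term m a b h = (\<lambda>v s.
     vscale ((1 / qh powi h) powi (m + 1) * qh powi h)
       (nth_prod (scale_arg h a) 0 b v (s + of_int (m + 1))))"

definition bullet :: "'n::{finite,linorder} oper \<Rightarrow> 'n oper \<Rightarrow> 'n oper"  (infixr \<open>\<^sub>\<bullet>\<close> 65) where
  "a \<^sub>\<bullet> b = Sum_any (\<lambda>\<beta>. Sum_any (\<lambda>h. bullet_term \<lfloor>form (wt a) \<beta>\<rfloor> a (wt_part b \<beta>) h))"

inductive_set iter_prods :: "'n::{finite,linorder} \<Rightarrow> 'n oper set" for i where
  base: "Y_op i \<in> iter_prods i"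
| x_plus: "b \<in> iter_prods i \<Longrightarrow> x_op 1 j \<^sub>\<bullet> b \<in> iter_prods i"
| x_minus: "b \<in> iter_prods i \<Longrightarrow> x_op (- 1) j \<^sub>\<bullet> b \<in> iter_prods i"
| psi: "b \<in> iter_prods i \<Longrightarrow> psi_op j \<^sub>\<bullet> b \<in> iter_prods i"
| phi: "b \<in> iter_prods i \<Longrightarrow> phi_op j \<^sub>\<bullet> b \<in> iter_prods i"

definition Y_space :: "'n::{finite,linorder} \<Rightarrow> 'n oper set" where
  "Y_space i = module.span oscale (iter_prods i)"


section \<open>The quantum group \<open>U\<^sub>q(sl\<^sub>n\<^sub>+\<^sub>1)\<close>\<close>

datatype 'n gen = gE 'n | gF 'n | gK 'n | gKi 'n

text \<open>Words under concatenation; the free algebra is their monoid algebra, whose multiplication is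
  the one of \<open>HOL-Library.Poly_Mapping\<close>.\<close>

datatype 'a word = Word "'a list"

instantiation word :: (type) monoid_add
begin

definition zero_word :: "'a word" where "zero_word = Word []"

fun plus_word :: "'a word \<Rightarrow> 'a word \<Rightarrow> 'a word" where "Word u + Word v = Word (u @ v)"

instance
proof
  fix a b c :: "'a word"
  show "a + b + c = a + (b + c)" by (cases a; cases b; cases c) simp
  show "0 + a = a" "a + 0 = a" by (cases a; simp add: zero_word_def)+
qed

end

type_synonym 'n falg = "'n gen word \<Rightarrow>\<^sub>0 scal"

definition fgen :: "'n gen \<Rightarrow> 'n falg" where
  "fgen g = Poly_Mapping.single (Word [g]) 1"

definition fconst :: "scal \<Rightarrow> 'n falg" where
  "fconst c = Poly_Mapping.single 0 c"

definition serre :: "('n::{finite,linorder} \<Rightarrow> 'n gen) \<Rightarrow> 'n \<Rightarrow> 'n \<Rightarrow> 'n falg" where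
  "serre y i j = (let m = nat (1 - cartan (idx i) (idx j)) in
     \<Sum>s\<le>m. fconst ((- 1) ^ s * qfact m / (qfact s * qfact (m - s)))
       * fgen (y i) ^ (m - s) * fgen (y j) * fgen (y i) ^ s)"

inductive_set uq_rels :: "'n::{finite,linorder} falg set" where
  KK: "fgen (gK i) * fgen (gK j) - fgen (gK j) * fgen (gK i) \<in> uq_rels"
| KKi: "fgen (gK i) * fgen (gKi i) - 1 \<in> uq_rels"
| KiK: "fgen (gKi i) * fgen (gK i) - 1 \<in> uq_rels"
| KE: "fgen (gK i) * fgen (gE j) * fgen (gKi i)
        - fconst (qq powi cartan (idx i) (idx j)) * fgen (gE j) \<in> uq_rels"
| KF: "fgen (gK i) * fgen (gF j) * fgen (gKi i)
        - fconst (qq powi (- cartan (idx i) (idx j))) * fgen (gF j) \<in> uq_rels"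
| EF: "fgen (gE i) * fgen (gF j) - fgen (gF j) * fgen (gE i)
        - (if i = j then fconst (1 / (qq - qq powi (- 1))) * (fgen (gK i) - fgen (gKi i)) else 0)
        \<in> uq_rels"
| serreE: "i \<noteq> j \<Longrightarrow> serre gE i j \<in> uq_rels"
| serreF: "i \<noteq> j \<Longrightarrow> serre gF i j \<in> uq_rels"

inductive_set uq_ideal :: "'n::{finite,linorder} falg set" where
  zero: "0 \<in> uq_ideal"
| rel: "r \<in> uq_rels \<Longrightarrow> a * r * b \<in> uq_ideal"
| add: "x \<in> uq_ideal \<Longrightarrow> y \<in> uq_ideal \<Longrightarrow> x + y \<in> uq_ideal"

lemma uq_ideal_mult: "x \<in> uq_ideal \<Longrightarrow> a * x * b \<in> uq_ideal"
proof (induction rule: uq_ideal.induct)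
  case (rel r c d)
  have "a * (c * r * d) * b = (a * c) * r * (d * b)" by (simp add: mult.assoc)
  with rel show ?case by (simp add: uq_ideal.rel)
qed (auto simp: distrib_left distrib_right intro: uq_ideal.intros)

lemma uq_ideal_uminus: "x \<in> uq_ideal \<Longrightarrow> - x \<in> uq_ideal"
  using uq_ideal_mult[of x "- 1" 1] by simp

definition uq_rel :: "'n::{finite,linorder} falg \<Rightarrow> 'n falg \<Rightarrow> bool" where
  "uq_rel x y \<longleftrightarrow> x - y \<in> uq_ideal"

lemma equivp_uq_rel: "equivp uq_rel"
proof (rule equivpI)
  show "reflp uq_rel" by (simp add: reflp_def uq_rel_def uq_ideal.zero)
  show "symp uq_rel"
    using uq_ideal_uminus by (fastforce simp: symp_def uq_rel_def)
  show "transp uq_rel"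
    using uq_ideal.add by (fastforce simp: transp_def uq_rel_def)
qed

quotient_type (overloaded) 'n uq = "'n::{finite,linorder} falg" / uq_rel
  by (rule equivp_uq_rel)

instantiation uq :: ("{finite,linorder}") "{ring, monoid_mult}"
begin

lift_definition zero_uq :: "'a uq" is 0 .

lift_definition one_uq :: "'a uq" is 1 .

lift_definition plus_uq :: "'a uq \<Rightarrow> 'a uq \<Rightarrow> 'a uq" is plus
  unfolding uq_rel_def by (metis add_diff_add uq_ideal.add)

lift_definition uminus_uq :: "'a uq \<Rightarrow> 'a uq" is uminus
  unfolding uq_rel_def by (metis minus_diff_minus uq_ideal_uminus)

lift_definition minus_uq :: "'a uq \<Rightarrow> 'a uq \<Rightarrow> 'a uq" is minus
proof -
  fix x x' y y' :: "'a falg"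
  assume "uq_rel x x'" "uq_rel y y'"
  then have "(x - x') + - (y - y') \<in> uq_ideal"
    unfolding uq_rel_def by (intro uq_ideal.add uq_ideal_uminus)
  then show "uq_rel (x - y) (x' - y')" by (simp add: uq_rel_def algebra_simps)
qed

lift_definition times_uq :: "'a uq \<Rightarrow> 'a uq \<Rightarrow> 'a uq" is times
proof -
  fix x x' y y' :: "'a falg"
  assume "uq_rel x x'" "uq_rel y y'"
  then have "1 * (x - x') * y + x' * (y - y') * 1 \<in> uq_ideal"
    unfolding uq_rel_def by (intro uq_ideal.add uq_ideal_mult)
  then show "uq_rel (x * y) (x' * y')" by (simp add: uq_rel_def algebra_simps)
qed

instance
  by standard (transfer; simp add: uq_rel_def uq_ideal.zero algebra_simps)+

end

lift_definition uq_const :: "scal \<Rightarrow> 'n::{finite,linorder} uq" is fconst .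

lift_definition uq_gen :: "'n gen \<Rightarrow> 'n::{finite,linorder} uq" is fgen .

text \<open>\<open>\<Prod>\<^sub>k K\<^sub>k\<^sup>c\<^sup>(\<^sup>k\<^sup>)\<close> for \<open>c\<close> with values in \<open>\<int>\<close>.\<close>

definition K_mon :: "('n::{finite,linorder} \<Rightarrow> int) \<Rightarrow> 'n uq" where
  "K_mon c = prod_list (map (\<lambda>k. if 0 \<le> c k then uq_gen (gK k) ^ nat (c k)
     else uq_gen (gKi k) ^ nat (- c k)) (sorted_list_of_set UNIV))"

text \<open>\<open>L_exp p\<close> is the family of exponents of \<open>K\<^sub>1, \<dots>, K\<^sub>n\<close> in \<open>L\<^sub>p\<close>, and \<open>M_exp j\<close> that in \<open>q\<^sup>(\<^sup>n\<^sup>+\<^sup>1\<^sup>)\<^sup>^\<^sup>2 M\<^sub>j\<close>.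
  \<open>M_el 1 j\<close> is \<open>M\<^sub>j\<close> and \<open>M_el (- 1) j\<close> is its inverse.\<close>

definition L_exp :: "nat \<Rightarrow> 'n::{finite,linorder} \<Rightarrow> int" where
  "L_exp p k = (if idx k \<le> p then int (idx k) * (int CARD('n) + 1 - int p)
     else int p * (int CARD('n) + 1 - int (idx k)))"

definition M_exp :: "'n::{finite,linorder} \<Rightarrow> 'n \<Rightarrow> int" where
  "M_exp j k = (if idx j = 1 \<or> idx j = CARD('n) then 0
     else L_exp (idx j - 1) k + L_exp (idx j + 1) k)"

definition M_el :: "int \<Rightarrow> 'n::{finite,linorder} \<Rightarrow> 'n uq" where
  "M_el s j = uq_const (qq powi (- s * (int CARD('n) + 1) ^ 2)) * K_mon (\<lambda>k. s * M_exp j k)"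


section \<open>The algebra \<open>U\<^sub>q(sl\<^sub>n\<^sub>+\<^sub>1)\<^sub>z\<close>\<close>

text \<open>A formal power series in \<open>z\<^sub>1, \<dots>, z\<^sub>n\<close> is the function mapping \<open>m\<close> to its coefficient at
  \<open>\<Prod>\<^sub>k z\<^sub>k\<^sup>m\<^sup>(\<^sup>k\<^sup>)\<close>. The Cauchy product is taken along an arbitrary pairing of the coefficients.\<close>

type_synonym ('n, 'a) ps = "('n \<Rightarrow> nat) \<Rightarrow> 'a"

definition ps_const :: "'a::zero \<Rightarrow> ('n, 'a) ps" where
  "ps_const c = (\<lambda>m. if \<forall>k. m k = 0 then c else 0)"

definition ps_conv :: "('a \<Rightarrow> 'b \<Rightarrow> 'b::comm_monoid_add) \<Rightarrow> ('n, 'a) ps \<Rightarrow> ('n, 'b) ps \<Rightarrow> ('n, 'b) ps" where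
  "ps_conv act f g = (\<lambda>m. \<Sum>a\<in>{a. \<forall>k. a k \<le> m k}. act (f a) (g (\<lambda>k. m k - a k)))"

abbreviation ps_mult :: "('n::{finite,linorder}, 'n uq) ps \<Rightarrow> ('n, 'n uq) ps \<Rightarrow> ('n, 'n uq) ps" where
  "ps_mult \<equiv> ps_conv (*)"

definition w_el :: "'n::{finite,linorder} \<Rightarrow> ('n, 'n uq) ps" where
  "w_el j = (\<lambda>m. if \<forall>k. k \<noteq> j \<longrightarrow> m k = 0
     then uq_const (cst (1 / fact (m j))) * (M_el 1 j - M_el (- 1) j) ^ m j else 0)"

definition e_bar :: "'n::{finite,linorder} \<Rightarrow> ('n, 'n uq) ps" where
  "e_bar j = ps_mult (ps_const (uq_gen (gE j))) (w_el j)"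

definition f_bar :: "'n::{finite,linorder} \<Rightarrow> ('n, 'n uq) ps" where
  "f_bar j = ps_const (uq_gen (gF j))"

definition k_bar :: "'n::{finite,linorder} \<Rightarrow> ('n, 'n uq) ps" where
  "k_bar j = ps_mult (ps_const (uq_gen (gK j) - uq_gen (gKi j))) (w_el j)"

inductive_set Uz :: "('n::{finite,linorder}, 'n uq) ps set" where
  scalar: "ps_const (uq_const c) \<in> Uz"
| e: "e_bar j \<in> Uz"
| f: "f_bar j \<in> Uz"
| k: "k_bar j \<in> Uz"
| add: "u \<in> Uz \<Longrightarrow> u' \<in> Uz \<Longrightarrow> u + u' \<in> Uz"
| mult: "u \<in> Uz \<Longrightarrow> u' \<in> Uz \<Longrightarrow> ps_mult u u' \<in> Uz"


section \<open>Modules\<close>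

definition uq_module :: "('n::{finite,linorder} uq \<Rightarrow> 'l::ab_group_add \<Rightarrow> 'l) \<Rightarrow> bool" where
  "uq_module act \<longleftrightarrow>
     (\<forall>u x y. act u (x + y) = act u x + act u y) \<and>
     (\<forall>u u' x. act (u + u') x = act u x + act u' x) \<and>
     (\<forall>u u' x. act (u * u') x = act u (act u' x)) \<and>
     (\<forall>x. act 1 x = x)"

definition uq_submodule :: "('n::{finite,linorder} uq \<Rightarrow> 'l::ab_group_add \<Rightarrow> 'l) \<Rightarrow> 'l set \<Rightarrow> bool" where
  "uq_submodule act S \<longleftrightarrow>
     0 \<in> S \<and> (\<forall>x\<in>S. \<forall>y\<in>S. x + y \<in> S) \<and> (\<forall>u. \<forall>x\<in>S. act u x \<in> S)"

text \<open>\<open>act\<close> is a realisation of \<open>L(\<Lambda>)\<close> on the type \<open>'l\<close> with highest weight vector \<open>v\<close>. The \<open>F\<close>-vector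
  space structure of \<open>'l\<close> is the one given by the action of \<open>uq_const\<close>.\<close>

definition irr_hw_module ::
  "('n::{finite,linorder} uq \<Rightarrow> 'l::ab_group_add \<Rightarrow> 'l) \<Rightarrow> 'n wgt \<Rightarrow> 'l \<Rightarrow> bool" where
  "irr_hw_module act \<Lambda> v \<longleftrightarrow>
     uq_module act \<and>
     v \<noteq> 0 \<and>
     (\<forall>j. act (uq_gen (gE j)) v = 0) \<and>
     (\<forall>j. act (uq_gen (gK j)) v = act (uq_const (qq powi \<Lambda> j)) v) \<and>
     (\<forall>S. uq_submodule act S \<longrightarrow> S = {0} \<or> S = UNIV)"

definition Lz :: "('n::{finite,linorder} uq \<Rightarrow> 'l::ab_group_add \<Rightarrow> 'l) \<Rightarrow> 'l \<Rightarrow> ('n, 'l) ps set" where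
  "Lz act v = {ps_conv act u (ps_const v) | u. u \<in> Uz}"

text \<open>\<open>\<rho>\<close> is a \<open>U\<^sub>q(sl\<^sub>n\<^sub>+\<^sub>1)\<^sub>z\<close>-module structure on the \<open>F\<close>-vector space \<open>M\<close> with scalar
  multiplication \<open>sc\<close>.\<close>

definition uz_module ::
  "(scal \<Rightarrow> 'm \<Rightarrow> 'm) \<Rightarrow> 'm::ab_group_add set \<Rightarrow> (('n::{finite,linorder}, 'n uq) ps \<Rightarrow> 'm \<Rightarrow> 'm) \<Rightarrow> bool" where
  "uz_module sc M \<rho> \<longleftrightarrow>
     module.subspace sc M \<and>
     (\<forall>u\<in>Uz. \<forall>x\<in>M. \<rho> u x \<in> M) \<and>
     (\<forall>u\<in>Uz. \<forall>x\<in>M. \<forall>y\<in>M. \<rho> u (x + y) = \<rho> u x + \<rho> u y) \<and>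
     (\<forall>u\<in>Uz. \<forall>u'\<in>Uz. \<forall>x\<in>M. \<rho> (u + u') x = \<rho> u x + \<rho> u' x) \<and>
     (\<forall>u\<in>Uz. \<forall>u'\<in>Uz. \<forall>x\<in>M. \<rho> (ps_mult u u') x = \<rho> u (\<rho> u' x)) \<and>
     (\<forall>c. \<forall>x\<in>M. \<rho> (ps_const (uq_const c)) x = sc c x)"

definition uz_isomorphic ::
  "'m::ab_group_add set \<Rightarrow> (('n::{finite,linorder}, 'n uq) ps \<Rightarrow> 'm \<Rightarrow> 'm) \<Rightarrow>
   'k::ab_group_add set \<Rightarrow> (('n, 'n uq) ps \<Rightarrow> 'k \<Rightarrow> 'k) \<Rightarrow> bool" where
  "uz_isomorphic M \<rho> M' \<rho>' \<longleftrightarrow> (\<exists>T. bij_betw T M M' \<and>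
     (\<forall>x\<in>M. \<forall>y\<in>M. T (x + y) = T x + T y) \<and>
     (\<forall>u\<in>Uz. \<forall>x\<in>M. T (\<rho> u x) = \<rho>' u (T x)))"

end

theory Submission
  imports Defs "HOL-Library.Product_Plus"
begin

text \<open>All iterated products of the operators can be computed in closed form. Each of \<open>x\<^sub>j\<^sup>\<plusminus>(z)\<close>, \<open>\<psi>\<^sub>j(z)\<close>,
  \<open>\<phi>\<^sub>j(z)\<close> and \<open>Y\<^sub>i(z)\<close> is a vertex operator: an exponential of creation operators times an exponential of
  annihilation operators times \<open>e\<^sup>\<gamma> z\<^sup>\<partial>\<^sup>\<gamma>\<close> and a scalar that depends on the weight. If the contraction of
  two such operators \<open>a(z\<^sub>1)\<close> and \<open>b(z\<^sub>2)\<close> is \<open>(z\<^sub>1 - c' z\<^sub>2) / (z\<^sub>1 - c z\<^sub>2)\<close>, then \<open>z\<^sub>1 - c z\<^sub>2\<close> clears the only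
  pole. Hence at most one \<open>t\<close> contributes to \<open>a(z)\<^sub>\<bullet> b(z)\<close>, namely the one with \<open>q\<^sup>t = c\<close>, and the product is
  a multiple of the vertex operator obtained from the normally ordered product at \<open>z\<^sub>1 = c z\<^sub>2\<close>; for
  \<open>c = 0\<close> the product vanishes (\<open>bullet_pole\<close>, \<open>bullet_no_pole\<close>).

  Starting from \<open>Y\<^sub>i(z)\<close> one reaches in this way the operators \<open>R i S n\<close>. Here \<open>S\<close> is an \<open>i\<close>-element subset of
  \<open>{1, \<dots>, n + 1}\<close>, that is, a basis vector of the fundamental module, the \<open>i\<close>-th exterior power of the vector
  representation, and \<open>n j k\<close> counts factors \<open>\<psi>\<^sub>j\<close> that have been absorbed. The operator \<open>x\<^sub>j\<^sup>-\<close> moves an element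
  from \<open>j\<close> to \<open>j + 1\<close>, and \<open>x\<^sub>j\<^sup>+\<close> moves it back but leaves one more factor \<open>\<psi>\<^sub>j\<close>; \<open>\<psi>\<^sub>j\<close> multiplies by
  \<open>q - q\<^sup>-\<^sup>1\<close> times the difference of the two occupation numbers and adds such a factor as well; \<open>\<phi>\<^sub>j\<close> gives zero
  (\<open>f_R\<close>, \<open>e_R\<close>, \<open>k_R\<close>, \<open>phi_R\<close>). The operators \<open>R i S n\<close> are linearly independent, because they are joint
  eigenvectors, with different eigenvalues, of the projections to a weight and of the commutators with the
  \<open>a\<^sub>k\<^sup>*(-1)\<close> (\<open>R_independent\<close>).

  The module \<open>L(\<lambda>\<^sub>i)\<^sub>z\<close> has the same structure. On the basis vector of \<open>S\<close>, the series \<open>w\<^sub>j\<close> is the scalar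
  \<open>exp ((q\<^sup>e - q\<^sup>-\<^sup>e) z\<^sub>j)\<close>; when exactly one of \<open>j\<close> and \<open>j + 1\<close> lies in \<open>S\<close>, the integer \<open>e\<close> depends only on \<open>j\<close>
  and on the number \<open>k\<close> of elements of \<open>S\<close> below \<open>j\<close>, and the values of \<open>e\<close> that occur for a given \<open>j\<close> are
  negative and pairwise different. So a factor \<open>w\<^sub>j\<close> increases the multiplicity \<open>n j k\<close> in the vector
  \<open>exp (\<Sum>\<^sub>j y\<^sub>j z\<^sub>j)\<close> times the basis vector of \<open>S\<close>, with \<open>y\<^sub>j = \<Sum>\<^sub>k n j k (q\<^sup>e - q\<^sup>-\<^sup>e)\<close>. These
  vectors are independent and satisfy the formulas found for the \<open>R i S n\<close> (\<open>f_model\<close>, \<open>e_model\<close>, \<open>k_model\<close>,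
  \<open>model_independent\<close>). Matching the two bases gives a linear map that is equivariant
  and maps the submodule generated by the highest weight vector onto the span of the iterated products
  (\<open>compare_image\<close>).

  It remains to pass from the concrete fundamental module to an arbitrary realisation of \<open>L(\<lambda>\<^sub>i)\<close>. The
  two highest weight vectors have the same annihilator (\<open>annihilators_equal\<close>): an element of the algebra
  acts on a highest weight vector as a scalar plus a combination of nonempty words in the \<open>f\<^sub>j\<close>, these lower
  the weight, and both modules are generated by each of their nonzero vectors.\<close>

abbreviation lookup where "lookup \<equiv> Poly_Mapping.lookup"
abbreviation keys where "keys \<equiv> Poly_Mapping.keys"
abbreviation single where "single \<equiv> Poly_Mapping.single"

section \<open>The space \<open>V\<close> and the Heisenberg algebra\<close>

lemma kconst_add: "kconst (c + d) = kconst c + kconst d"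
  and kconst_mult: "kconst (c * d) = kconst c * kconst d"
  and kconst_0 [simp]: "kconst 0 = 0"
  and kconst_1 [simp]: "kconst 1 = 1"
  by (simp_all add: kconst_def single_add mult_single)

interpretation V: vector_space vscale
  by unfold_locales
    (auto simp: poly_mapping_eq_iff fun_eq_iff lookup_vscale lookup_add kconst_add kconst_mult
      distrib_left distrib_right mult.assoc)

abbreviation V_linear :: "('n V \<Rightarrow> 'n V) \<Rightarrow> bool" where
  "V_linear \<equiv> module_hom vscale vscale"

lemma V_linearI:
  assumes "\<And>u v. f (u + v) = f u + f v" "\<And>c v. f (vscale c v) = vscale c (f v)"
  shows "V_linear f"
  using assms by (intro module_hom.intro module_hom_axioms.intro V.module_axioms) auto

lemma V_linear_scaled: "V_linear f \<Longrightarrow> V_linear (\<lambda>v. vscale c (f v))"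
  by (rule V_linearI) (simp_all add: module_hom.add module_hom.scale V.scale_right_distrib mult.commute)

lemma V_linear_add: "V_linear f \<Longrightarrow> V_linear g \<Longrightarrow> V_linear (\<lambda>v. f v + g v)"
  by (rule V_linearI) (simp_all add: module_hom.add module_hom.scale V.scale_right_distrib algebra_simps)

lemma V_linear_diff: "V_linear f \<Longrightarrow> V_linear g \<Longrightarrow> V_linear (\<lambda>v. f v - g v)"
  by (rule V_linearI) (simp_all add: module_hom.add module_hom.scale V.scale_right_diff_distrib algebra_simps)

lemma V_linear_sum:
  assumes "\<And>x. x \<in> A \<Longrightarrow> V_linear (f x)"
  shows "V_linear (\<lambda>v. \<Sum>x\<in>A. f x v)"
  using module_hom.add[OF assms] module_hom.scale[OF assms]
  by (intro V_linearI) (simp_all add: V.scale_sum_right sum.distrib cong: sum.cong)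

lemma V_linear_comp: "V_linear f \<Longrightarrow> V_linear g \<Longrightarrow> V_linear (\<lambda>v. f (g v))"
  by (rule V_linearI) (simp_all add: module_hom.add module_hom.scale)

lemma V_linear_0 [simp]: "V_linear (\<lambda>v. 0)"
  by (rule V_linearI) simp_all

lemma V_linear_id [simp]: "V_linear (\<lambda>v. v)"
  by (rule V_linearI) simp_all

lemma V_linear_if: "V_linear f \<Longrightarrow> V_linear g \<Longrightarrow> V_linear (\<lambda>v. if P then f v else g v)"
  by (cases P) simp_all

subsection \<open>Extension from a basis\<close>

lemma keys_sum_add:
  fixes F :: "'a \<Rightarrow> 'b::comm_monoid_add \<Rightarrow> 'c::comm_monoid_add"
  assumes "\<And>k. F k 0 = 0" "\<And>k x y. F k (x + y) = F k x + F k y"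
  shows "(\<Sum>k\<in>keys (p + q). F k (lookup (p + q) k))
    = (\<Sum>k\<in>keys p. F k (lookup p k)) + (\<Sum>k\<in>keys q. F k (lookup q k))"
proof -
  let ?K = "keys p \<union> keys q"
  have *: "(\<Sum>k\<in>keys r. F k (lookup r k)) = (\<Sum>k\<in>?K. F k (lookup r k))" if "keys r \<subseteq> ?K" for r
    using that by (intro sum.mono_neutral_left) (auto simp: in_keys_iff assms)
  show ?thesis
    unfolding *[OF keys_add] *[OF Un_upper1] *[OF Un_upper2] by (simp add: lookup_add assms(2) sum.distrib)
qed

lemma sum_keys_single:
  "F k 0 = 0 \<Longrightarrow> (\<Sum>m\<in>keys (single k c). F m (lookup (single k c) m)) = F k c"
  by auto

lemma poly_mapping_decomp: "p = (\<Sum>k\<in>keys p. single k (lookup p k))"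
  by (rule poly_mapping_eqI) (auto simp: lookup_sum lookup_single when_def not_in_keys_iff_lookup_eq_zero)

text \<open>Finitely supported functions are sums of the \<open>single k c\<close>, so identities between additive maps are checked on these.\<close>

lemma additive_eqI:
  fixes f g :: "('a \<Rightarrow>\<^sub>0 'b::comm_monoid_add) \<Rightarrow> 'c::ab_group_add"
  assumes f: "\<And>p q. f (p + q) = f p + f q" and g: "\<And>p q. g (p + q) = g p + g q"
    and eq: "\<And>k c. f (single k c) = g (single k c)"
  shows "f p = g p"
proof -
  have z: "f 0 = 0" "g 0 = 0" using f[of 0 0] g[of 0 0] by auto
  have fs: "f (sum h A) = (\<Sum>a\<in>A. f (h a))" and gs: "g (sum h A) = (\<Sum>a\<in>A. g (h a))"
    if "finite A" for h :: "'a \<Rightarrow> ('a \<Rightarrow>\<^sub>0 'b)" and A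
    using that by (induction A rule: finite_induct) (simp_all add: z f g)
  show ?thesis
    by (subst (1 2) poly_mapping_decomp[of p]) (simp add: fs gs eq)
qed

lemma vscale_single: "vscale c (single \<beta> p) = single \<beta> (kconst c * p)"
  by (rule poly_mapping_eqI) (simp add: lookup_vscale lookup_single when_def)

lemma V_linear_eqI:
  assumes "V_linear f" "V_linear g" "\<And>\<beta> p. f (single \<beta> p) = g (single \<beta> p)"
  shows "f v = g v"
  by (rule additive_eqI[of f g]) (fact module_hom.add[OF assms(1)] module_hom.add[OF assms(2)] assms(3))+

text \<open>All operators on \<open>V\<close> below are given weight by weight in this form.\<close>

lemma V_linear_wext:
  fixes F :: "'n wgt \<Rightarrow> 'n K1 \<Rightarrow> 'n V"
  assumes add: "\<And>\<beta> p q. F \<beta> (p + q) = F \<beta> p + F \<beta> q"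
    and sc: "\<And>\<beta> c p. F \<beta> (kconst c * p) = vscale c (F \<beta> p)"
  shows "V_linear (\<lambda>v. \<Sum>\<beta>\<in>keys v. F \<beta> (lookup v \<beta>))"
proof -
  have F0: "F \<beta> 0 = 0" for \<beta> using add[of \<beta> 0 0] by simp
  show ?thesis
  proof (rule V_linearI)
    fix c v
    have "(\<Sum>\<beta>\<in>keys (vscale c v). F \<beta> (lookup (vscale c v) \<beta>)) = (\<Sum>\<beta>\<in>keys v. F \<beta> (lookup (vscale c v) \<beta>))"
      by (intro sum.mono_neutral_left) (auto simp: in_keys_iff lookup_vscale F0)
    then show "(\<Sum>\<beta>\<in>keys (vscale c v). F \<beta> (lookup (vscale c v) \<beta>)) = vscale c (\<Sum>\<beta>\<in>keys v. F \<beta> (lookup v \<beta>))"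
      by (simp add: lookup_vscale sc V.scale_sum_right)
  qed (rule keys_sum_add[OF F0 add])
qed

subsection \<open>The Heisenberg relations\<close>

lemma kderiv_single: "kderiv x (single m c) = single (m - single x 1) (of_nat (lookup m x) * c)"
  by (simp add: kderiv_def)

lemma kderiv_add: "kderiv x (p + q) = kderiv x p + kderiv x q"
  unfolding kderiv_def by (rule keys_sum_add) (simp_all add: single_add distrib_left)

lemma kderiv_0 [simp]: "kderiv x 0 = 0"
  by (simp add: kderiv_def)

lemma kderiv_kconst: "kderiv x (kconst c * p) = kconst c * kderiv x p"
proof (rule additive_eqI[of "\<lambda>p. kderiv x (kconst c * p)" "\<lambda>p. kconst c * kderiv x p"])
  show "kderiv x (kconst c * single k d) = kconst c * kderiv x (single k d)" for k d
    by (simp add: kconst_def mult_single kderiv_single mult.left_commute)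
qed (simp_all add: kderiv_add distrib_left)

text \<open>The canonical commutation relation; all Heisenberg relations are linear combinations of it.\<close>

lemma kderiv_kvar: "kderiv x (kvar y * p) = (if x = y then p else 0) + kvar y * kderiv x p"
proof (rule additive_eqI[of "\<lambda>p. kderiv x (kvar y * p)" "\<lambda>p. (if x = y then p else 0) + kvar y * kderiv x p"])
  fix m c
  show "kderiv x (kvar y * single m c) = (if x = y then single m c else 0) + kvar y * kderiv x (single m c)"
  proof (cases "x = y")
    case True
    have "single y 1 + (m - single y 1) = m" if "lookup m y \<noteq> 0"
      using that by (intro poly_mapping_eqI) (auto simp: lookup_add lookup_minus lookup_single when_def)
    then have "single (single y 1 + (m - single y 1)) (of_nat (lookup m y) * c) = single m (of_nat (lookup m y) * c)"
      by (cases "lookup m y = 0") auto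
    with True show ?thesis
      by (simp add: kvar_def mult_single kderiv_single lookup_add algebra_simps flip: single_add)
  next
    case False
    then have "single y 1 + m - single x 1 = single y 1 + (m - single x 1)"
      by (intro poly_mapping_eqI) (auto simp: lookup_add lookup_minus lookup_single when_def)
    with False show ?thesis
      by (simp add: kvar_def mult_single kderiv_single lookup_add lookup_single)
  qed
qed (simp_all add: kderiv_add distrib_left)

lemma kderiv_commute: "kderiv x (kderiv y p) = kderiv y (kderiv x p)"
proof (rule additive_eqI[of "\<lambda>p. kderiv x (kderiv y p)" "\<lambda>p. kderiv y (kderiv x p)"])
  fix m :: "'a \<times> nat \<Rightarrow>\<^sub>0 nat" and c
  have "m - single y 1 - single x 1 = m - single x 1 - single y 1"
    by (intro poly_mapping_eqI) (simp only: lookup_minus diff_commute)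
  then show "kderiv x (kderiv y (single m c)) = kderiv y (kderiv x (single m c))"
    by (cases "x = y") (simp_all add: kderiv_single lookup_minus lookup_single mult.left_commute)
qed (simp_all add: kderiv_add)

lemma heisK_add: "heisK i l (p + q) = heisK i l p + heisK i l q"
  by (simp add: heisK_def distrib_left kderiv_add sum.distrib)

lemma heisK_0 [simp]: "heisK i l 0 = 0"
  by (simp add: heisK_def)

lemma heisK_kconst: "heisK i l (kconst c * p) = kconst c * heisK i l p"
  by (simp add: heisK_def kderiv_kconst sum_distrib_left mult.left_commute)

lemma lookup_heis: "lookup (heis i l v) \<beta> = heisK i l (lookup v \<beta>)"
  by (simp add: heis_def Poly_Mapping.map.rep_eq when_def)

lemma heis_single: "heis i l (single \<beta> p) = single \<beta> (heisK i l p)"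
  by (rule poly_mapping_eqI) (simp add: lookup_heis lookup_single when_def)

lemma heis_linear [simp, intro]: "V_linear (heis i l)"
  by (rule V_linearI) (auto intro!: poly_mapping_eqI simp: lookup_heis lookup_add heisK_add lookup_vscale heisK_kconst)

lemma kderiv_sum: "kderiv x (sum f A) = (\<Sum>a\<in>A. kderiv x (f a))"
  by (induction A rule: infinite_finite_induct) (auto simp: kderiv_add)

text \<open>The value of the commutator of \<open>a\<^sub>i(l)\<close> and \<open>a\<^sub>j(-l)\<close>.\<close>

definition heis_bracket :: "'n::{finite,linorder} \<Rightarrow> 'n \<Rightarrow> int \<Rightarrow> scal" where
  "heis_bracket i j l = qint (cartan (idx i) (idx j) * l) * qint l / of_int l"

lemma heisK_cre_cre:
  assumes "l < 0" "m < 0"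
  shows "heisK i l (heisK j m p) = heisK j m (heisK i l p)"
  using assms by (simp add: heisK_def mult.left_commute)

lemma heisK_ann_ann:
  assumes "l > 0" "m > 0"
  shows "heisK i l (heisK j m p) = heisK j m (heisK i l p)"
proof -
  have "heisK i l (heisK j m p) = (\<Sum>k\<in>UNIV. \<Sum>k'\<in>UNIV. kconst (heis_bracket i k l) * (kconst (heis_bracket j k' m)
       * kderiv (k, nat l - 1) (kderiv (k', nat m - 1) p)))"
    using assms by (simp add: heisK_def kderiv_sum kderiv_kconst sum_distrib_left heis_bracket_def)
  also have "\<dots> = (\<Sum>k'\<in>UNIV. \<Sum>k\<in>UNIV. kconst (heis_bracket j k' m) * (kconst (heis_bracket i k l)
       * kderiv (k', nat m - 1) (kderiv (k, nat l - 1) p)))"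
    by (subst sum.swap) (simp add: kderiv_commute mult.left_commute)
  also have "\<dots> = heisK j m (heisK i l p)"
    using assms by (simp add: heisK_def kderiv_sum kderiv_kconst sum_distrib_left heis_bracket_def)
  finally show ?thesis .
qed

lemma heisK_ann_cre:
  assumes "l > 0" "m > 0"
  shows "heisK i l (heisK j (- m) p) = heisK j (- m) (heisK i l p) + (if l = m then kconst (heis_bracket i j l) * p else 0)"
proof -
  have eq: "nat l - 1 = nat m - Suc 0 \<longleftrightarrow> l = m" using assms by linarith
  have "kconst (heis_bracket i k l) * kderiv (k, nat l - 1) (kvar (j, nat m - 1) * p)
      = (if k = j then if l = m then kconst (heis_bracket i j l) * p else 0 else 0)
        + kvar (j, nat m - 1) * (kconst (heis_bracket i k l) * kderiv (k, nat l - 1) p)" for k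
    using eq by (simp add: kderiv_kvar distrib_left mult.left_commute)
  then have "heisK i l (heisK j (- m) p) = (\<Sum>k\<in>UNIV. (if k = j then if l = m then kconst (heis_bracket i j l) * p else 0 else 0)
        + kvar (j, nat m - 1) * (kconst (heis_bracket i k l) * kderiv (k, nat l - 1) p))"
    using assms by (simp add: heisK_def heis_bracket_def)
  also have "\<dots> = heisK j (- m) (heisK i l p) + (if l = m then kconst (heis_bracket i j l) * p else 0)"
    using assms by (simp add: sum.distrib heisK_def heis_bracket_def sum_distrib_left)
  finally show ?thesis .
qed

lemma heis_cre_cre: "l < 0 \<Longrightarrow> m < 0 \<Longrightarrow> heis i l (heis j m v) = heis j m (heis i l v)"
  and heis_ann_ann: "l > 0 \<Longrightarrow> m > 0 \<Longrightarrow> heis i l (heis j m v) = heis j m (heis i l v)"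
  by (auto intro!: poly_mapping_eqI simp: lookup_heis heisK_cre_cre heisK_ann_ann)

lemma heis_ann_cre:
  assumes "l > 0" "m > 0"
  shows "heis i l (heis j (- m) v) = heis j (- m) (heis i l v) + (if l = m then vscale (heis_bracket i j l) v else 0)"
  by (rule poly_mapping_eqI)
    (simp only: lookup_heis heisK_ann_cre[OF assms] lookup_add lookup_vscale lookup_zero if_distrib[of "\<lambda>u. lookup u _"])

subsection \<open>The degree\<close>

text \<open>The degree of \<open>a\<^sub>i(-r)\<close> is \<open>r\<close>. Annihilation operators lower the degree, so that only finitely many of
  them contribute on a given vector; this makes all sums below finite.\<close>

definition wdeg :: "('n \<times> nat \<Rightarrow>\<^sub>0 nat) \<Rightarrow> nat" where
  "wdeg m = (\<Sum>x\<in>keys m. (snd x + 1) * lookup m x)"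

lemma wdeg_add: "wdeg (m + m') = wdeg m + wdeg m'"
  unfolding wdeg_def by (rule keys_sum_add) (simp_all add: distrib_left)

lemma wdeg_single: "wdeg (single x c) = (snd x + 1) * c"
  by (simp add: wdeg_def)

definition Kdeg :: "int \<Rightarrow> 'n K1 \<Rightarrow> bool" where
  "Kdeg N p \<longleftrightarrow> (\<forall>m\<in>keys p. int (wdeg m) \<le> N)"

definition Vdeg :: "int \<Rightarrow> 'n V \<Rightarrow> bool" where
  "Vdeg N v \<longleftrightarrow> (\<forall>\<beta>. Kdeg N (lookup v \<beta>))"

lemma Kdeg_add: "Kdeg N p \<Longrightarrow> Kdeg N q \<Longrightarrow> Kdeg N (p + q)"
  unfolding Kdeg_def using keys_add[of p q] by blast

lemma Kdeg_0 [simp]: "Kdeg N 0"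
  by (simp add: Kdeg_def)

lemma Kdeg_sum: "(\<And>a. a \<in> A \<Longrightarrow> Kdeg N (f a)) \<Longrightarrow> Kdeg N (sum f A)"
  by (induction A rule: infinite_finite_induct) (auto intro: Kdeg_add)

lemma Kdeg_mult:
  assumes "Kdeg M p" "Kdeg N q"
  shows "Kdeg (M + N) (p * q)"
  unfolding Kdeg_def
proof
  fix m assume "m \<in> keys (p * q)"
  then obtain a b where ab: "m = a + b" "a \<in> keys p" "b \<in> keys q"
    using keys_mult[of p q] by blast
  have "int (wdeg a) \<le> M" "int (wdeg b) \<le> N"
    using assms ab unfolding Kdeg_def by blast+
  then show "int (wdeg m) \<le> M + N" by (simp add: ab wdeg_add)
qed

lemma Kdeg_kconst: 
  assumes "Kdeg N p"
  shows "Kdeg N (kconst c * p)"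
proof -
  have "Kdeg 0 (kconst c)" by (simp add: Kdeg_def kconst_def wdeg_def)
  from Kdeg_mult[OF this assms] show ?thesis by simp
qed

lemma Kdeg_kvar:
  assumes "Kdeg N p"
  shows "Kdeg (N + int (snd x) + 1) (kvar x * p)"
proof -
  have "Kdeg (int (snd x) + 1) (kvar x)" by (simp add: Kdeg_def kvar_def wdeg_single)
  from Kdeg_mult[OF this assms] show ?thesis by (simp add: algebra_simps)
qed

lemma wdeg_minus_single:
  assumes "lookup m x \<noteq> 0"
  shows "int (wdeg (m - single x 1)) = int (wdeg m) - int (snd x) - 1"
proof -
  have eq: "single x 1 + (m - single x 1) = m"
    using assms by (intro poly_mapping_eqI) (auto simp: lookup_add lookup_minus lookup_single when_def)
  have "wdeg m = wdeg (single x 1) + wdeg (m - single x 1)"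
    by (subst wdeg_add[symmetric]) (simp only: eq)
  then show ?thesis unfolding wdeg_single by simp
qed

lemma Kdeg_kderiv:
  assumes "Kdeg N p"
  shows "Kdeg (N - int (snd x) - 1) (kderiv x p)"
  unfolding kderiv_def
proof (rule Kdeg_sum)
  fix m assume m: "m \<in> keys p"
  show "Kdeg (N - int (snd x) - 1) (single (m - single x 1) (of_nat (lookup m x) * lookup p m))"
  proof (cases "lookup m x = 0")
    case False
    have "int (wdeg m) \<le> N" using assms m unfolding Kdeg_def by blast
    with wdeg_minus_single[OF False] have *: "int (wdeg (m - single x 1)) \<le> N - int (snd x) - 1"
      by linarith
    have "keys (single (m - single x 1) (of_nat (lookup m x) * lookup p m)) \<subseteq> {m - single x 1}"
      by (simp only: keys_single split: if_splits) blast
    with * show ?thesis unfolding Kdeg_def by blast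
  qed (simp only: of_nat_0 mult_zero_left single_zero Kdeg_0)
qed

lemma Vdeg_add: "Vdeg N u \<Longrightarrow> Vdeg N v \<Longrightarrow> Vdeg N (u + v)"
  and Vdeg_scale: "Vdeg N v \<Longrightarrow> Vdeg N (vscale c v)"
  and Vdeg_0 [simp]: "Vdeg N 0"
  by (auto simp: Vdeg_def lookup_add lookup_vscale Kdeg_add Kdeg_kconst)

lemma Vdeg_sum: "(\<And>a. a \<in> A \<Longrightarrow> Vdeg N (f a)) \<Longrightarrow> Vdeg N (sum f A)"
  by (induction A rule: infinite_finite_induct) (auto intro: Vdeg_add)

lemma Vdeg_mono: "Vdeg N v \<Longrightarrow> N \<le> M \<Longrightarrow> Vdeg M v"
  unfolding Vdeg_def Kdeg_def by (meson order_trans)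

lemma Vdeg_neg:
  assumes "Vdeg N v" "N < 0"
  shows "v = 0"
proof (rule poly_mapping_eqI)
  fix \<beta>
  have "keys (lookup v \<beta>) = {}"
  proof (rule ccontr)
    assume "keys (lookup v \<beta>) \<noteq> {}"
    then obtain m where "m \<in> keys (lookup v \<beta>)" by blast
    then have "int (wdeg m) \<le> N" using assms(1) unfolding Vdeg_def Kdeg_def by blast
    with assms(2) show False by linarith
  qed
  then show "lookup v \<beta> = lookup 0 \<beta>" by simp
qed

lemma Vdeg_exists: "\<exists>N\<ge>0. Vdeg N v"
proof -
  let ?A = "\<Union>\<beta>\<in>keys v. keys (lookup v \<beta>)"
  have fin: "finite ?A" by auto
  have "Kdeg (int (\<Sum>m\<in>?A. wdeg m)) (lookup v \<beta>)" for \<beta>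
    unfolding Kdeg_def
  proof
    fix m assume m: "m \<in> keys (lookup v \<beta>)"
    then have "\<beta> \<in> keys v" by (metis in_keys_iff keys_zero empty_iff)
    with m have "m \<in> ?A" by blast
    then have "wdeg m \<le> (\<Sum>m\<in>?A. wdeg m)" using fin by (intro member_le_sum) auto
    then show "int (wdeg m) \<le> int (\<Sum>m\<in>?A. wdeg m)" by (simp only: of_nat_le_iff)
  qed
  then have "Vdeg (int (\<Sum>m\<in>?A. wdeg m)) v" unfolding Vdeg_def by blast
  then show ?thesis using of_nat_0_le_iff by blast
qed

lemma Vdeg_heis: "Vdeg N v \<Longrightarrow> Vdeg (N - l) (heis i l v)"
  unfolding Vdeg_def lookup_heis
proof
  fix \<beta> assume "\<forall>\<beta>. Kdeg N (lookup v \<beta>)"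
  then have d: "Kdeg N (lookup v \<beta>)" by simp
  show "Kdeg (N - l) (heisK i l (lookup v \<beta>))"
  proof (cases l "0::int" rule: linorder_cases)
    case less
    then have eq: "N + int (nat (- l) - 1) + 1 = N - l" and *: "heisK i l (lookup v \<beta>) = kvar (i, nat (- l) - 1) * lookup v \<beta>"
      by (simp_all add: heisK_def)
    show ?thesis
      using Kdeg_kvar[OF d, of "(i, nat (- l) - 1)"] unfolding * snd_conv eq .
  next
    case greater
    then have eq: "N - int (nat l - 1) - 1 = N - l"
      and *: "heisK i l (lookup v \<beta>) = (\<Sum>j\<in>UNIV. kconst (heis_bracket i j l) * kderiv (j, nat l - 1) (lookup v \<beta>))"
      by (simp_all add: heisK_def heis_bracket_def)
    have "Kdeg (N - l) (kderiv (j, nat l - 1) (lookup v \<beta>))" for j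
      using Kdeg_kderiv[OF d, of "(j, nat l - 1)"] unfolding snd_conv eq .
    then show ?thesis unfolding * by (intro Kdeg_sum Kdeg_kconst)
  next
    case equal
    then have "heisK i l (lookup v \<beta>) = 0" by (simp add: heisK_def)
    then show ?thesis by (simp only: Kdeg_0)
  qed
qed

section \<open>Exponentials of Heisenberg operators\<close>

lemma cst_add: "cst (a + b) = cst a + cst b"
  and cst_mult: "cst (a * b) = cst a * cst b"
  and cst_0 [simp]: "cst 0 = 0"
  and cst_1 [simp]: "cst 1 = 1"
  by (simp_all add: cst_def Zero_fract_def One_fract_def pCons_one mult.commute)

lemma cst_of_nat: "cst (of_nat n) = of_nat n"
  by (induction n) (simp_all add: cst_add)

text \<open>The recursions for exponentials divide by the degree, which requires characteristic zero.\<close>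

instance fract :: ("{idom, ring_char_0}") ring_char_0
proof
  have "of_nat n = Fract (of_nat n) (1 :: 'a)" for n
    by (induction n) (simp_all add: Zero_fract_def One_fract_def)
  then show "inj (of_nat :: nat \<Rightarrow> 'a fract)"
    by (auto intro!: injI simp: eq_fract)
qed

instance fract :: ("{idom, ring_char_0}") field_char_0 ..

subsection \<open>Exponentials of commuting operators\<close>

lemma sum_triangle_swap:
  fixes F :: "nat \<Rightarrow> nat \<Rightarrow> 'a::comm_monoid_add"
  shows "(\<Sum>r=1..m. \<Sum>s=1..m - r. F r s) = (\<Sum>s=1..m. \<Sum>r=1..m - s. F r s)"
proof -
  have "(\<Sum>r=1..m. \<Sum>s=1..m - r. F r s) = (\<Sum>r=1..m. \<Sum>s\<in>{s \<in> {1..m}. r + s \<le> m}. F r s)"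
    by (intro sum.cong) auto
  also have "\<dots> = (\<Sum>s=1..m. \<Sum>r\<in>{r \<in> {1..m}. r + s \<le> m}. F r s)"
    by (rule sum.swap_restrict) auto
  also have "\<dots> = (\<Sum>s=1..m. \<Sum>r=1..m - s. F r s)"
    by (intro sum.cong) auto
  finally show ?thesis .
qed

text \<open>Let \<open>E(u) = exp (\<Sum>\<^sub>r h(r) u\<^sup>r)\<close> with commuting \<open>h(r)\<close>. All facts about such exponentials are derived from
  the differential equation \<open>u E'(u) = (\<Sum>\<^sub>r r h(r) u\<^sup>r) E(u)\<close>, which is a recursion for the coefficients.\<close>

locale comm_ops =
  fixes h :: "nat \<Rightarrow> 'n V \<Rightarrow> 'n V"
  assumes lin [intro, simp]: "V_linear (h r)"
    and comm: "r > 0 \<Longrightarrow> s > 0 \<Longrightarrow> h r (h s v) = h s (h r v)"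
begin

lemmas h_add = module_hom.add[OF lin]
  and h_scale = module_hom.scale[OF lin]
  and h_0 = module_hom.zero[OF lin]
  and h_sum = module_hom.sum[OF lin]

lemma opow_linear: "V_linear (opow h k m)"
proof (induction k arbitrary: m)
  case (Suc k)
  show ?case unfolding opow.simps
    by (intro V_linear_sum V_linear_comp[OF lin] Suc)
qed (auto intro!: V_linearI)

lemma opow_gt: "k > m \<Longrightarrow> opow h k m v = 0"
proof (induction k arbitrary: m)
  case (Suc k)
  have "opow h k (m - r) v = 0" if "r \<in> {1..m}" for r
    using that Suc.prems by (intro Suc.IH) auto
  then show ?case by (auto simp: h_0 intro!: sum.neutral)
qed simp

text \<open>The derivation \<open>u d/du\<close> of a power, by the product rule.\<close>

lemma opow_derivation:
  "vscale (of_nat m) (opow h (Suc k) m v)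
    = vscale (of_nat (Suc k)) (\<Sum>r=1..m. vscale (of_nat r) (h r (opow h k (m - r) v)))"
proof (induction k arbitrary: m)
  case 0
  have "(\<Sum>r=1..m. vscale (of_nat r) (h r (opow h 0 (m - r) v))) = (\<Sum>r=1..m. if r = m then vscale (of_nat m) (h m v) else 0)"
    by (intro sum.cong) (auto simp: h_0)
  moreover have "opow h (Suc 0) m v = (\<Sum>r=1..m. if r = m then h m v else 0)"
    unfolding opow.simps by (intro sum.cong) (auto simp: h_0)
  ultimately show ?case by (cases "m = 0") (simp_all del: opow.simps)
next
  case (Suc k)
  let ?D = "\<Sum>r=1..m. vscale (of_nat r) (h r (opow h (Suc k) (m - r) v))"
  have "vscale (of_nat m) (opow h (Suc (Suc k)) m v) = (\<Sum>r=1..m. vscale (of_nat m) (h r (opow h (Suc k) (m - r) v)))"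
    by (subst opow.simps(2)) (rule V.scale_sum_right)
  also have "\<dots> = (\<Sum>r=1..m. vscale (of_nat r) (h r (opow h (Suc k) (m - r) v))
      + h r (vscale (of_nat (m - r)) (opow h (Suc k) (m - r) v)))"
  proof (intro sum.cong refl)
    fix r assume "r \<in> {1..m}"
    then have "(of_nat m :: scal) = of_nat r + of_nat (m - r)" by (simp flip: of_nat_add)
    then show "vscale (of_nat m) (h r (opow h (Suc k) (m - r) v)) = vscale (of_nat r) (h r (opow h (Suc k) (m - r) v))
      + h r (vscale (of_nat (m - r)) (opow h (Suc k) (m - r) v))"
      by (simp only: V.scale_left_distrib h_scale)
  qed
  also have "\<dots> = ?D + (\<Sum>r=1..m. vscale (of_nat (Suc k)) (\<Sum>s=1..m - r. vscale (of_nat s) (h r (h s (opow h k (m - r - s) v)))))"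
    unfolding sum.distrib Suc.IH h_scale h_sum ..
  also have "(\<Sum>r=1..m. vscale (of_nat (Suc k)) (\<Sum>s=1..m - r. vscale (of_nat s) (h r (h s (opow h k (m - r - s) v)))))
      = vscale (of_nat (Suc k)) (\<Sum>r=1..m. \<Sum>s=1..m - r. vscale (of_nat s) (h r (h s (opow h k (m - r - s) v))))"
    by (rule V.scale_sum_right[symmetric])
  also have "(\<Sum>r=1..m. \<Sum>s=1..m - r. vscale (of_nat s) (h r (h s (opow h k (m - r - s) v))))
      = (\<Sum>s=1..m. \<Sum>r=1..m - s. vscale (of_nat s) (h r (h s (opow h k (m - r - s) v))))"
    by (rule sum_triangle_swap)
  also have "\<dots> = (\<Sum>s=1..m. vscale (of_nat s) (h s (\<Sum>r=1..m - s. h r (opow h k (m - s - r) v))))"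
    unfolding V.scale_sum_right h_sum
    by (intro sum.cong refl) (simp add: comm add.commute)
  also have "\<dots> = ?D" by (simp only: opow.simps)
  also have "?D + vscale (of_nat (Suc k)) ?D = vscale (of_nat (Suc (Suc k))) ?D"
    by (simp only: of_nat_Suc[of "Suc k"] V.scale_left_distrib V.scale_one)
  finally show ?case .
qed

lemma opexp_extend:
  assumes "m \<le> K"
  shows "opexp h m v = (\<Sum>k\<le>K. vscale (cst (1 / fact k)) (opow h k m v))"
  unfolding opexp_def using assms by (intro sum.mono_neutral_left) (auto simp: opow_gt)

lemma opexp_recursion:
  "vscale (of_nat m) (opexp h m v) = (\<Sum>r=1..m. vscale (of_nat r) (h r (opexp h (m - r) v)))"
proof (cases m)
  case m: (Suc m')
  have cf: "cst (1 / fact (Suc k)) * of_nat (Suc k) = cst (1 / fact k)" for k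
    unfolding cst_of_nat[symmetric] cst_mult[symmetric]
    by (rule arg_cong[where f = cst]) (simp add: divide_simps del: of_nat_Suc)
  have "vscale (of_nat m) (opexp h m v) = (\<Sum>k\<le>Suc m'. vscale (cst (1 / fact k)) (vscale (of_nat m) (opow h k m v)))"
    unfolding opexp_def V.scale_sum_right m by (simp only: V.scale_scale mult.commute)
  also have "\<dots> = (\<Sum>k\<le>m'. vscale (cst (1 / fact (Suc k))) (vscale (of_nat m) (opow h (Suc k) m v)))"
    by (subst sum.atMost_Suc_shift) (simp add: m del: opow.simps(2))
  also have "\<dots> = (\<Sum>k\<le>m'. vscale (cst (1 / fact k)) (\<Sum>r=1..m. vscale (of_nat r) (h r (opow h k (m - r) v))))"
    unfolding opow_derivation V.scale_scale cf ..
  also have "\<dots> = (\<Sum>r=1..m. \<Sum>k\<le>m'. vscale (of_nat r) (h r (vscale (cst (1 / fact k)) (opow h k (m - r) v))))"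
    unfolding V.scale_sum_right by (subst sum.swap) (simp only: h_scale V.scale_scale mult.commute)
  also have "\<dots> = (\<Sum>r=1..m. vscale (of_nat r) (h r (opexp h (m - r) v)))"
  proof (intro sum.cong refl)
    fix r assume "r \<in> {1..m}"
    then have "m - r \<le> m'" using m by auto
    then show "(\<Sum>k\<le>m'. vscale (of_nat r) (h r (vscale (cst (1 / fact k)) (opow h k (m - r) v)))) = vscale (of_nat r) (h r (opexp h (m - r) v))"
      by (simp only: opexp_extend h_sum V.scale_sum_right)
  qed
  finally show ?thesis .
qed simp

lemma opexp_linear: "V_linear (opexp h m)"
  unfolding opexp_def by (intro V_linear_sum V_linear_scaled opow_linear)

lemma opexp_0: "opexp h 0 v = v"
  by (simp add: opexp_def)

end

text \<open>Coefficients with negative index are zero, so that summation indices can be shifted freely.\<close>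

definition iexp :: "(nat \<Rightarrow> 'n V \<Rightarrow> 'n V) \<Rightarrow> int \<Rightarrow> 'n V \<Rightarrow> 'n V" where
  "iexp h m v = (if m < 0 then 0 else opexp h (nat m) v)"

text \<open>Since \<open>m\<close> is invertible, the recursion computes each coefficient from the earlier ones.\<close>

lemma exp_recursion_unique:
  fixes X Y :: "int \<Rightarrow> 'n V" and h :: "int \<Rightarrow> 'n V \<Rightarrow> 'n V"
  assumes neg: "\<And>m. m < 0 \<Longrightarrow> X m = 0" "\<And>m. m < 0 \<Longrightarrow> Y m = 0" and "X 0 = Y 0"
    and "\<And>m. 0 < m \<Longrightarrow> vscale (of_int m) (X m) = (\<Sum>r\<in>{1..m}. vscale (of_int r) (h r (X (m - r))))"
    and "\<And>m. 0 < m \<Longrightarrow> vscale (of_int m) (Y m) = (\<Sum>r\<in>{1..m}. vscale (of_int r) (h r (Y (m - r))))"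
  shows "X m = Y m"
proof (induction "nat m" arbitrary: m rule: less_induct)
  case less
  show ?case
  proof (cases m "0::int" rule: linorder_cases)
    case greater
    have "vscale (of_int m) (X m) = vscale (of_int m) (Y m)"
      unfolding assms(4,5)[OF greater]
      using less greater by (intro sum.cong refl) auto
    then show ?thesis using greater by simp
  qed (simp_all add: assms)
qed

lemma sum_shift_neg:
  fixes F :: "int \<Rightarrow> 'a::comm_monoid_add"
  assumes "\<And>a. a < 0 \<Longrightarrow> F a = 0" "r \<ge> 0"
  shows "(\<Sum>a\<in>{0..m}. F (a - r)) = (\<Sum>a\<in>{0..m - r}. F a)"
proof -
  have "(\<Sum>a\<in>{0..m}. F (a - r)) = (\<Sum>a\<in>{r..m}. F (a - r))"
    using assms by (intro sum.mono_neutral_right) auto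
  also have "\<dots> = (\<Sum>a\<in>{0..m - r}. F a)"
    by (rule sum.reindex_bij_witness[of _ "\<lambda>a. a + r" "\<lambda>a. a - r"]) auto
  finally show ?thesis .
qed

context comm_ops begin

lemma iexp_linear [simp, intro]: "V_linear (iexp h m)"
  unfolding iexp_def by (intro V_linear_if opexp_linear V_linear_0)

lemma iexp_neg [simp]: "m < 0 \<Longrightarrow> iexp h m v = 0" by (simp add: iexp_def)

lemma iexp_0 [simp]: "iexp h 0 v = v" by (simp add: iexp_def opexp_0)

text \<open>The upper limit may be enlarged since the additional terms have negative indices; the double sums below
  need a limit that does not depend on the index.\<close>

lemma iexp_recursion:
  assumes "m \<le> M"
  shows "vscale (of_int m) (iexp h m v) = (\<Sum>r\<in>{1..M}. vscale (of_int r) (h (nat r) (iexp h (m - r) v)))"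
proof (cases "m < 0")
  case True
  then show ?thesis by (auto simp: h_0 intro!: sum.neutral[symmetric])
next
  case False
  have "(\<Sum>r\<in>{1..M}. vscale (of_int r) (h (nat r) (iexp h (m - r) v)))
      = (\<Sum>r\<in>{1..m}. vscale (of_int r) (h (nat r) (iexp h (m - r) v)))"
    using assms by (intro sum.mono_neutral_right) (auto simp: h_0)
  also have "\<dots> = (\<Sum>r=1..nat m. vscale (of_nat r) (h r (opexp h (nat m - r) v)))"
    by (rule sum.reindex_bij_witness[of _ int nat])
      (auto simp: iexp_def nat_diff_distrib')
  also have "\<dots> = vscale (of_int m) (iexp h m v)"
    using False opexp_recursion[of "nat m" v] by (simp add: iexp_def)
  finally show ?thesis ..
qed

lemma iexp_commute:
  assumes g: "V_linear g" and c: "\<And>r v. r > 0 \<Longrightarrow> g (h r v) = h r (g v)"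
  shows "g (iexp h m v) = iexp h m (g v)"
proof (rule exp_recursion_unique[where h = "\<lambda>r. h (nat r)"])
  fix m :: int assume "0 < m"
  have "vscale (of_int m) (g (iexp h m v)) = g (vscale (of_int m) (iexp h m v))"
    by (simp add: module_hom.scale[OF g])
  also have "\<dots> = (\<Sum>r\<in>{1..m}. vscale (of_int r) (h (nat r) (g (iexp h (m - r) v))))"
    by (subst iexp_recursion[OF order_refl]) (simp add: module_hom.sum[OF g] module_hom.scale[OF g] c)
  finally show "vscale (of_int m) (g (iexp h m v)) = (\<Sum>r\<in>{1..m}. vscale (of_int r) (h (nat r) (g (iexp h (m - r) v))))" .
qed (simp_all add: iexp_recursion module_hom.zero[OF g])

lemma iexp_scale:
  assumes "comm_ops h'" "\<And>r v. r > 0 \<Longrightarrow> h' r v = vscale (c ^ r) (h r v)"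
  shows "iexp h' m v = vscale (if m < 0 then 0 else c ^ nat m) (iexp h m v)"
proof -
  interpret h': comm_ops h' by fact
  show ?thesis
  proof (rule exp_recursion_unique[where h = "\<lambda>r. h' (nat r)"])
    fix m :: int assume "0 < m"
    have "vscale (of_int m) (vscale (c ^ nat m) (iexp h m v)) = (\<Sum>r\<in>{1..m}. vscale (c ^ nat m) (vscale (of_int r) (h (nat r) (iexp h (m - r) v))))"
      by (subst V.scale_left_commute, subst iexp_recursion[OF order_refl]) (simp only: V.scale_sum_right)
    also have "\<dots> = (\<Sum>r\<in>{1..m}. vscale (of_int r) (h' (nat r) (vscale (if m - r < 0 then 0 else c ^ nat (m - r)) (iexp h (m - r) v))))"
    proof (intro sum.cong refl)
      fix r assume r: "r \<in> {1..m}"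
      then have "nat m = nat r + nat (m - r)" by auto
      with r show "vscale (c ^ nat m) (vscale (of_int r) (h (nat r) (iexp h (m - r) v))) = vscale (of_int r) (h' (nat r) (vscale (if m - r < 0 then 0 else c ^ nat (m - r)) (iexp h (m - r) v)))"
        by (simp add: h'.h_scale assms(2) power_add mult_ac)
    qed
    finally show "vscale (of_int m) (vscale (if m < 0 then 0 else c ^ nat m) (iexp h m v)) = (\<Sum>r\<in>{1..m}. vscale (of_int r) (h' (nat r) (vscale (if m - r < 0 then 0 else c ^ nat (m - r)) (iexp h (m - r) v))))"
      using \<open>0 < m\<close> by simp
  qed (simp_all add: h'.iexp_recursion)
qed

lemma iexp_cong:
  assumes "comm_ops h'" "\<And>r v. r > 0 \<Longrightarrow> h' r v = h r v"
  shows "iexp h' m v = iexp h m v"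
  using iexp_scale[OF assms(1), of 1] assms(2) by (cases "m < 0") simp_all

lemma iexp_zero:
  assumes "\<And>r v. r > 0 \<Longrightarrow> h r v = 0"
  shows "iexp h m v = (if m = 0 then v else 0)"
proof (cases "m > 0")
  case True
  have "vscale (of_int m) (iexp h m v) = 0"
    unfolding iexp_recursion[OF order_refl] using assms by (intro sum.neutral) auto
  with True show ?thesis by simp
qed (cases "m = 0"; simp)

lemma iexp_1: "iexp h 1 v = h 1 v"
  using iexp_recursion[of 1 1 v] by simp

text \<open>The product of the exponentials solves the recursion that belongs to the sum of the exponents.\<close>

lemma iexp_add:
  assumes "comm_ops h'" "comm_ops k" and k: "\<And>r v. r > 0 \<Longrightarrow> k r v = h r v + h' r v"
    and hh: "\<And>r s v. r > 0 \<Longrightarrow> s > 0 \<Longrightarrow> h' r (h s v) = h s (h' r v)"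
  shows "(\<Sum>a\<in>{0..m}. iexp h a (iexp h' (m - a) v)) = iexp k m v"
proof -
  interpret h': comm_ops h' by fact
  interpret k: comm_ops k by fact
  show ?thesis
  proof (rule exp_recursion_unique[where h = "\<lambda>r. k (nat r)"])
    fix m :: int assume m: "0 < m"
    let ?P = "iexp h" and ?Q = "\<lambda>a. iexp h' a v"
    have "vscale (of_int m) (\<Sum>a\<in>{0..m}. ?P a (?Q (m - a)))
       = (\<Sum>a\<in>{0..m}. vscale (of_int a) (?P a (?Q (m - a))) + ?P a (vscale (of_int (m - a)) (?Q (m - a))))"
      by (simp add: V.scale_sum_right module_hom.scale[OF iexp_linear] flip: V.scale_left_distrib)
    also have "\<dots> = (\<Sum>a\<in>{0..m}. \<Sum>r\<in>{1..m}. vscale (of_int r) (h (nat r) (?P (a - r) (?Q (m - a)))) + vscale (of_int r) (?P a (h' (nat r) (?Q (m - a - r)))))"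
      by (intro sum.cong refl)
        (simp add: iexp_recursion[of _ m] h'.iexp_recursion[of _ m] module_hom.sum[OF iexp_linear] module_hom.scale[OF iexp_linear] sum.distrib del: of_int_diff)
    also have "\<dots> = (\<Sum>r\<in>{1..m}. \<Sum>a\<in>{0..m}. vscale (of_int r) (h (nat r) (?P (a - r) (?Q (m - a)))) + vscale (of_int r) (h' (nat r) (?P a (?Q (m - a - r)))))"
      by (subst sum.swap) (intro sum.cong refl, simp add: iexp_commute[OF h'.lin hh])
    also have "\<dots> = (\<Sum>r\<in>{1..m}. vscale (of_int r) (k (nat r) (\<Sum>a\<in>{0..m - r}. ?P a (?Q (m - r - a)))))"
    proof (intro sum.cong refl)
      fix r assume r: "r \<in> {1..m}"
      have "(\<Sum>a\<in>{0..m}. ?P (a - r) (?Q (m - a))) = (\<Sum>a\<in>{0..m - r}. ?P a (?Q (m - r - a)))"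
        using sum_shift_neg[of "\<lambda>a. ?P a (?Q (m - r - a))" r m] r by (simp add: algebra_simps)
      moreover have "(\<Sum>a\<in>{0..m}. ?P a (?Q (m - a - r))) = (\<Sum>a\<in>{0..m - r}. ?P a (?Q (m - r - a)))"
        using r by (intro sum.mono_neutral_cong_right) (auto simp: module_hom.zero[OF iexp_linear] algebra_simps)
      ultimately show "(\<Sum>a\<in>{0..m}. vscale (of_int r) (h (nat r) (?P (a - r) (?Q (m - a)))) + vscale (of_int r) (h' (nat r) (?P a (?Q (m - a - r)))))
          = vscale (of_int r) (k (nat r) (\<Sum>a\<in>{0..m - r}. ?P a (?Q (m - r - a))))"
        using r unfolding sum.distrib V.scale_sum_right[symmetric] h_sum[symmetric] h'.h_sum[symmetric]
        by (simp add: k V.scale_right_distrib)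
    qed
    finally show "vscale (of_int m) (\<Sum>a\<in>{0..m}. ?P a (?Q (m - a))) = (\<Sum>r\<in>{1..m}. vscale (of_int r) (k (nat r) (\<Sum>a\<in>{0..m - r}. ?P a (?Q (m - r - a)))))" .
  qed (simp_all add: k.iexp_recursion)
qed

lemma iexp_Vdeg:
  assumes "\<And>r v N. r > 0 \<Longrightarrow> Vdeg N v \<Longrightarrow> Vdeg (N + e * int r) (h r v)"
  shows "Vdeg N v \<Longrightarrow> Vdeg (N + e * m) (iexp h m v)"
proof (induction "nat m" arbitrary: m rule: less_induct)
  case less
  show ?case
  proof (cases "m \<le> 0")
    case True
    then show ?thesis using less.prems by (cases "m = 0") simp_all
  next
    case False
    have "Vdeg (N + e * m) (\<Sum>r\<in>{1..m}. vscale (of_int r) (h (nat r) (iexp h (m - r) v)))"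
    proof (intro Vdeg_sum Vdeg_scale)
      fix r assume r: "r \<in> {1..m}"
      then have "Vdeg (N + e * (m - r)) (iexp h (m - r) v)"
        using less by auto
      then have "Vdeg (N + e * (m - r) + e * int (nat r)) (h (nat r) (iexp h (m - r) v))"
        using r by (intro assms) auto
      then show "Vdeg (N + e * m) (h (nat r) (iexp h (m - r) v))"
        using r by (simp add: algebra_simps)
    qed
    then have "Vdeg (N + e * m) (vscale (1 / of_int m) (vscale (of_int m) (iexp h m v)))"
      by (simp only: iexp_recursion[OF order_refl] Vdeg_scale)
    then show ?thesis using False by simp
  qed
qed

end

subsection \<open>The contraction of an annihilation and a creation exponential\<close>

text \<open>The \<open>\<kappa> b\<close> are the coefficients of \<open>exp (\<Sum>\<^sub>r G(r) x\<^sup>r)\<close>, given by the recursion that determines them.\<close>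

locale heis_pair = D: comm_ops D + c: comm_ops c
  for D c :: "nat \<Rightarrow> 'n V \<Rightarrow> 'n V" +
  fixes \<gamma> :: "nat \<Rightarrow> scal" and \<kappa> :: "int \<Rightarrow> scal"
  assumes comm: "r > 0 \<Longrightarrow> s > 0 \<Longrightarrow> D r (c s v) = c s (D r v) + (if r = s then vscale (\<gamma> r) v else 0)"
    and \<kappa>_0: "\<kappa> 0 = 1" and \<kappa>_neg: "b < 0 \<Longrightarrow> \<kappa> b = 0"
    and \<kappa>_rec: "0 < b \<Longrightarrow> of_int b * \<kappa> b = (\<Sum>r\<in>{1..b}. of_int r * \<gamma> (nat r) * \<kappa> (b - r))"
begin

text \<open>The commutator with \<open>D(r)\<close> is a derivation that maps \<open>\<Sum>\<^sub>s c(s) u\<^sup>s\<close> to the scalar \<open>G(r) u\<^sup>r\<close>.\<close>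

lemma D_iexp:
  assumes "r > 0"
  shows "D r (iexp c l v) = iexp c l (D r v) + vscale (\<gamma> r) (iexp c (l - int r) v)"
proof (induction "nat l" arbitrary: l rule: less_induct)
  case less
  show ?case
  proof (cases "l > 0")
    case False
    then show ?thesis using assms by (cases "l = 0") (simp_all add: D.h_0)
  next
    case l: True
    let ?G = "iexp c"
    have "vscale (of_int l) (D r (?G l v)) = (\<Sum>s\<in>{1..l}. vscale (of_int s) (D r (c (nat s) (?G (l - s) v))))"
      unfolding D.h_scale[symmetric] c.iexp_recursion[OF order_refl] D.h_sum
      by (simp only: D.h_scale)
    also have "\<dots> = (\<Sum>s\<in>{1..l}. vscale (of_int s) (c (nat s) (?G (l - s) (D r v)))
         + vscale (\<gamma> r) (vscale (of_int s) (c (nat s) (?G (l - int r - s) v)))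
         + (if s = int r then vscale (of_nat r) (vscale (\<gamma> r) (?G (l - int r) v)) else 0))"
    proof (intro sum.cong refl)
      fix s assume s: "s \<in> {1..l}"
      then have "D r (?G (l - s) v) = ?G (l - s) (D r v) + vscale (\<gamma> r) (?G (l - s - int r) v)"
        using less by auto
      then show "vscale (of_int s) (D r (c (nat s) (?G (l - s) v))) = vscale (of_int s) (c (nat s) (?G (l - s) (D r v)))
         + vscale (\<gamma> r) (vscale (of_int s) (c (nat s) (?G (l - int r - s) v)))
         + (if s = int r then vscale (of_nat r) (vscale (\<gamma> r) (?G (l - int r) v)) else 0)"
        using s assms
        by (auto simp: comm c.h_add c.h_scale V.scale_right_distrib algebra_simps)
    qed
    also have "\<dots> = vscale (of_int l) (?G l (D r v)) + vscale (\<gamma> r) (vscale (of_int (l - int r)) (?G (l - int r) v))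
        + (if int r \<in> {1..l} then vscale (of_nat r) (vscale (\<gamma> r) (?G (l - int r) v)) else 0)"
      unfolding sum.distrib V.scale_sum_right[symmetric]
      using assms by (simp add: c.iexp_recursion[of _ l] del: of_int_diff)
    also have "\<dots> = vscale (of_int l) (?G l (D r v) + vscale (\<gamma> r) (?G (l - int r) v))"
      using assms by (auto simp: V.scale_right_distrib algebra_simps simp flip: V.scale_left_distrib)
    finally show ?thesis using l by simp
  qed
qed

text \<open>As sequences in \<open>p\<close>, both sides solve the recursion of the exponential of \<open>D\<close>.\<close>

theorem iexp_contraction:
  assumes "p \<le> M"
  shows "iexp D p (iexp c l v) = (\<Sum>b\<in>{0..M}. vscale (\<kappa> b) (iexp c (l - b) (iexp D (p - b) v)))"
proof -
  let ?T = "iexp D" and ?G = "iexp c"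
  have "iexp D p (iexp c l v) = (\<Sum>b\<in>{0..p}. vscale (\<kappa> b) (iexp c (l - b) (iexp D (p - b) v)))"
  proof (rule exp_recursion_unique[where h = "\<lambda>r. D (nat r)"])
    fix p :: int assume p: "0 < p"
    have "(\<Sum>r\<in>{1..p}. vscale (of_int r) (D (nat r) (\<Sum>b\<in>{0..p - r}. vscale (\<kappa> b) (?G (l - b) (?T (p - r - b) v)))))
      = (\<Sum>r\<in>{1..p}. (\<Sum>b\<in>{0..p}. vscale (\<kappa> b) (?G (l - b) (vscale (of_int r) (D (nat r) (?T (p - b - r) v)))))
          + (\<Sum>b\<in>{0..p}. vscale (of_int r * \<gamma> (nat r) * \<kappa> (b - r)) (?G (l - b) (?T (p - b) v))))"
    proof (intro sum.cong refl)
      fix r assume r: "r \<in> {1..p}"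
      have "(\<Sum>b\<in>{0..p - r}. vscale (\<kappa> b) (?G (l - b) (?T (p - r - b) v))) = (\<Sum>b\<in>{0..p}. vscale (\<kappa> b) (?G (l - b) (?T (p - r - b) v)))"
        using r by (intro sum.mono_neutral_left) (auto simp: module_hom.zero[OF c.iexp_linear])
      then have "vscale (of_int r) (D (nat r) (\<Sum>b\<in>{0..p - r}. vscale (\<kappa> b) (?G (l - b) (?T (p - r - b) v))))
         = (\<Sum>b\<in>{0..p}. vscale (\<kappa> b) (?G (l - b) (vscale (of_int r) (D (nat r) (?T (p - b - r) v)))))
          + (\<Sum>b\<in>{0..p}. vscale (of_int r * \<gamma> (nat r) * \<kappa> b) (?G (l - b - r) (?T (p - r - b) v)))"
        using r by (simp add: D.h_sum D.h_scale D_iexp V.scale_sum_right V.scale_right_distrib sum.distrib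
          module_hom.scale[OF c.iexp_linear] algebra_simps)
      also have "(\<Sum>b\<in>{0..p}. vscale (of_int r * \<gamma> (nat r) * \<kappa> b) (?G (l - b - r) (?T (p - r - b) v)))
         = (\<Sum>b\<in>{0..p - r}. vscale (of_int r * \<gamma> (nat r) * \<kappa> b) (?G (l - b - r) (?T (p - r - b) v)))"
        using r by (intro sum.mono_neutral_right) (auto simp: module_hom.zero[OF c.iexp_linear])
      also have "\<dots> = (\<Sum>b\<in>{0..p}. vscale (of_int r * \<gamma> (nat r) * \<kappa> (b - r)) (?G (l - (b - r) - r) (?T (p - r - (b - r)) v)))"
        using r by (intro sum_shift_neg[symmetric, where F = "\<lambda>b. vscale (of_int r * \<gamma> (nat r) * \<kappa> b) (?G (l - b - r) (?T (p - r - b) v))"]) (auto simp: \<kappa>_neg)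
      finally show "vscale (of_int r) (D (nat r) (\<Sum>b\<in>{0..p - r}. vscale (\<kappa> b) (?G (l - b) (?T (p - r - b) v))))
         = (\<Sum>b\<in>{0..p}. vscale (\<kappa> b) (?G (l - b) (vscale (of_int r) (D (nat r) (?T (p - b - r) v)))))
          + (\<Sum>b\<in>{0..p}. vscale (of_int r * \<gamma> (nat r) * \<kappa> (b - r)) (?G (l - b) (?T (p - b) v)))"
        by simp
    qed
    also have "\<dots> = (\<Sum>b\<in>{0..p}. vscale (\<kappa> b) (?G (l - b) (\<Sum>r\<in>{1..p}. vscale (of_int r) (D (nat r) (?T (p - b - r) v)))))
          + (\<Sum>b\<in>{0..p}. vscale (\<Sum>r\<in>{1..p}. of_int r * \<gamma> (nat r) * \<kappa> (b - r)) (?G (l - b) (?T (p - b) v)))"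
      unfolding sum.distrib module_hom.sum[OF c.iexp_linear] V.scale_sum_right V.scale_sum_left
      by (intro arg_cong2[where f = "(+)"] sum.swap)
    also have "(\<Sum>b\<in>{0..p}. vscale (\<Sum>r\<in>{1..p}. of_int r * \<gamma> (nat r) * \<kappa> (b - r)) (?G (l - b) (?T (p - b) v)))
        = (\<Sum>b\<in>{0..p}. vscale (of_int b * \<kappa> b) (?G (l - b) (?T (p - b) v)))"
    proof (intro sum.cong refl arg_cong2[where f = vscale])
      fix b assume b: "b \<in> {0..p}"
      have "(\<Sum>r\<in>{1..p}. of_int r * \<gamma> (nat r) * \<kappa> (b - r)) = (\<Sum>r\<in>{1..b}. of_int r * \<gamma> (nat r) * \<kappa> (b - r))"
        using b by (intro sum.mono_neutral_right) (auto simp: \<kappa>_neg)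
      also have "\<dots> = of_int b * \<kappa> b"
        using b by (cases "b = 0") (simp_all add: \<kappa>_rec)
      finally show "(\<Sum>r\<in>{1..p}. of_int r * \<gamma> (nat r) * \<kappa> (b - r)) = of_int b * \<kappa> b" .
    qed
    also have "(\<Sum>b\<in>{0..p}. vscale (\<kappa> b) (?G (l - b) (\<Sum>r\<in>{1..p}. vscale (of_int r) (D (nat r) (?T (p - b - r) v)))))
        = (\<Sum>b\<in>{0..p}. vscale (of_int (p - b) * \<kappa> b) (?G (l - b) (?T (p - b) v)))"
    proof (intro sum.cong refl)
      fix b assume b: "b \<in> {0..p}"
      then show "vscale (\<kappa> b) (?G (l - b) (\<Sum>r\<in>{1..p}. vscale (of_int r) (D (nat r) (?T (p - b - r) v))))
        = vscale (of_int (p - b) * \<kappa> b) (?G (l - b) (?T (p - b) v))"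
        by (subst D.iexp_recursion[symmetric]) (auto simp: module_hom.scale[OF c.iexp_linear] mult.commute)
    qed
    also have "\<dots> + (\<Sum>b\<in>{0..p}. vscale (of_int b * \<kappa> b) (?G (l - b) (?T (p - b) v)))
        = vscale (of_int p) (\<Sum>b\<in>{0..p}. vscale (\<kappa> b) (?G (l - b) (?T (p - b) v)))"
      by (simp add: V.scale_sum_right flip: sum.distrib V.scale_left_distrib) (simp add: algebra_simps)
    finally show "vscale (of_int p) (\<Sum>b\<in>{0..p}. vscale (\<kappa> b) (?G (l - b) (?T (p - b) v)))
        = (\<Sum>r\<in>{1..p}. vscale (of_int r) (D (nat r) (\<Sum>b\<in>{0..p - r}. vscale (\<kappa> b) (?G (l - b) (?T (p - r - b) v)))))" ..
  qed (simp_all add: D.iexp_recursion \<kappa>_0)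
  also have "\<dots> = (\<Sum>b\<in>{0..M}. vscale (\<kappa> b) (iexp c (l - b) (iexp D (p - b) v)))"
    using assms by (intro sum.mono_neutral_left) (auto simp: module_hom.zero[OF c.iexp_linear])
  finally show ?thesis .
qed

end

section \<open>Powers of \<open>q\<close>\<close>

text \<open>Exponents are counted in halves: \<open>Q e\<close> is \<open>q\<^sup>e\<^sup>/\<^sup>2\<close>.\<close>

definition Q :: "int \<Rightarrow> scal" where "Q e = qh powi e"

lemma qh_neq_0 [simp]: "qh \<noteq> 0"
  by (simp add: qh_def Zero_fract_def eq_fract)

lemma Q_add: "Q (a + b) = Q a * Q b"
  by (simp add: Q_def power_int_add)

lemma Q_0 [simp]: "Q 0 = 1"
  by (simp add: Q_def)

lemma Q_nonzero [simp]: "Q a \<noteq> 0"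
  by (simp add: Q_def)

lemma Q_minus: "Q (- a) = 1 / Q a"
  by (simp add: Q_def power_int_minus divide_inverse)

lemma Q_power: "Q a ^ r = Q (a * int r)"
  by (simp add: Q_def power_int_mult)

lemma qh_power: "qh ^ k = Fract (monom 1 k) 1"
  by (induction k) (simp_all add: qh_def One_fract_def monom_0 monom_Suc pCons_one mult.commute)

lemma of_int_Fract: "(of_int c :: 'a::idom fract) = Fract (of_int c) 1"
proof -
  have "(of_nat n :: 'a fract) = Fract (of_nat n) 1" for n
    by (induction n) (simp_all add: Zero_fract_def One_fract_def)
  then show ?thesis by (cases c) (simp_all del: of_nat_Suc)
qed

text \<open>After multiplication by a power of the indeterminate \<open>q\<^sup>1\<^sup>/\<^sup>2\<close> the sum becomes a polynomial, whose coefficients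
  are the \<open>c e\<close>.\<close>

lemma Q_independent:
  assumes A: "finite A" and zero: "(\<Sum>e\<in>A. of_int (c e) * Q e) = 0" and e: "e \<in> A"
  shows "c e = 0"
proof -
  define M where "M = (\<Sum>e\<in>A. \<bar>e\<bar>)"
  have M: "0 \<le> e + M" if "e \<in> A" for e
    using member_le_sum[OF that, of abs] A unfolding M_def by auto
  define p :: "complex poly" where "p = (\<Sum>e\<in>A. monom (of_int (c e)) (nat (e + M)))"
  have Fsum: "Fract (\<Sum>e\<in>B. g e) 1 = (\<Sum>e\<in>B. Fract (g e) 1)" if "finite B" for B and g :: "int \<Rightarrow> complex poly"
    using that
  proof (induction B rule: finite_induct)
    case (insert x F)
    have "Fract (g x + sum g F) 1 = Fract (g x) 1 + Fract (sum g F) 1" by simp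
    with insert show ?case by (simp only: sum.insert[OF insert(1,2)])
  qed (simp add: Zero_fract_def)
  have "Fract p 1 = (\<Sum>e\<in>A. of_int (c e) * Q (e + M))"
    unfolding p_def Fsum[OF A]
  proof (intro sum.cong refl)
    fix e assume "e \<in> A"
    then have "Q (e + M) = qh ^ nat (e + M)" using M by (simp add: Q_def power_int_def)
    then show "Fract (monom (of_int (c e)) (nat (e + M))) 1 = of_int (c e) * Q (e + M)"
      by (simp add: qh_power of_int_Fract of_int_poly smult_monom)
  qed
  also have "\<dots> = Q M * (\<Sum>e\<in>A. of_int (c e) * Q e)"
    by (simp add: Q_add sum_distrib_left mult_ac)
  finally have "Fract p 1 = 0" unfolding zero by simp
  then have "p = 0" by (simp add: Zero_fract_def eq_fract)
  moreover have "coeff p (nat (e + M)) = of_int (c e)"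
  proof -
    have "coeff p (nat (e + M)) = (\<Sum>x\<in>A. if x = e then of_int (c e) else 0)"
      unfolding p_def coeff_sum using M e by (intro sum.cong) (auto simp: nat_eq_iff2)
    then show ?thesis using A e by simp
  qed
  ultimately show ?thesis by simp
qed

lemma Q_inject [simp]: "Q a = Q b \<longleftrightarrow> a = b"
proof
  assume eq: "Q a = Q b"
  show "a = b"
  proof (rule ccontr)
    assume ne: "a \<noteq> b"
    have "(\<Sum>e\<in>{a, b}. of_int (if e = a then 1 else - 1) * Q e) = 0"
      using ne eq by simp
    from Q_independent[OF _ this, of a] show False by simp
  qed
qed simp

lemma qq_powi: "qq powi m = Q (2 * m)"
  by (simp add: qq_def Q_def power_int_mult)

lemma qq_Q: "qq = Q 2" using qq_powi[of 1] by simp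

lemma qint_Q: "qint m = (Q (2 * m) - Q (- 2 * m)) / (Q 2 - Q (- 2))"
  using qq_powi[of m] qq_powi[of "- m"] qq_powi[of "-1"] by (simp add: qint_def qq_Q)

lemma q_diff_nonzero [simp]: "Q 2 - Q (- 2) \<noteq> 0"
  by (simp only: right_minus_eq Q_inject)

lemma qint_0 [simp]: "qint 0 = 0" by (simp add: qint_Q)
lemma qint_minus [simp]: "qint (- m) = - qint m"
  unfolding qint_Q minus_divide_left by simp
lemma qint_eq_0_iff [simp]: "qint m = 0 \<longleftrightarrow> m = 0"
  unfolding qint_Q divide_eq_0_iff using q_diff_nonzero by simp
lemma qint_1 [simp]: "qint 1 = 1" unfolding qint_Q using q_diff_nonzero by simp

lemma q_diff_qint: "(Q 2 - Q (- 2)) * qint m = Q (2 * m) - Q (- 2 * m)"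
  unfolding qint_Q using q_diff_nonzero by simp

lemma qint_2_mult: "qint (2 * l) * qint a = qint l * (qint (a + l) + qint (a - l))"
proof -
  have "(Q (2 * (2 * l)) - Q (- 2 * (2 * l))) * (Q (2 * a) - Q (- 2 * a))
    = (Q (2 * l) - Q (- 2 * l)) * ((Q (2 * (a + l)) - Q (- 2 * (a + l))) + (Q (2 * (a - l)) - Q (- 2 * (a - l))))"
    by (simp add: algebra_simps flip: Q_add)
  then show ?thesis unfolding qint_Q add_divide_distrib[symmetric] times_divide_times_eq by simp
qed

lemma qint_mult_diff: "qint (a + l) * qint b - qint a * qint (b - l) = qint l * qint (a + b)"
proof -
  have "(Q (2 * (a + l)) - Q (- 2 * (a + l))) * (Q (2 * b) - Q (- 2 * b)) - (Q (2 * a) - Q (- 2 * a)) * (Q (2 * (b - l)) - Q (- 2 * (b - l)))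
    = (Q (2 * l) - Q (- 2 * l)) * (Q (2 * (a + b)) - Q (- 2 * (a + b)))"
    by (simp add: algebra_simps flip: Q_add)
  then show ?thesis unfolding qint_Q times_divide_times_eq diff_divide_distrib[symmetric] by simp
qed

section \<open>The quantum Cartan matrix and its inverse\<close>

text \<open>A row of the matrix \<open>[a\<^sub>k\<^sub>j l]\<close> is a three-term relation; at the ends of the diagram the missing
  neighbour is replaced by a boundary value that vanishes.\<close>

lemma sum_qcartan:
  fixes g :: "nat \<Rightarrow> scal"
  assumes "g 0 = 0" "g (Suc n) = 0" "1 \<le> j" "j \<le> n"
  shows "(\<Sum>k=1..n. qint (cartan k j * l) * g k) = qint (2 * l) * g j - qint l * (g (j - 1) + g (j + 1))"
proof -
  have "(\<Sum>k=1..n. qint (cartan k j * l) * g k) = (\<Sum>k=0..Suc n. qint (cartan k j * l) * g k)"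
    using assms by (intro sum.mono_neutral_left) (auto simp: not_le le_Suc_eq)
  also have "\<dots> = (\<Sum>k\<in>{j, j - 1, j + 1}. qint (cartan k j * l) * g k)"
    using assms by (intro sum.mono_neutral_right) (auto simp: cartan_def)
  also have "\<dots> = qint (2 * l) * g j - qint l * (g (j - 1) + g (j + 1))"
    using assms by (simp add: cartan_def algebra_simps)
  finally show ?thesis .
qed

lemma dual_coeff_uminus: "dual_coeff i j (- l) = dual_coeff i j l"
  by (simp add: dual_coeff_def)

lemma dual_coeff_sym: "dual_coeff i j l = dual_coeff j i l"
  by (auto simp: dual_coeff_def mult.commute)

text \<open>The coefficients of \<open>a\<^sub>i\<^sup>*(l)\<close> are, up to the factor \<open>[l]\<close>, the entries of the inverse of the matrix
  \<open>[a\<^sub>i\<^sub>j l]\<close>. Away from the diagonal this is \<open>[2l][a] = [l]([a + l] + [a - l])\<close>.\<close>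

lemma qcartan_inverse:
  fixes j m :: "'n::{finite,linorder}"
  assumes l: "l \<noteq> 0"
  shows "(\<Sum>k\<in>UNIV. qint (cartan (idx k) (idx j) * l) * dual_coeff k m l) = (if j = m then qint l else 0)"
proof -
  let ?n = "CARD('n)"
  define g where "g k = qint (int (min k (idx m)) * l) * qint (int (?n + 1 - max k (idx m)) * l)" for k
  have g_dual: "dual_coeff k m l = g (idx k) / (qint (int (?n + 1) * l) * qint l)" for k :: 'n
    by (auto simp: dual_coeff_def g_def min_def max_def mult.commute)
  have jb: "1 \<le> idx j" "idx j \<le> ?n" "1 \<le> idx m" "idx m \<le> ?n" by (simp_all only: idx_ge1 idx_le)
  have "(\<Sum>k\<in>UNIV. qint (cartan (idx k) (idx j) * l) * dual_coeff k m l)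
      = (\<Sum>k\<in>(UNIV :: 'n set). (\<lambda>k. qint (cartan k (idx j) * l) * g k) (idx k)) / (qint (int (?n + 1) * l) * qint l)"
    by (simp add: g_dual sum_divide_distrib)
  also have "(\<Sum>k\<in>(UNIV :: 'n set). (\<lambda>k. qint (cartan k (idx j) * l) * g k) (idx k)) = (\<Sum>k=1..?n. qint (cartan k (idx j) * l) * g k)"
    by (rule sum.reindex_bij_betw[OF bij_idx])
  also have "\<dots> = qint (2 * l) * g (idx j) - qint l * (g (idx j - 1) + g (idx j + 1))"
    using jb by (intro sum_qcartan) (auto simp: g_def)
  also have "\<dots> = (if j = m then qint l * qint l * qint (int (?n + 1) * l) else 0)"
  proof (cases "idx j" "idx m" rule: linorder_cases)
    case less
    then have [simp]: "min (idx j) (idx m) = idx j" "min (idx j - Suc 0) (idx m) = idx j - Suc 0" "min (Suc (idx j)) (idx m) = Suc (idx j)"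
      "max (idx j) (idx m) = idx m" "max (idx j - Suc 0) (idx m) = idx m" "max (Suc (idx j)) (idx m) = idx m" by auto
    have "g (idx j) = qint (int (idx j) * l) * qint (int (?n + 1 - idx m) * l)"
      "g (idx j - 1) = qint (int (idx j) * l - l) * qint (int (?n + 1 - idx m) * l)"
      "g (idx j + 1) = qint (int (idx j) * l + l) * qint (int (?n + 1 - idx m) * l)"
      using jb by (auto simp: g_def of_nat_diff algebra_simps)
    then have "qint (2 * l) * g (idx j) - qint l * (g (idx j - 1) + g (idx j + 1)) = 0"
      by (simp only: mult.assoc[symmetric] qint_2_mult) (simp add: algebra_simps)
    moreover have "j \<noteq> m" using less by auto
    ultimately show ?thesis by simp
  next
    case greater
    then have [simp]: "min (idx j) (idx m) = idx m" "min (idx j - Suc 0) (idx m) = idx m" "min (Suc (idx j)) (idx m) = idx m"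
      "max (idx j) (idx m) = idx j" "max (idx j - Suc 0) (idx m) = idx j - Suc 0" "max (Suc (idx j)) (idx m) = Suc (idx j)" by auto
    have "g (idx j) = qint (int (?n + 1 - idx j) * l) * qint (int (idx m) * l)"
      "g (idx j - 1) = qint (int (?n + 1 - idx j) * l + l) * qint (int (idx m) * l)"
      "g (idx j + 1) = qint (int (?n + 1 - idx j) * l - l) * qint (int (idx m) * l)"
      using jb by (auto simp: g_def of_nat_diff algebra_simps)
    then have "qint (2 * l) * g (idx j) - qint l * (g (idx j - 1) + g (idx j + 1)) = 0"
      by (simp only: mult.assoc[symmetric] qint_2_mult) (simp add: algebra_simps)
    moreover have "j \<noteq> m" using greater by auto
    ultimately show ?thesis by simp
  next
    case equal
    define a b where "a = int (idx j) * l" and "b = int (?n + 1 - idx j) * l"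
    have g: "g (idx j) = qint a * qint b" "g (idx j - 1) = qint (a - l) * qint b"
      "g (idx j + 1) = qint a * qint (b - l)"
      using jb equal by (auto simp: g_def min_def max_def of_nat_diff algebra_simps a_def b_def)
    have "qint (2 * l) * g (idx j) - qint l * (g (idx j - 1) + g (idx j + 1))
        = qint l * (qint (a + l) * qint b - qint a * qint (b - l))"
      unfolding g mult.assoc[symmetric] qint_2_mult by (simp add: algebra_simps)
    also have "\<dots> = qint l * qint l * qint (a + b)" unfolding qint_mult_diff by simp
    also have "a + b = int (?n + 1) * l" using jb by (simp add: a_def b_def of_nat_diff algebra_simps)
    finally show ?thesis using equal by simp
  qed
  finally show ?thesis using l by auto
qed

lemma heis_dual_linear [simp, intro]: "V_linear (heis_dual i l)"
  unfolding heis_dual_def by (intro V_linear_sum V_linear_scaled heis_linear)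

lemma heis_eq_dual:
  assumes "l \<noteq> 0"
  shows "heis j l v = (\<Sum>k\<in>UNIV. vscale (qint (cartan (idx k) (idx j) * l) / qint l) (heis_dual k l v))"
proof -
  have "(\<Sum>k\<in>UNIV. vscale (qint (cartan (idx k) (idx j) * l) / qint l) (heis_dual k l v))
      = (\<Sum>m\<in>UNIV. vscale ((\<Sum>k\<in>UNIV. qint (cartan (idx k) (idx j) * l) * dual_coeff k m l) / qint l) (heis m l v))"
    unfolding heis_dual_def V.scale_sum_right V.scale_scale sum_divide_distrib V.scale_sum_left
    by (subst sum.swap) simp
  also have "\<dots> = (\<Sum>m\<in>UNIV. if m = j then heis m l v else 0)"
    unfolding qcartan_inverse[OF assms] using assms by (intro sum.cong) auto
  finally show ?thesis by simp
qed

lemma heis_dual_cre_cre: "l < 0 \<Longrightarrow> m < 0 \<Longrightarrow> heis_dual i l (heis_dual j m v) = heis_dual j m (heis_dual i l v)"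
  unfolding heis_dual_def module_hom.sum[OF heis_linear] module_hom.scale[OF heis_linear] V.scale_sum_right
  by (subst sum.swap) (simp add: heis_cre_cre mult.commute)

text \<open>Duality of the \<open>a\<^sub>j(r)\<close> and the \<open>a\<^sub>k\<^sup>*(-r)\<close>, an instance of the inversion of the quantum Cartan matrix.\<close>

lemma heis_ann_dual:
  assumes "l > 0" "m > 0"
  shows "heis i l (heis_dual k (- m) v) = heis_dual k (- m) (heis i l v)
    + (if l = m then vscale (if i = k then qint l ^ 2 / of_int l else 0) v else 0)"
proof -
  have "heis i l (heis_dual k (- m) v) = heis_dual k (- m) (heis i l v)
    + (\<Sum>j\<in>UNIV. if l = m then vscale (dual_coeff k j m * heis_bracket i j l) v else 0)"
    unfolding heis_dual_def module_hom.sum[OF heis_linear] module_hom.scale[OF heis_linear]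
      heis_ann_cre[OF assms] dual_coeff_uminus V.scale_right_distrib sum.distrib
    by (auto intro!: sum.cong)
  also have "(\<Sum>j\<in>UNIV. if l = m then vscale (dual_coeff k j m * heis_bracket i j l) v else 0)
      = (if l = m then vscale ((\<Sum>j\<in>UNIV. qint (cartan (idx j) (idx i) * l) * dual_coeff j k l) * (qint l / of_int l)) v else 0)"
  proof (cases "l = m")
    case True
    have "dual_coeff k j m * heis_bracket i j m = qint (cartan (idx j) (idx i) * m) * dual_coeff j k m * (qint m / of_int m)" for j
      unfolding heis_bracket_def dual_coeff_sym[of k j] cartan_sym[of "idx i" "idx j"] by (simp add: mult_ac)
    with True show ?thesis unfolding sum_distrib_right V.scale_sum_left by simp
  qed simp
  also have "(\<Sum>j\<in>UNIV. qint (cartan (idx j) (idx i) * l) * dual_coeff j k l) = (if i = k then qint l else 0)"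
    using assms by (intro qcartan_inverse) auto
  finally show ?thesis by (simp add: power2_eq_square)
qed

lemma Vdeg_heis_dual: "Vdeg N v \<Longrightarrow> Vdeg (N - l) (heis_dual i l v)"
  unfolding heis_dual_def by (intro Vdeg_sum Vdeg_scale Vdeg_heis)

section \<open>The oscillator part of a vertex operator\<close>

text \<open>Creation parts are expanded in the \<open>a\<^sub>k\<^sup>*(-r)\<close> and annihilation parts in the dual family \<open>a\<^sub>k(r)\<close>, so that
  contractions are diagonal in \<open>k\<close>.\<close>

definition cre :: "('n::{finite,linorder} \<Rightarrow> nat \<Rightarrow> scal) \<Rightarrow> nat \<Rightarrow> 'n V \<Rightarrow> 'n V" where
  "cre C r v = (\<Sum>k\<in>UNIV. vscale (C k r) (heis_dual k (- int r) v))"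

definition ann :: "('n::{finite,linorder} \<Rightarrow> nat \<Rightarrow> scal) \<Rightarrow> nat \<Rightarrow> 'n V \<Rightarrow> 'n V" where
  "ann A r v = (\<Sum>k\<in>UNIV. vscale (A k r) (heis k (int r) v))"

lemma cre_linear [simp, intro]: "V_linear (cre C r)"
  unfolding cre_def by (intro V_linear_sum V_linear_scaled heis_dual_linear)

lemma ann_linear [simp, intro]: "V_linear (ann C r)"
  unfolding ann_def by (intro V_linear_sum V_linear_scaled heis_linear)

lemma cre_commute:
  assumes "r > 0" "s > 0"
  shows "cre C r (cre C' s v) = cre C' s (cre C r v)"
  unfolding cre_def module_hom.sum[OF heis_dual_linear] module_hom.scale[OF heis_dual_linear] V.scale_sum_right
  using assms by (subst sum.swap) (simp add: heis_dual_cre_cre mult.commute)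

lemma ann_commute:
  assumes "r > 0" "s > 0"
  shows "ann C r (ann C' s v) = ann C' s (ann C r v)"
  unfolding ann_def module_hom.sum[OF heis_linear] module_hom.scale[OF heis_linear] V.scale_sum_right
  using assms by (subst sum.swap) (simp add: heis_ann_ann mult.commute)

interpretation cre: comm_ops "cre C" for C by (intro comm_ops.intro cre_linear cre_commute)
interpretation ann: comm_ops "ann A" for A by (intro comm_ops.intro ann_linear ann_commute)

lemma ann_cre:
  assumes "r > 0" "s > 0"
  shows "ann A r (cre C s v) = cre C s (ann A r v)
    + (if r = s then vscale ((\<Sum>k\<in>UNIV. A k r * C k r) * (qint (int r) ^ 2 / of_nat r)) v else 0)"
proof -
  have "ann A r (cre C s v) = cre C s (ann A r v)
    + (\<Sum>i\<in>UNIV. \<Sum>k\<in>UNIV. vscale (A i r * C k s) (if int r = int s then vscale (if i = k then qint (int r) ^ 2 / of_int (int r) else 0) v else 0))"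
    unfolding ann_def cre_def module_hom.sum[OF heis_linear] module_hom.scale[OF heis_linear]
      module_hom.sum[OF heis_dual_linear] module_hom.scale[OF heis_dual_linear] V.scale_sum_right
    by (subst (2) sum.swap) (use assms in \<open>simp add: heis_ann_dual V.scale_right_distrib sum.distrib mult.commute del: of_int_of_nat_eq\<close>)
  also have "(\<Sum>i\<in>UNIV. \<Sum>k\<in>UNIV. vscale (A i r * C k s) (if int r = int s then vscale (if i = k then qint (int r) ^ 2 / of_int (int r) else 0) v else 0))
     = (\<Sum>i\<in>UNIV. \<Sum>k\<in>UNIV. if k = i then if r = s then vscale (A i r * C i r * (qint (int r) ^ 2 / of_nat r)) v else 0 else 0)"
    by (intro sum.cong refl) auto
  also have "\<dots> = (if r = s then vscale ((\<Sum>k\<in>UNIV. A k r * C k r) * (qint (int r) ^ 2 / of_nat r)) v else 0)"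
    unfolding sum_distrib_right V.scale_sum_left by simp
  finally show ?thesis .
qed

abbreviation "ce C \<equiv> iexp (cre C)"
abbreviation "an A \<equiv> iexp (ann A)"

lemma Vdeg_cre: "Vdeg N v \<Longrightarrow> Vdeg (N + int r) (cre C r v)"
  unfolding cre_def using Vdeg_heis_dual[of N v "- int r"]
  by (intro Vdeg_sum Vdeg_scale) (simp only: diff_minus_eq_add)

lemma Vdeg_ann: "Vdeg N v \<Longrightarrow> Vdeg (N - int r) (ann A r v)"
  unfolding ann_def by (intro Vdeg_sum Vdeg_scale Vdeg_heis)

lemma Vdeg_ce: "Vdeg N v \<Longrightarrow> Vdeg (N + m) (ce C m v)"
  by (rule cre.iexp_Vdeg[of 1 C N v m, unfolded mult_1]) (rule Vdeg_cre)

lemma Vdeg_an: "Vdeg N v \<Longrightarrow> Vdeg (N - m) (an A m v)"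
  by (rule ann.iexp_Vdeg[of "- 1" A N v m, unfolded mult_minus1 add_uminus_conv_diff]) (rule Vdeg_ann)

lemma an_an_eq_0:
  assumes "Vdeg N v" "p + p' > N"
  shows "an A p (an A' p' v) = 0"
  using assms(2) by (intro Vdeg_neg[OF Vdeg_an[OF Vdeg_an[OF assms(1)]]]) simp

lemma an_eq_0:
  assumes "Vdeg N v" "p > N"
  shows "an A p v = 0"
  using assms(2) by (intro Vdeg_neg[OF Vdeg_an[OF assms(1)]]) simp

lemma ce_0 [simp]: "ce C m 0 = 0" and an_0 [simp]: "an A p 0 = 0"
  by (rule module_hom.zero[OF cre.iexp_linear], rule module_hom.zero[OF ann.iexp_linear])

text \<open>The coefficients of \<open>(1 - c'x) / (1 - cx)\<close>, and the differential equation of this series.\<close>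

definition contraction :: "scal \<Rightarrow> scal \<Rightarrow> int \<Rightarrow> scal" where
  "contraction c c' b = (if b < 0 then 0 else if b = 0 then 1 else c ^ (nat b - 1) * (c - c'))"

lemma contraction_step: "contraction c c' b - c * contraction c c' (b - 1) = (if b = 0 then 1 else if b = 1 then - c' else 0)"
proof (cases "b > 1")
  case True
  then have "nat b - 1 = Suc (nat (b - 1) - 1)" by simp
  then have "c ^ (nat b - 1) = c * c ^ (nat (b - 1) - 1)" by (simp only: power_Suc)
  with True show ?thesis by (simp add: contraction_def)
qed (auto simp: contraction_def)

lemma contraction_rec:
  assumes \<gamma>: "\<And>r. r > 0 \<Longrightarrow> of_nat r * \<gamma> r = c ^ r - c' ^ r" and b: "0 < b"
  shows "of_int b * contraction c c' b = (\<Sum>r\<in>{1..b}. of_int r * \<gamma> (nat r) * contraction c c' (b - r))"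
proof -
  define S where "S m = (\<Sum>r=1..m. (c ^ r - c' ^ r) * contraction c c' (int m - int r))" for m
  have "S (Suc m) = of_nat (Suc m) * c ^ m * (c - c')" for m
  proof (induction m)
    case 0
    show ?case by (simp add: S_def contraction_def)
  next
    case (Suc m)
    have "S (Suc (Suc m)) = (\<Sum>r=1..Suc m. (c ^ r - c' ^ r) * contraction c c' (int (Suc (Suc m)) - int r)) + (c ^ Suc (Suc m) - c' ^ Suc (Suc m))"
      unfolding S_def by (subst sum.cl_ivl_Suc) (simp add: contraction_def)
    also have "(\<Sum>r=1..Suc m. (c ^ r - c' ^ r) * contraction c c' (int (Suc (Suc m)) - int r))
        = (\<Sum>r=1..Suc m. c * ((c ^ r - c' ^ r) * contraction c c' (int (Suc m) - int r)) - (if r = Suc m then c' * (c ^ r - c' ^ r) else 0))"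
    proof (intro sum.cong refl)
      fix r assume r: "r \<in> {1..Suc m}"
      have "contraction c c' (int (Suc (Suc m)) - int r) = c * contraction c c' (int (Suc m) - int r) - (if r = Suc m then c' else 0)"
        using contraction_step[of c c' "int (Suc (Suc m)) - int r"] r by (auto simp: algebra_simps split: if_splits)
      then show "(c ^ r - c' ^ r) * contraction c c' (int (Suc (Suc m)) - int r)
        = c * ((c ^ r - c' ^ r) * contraction c c' (int (Suc m) - int r)) - (if r = Suc m then c' * (c ^ r - c' ^ r) else 0)"
        by (simp only:) (simp add: algebra_simps)
    qed
    also have "\<dots> = c * S (Suc m) - c' * (c ^ Suc m - c' ^ Suc m)"
      unfolding sum_subtractf sum_distrib_left[symmetric] S_def[symmetric] by simp
    also have "c * S (Suc m) - c' * (c ^ Suc m - c' ^ Suc m) + (c ^ Suc (Suc m) - c' ^ Suc (Suc m)) = of_nat (Suc (Suc m)) * c ^ Suc m * (c - c')"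
      unfolding Suc.IH by (simp add: algebra_simps)
    finally show ?case .
  qed
  moreover obtain m where m: "b = int (Suc m)" using b by (metis Suc_pred zero_less_imp_eq_int)
  moreover have "(\<Sum>r\<in>{1..b}. of_int r * \<gamma> (nat r) * contraction c c' (b - r)) = S (Suc m)"
    unfolding S_def
  proof (rule sum.reindex_bij_witness[of _ int nat])
    fix r assume "r \<in> {1..b}"
    then show "(c ^ nat r - c' ^ nat r) * contraction c c' (int (Suc m) - int (nat r)) = of_int r * \<gamma> (nat r) * contraction c c' (b - r)"
      using \<gamma>[of "nat r"] m by (simp add: of_nat_nat)
  qed (auto simp: m)
  moreover have "contraction c c' b = c ^ m * (c - c')" using m by (simp add: contraction_def nat_add_distrib)
  ultimately show ?thesis using m by (simp add: mult_ac)
qed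

text \<open>The commutator of the degree \<open>r\<close> parts, multiplied by \<open>r\<close>. If it is \<open>c\<^sup>r - c'\<^sup>r\<close> for all \<open>r\<close>, then the
  exponential of the commutators is \<open>(1 - c'x) / (1 - cx)\<close>.\<close>

definition pairing :: "('n::{finite,linorder} \<Rightarrow> nat \<Rightarrow> scal) \<Rightarrow> ('n \<Rightarrow> nat \<Rightarrow> scal) \<Rightarrow> nat \<Rightarrow> scal" where
  "pairing A C r = (\<Sum>k\<in>UNIV. A k r * C k r) * qint (int r) ^ 2"

lemma an_ce:
  assumes pair: "\<And>r. r > 0 \<Longrightarrow> pairing A C r = c ^ r - c' ^ r" and "p \<le> M"
  shows "an A p (ce C l v) = (\<Sum>b\<in>{0..M}. vscale (contraction c c' b) (ce C (l - b) (an A (p - b) v)))"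
proof -
  interpret heis_pair "ann A" "cre C" "\<lambda>r. (\<Sum>k\<in>UNIV. A k r * C k r) * (qint (int r) ^ 2 / of_nat r)" "contraction c c'"
  proof (intro heis_pair.intro ann.comm_ops_axioms cre.comm_ops_axioms heis_pair_axioms.intro ann_cre)
    fix b :: int assume "0 < b"
    then show "of_int b * contraction c c' b = (\<Sum>r\<in>{1..b}. of_int r * ((\<Sum>k\<in>UNIV. A k (nat r) * C k (nat r)) * (qint (int (nat r)) ^ 2 / of_nat (nat r))) * contraction c c' (b - r))"
      by (intro contraction_rec[where \<gamma> = "\<lambda>r. (\<Sum>k\<in>UNIV. A k r * C k r) * (qint (int r) ^ 2 / of_nat r)"])
        (simp_all add: pairing_def flip: pair)
  qed (auto simp: contraction_def)
  show ?thesis by (rule iexp_contraction[OF \<open>p \<le> M\<close>])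
qed

definition vdeg :: "'n V \<Rightarrow> int" where
  "vdeg v = int (LEAST N. Vdeg (int N) v)"

lemma vdeg: "Vdeg (vdeg v) v" and vdeg_nonneg: "0 \<le> vdeg v"
proof -
  obtain N where "0 \<le> N" "Vdeg N v" using Vdeg_exists by blast
  then have "Vdeg (int (nat N)) v" by simp
  then show "Vdeg (vdeg v) v" unfolding vdeg_def by (rule LeastI)
qed (simp add: vdeg_def)

lemma vdeg_le:
  assumes "Vdeg N v" "0 \<le> N"
  shows "vdeg v \<le> N"
proof -
  have "Vdeg (int (nat N)) v" using assms by simp
  then have "(LEAST N. Vdeg (int N) v) \<le> nat N" by (rule Least_le)
  then show ?thesis using assms by (simp add: vdeg_def)
qed

text \<open>The coefficient of \<open>z\<^sup>k\<close> in the product of the two exponentials; the summands with \<open>p > vdeg v\<close> vanish.\<close>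

definition osc :: "('n::{finite,linorder} \<Rightarrow> nat \<Rightarrow> scal) \<Rightarrow> ('n \<Rightarrow> nat \<Rightarrow> scal) \<Rightarrow> int \<Rightarrow> 'n V \<Rightarrow> 'n V" where
  "osc C A k v = (\<Sum>p\<in>{0..vdeg v}. ce C (k + p) (an A p v))"

lemma osc_eq:
  assumes "Vdeg N v" "0 \<le> N" "N \<le> M"
  shows "osc C A k v = (\<Sum>p\<in>{0..M}. ce C (k + p) (an A p v))"
  unfolding osc_def using vdeg_le[OF assms(1,2)] assms
  by (intro sum.mono_neutral_left) (auto simp: an_eq_0[OF vdeg])

lemma osc_linear [simp, intro]: "V_linear (osc C A k)"
proof (rule V_linearI)
  fix u v :: "'a V" and c
  define M where "M = max (vdeg u) (vdeg v)"
  have M: "Vdeg M u" "Vdeg M v" "0 \<le> M" by (simp_all add: M_def Vdeg_mono[OF vdeg] le_max_iff_disj vdeg_nonneg)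
  have lin: "V_linear (\<lambda>v. \<Sum>p\<in>{0..M}. ce C (k + p) (an A p v))"
    by (intro V_linear_sum V_linear_comp[OF cre.iexp_linear] ann.iexp_linear)
  show "osc C A k (u + v) = osc C A k u + osc C A k v"
    using module_hom.add[OF lin, of u v] Vdeg_add[OF M(1,2)] M by (simp only: osc_eq[OF _ M(3) order_refl])
  show "osc C A k (vscale c v) = vscale c (osc C A k v)"
    using module_hom.scale[OF lin, of c v] Vdeg_scale[OF M(2)] M by (simp only: osc_eq[OF _ M(3) order_refl])
qed

lemma osc_Vdeg:
  assumes "Vdeg N v" "0 \<le> N"
  shows "Vdeg (N + k) (osc C A k v)"
  unfolding osc_def
proof (rule Vdeg_sum)
  fix p
  show "Vdeg (N + k) (ce C (k + p) (an A p v))"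
    using Vdeg_ce[OF Vdeg_an[OF assms(1), of p A], of "k + p" C] by (simp add: algebra_simps)
qed

text \<open>Translations of the weight and projections to a weight commute with the Heisenberg algebra, hence with the
  oscillator parts, which therefore act on each \<open>K(1) \<otimes> e\<^sup>\<beta>\<close> in the same way.\<close>

definition heis_commuting :: "('n::{finite,linorder} V \<Rightarrow> 'n V) \<Rightarrow> bool" where
  "heis_commuting g \<longleftrightarrow> V_linear g \<and> (\<forall>i l v. g (heis i l v) = heis i l (g v))"

lemma heis_commuting_linear: "heis_commuting g \<Longrightarrow> V_linear g"
  by (simp add: heis_commuting_def)

lemma
  assumes "heis_commuting g"
  shows heis_commuting_cre: "g (cre C r v) = cre C r (g v)"
    and heis_commuting_ann: "g (ann A r v) = ann A r (g v)"
proof -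
  note lin = heis_commuting_linear[OF assms]
  have h: "g (heis i l v) = heis i l (g v)" for i l v using assms by (simp add: heis_commuting_def)
  then have "g (heis_dual i l v) = heis_dual i l (g v)" for i l v
    unfolding heis_dual_def module_hom.sum[OF lin] module_hom.scale[OF lin] by simp
  with h show "g (cre C r v) = cre C r (g v)" "g (ann A r v) = ann A r (g v)"
    unfolding cre_def ann_def module_hom.sum[OF lin] module_hom.scale[OF lin] by simp_all
qed

lemma heis_commuting_ce:
  assumes "heis_commuting g"
  shows "g (ce C m v) = ce C m (g v)"
  by (rule cre.iexp_commute) (use assms in \<open>auto simp: heis_commuting_linear heis_commuting_cre\<close>)

lemma heis_commuting_an:
  assumes "heis_commuting g"
  shows "g (an A m v) = an A m (g v)"
  by (rule ann.iexp_commute) (use assms in \<open>auto simp: heis_commuting_linear heis_commuting_ann\<close>)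

lemma heis_commuting_osc:
  assumes "heis_commuting g"
  shows "g (osc C A k v) = osc C A k (g v)"
proof -
  define M where "M = max (vdeg v) (vdeg (g v))"
  have M: "Vdeg M v" "Vdeg M (g v)" "0 \<le> M" by (simp_all add: M_def Vdeg_mono[OF vdeg] le_max_iff_disj vdeg_nonneg)
  show ?thesis
    unfolding osc_eq[OF M(1,3) order_refl] osc_eq[OF M(2,3) order_refl]
      module_hom.sum[OF heis_commuting_linear[OF assms]]
    by (simp add: heis_commuting_ce[OF assms] heis_commuting_an[OF assms])
qed

definition wshift :: "'n wgt \<Rightarrow> 'n V \<Rightarrow> 'n V" where
  "wshift \<gamma> v = (\<Sum>\<beta>\<in>keys v. single (\<gamma> + \<beta>) (lookup v \<beta>))"

definition wproj :: "'n wgt \<Rightarrow> 'n V \<Rightarrow> 'n V" where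
  "wproj \<delta> v = single \<delta> (lookup v \<delta>)"

lemma wshift_single: "wshift \<gamma> (single \<beta> p) = single (\<gamma> + \<beta>) p"
  by (simp add: wshift_def)

lemma heis_commuting_wshift: "heis_commuting (wshift \<gamma>)"
proof -
  have lin: "V_linear (wshift \<gamma>)" unfolding wshift_def
    by (rule V_linear_wext) (simp_all add: single_add vscale_single)
  have "wshift \<gamma> (heis i l v) = heis i l (wshift \<gamma> v)" for i l v
    by (rule V_linear_eqI[OF V_linear_comp[OF lin heis_linear] V_linear_comp[OF heis_linear lin]])
      (simp add: heis_single wshift_single)
  with lin show ?thesis by (simp add: heis_commuting_def)
qed

lemma heis_commuting_wproj: "heis_commuting (wproj \<delta>)"
proof -
  have lin: "V_linear (wproj \<delta>)"
    by (rule V_linearI) (simp_all add: wproj_def lookup_add single_add lookup_vscale vscale_single)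
  have "wproj \<delta> (heis i l v) = heis i l (wproj \<delta> v)" for i l v
    by (simp add: wproj_def heis_single lookup_heis)
  with lin show ?thesis by (simp add: heis_commuting_def)
qed

lemma osc_single: "osc C A k (single \<beta> p) = single \<beta> (lookup (osc C A k (single \<beta> p)) \<beta>)"
  using heis_commuting_osc[OF heis_commuting_wproj, of \<beta> C A k "single \<beta> p"]
  by (simp add: wproj_def)

lemma osc_wshift: "osc C A k (single (\<gamma> + \<beta>) p) = wshift \<gamma> (osc C A k (single \<beta> p))"
  using heis_commuting_osc[OF heis_commuting_wshift, of \<gamma> C A k "single \<beta> p"] by (simp add: wshift_single)

lemma osc_scale:
  assumes "\<And>k r. r > 0 \<Longrightarrow> C' k r = c ^ r * C k r" "\<And>k r. r > 0 \<Longrightarrow> A' k r = A k r / c ^ r" "c \<noteq> 0"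
  shows "osc C' A' k v = vscale (c powi k) (osc C A k v)"
proof -
  have C: "cre C' r v = vscale (c ^ r) (cre C r v)" if "r > 0" for r v
    using that by (simp add: cre_def assms(1) V.scale_sum_right)
  have A: "ann A' r v = vscale ((1 / c) ^ r) (ann A r v)" if "r > 0" for r v
    using that by (simp add: ann_def assms(2) V.scale_sum_right power_divide)
  show ?thesis unfolding osc_def V.scale_sum_right
  proof (intro sum.cong refl)
    fix p assume p: "p \<in> {0..vdeg v}"
    show "ce C' (k + p) (an A' p v) = vscale (c powi k) (ce C (k + p) (an A p v))"
    proof (cases "k + p < 0")
      case False
      have "c ^ nat (k + p) * (1 / c) ^ nat p = c powi (k + p) * c powi (- p)"
        using False p assms(3) by (simp add: power_int_def divide_inverse power_inverse)
      also have "\<dots> = c powi k" using assms(3) by (simp flip: power_int_add)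
      finally show ?thesis using False p
        by (simp add: cre.iexp_scale[OF cre.comm_ops_axioms C] ann.iexp_scale[OF ann.comm_ops_axioms A]
          module_hom.scale[OF cre.iexp_linear] mult.commute del: power_one_over)
    qed simp
  qed
qed

lemma osc_cong:
  assumes "\<And>k r. r > 0 \<Longrightarrow> C' k r = C k r" "\<And>k r. r > 0 \<Longrightarrow> A' k r = A k r"
  shows "osc C' A' k v = osc C A k v"
  using osc_scale[of C' 1 C A' A k v] assms by simp

lemma cre_add: "cre (\<lambda>k r. C1 k r + C2 k r) r v = cre C1 r v + cre C2 r v"
  and ann_add: "ann (\<lambda>k r. A1 k r + A2 k r) r v = ann A1 r v + ann A2 r v"
  by (simp_all add: cre_def ann_def V.scale_left_distrib sum.distrib)

lemma ce_add: "(\<Sum>a\<in>{0..m}. ce C1 a (ce C2 (m - a) v)) = ce (\<lambda>k r. C1 k r + C2 k r) m v"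
  by (rule cre.iexp_add[OF cre.comm_ops_axioms cre.comm_ops_axioms]) (simp_all add: cre_add cre_commute)

lemma an_add: "(\<Sum>a\<in>{0..m}. an A1 a (an A2 (m - a) v)) = an (\<lambda>k r. A1 k r + A2 k r) m v"
  by (rule ann.iexp_add[OF ann.comm_ops_axioms ann.comm_ops_axioms]) (simp_all add: ann_add ann_commute)

subsection \<open>Normal ordering\<close>

text \<open>Normally ordered product of two oscillator parts: all creation operators stand to the left.\<close>

definition osc2 where
  "osc2 C1 A1 C2 A2 k l v =
     (\<Sum>p\<in>{0..vdeg v}. \<Sum>p'\<in>{0..vdeg v}. ce C1 (k + p) (ce C2 (l + p') (an A1 p (an A2 p' v))))"

lemma osc2_eq:
  assumes "Vdeg N v" "0 \<le> N" "N \<le> M" "N \<le> M'"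
  shows "osc2 C1 A1 C2 A2 k l v = (\<Sum>p\<in>{0..M}. \<Sum>p'\<in>{0..M'}. ce C1 (k + p) (ce C2 (l + p') (an A1 p (an A2 p' v))))"
proof -
  have le: "vdeg v \<le> M" "vdeg v \<le> M'" using vdeg_le[OF assms(1,2)] assms by auto
  have "(\<Sum>p\<in>{0..M}. \<Sum>p'\<in>{0..M'}. ce C1 (k + p) (ce C2 (l + p') (an A1 p (an A2 p' v))))
    = (\<Sum>p\<in>{0..M}. \<Sum>p'\<in>{0..vdeg v}. ce C1 (k + p) (ce C2 (l + p') (an A1 p (an A2 p' v))))"
    using le by (intro sum.cong refl sum.mono_neutral_right) (auto simp: an_eq_0[OF vdeg])
  also have "\<dots> = (\<Sum>p\<in>{0..vdeg v}. \<Sum>p'\<in>{0..vdeg v}. ce C1 (k + p) (ce C2 (l + p') (an A1 p (an A2 p' v))))"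
    using le by (intro sum.mono_neutral_right) (auto simp: an_an_eq_0[OF vdeg] intro!: sum.neutral)
  finally show ?thesis by (simp add: osc2_def)
qed

lemma osc2_eq_0:
  assumes "k < - vdeg v \<or> l < - vdeg v"
  shows "osc2 C1 A1 C2 A2 k l v = 0"
  using assms by (auto simp: osc2_def intro!: sum.neutral)

lemma osc2_linear [simp, intro]: "V_linear (osc2 C1 A1 C2 A2 k l)"
proof (rule V_linearI)
  fix u v :: "'a V" and c
  define M where "M = max (vdeg u) (vdeg v)"
  have M: "Vdeg M u" "Vdeg M v" "0 \<le> M" by (simp_all add: M_def Vdeg_mono[OF vdeg] le_max_iff_disj vdeg_nonneg)
  have lin: "V_linear (\<lambda>v. \<Sum>p\<in>{0..M}. \<Sum>p'\<in>{0..M}. ce C1 (k + p) (ce C2 (l + p') (an A1 p (an A2 p' v))))"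
    by (intro V_linear_sum V_linear_comp[OF cre.iexp_linear] V_linear_comp[OF ann.iexp_linear] ann.iexp_linear)
  show "osc2 C1 A1 C2 A2 k l (u + v) = osc2 C1 A1 C2 A2 k l u + osc2 C1 A1 C2 A2 k l v"
    using module_hom.add[OF lin, of u v] Vdeg_add[OF M(1,2)] M by (simp only: osc2_eq[OF _ M(3) order_refl order_refl])
  show "osc2 C1 A1 C2 A2 k l (vscale c v) = vscale c (osc2 C1 A1 C2 A2 k l v)"
    using module_hom.scale[OF lin, of c v] Vdeg_scale[OF M(2)] M by (simp only: osc2_eq[OF _ M(3) order_refl order_refl])
qed

lemma sum_shift_both:
  fixes F :: "int \<Rightarrow> 'a::comm_monoid_add"
  assumes "\<And>a. a < 0 \<Longrightarrow> F a = 0" "b \<ge> 0" "\<And>a. a > M - b \<Longrightarrow> F a = 0"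
  shows "(\<Sum>p\<in>{0..M}. F (p - b)) = (\<Sum>p\<in>{0..M}. F p)"
proof -
  have "(\<Sum>p\<in>{0..M}. F (p - b)) = (\<Sum>p\<in>{0..M - b}. F p)"
    using assms by (intro sum_shift_neg) auto
  also have "\<dots> = (\<Sum>p\<in>{0..M}. F p)"
    using assms by (intro sum.mono_neutral_left) auto
  finally show ?thesis .
qed

text \<open>Moving the first annihilation part past the second creation part produces the contraction.\<close>

lemma osc_osc:
  assumes pair: "\<And>r. r > 0 \<Longrightarrow> pairing A1 C2 r = c ^ r - c' ^ r"
    and B: "vdeg v + \<bar>l\<bar> \<le> B"
  shows "osc C1 A1 k (osc C2 A2 l v)
    = (\<Sum>b\<in>{0..B}. vscale (contraction c c' b) (osc2 C1 A1 C2 A2 (k + b) (l - b) v))"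
proof -
  define N where "N = vdeg v"
  have N: "Vdeg N v" "0 \<le> N" by (simp_all add: N_def vdeg vdeg_nonneg)
  have BN: "N \<le> B" "N + l \<le> B" "0 \<le> B" using B N by (auto simp: N_def)
  have "Vdeg B (osc C2 A2 l v)"
    using osc_Vdeg[OF N] Vdeg_mono BN by blast
  from osc_eq[OF this BN(3) order_refl] have "osc C1 A1 k (osc C2 A2 l v) = (\<Sum>p\<in>{0..B}. ce C1 (k + p) (an A1 p (osc C2 A2 l v)))" .
  also have "\<dots> = (\<Sum>p\<in>{0..B}. \<Sum>p'\<in>{0..B}. \<Sum>b\<in>{0..B}. vscale (contraction c c' b)
        (ce C1 (k + p) (ce C2 (l + p' - b) (an A1 (p - b) (an A2 p' v)))))"
    unfolding osc_eq[OF N BN(1)] module_hom.sum[OF ann.iexp_linear] module_hom.sum[OF cre.iexp_linear]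
    by (intro sum.cong refl)
      (simp add: an_ce[OF pair, where M = B] module_hom.sum[OF cre.iexp_linear] module_hom.scale[OF cre.iexp_linear])
  also have "\<dots> = (\<Sum>b\<in>{0..B}. \<Sum>p\<in>{0..B}. \<Sum>p'\<in>{0..B}. vscale (contraction c c' b)
        (ce C1 (k + p) (ce C2 (l + p' - b) (an A1 (p - b) (an A2 p' v)))))"
    by (rule trans[OF sum.cong[OF refl sum.swap] sum.swap])
  also have "\<dots> = (\<Sum>b\<in>{0..B}. vscale (contraction c c' b) (osc2 C1 A1 C2 A2 (k + b) (l - b) v))"
  proof (intro sum.cong refl)
    fix b assume b: "b \<in> {0..B}"
    let ?F = "\<lambda>p. \<Sum>p'\<in>{0..B}. ce C1 (k + b + p) (ce C2 (l - b + p') (an A1 p (an A2 p' v)))"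
    have "(\<Sum>p\<in>{0..B}. ?F (p - b)) = (\<Sum>p\<in>{0..B}. ?F p)"
    proof (rule sum_shift_both)
      \<comment> \<open>If \<open>a + p'\<close> exceeds the degree of \<open>v\<close> the annihilation part is zero; otherwise the creation index is negative.\<close>
      fix a assume a: "a > B - b"
      show "?F a = 0"
      proof (intro sum.neutral ballI)
        fix p' assume "p' \<in> {0..B}"
        show "ce C1 (k + b + a) (ce C2 (l - b + p') (an A1 a (an A2 p' v))) = 0"
        proof (cases "a + p' > N")
          case True
          then show ?thesis by (simp add: an_an_eq_0[OF N(1)])
        next
          case False
          then have "l - b + p' < 0" using a BN by linarith
          then show ?thesis by simp
        qed
      qed
    qed (use b in auto)
    then show "(\<Sum>p\<in>{0..B}. \<Sum>p'\<in>{0..B}. vscale (contraction c c' b)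
        (ce C1 (k + p) (ce C2 (l + p' - b) (an A1 (p - b) (an A2 p' v)))))
        = vscale (contraction c c' b) (osc2 C1 A1 C2 A2 (k + b) (l - b) v)"
      unfolding osc2_eq[OF N BN(1) BN(1)] V.scale_sum_right[symmetric] by (simp add: algebra_simps)
  qed
  finally show ?thesis .
qed

text \<open>Multiplication by \<open>z\<^sub>1 - c z\<^sub>2\<close> turns the contraction into the factor \<open>z\<^sub>1 - c' z\<^sub>2\<close>.\<close>

lemma osc_osc_pole:
  assumes pair: "\<And>r. r > 0 \<Longrightarrow> pairing A1 C2 r = c ^ r - c' ^ r"
  shows "osc C1 A1 (k - 1) (osc C2 A2 l v) - vscale c (osc C1 A1 k (osc C2 A2 (l - 1) v))
    = osc2 C1 A1 C2 A2 (k - 1) l v - vscale c' (osc2 C1 A1 C2 A2 k (l - 1) v)"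
proof -
  define B where "B = vdeg v + \<bar>l\<bar> + 1"
  let ?O = "osc2 C1 A1 C2 A2" and ?\<kappa> = "contraction c c'"
  have B: "0 < B" using vdeg_nonneg[of v] by (simp add: B_def)
  have 1: "osc C1 A1 (k - 1) (osc C2 A2 l v) = (\<Sum>b\<in>{0..B + 1}. vscale (?\<kappa> b) (?O (k - 1 + b) (l - b) v))"
    by (rule osc_osc[OF pair]) (auto simp: B_def)
  have "osc C1 A1 k (osc C2 A2 (l - 1) v) = (\<Sum>b\<in>{0..B}. vscale (?\<kappa> b) (?O (k + b) (l - 1 - b) v))"
    by (rule osc_osc[OF pair]) (auto simp: B_def)
  also have "\<dots> = (\<Sum>b\<in>{0..B + 1}. vscale (?\<kappa> (b - 1)) (?O (k + (b - 1)) (l - 1 - (b - 1)) v))"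
    using sum_shift_neg[where F = "\<lambda>b. vscale (?\<kappa> b) (?O (k + b) (l - 1 - b) v)" and r = 1 and m = "B + 1"]
    by (simp add: contraction_def)
  finally have 2: "vscale c (osc C1 A1 k (osc C2 A2 (l - 1) v)) = (\<Sum>b\<in>{0..B + 1}. vscale (c * ?\<kappa> (b - 1)) (?O (k - 1 + b) (l - b) v))"
    by (simp add: V.scale_sum_right algebra_simps)
  have "osc C1 A1 (k - 1) (osc C2 A2 l v) - vscale c (osc C1 A1 k (osc C2 A2 (l - 1) v))
      = (\<Sum>b\<in>{0..B + 1}. vscale (if b = 0 then 1 else if b = 1 then - c' else 0) (?O (k - 1 + b) (l - b) v))"
    unfolding 1 2 sum_subtractf[symmetric] V.scale_left_diff_distrib[symmetric] contraction_step ..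
  also have "\<dots> = (\<Sum>b\<in>{0, 1}. vscale (if b = 0 then 1 else if b = 1 then - c' else 0) (?O (k - 1 + b) (l - b) v))"
    using B by (intro sum.mono_neutral_right) auto
  finally show ?thesis by simp
qed

text \<open>At \<open>z\<^sub>1 = z\<^sub>2\<close> the two exponentials of the same kind multiply to one.\<close>

lemma osc2_diagonal:
  assumes K: "finite K" "{- vdeg v..m + vdeg v} \<subseteq> K"
  shows "(\<Sum>k\<in>K. osc2 C1 A1 C2 A2 k (m - k) v) = osc (\<lambda>k r. C1 k r + C2 k r) (\<lambda>k r. A1 k r + A2 k r) m v"
proof -
  define N where "N = vdeg v"
  have N: "Vdeg N v" "0 \<le> N" by (simp_all add: N_def vdeg vdeg_nonneg)
  let ?C = "\<lambda>k r. C1 k r + C2 k r" and ?A = "\<lambda>k r. A1 k r + A2 k r"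
  have "(\<Sum>k\<in>K. osc2 C1 A1 C2 A2 k (m - k) v)
      = (\<Sum>p\<in>{0..N}. \<Sum>p'\<in>{0..N}. \<Sum>k\<in>K. ce C1 (k + p) (ce C2 (m - k + p') (an A1 p (an A2 p' v))))"
    unfolding osc2_eq[OF N order_refl order_refl] by (rule trans[OF sum.swap]) (rule sum.cong[OF refl], rule sum.swap)
  also have "\<dots> = (\<Sum>p\<in>{0..N}. \<Sum>p'\<in>{0..N}. ce ?C (m + p + p') (an A1 p (an A2 p' v)))"
  proof (intro sum.cong refl)
    fix p p' assume p: "p \<in> {0..N}" "p' \<in> {0..N}"
    have "(\<Sum>k\<in>K. ce C1 (k + p) (ce C2 (m - k + p') (an A1 p (an A2 p' v))))
      = (\<Sum>k\<in>{- p..m + p'}. ce C1 (k + p) (ce C2 (m - k + p') (an A1 p (an A2 p' v))))"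
      using p K by (intro sum.mono_neutral_right) (auto simp: N_def not_le)
    also have "\<dots> = (\<Sum>a\<in>{0..m + p + p'}. ce C1 a (ce C2 (m + p + p' - a) (an A1 p (an A2 p' v))))"
      by (rule sum.reindex_bij_witness[of _ "\<lambda>a. a - p" "\<lambda>k. k + p"]) (auto simp: algebra_simps)
    also have "\<dots> = ce ?C (m + p + p') (an A1 p (an A2 p' v))" by (rule ce_add)
    finally show "(\<Sum>k\<in>K. ce C1 (k + p) (ce C2 (m - k + p') (an A1 p (an A2 p' v)))) = ce ?C (m + p + p') (an A1 p (an A2 p' v))" .
  qed
  also have "\<dots> = (\<Sum>p\<in>{0..N}. \<Sum>t\<in>{p..N}. ce ?C (m + t) (an A1 p (an A2 (t - p) v)))"
  proof (rule sum.cong[OF refl])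
    fix p assume p: "p \<in> {0..N}"
    have "(\<Sum>p'\<in>{0..N}. ce ?C (m + p + p') (an A1 p (an A2 p' v))) = (\<Sum>p'\<in>{0..N - p}. ce ?C (m + p + p') (an A1 p (an A2 p' v)))"
      using p by (intro sum.mono_neutral_right) (auto simp: an_an_eq_0[OF N(1)])
    also have "\<dots> = (\<Sum>t\<in>{p..N}. ce ?C (m + t) (an A1 p (an A2 (t - p) v)))"
      by (rule sum.reindex_bij_witness[of _ "\<lambda>t. t - p" "\<lambda>p'. p' + p"]) (auto simp: algebra_simps)
    finally show "(\<Sum>p'\<in>{0..N}. ce ?C (m + p + p') (an A1 p (an A2 p' v))) = (\<Sum>t\<in>{p..N}. ce ?C (m + t) (an A1 p (an A2 (t - p) v)))" .
  qed
  also have "\<dots> = (\<Sum>p\<in>{0..N}. \<Sum>t\<in>{t \<in> {0..N}. p \<le> t}. ce ?C (m + t) (an A1 p (an A2 (t - p) v)))"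
    by (rule sum.cong[OF refl], rule sum.cong) auto
  also have "\<dots> = (\<Sum>t\<in>{0..N}. \<Sum>p\<in>{p \<in> {0..N}. p \<le> t}. ce ?C (m + t) (an A1 p (an A2 (t - p) v)))"
    by (rule sum.swap_restrict) auto
  also have "\<dots> = (\<Sum>t\<in>{0..N}. ce ?C (m + t) (\<Sum>p\<in>{0..t}. an A1 p (an A2 (t - p) v)))"
    unfolding module_hom.sum[OF cre.iexp_linear] by (rule sum.cong[OF refl], rule sum.cong) auto
  also have "\<dots> = osc ?C ?A m v"
    unfolding an_add osc_eq[OF N order_refl] ..
  finally show ?thesis .
qed

lemma osc_heis_dual:
  "osc C A k (heis_dual j (- 1) v) = heis_dual j (- 1) (osc C A k v) + vscale (A j 1) (osc C A (k + 1) v)"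
proof -
  define E where "E = (\<lambda>i r. if i = j \<and> r = Suc 0 then 1 else 0 :: scal)"
  have E1: "cre E 1 v = heis_dual j (- 1) v" for v
    by (simp add: cre_def E_def if_distrib[of "\<lambda>c. vscale c _"] cong: if_cong)
  define N where "N = vdeg v + 1"
  have N: "Vdeg N v" "0 \<le> N" "Vdeg N (cre E 1 v)"
    using Vdeg_mono[OF vdeg[of v], of N] Vdeg_cre[OF vdeg[of v], of 1 E] vdeg_nonneg[of v] by (simp_all add: N_def)
  have ES: "(\<Sum>k\<in>UNIV. A k r * E k r) = (if r = Suc 0 then A j 1 else 0)" for r
    by (simp add: E_def if_distrib[of "\<lambda>c. _ * c"] cong: if_cong)
  have comm: "an A p (cre E 1 v) = cre E 1 (an A p v) + vscale (A j 1) (an A (p - 1) v)" for p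
  proof -
    have Dc: "heis_pair (ann A) (cre E) (\<lambda>r. (\<Sum>k\<in>UNIV. A k r * E k r) * (qint (int r) ^ 2 / of_nat r))
       (\<lambda>b. if b < 0 then 0 else A j 1 ^ nat b / of_nat (fact (nat b)))"
    proof (intro heis_pair.intro ann.comm_ops_axioms cre.comm_ops_axioms heis_pair_axioms.intro ann_cre)
      fix b :: int assume b: "0 < b"
      have "(\<Sum>r\<in>{1..b}. of_int r * ((\<Sum>k\<in>UNIV. A k (nat r) * E k (nat r)) * (qint (int (nat r)) ^ 2 / of_nat (nat r)))
             * (if b - r < 0 then 0 else A j 1 ^ nat (b - r) / of_nat (fact (nat (b - r)))))
         = (\<Sum>r\<in>{1..b}. if r = 1 then A j 1 * (A j 1 ^ nat (b - 1) / of_nat (fact (nat (b - 1)))) else 0)"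
        unfolding ES by (intro sum.cong refl) (auto simp: nat_eq_iff)
      also have "\<dots> = A j 1 * (A j 1 ^ nat (b - 1) / of_nat (fact (nat (b - 1))))" using b by simp
      also have "\<dots> = of_int b * (A j 1 ^ nat b / of_nat (fact (nat b)))"
      proof -
        obtain m where m: "b = int (Suc m)" using b by (metis Suc_pred zero_less_imp_eq_int)
        have "nat b = Suc m" "nat (b - 1) = m" "(of_int b :: scal) = of_nat (Suc m)" by (simp_all add: m nat_add_distrib)
        then show ?thesis by (simp only: fact_Suc of_nat_mult power_Suc) (simp del: of_nat_Suc)
      qed
      finally show "of_int b * (if b < 0 then 0 else A j 1 ^ nat b / of_nat (fact (nat b))) = (\<Sum>r\<in>{1..b}. of_int r * ((\<Sum>k\<in>UNIV. A k (nat r) * E k (nat r)) * (qint (int (nat r)) ^ 2 / of_nat (nat r)))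
             * (if b - r < 0 then 0 else A j 1 ^ nat (b - r) / of_nat (fact (nat (b - r)))))"
        using b by simp
    qed auto
    define M where "M = max p 1"
    have "an A p (ce E 1 v) = (\<Sum>b\<in>{0..M}. vscale (if b < 0 then 0 else A j 1 ^ nat b / of_nat (fact (nat b))) (ce E (1 - b) (an A (p - b) v)))"
      by (rule heis_pair.iexp_contraction[OF Dc]) (simp add: M_def)
    also have "\<dots> = (\<Sum>b\<in>{0, 1}. vscale (if b < 0 then 0 else A j 1 ^ nat b / of_nat (fact (nat b))) (ce E (1 - b) (an A (p - b) v)))"
      by (intro sum.mono_neutral_right) (auto simp: M_def)
    finally show ?thesis by (simp add: cre.iexp_1)
  qed
  have cc: "ce C m (cre E 1 v) = cre E 1 (ce C m v)" for m v
    using cre.iexp_commute[OF cre_linear, of E 1 C m v] by (simp add: cre_commute)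
  have "osc C A k (cre E 1 v) = (\<Sum>p\<in>{0..N}. ce C (k + p) (an A p (cre E 1 v)))"
    by (rule osc_eq[OF N(3,2) order_refl])
  also have "\<dots> = cre E 1 (\<Sum>p\<in>{0..N}. ce C (k + p) (an A p v)) + vscale (A j 1) (\<Sum>p\<in>{0..N}. ce C (k + 1 + (p - 1)) (an A (p - 1) v))"
    unfolding comm module_hom.add[OF cre.iexp_linear] module_hom.scale[OF cre.iexp_linear] cc sum.distrib
    by (simp add: cre.h_sum V.scale_sum_right)
  also have "(\<Sum>p\<in>{0..N}. ce C (k + 1 + (p - 1)) (an A (p - 1) v)) = (\<Sum>p\<in>{0..N - 1}. ce C (k + 1 + p) (an A p v))"
    using sum_shift_neg[where F = "\<lambda>p. ce C (k + 1 + p) (an A p v)" and r = 1 and m = N] by simp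
  also have "\<dots> = osc C A (k + 1) v" by (simp add: osc_def N_def)
  also have "(\<Sum>p\<in>{0..N}. ce C (k + p) (an A p v)) = osc C A k v"
    by (rule osc_eq[OF N(1,2) order_refl, symmetric])
  finally show ?thesis unfolding E1 .
qed

section \<open>The products of a quasi compatible pair\<close>

lemma Sum_any_superset:
  assumes "finite A" "\<And>x. x \<notin> A \<Longrightarrow> f x = 0"
  shows "Sum_any f = sum f A"
  using assms by (intro Sum_any.expand_superset) auto

lemma laurent2I:
  fixes g :: "rat \<Rightarrow> rat \<Rightarrow> 'n::{finite,linorder} V"
  assumes "\<And>r s. g r s \<noteq> 0 \<Longrightarrow> r \<in> \<int> \<and> of_nat (CARD('n) + 1) * s \<in> \<int> \<and> N \<le> r \<and> N \<le> s"
  shows "g \<in> laurent2"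
  using assms unfolding laurent2_def by blast

lemma laurent2E:
  fixes g :: "rat \<Rightarrow> rat \<Rightarrow> 'n::{finite,linorder} V"
  assumes "g \<in> laurent2"
  obtains N where "\<And>r s. g r s \<noteq> 0 \<Longrightarrow> r \<in> \<int> \<and> of_nat (CARD('n) + 1) * s \<in> \<int> \<and> N \<le> r \<and> N \<le> s"
  using assms unfolding laurent2_def by blast

lemma laurent2_0: "(\<lambda>r s. 0) \<in> laurent2"
  by (rule laurent2I[where N = 0]) auto

lemma laurent2_add:
  assumes "g \<in> laurent2" "h \<in> laurent2"
  shows "(\<lambda>r s. g r s + h r s) \<in> laurent2"
proof -
  from assms(1) obtain N where N: "\<And>r s. g r s \<noteq> 0 \<Longrightarrow> r \<in> \<int> \<and> of_nat (CARD('a) + 1) * s \<in> \<int> \<and> N \<le> r \<and> N \<le> s"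
    by (rule laurent2E) blast
  from assms(2) obtain M where M: "\<And>r s. h r s \<noteq> 0 \<Longrightarrow> r \<in> \<int> \<and> of_nat (CARD('a) + 1) * s \<in> \<int> \<and> M \<le> r \<and> M \<le> s"
    by (rule laurent2E) blast
  show ?thesis
  proof (rule laurent2I[where N = "min N M"])
    fix r s assume "g r s + h r s \<noteq> 0"
    then have "g r s \<noteq> 0 \<or> h r s \<noteq> 0" by auto
    then show "r \<in> \<int> \<and> of_nat (CARD('a) + 1) * s \<in> \<int> \<and> min N M \<le> r \<and> min N M \<le> s"
    proof
      assume "g r s \<noteq> 0" from N[OF this] show ?thesis by auto
    next
      assume "h r s \<noteq> 0" from M[OF this] show ?thesis by auto
    qed
  qed
qed

lemma laurent2_scale:
  assumes "g \<in> laurent2"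
  shows "(\<lambda>r s. vscale c (g r s)) \<in> laurent2"
proof -
  from assms obtain N where N: "\<And>r s. g r s \<noteq> 0 \<Longrightarrow> r \<in> \<int> \<and> of_nat (CARD('a) + 1) * s \<in> \<int> \<and> N \<le> r \<and> N \<le> s"
    by (rule laurent2E) blast
  show ?thesis by (rule laurent2I[where N = N]) (use N in auto)
qed

lemma laurent2_sum: "(\<And>i. i \<in> A \<Longrightarrow> g i \<in> laurent2) \<Longrightarrow> (\<lambda>r s. \<Sum>i\<in>A. g i r s) \<in> laurent2"
  by (induction A rule: infinite_finite_induct) (auto simp: laurent2_0 laurent2_add)

lemma laurent2_shift:
  assumes "g \<in> laurent2"
  shows "(\<lambda>r s. g (r - of_int i) (s - of_int j)) \<in> laurent2"
proof -
  from assms obtain N where N: "\<And>r s. g r s \<noteq> 0 \<Longrightarrow> r \<in> \<int> \<and> of_nat (CARD('a) + 1) * s \<in> \<int> \<and> N \<le> r \<and> N \<le> s"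
    by (rule laurent2E) blast
  show ?thesis
  proof (rule laurent2I[where N = "N + min (of_int i) (of_int j)"])
    fix r s assume "g (r - of_int i) (s - of_int j) \<noteq> 0"
    from N[OF this] have *: "r - of_int i \<in> \<int>" "of_nat (CARD('a) + 1) * (s - of_int j) \<in> \<int>" "N \<le> r - of_int i" "N \<le> s - of_int j"
      by auto
    have "r - of_int i + of_int i \<in> \<int>" by (rule Ints_add[OF *(1)]) simp
    moreover have "of_nat (CARD('a) + 1) * (s - of_int j) + of_int (int (CARD('a) + 1) * j) \<in> \<int>"
      by (rule Ints_add[OF *(2)]) (rule Ints_of_int)
    then have "of_nat (CARD('a) + 1) * s \<in> \<int>" by (simp add: algebra_simps)
    ultimately show "r \<in> \<int> \<and> of_nat (CARD('a) + 1) * s \<in> \<int> \<and> N + min (of_int i) (of_int j) \<le> r \<and> N + min (of_int i) (of_int j) \<le> s"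
      using * by auto
  qed
qed

text \<open>Unlike \<open>poly_prod\<close>, this can be iterated.\<close>

definition pmul :: "scal poly poly \<Rightarrow> (rat \<Rightarrow> rat \<Rightarrow> 'n V) \<Rightarrow> rat \<Rightarrow> rat \<Rightarrow> 'n V" where
  "pmul p g r s = (\<Sum>i\<le>degree p. \<Sum>j\<le>degree (coeff p i).
     vscale (coeff (coeff p i) j) (g (r - of_nat i) (s - of_nat j)))"

lemma poly_prod_pmul: "poly_prod p a b v = pmul p (\<lambda>r s. a (b v s) r)"
  by (intro ext) (simp add: poly_prod_def pmul_def)

lemma pmul_Sigma: "pmul p g r s = (\<Sum>x\<in>Sigma {..degree p} (\<lambda>i. {..degree (coeff p i)}).
    vscale (coeff (coeff p (fst x)) (snd x)) (g (r - of_nat (fst x)) (s - of_nat (snd x))))"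
  unfolding pmul_def by (simp add: sum.Sigma case_prod_beta)

lemma pmul_commute: "pmul p (pmul f g) = pmul f (pmul p g)"
proof (intro ext)
  fix r s
  show "pmul p (pmul f g) r s = pmul f (pmul p g) r s"
    unfolding pmul_Sigma V.scale_sum_right
    by (subst sum.swap) (simp add: mult.commute diff_diff_eq add.commute)
qed

lemma pmul_add: "pmul p (\<lambda>r s. g r s + h r s) = (\<lambda>r s. pmul p g r s + pmul p h r s)"
  by (intro ext) (simp add: pmul_def V.scale_right_distrib sum.distrib)

lemma pmul_scale: "pmul p (\<lambda>r s. vscale c (g r s)) = (\<lambda>r s. vscale c (pmul p g r s))"
  by (intro ext) (simp add: pmul_def V.scale_sum_right mult.commute)

subsection \<open>Matrix coefficients as iterated Laurent series\<close>

text \<open>A scalar component of a vector. The products are defined with inverses in a field of iterated Laurent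
  series, which can be used for series with scalar coefficients only.\<close>

definition mcoeff :: "'n wgt \<Rightarrow> ('n \<times> nat \<Rightarrow>\<^sub>0 nat) \<Rightarrow> 'n V \<Rightarrow> scal" where
  "mcoeff \<beta> m v = lookup (lookup v \<beta>) m"

lemma mcoeff_add: "mcoeff \<beta> m (u + v) = mcoeff \<beta> m u + mcoeff \<beta> m v"
  by (simp add: mcoeff_def lookup_add)

lemma mcoeff_0 [simp]: "mcoeff \<beta> m 0 = 0"
  by (simp add: mcoeff_def)

lemma lookup_kconst_mult: "lookup (kconst c * p) m = c * lookup p m"
proof -
  have "kconst c * p = Poly_Mapping.map ((*) c) p"
    by (simp add: kconst_def mult_map_scale_conv_mult)
  then show ?thesis by (simp add: Poly_Mapping.map.rep_eq when_def)
qed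

lemma mcoeff_scale: "mcoeff \<beta> m (vscale c v) = c * mcoeff \<beta> m v"
  by (simp add: mcoeff_def lookup_vscale lookup_kconst_mult)

lemma mcoeff_sum: "mcoeff \<beta> m (sum f A) = (\<Sum>a\<in>A. mcoeff \<beta> m (f a))"
  by (induction A rule: infinite_finite_induct) (auto simp: mcoeff_add)

lemma mcoeff_eqI: "(\<And>\<beta> m. mcoeff \<beta> m u = mcoeff \<beta> m v) \<Longrightarrow> u = v"
  by (intro poly_mapping_eqI) (simp add: mcoeff_def)

definition zbound :: "(rat \<Rightarrow> rat \<Rightarrow> 'n V) \<Rightarrow> int \<Rightarrow> bool" where
  "zbound g N \<longleftrightarrow> (\<forall>r s. g r s \<noteq> 0 \<longrightarrow> of_int N \<le> r \<and> of_int N \<le> s)"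

lemma laurent2_zbound: "g \<in> laurent2 \<Longrightarrow> \<exists>N. zbound g N"
proof -
  assume "g \<in> laurent2"
  then obtain N where N: "\<And>r s. g r s \<noteq> 0 \<Longrightarrow> r \<in> \<int> \<and> of_nat (CARD('a) + 1) * s \<in> \<int> \<and> N \<le> r \<and> N \<le> s"
    by (rule laurent2E) blast
  have "of_int \<lfloor>N\<rfloor> \<le> N" by simp
  then have "zbound g \<lfloor>N\<rfloor>" unfolding zbound_def using N order_trans by blast
  then show ?thesis ..
qed

lemma subst_sum_finite:
  assumes N: "zbound g N" and A: "finite A" "{N..\<lceil>s\<rceil> + int u - N} \<subseteq> A"
  shows "subst_sum g u s = (\<Sum>k\<in>A. vscale (cst (of_int k gchoose u)) (g (of_int k) (s - of_int k + of_nat u)))"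
  unfolding subst_sum_def
proof (rule Sum_any_superset[OF A(1)])
  fix k assume k: "k \<notin> A"
  show "vscale (cst (of_int k gchoose u)) (g (of_int k) (s - of_int k + of_nat u)) = 0"
  proof (rule ccontr)
    assume "vscale (cst (of_int k gchoose u)) (g (of_int k) (s - of_int k + of_nat u)) \<noteq> 0"
    then have "g (of_int k) (s - of_int k + of_nat u) \<noteq> 0" by auto
    then have "of_int N \<le> (of_int k :: rat)" and *: "of_int N \<le> s - of_int k + of_nat u"
      using N unfolding zbound_def by blast+
    then have "N \<le> k" by simp
    moreover have "of_int (k + N - int u) \<le> s" using * by simp
    then have "k + N - int u \<le> \<lceil>s\<rceil>" by linarith
    ultimately have "k \<in> {N..\<lceil>s\<rceil> + int u - N}" by simp
    with k A(2) show False by blast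
  qed
qed

lemma subst_sum_bound:
  assumes "zbound g N" "s < of_int (2 * N) - of_nat u"
  shows "subst_sum g u s = 0"
proof -
  have "\<lceil>s\<rceil> \<le> 2 * N - int u" using assms(2) by (simp add: ceiling_le_iff)
  show ?thesis
  proof (cases "{N..\<lceil>s\<rceil> + int u - N} = {}")
    case True
    then show ?thesis using subst_sum_finite[OF assms(1), of "{}" s u] by simp
  next
    case False
    then have "\<lceil>s\<rceil> = 2 * N - int u" using \<open>\<lceil>s\<rceil> \<le> 2 * N - int u\<close> by auto
    have "subst_sum g u s = (\<Sum>k\<in>{N}. vscale (cst (of_int k gchoose u)) (g (of_int k) (s - of_int k + of_nat u)))"
      using \<open>\<lceil>s\<rceil> = 2 * N - int u\<close> by (intro subst_sum_finite[OF assms(1)]) auto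
    moreover have "g (of_int N) (s - of_int N + of_nat u) = 0"
    proof (rule ccontr)
      assume "g (of_int N) (s - of_int N + of_nat u) \<noteq> 0"
      then have "of_int N \<le> s - of_int N + of_nat u" using assms(1) unfolding zbound_def by blast
      with assms(2) show False by simp
    qed
    ultimately show ?thesis by simp
  qed
qed

lemma subst_sum_add:
  assumes "g \<in> laurent2" "h \<in> laurent2"
  shows "subst_sum (\<lambda>r s. g r s + h r s) u s = subst_sum g u s + subst_sum h u s"
proof -
  obtain N M L where N: "zbound g N" "zbound h M" "zbound (\<lambda>r s. g r s + h r s) L"
    using laurent2_zbound[OF assms(1)] laurent2_zbound[OF assms(2)] laurent2_zbound[OF laurent2_add[OF assms]] by blast
  define A where "A = {N..\<lceil>s\<rceil> + int u - N} \<union> {M..\<lceil>s\<rceil> + int u - M} \<union> {L..\<lceil>s\<rceil> + int u - L}"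
  have A: "finite A" by (simp add: A_def)
  show ?thesis
    by (subst (1 2 3) subst_sum_finite[OF _ A]) (use N in \<open>auto simp: A_def V.scale_right_distrib sum.distrib\<close>)
qed

lemma subst_sum_scale:
  assumes "g \<in> laurent2"
  shows "subst_sum (\<lambda>r s. vscale c (g r s)) u s = vscale c (subst_sum g u s)"
proof -
  obtain N L where N: "zbound g N" "zbound (\<lambda>r s. vscale c (g r s)) L"
    using laurent2_zbound[OF assms(1)] laurent2_zbound[OF laurent2_scale[OF assms]] by blast
  define A where "A = {N..\<lceil>s\<rceil> + int u - N} \<union> {L..\<lceil>s\<rceil> + int u - L}"
  have A: "finite A" by (simp add: A_def)
  show ?thesis
    by (subst (1 2) subst_sum_finite[OF _ A]) (use N in \<open>auto simp: A_def V.scale_sum_right mult.commute\<close>)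
qed

lemma subst_sum_sum:
  assumes "\<And>i. i \<in> A \<Longrightarrow> g i \<in> laurent2"
  shows "subst_sum (\<lambda>r s. \<Sum>i\<in>A. g i r s) u s = (\<Sum>i\<in>A. subst_sum (g i) u s)"
  using assms
proof (induction A rule: infinite_finite_induct)
  case (insert x F)
  then show ?case by (simp add: subst_sum_add laurent2_sum)
qed (simp_all add: subst_sum_def)

lemma subst_sum_z2:
  "subst_sum (\<lambda>r s. g r (s - of_int j)) u s = subst_sum g u (s - of_int j)"
  by (simp add: subst_sum_def algebra_simps)

text \<open>Multiplication by \<open>z\<^sub>1\<close> becomes multiplication by \<open>z + z\<^sub>0\<close>, by the recursion of the binomial coefficients.\<close>

lemma subst_sum_z1:
  assumes g: "g \<in> laurent2"
  shows "subst_sum (\<lambda>r s. g (r - 1) s) u s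
    = subst_sum g u (s - 1) + (if u = 0 then 0 else subst_sum g (u - 1) s)"
proof -
  have g': "(\<lambda>r s. g (r - 1) s) \<in> laurent2" using laurent2_shift[OF g, of 1 0] by simp
  obtain N where N: "zbound g N" using laurent2_zbound[OF g] ..
  obtain N' where N': "zbound (\<lambda>r s. g (r - 1) s) N'" using laurent2_zbound[OF g'] ..
  define A where "A = {min N (N' - 1)..\<lceil>s\<rceil> + int u - min N N'}"
  have A: "finite A" by (simp add: A_def)
  have "subst_sum (\<lambda>r s. g (r - 1) s) u s = (\<Sum>k\<in>(\<lambda>k. k + 1) ` A. vscale (cst (of_int k gchoose u)) (g (of_int k - 1) (s - of_int k + of_nat u)))"
    using N' A by (intro subst_sum_finite) (force simp: A_def image_iff intro!: bexI[of _ "_ - 1"])+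
  also have "\<dots> = (\<Sum>k\<in>A. vscale (cst ((of_int k + 1) gchoose u)) (g (of_int k) (s - 1 - of_int k + of_nat u)))"
    by (subst sum.reindex) (auto simp: algebra_simps inj_on_def)
  also have "\<dots> = (\<Sum>k\<in>A. vscale (cst (of_int k gchoose u)) (g (of_int k) (s - 1 - of_int k + of_nat u))
        + (if u = 0 then 0 else vscale (cst (of_int k gchoose (u - 1))) (g (of_int k) (s - of_int k + of_nat (u - 1)))))"
  proof (intro sum.cong refl)
    fix k
    show "vscale (cst ((of_int k + 1) gchoose u)) (g (of_int k) (s - 1 - of_int k + of_nat u))
       = vscale (cst (of_int k gchoose u)) (g (of_int k) (s - 1 - of_int k + of_nat u))
        + (if u = 0 then 0 else vscale (cst (of_int k gchoose (u - 1))) (g (of_int k) (s - of_int k + of_nat (u - 1))))"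
    proof (cases u)
      case (Suc n)
      have "cst ((of_int k + 1) gchoose Suc n) = cst (of_int k gchoose n) + cst (of_int k gchoose Suc n)"
        by (simp only: gbinomial_Suc_Suc cst_add)
      with Suc show ?thesis by (simp add: V.scale_left_distrib algebra_simps)
    qed simp
  qed
  also have "\<dots> = subst_sum g u (s - 1) + (if u = 0 then 0 else subst_sum g (u - 1) s)"
  proof -
    have 1: "subst_sum g u (s - 1) = (\<Sum>k\<in>A. vscale (cst (of_int k gchoose u)) (g (of_int k) (s - 1 - of_int k + of_nat u)))"
      by (rule subst_sum_finite[OF N A]) (auto simp: A_def)
    have 2: "subst_sum g (u - 1) s = (\<Sum>k\<in>A. vscale (cst (of_int k gchoose (u - 1))) (g (of_int k) (s - of_int k + of_nat (u - 1))))"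
      by (rule subst_sum_finite[OF N A]) (auto simp: A_def)
    show ?thesis unfolding 1 2 sum.distrib by auto
  qed
  finally show ?thesis .
qed

text \<open>A matrix coefficient of \<open>g(z + z\<^sub>0, z)\<close>, restricted to the powers of \<open>z\<close> in \<open>s + \<int>\<close>
  and divided by \<open>z\<^sup>s\<close>; an element of \<open>F((z))((z\<^sub>0))\<close>.\<close>

definition shifted :: "'n wgt \<Rightarrow> ('n \<times> nat \<Rightarrow>\<^sub>0 nat) \<Rightarrow> rat \<Rightarrow> (rat \<Rightarrow> rat \<Rightarrow> 'n V) \<Rightarrow> scal fls fls" where
  "shifted \<beta> m s g = fps_to_fls (Abs_fps (\<lambda>u. Abs_fls (\<lambda>l. mcoeff \<beta> m (subst_sum g u (s + of_int l)))))"

lemma shifted_nth: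
  assumes "g \<in> laurent2"
  shows "fls_nth (fls_nth (shifted \<beta> m s g) u) l
    = (if u < 0 then 0 else mcoeff \<beta> m (subst_sum g (nat u) (s + of_int l)))"
proof (cases "u < 0")
  case False
  obtain N where N: "zbound g N" using laurent2_zbound[OF assms] ..
  have "fls_nth (Abs_fls (\<lambda>l. mcoeff \<beta> m (subst_sum g (nat u) (s + of_int l)))) l = mcoeff \<beta> m (subst_sum g (nat u) (s + of_int l))"
  proof (rule nth_Abs_fls_ex_lower_bound, intro exI allI impI)
    fix l assume "l < 2 * N - u - \<lceil>s\<rceil>"
    then have "of_int l + of_int \<lceil>s\<rceil> < (of_int (2 * N - u) :: rat)"
      by (simp flip: of_int_add)
    moreover have "s \<le> of_int \<lceil>s\<rceil>" by simp
    moreover have "(of_int (2 * N - u) :: rat) = of_int (2 * N) - of_nat (nat u)" using False by simp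
    ultimately have "s + of_int l < of_int (2 * N) - of_nat (nat u)" by linarith
    then show "mcoeff \<beta> m (subst_sum g (nat u) (s + of_int l)) = 0"
      by (simp add: subst_sum_bound[OF N])
  qed
  with False show ?thesis by (simp add: shifted_def)
qed (simp add: shifted_def)

lemma fls2_eqI: "(\<And>u l. fls_nth (fls_nth X u) l = fls_nth (fls_nth Y u) l) \<Longrightarrow> X = Y"
  by (intro fls_eqI)

lemma shifted_add:
  assumes "g \<in> laurent2" "h \<in> laurent2"
  shows "shifted \<beta> m s (\<lambda>r s. g r s + h r s) = shifted \<beta> m s g + shifted \<beta> m s h"
  by (rule fls2_eqI) (simp add: shifted_nth assms laurent2_add subst_sum_add mcoeff_add)

lemma shifted_sum:
  assumes "\<And>i. i \<in> A \<Longrightarrow> g i \<in> laurent2"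
  shows "shifted \<beta> m s (\<lambda>r s. \<Sum>i\<in>A. g i r s) = (\<Sum>i\<in>A. shifted \<beta> m s (g i))"
  using assms
proof (induction A rule: infinite_finite_induct)
  case (insert x F)
  then show ?case by (simp add: shifted_add laurent2_sum)
qed (auto intro!: fls2_eqI simp: shifted_nth laurent2_0 subst_sum_def)

lemma shifted_scale:
  assumes "g \<in> laurent2"
  shows "shifted \<beta> m s (\<lambda>r s. vscale c (g r s)) = fls_const (fls_const c) * shifted \<beta> m s g"
  by (rule fls2_eqI) (simp add: shifted_nth assms laurent2_scale subst_sum_scale mcoeff_scale)

lemma shifted_z2:
  assumes "g \<in> laurent2"
  shows "shifted \<beta> m s (\<lambda>r s. g r (s - 1)) = fls_const fls_X * shifted \<beta> m s g"
proof -
  have g': "(\<lambda>r s. g r (s - 1)) \<in> laurent2" using laurent2_shift[OF assms, of 0 1] by simp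
  show ?thesis
    using subst_sum_z2[of g 1]
    by (intro fls2_eqI) (simp add: shifted_nth assms g' fls_X_times_conv_shift algebra_simps)
qed

lemma shifted_z1:
  assumes "g \<in> laurent2"
  shows "shifted \<beta> m s (\<lambda>r s. g (r - 1) s) = (fls_X + fls_const fls_X) * shifted \<beta> m s g"
proof -
  have g': "(\<lambda>r s. g (r - 1) s) \<in> laurent2" using laurent2_shift[OF assms, of 1 0] by simp
  show ?thesis
  proof (rule fls2_eqI)
    fix u l
    show "fls_nth (fls_nth (shifted \<beta> m s (\<lambda>r s. g (r - 1) s)) u) l = fls_nth (fls_nth ((fls_X + fls_const fls_X) * shifted \<beta> m s g) u) l"
      using nat_diff_distrib'[of u 1]
      by (cases "u < 0"; cases "u = 0")
        (auto simp: shifted_nth assms g' distrib_right fls_X_times_conv_shift subst_sum_z1 mcoeff_add algebra_simps)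
  qed
qed

lemma shifted_pmul:
  assumes g: "g \<in> laurent2"
  shows "shifted \<beta> m s (pmul p g) = poly_shift p * shifted \<beta> m s g"
proof -
  let ?z = "fls_const fls_X :: scal fls fls" and ?H = "\<lambda>c. fls_const (fps_to_fls (fps_of_poly c)) :: scal fls fls"
  have L: "(\<lambda>r s. g (r - of_nat i) (s - of_nat j)) \<in> laurent2" for i j
    using laurent2_shift[OF g, of "int i" "int j"] by simp
  have 1: "shifted \<beta> m s (\<lambda>r s. g r (s - of_nat j)) = ?z ^ j * shifted \<beta> m s g" for j
  proof (induction j)
    case (Suc j)
    have "shifted \<beta> m s (\<lambda>r s. g r (s - of_nat (Suc j))) = ?z * shifted \<beta> m s (\<lambda>r s. g r (s - of_nat j))"
      using shifted_z2[OF L[of 0 j], of \<beta> m s] by (simp add: algebra_simps)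
    with Suc show ?case by (simp add: mult.assoc)
  qed simp
  have 2: "shifted \<beta> m s (\<lambda>r s. g (r - of_nat i) (s - of_nat j)) = (fls_X + ?z) ^ i * (?z ^ j * shifted \<beta> m s g)" for i j
  proof (induction i)
    case (Suc i)
    have "shifted \<beta> m s (\<lambda>r s. g (r - of_nat (Suc i)) (s - of_nat j)) = (fls_X + ?z) * shifted \<beta> m s (\<lambda>r s. g (r - of_nat i) (s - of_nat j))"
      using shifted_z1[OF L[of i j], of \<beta> m s] by (simp add: algebra_simps)
    with Suc show ?case by (simp add: mult.assoc)
  qed (simp add: 1)
  have H: "?H c = (\<Sum>j\<le>degree c. fls_const (fls_const (coeff c j)) * ?z ^ j)" for c
  proof -
    have "?H c = poly (map_poly (\<lambda>a. fls_const (fls_const a)) c) ?z"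
      by (induction c) (simp_all add: map_poly_pCons fps_of_poly_pCons fls_times_fps_to_fls fls_plus_const[symmetric] fls_const_mult_const[symmetric] mult.commute del: fls_const_mult_const)
    also have "\<dots> = (\<Sum>j\<le>degree c. fls_const (fls_const (coeff c j)) * ?z ^ j)"
      by (subst poly_altdef) (simp add: coeff_map_poly degree_map_poly fls_const_nonzero)
    finally show ?thesis .
  qed
  have "shifted \<beta> m s (pmul p g) = (\<Sum>x\<in>Sigma {..degree p} (\<lambda>i. {..degree (coeff p i)}).
      fls_const (fls_const (coeff (coeff p (fst x)) (snd x))) * ((fls_X + ?z) ^ fst x * (?z ^ snd x * shifted \<beta> m s g)))"
  proof -
    have "pmul p g = (\<lambda>r s. \<Sum>x\<in>Sigma {..degree p} (\<lambda>i. {..degree (coeff p i)}).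
        vscale (coeff (coeff p (fst x)) (snd x)) (g (r - of_nat (fst x)) (s - of_nat (snd x))))"
      by (intro ext) (rule pmul_Sigma)
    then show ?thesis by (simp add: shifted_sum laurent2_scale L shifted_scale 2)
  qed
  also have "\<dots> = (\<Sum>i\<le>degree p. \<Sum>j\<le>degree (coeff p i). fls_const (fls_const (coeff (coeff p i) j)) * ?z ^ j * (fls_X + ?z) ^ i * shifted \<beta> m s g)"
    by (subst sum.Sigma) (simp_all add: case_prod_beta mult_ac)
  also have "\<dots> = (\<Sum>i\<le>degree p. ?H (coeff p i) * (fls_X + ?z) ^ i) * shifted \<beta> m s g"
    unfolding H sum_distrib_right ..
  also have "(\<Sum>i\<le>degree p. ?H (coeff p i) * (fls_X + ?z) ^ i) = poly_shift p"
    unfolding poly_shift_def by (subst poly_altdef) (simp add: coeff_map_poly degree_map_poly)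
  finally show ?thesis .
qed

text \<open>As a polynomial in \<open>z\<^sub>0\<close>, \<open>p(z\<^sub>0 + z, z)\<close> has the same leading coefficient as \<open>p(z\<^sub>0, z)\<close>.\<close>

lemma poly_shift_nonzero:
  assumes "p \<noteq> 0"
  shows "poly_shift p \<noteq> 0"
proof -
  let ?z = "fls_const fls_X :: scal fls fls" and ?H = "\<lambda>c. fls_const (fps_to_fls (fps_of_poly c)) :: scal fls fls"
  have top: "fls_nth ((fls_X + ?z) ^ i) (int n) = (if n = i then 1 else 0)" if "i \<le> n" for i n
    using that
  proof (induction i arbitrary: n)
    case (Suc i)
    obtain n' where n: "n = Suc n'" using Suc.prems by (cases n) auto
    have "fls_nth ((fls_X + ?z) ^ Suc i) (int n) = fls_nth ((fls_X + ?z) ^ i) (int n') + fls_X * fls_nth ((fls_X + ?z) ^ i) (int n)"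
      by (simp add: n distrib_right fls_X_times_conv_shift)
    also have "\<dots> = (if n = Suc i then 1 else 0)"
      using Suc.prems by (subst (1 2) Suc.IH) (auto simp: n)
    finally show ?case .
  qed auto
  have "poly_shift p = (\<Sum>i\<le>degree p. ?H (coeff p i) * (fls_X + ?z) ^ i)"
    unfolding poly_shift_def by (subst poly_altdef) (simp add: coeff_map_poly degree_map_poly)
  then have "fls_nth (poly_shift p) (int (degree p)) = (\<Sum>i\<le>degree p. fps_to_fls (fps_of_poly (coeff p i)) * fls_nth ((fls_X + ?z) ^ i) (int (degree p)))"
    by (simp add: fls_nth_sum)
  also have "\<dots> = (\<Sum>i\<le>degree p. if i = degree p then fps_to_fls (fps_of_poly (coeff p i)) else 0)"
    by (intro sum.cong) (auto simp: top)
  also have "\<dots> = fps_to_fls (fps_of_poly (lead_coeff p))" by simp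
  also have "\<dots> \<noteq> 0" using assms by simp
  finally show ?thesis by auto
qed

lemma fls_times_nth_superset:
  fixes f g :: "'a::{comm_monoid_add, mult_zero} fls"
  assumes "finite A" "{fls_subdegree f..n - fls_subdegree g} \<subseteq> A"
  shows "fls_nth (f * g) n = (\<Sum>i\<in>A. fls_nth f i * fls_nth g (n - i))"
  unfolding fls_times_nth(2) using assms
  by (intro sum.mono_neutral_left) (auto simp: not_le)

text \<open>The double sum in the definition of the products is a coefficient of a product in \<open>F((z))((z\<^sub>0))\<close>.\<close>

lemma mcoeff_nth_prod_expansion:
  fixes R :: "scal fls fls"
  assumes g: "g \<in> laurent2"
  shows "mcoeff \<beta> m (Sum_any (\<lambda>u::nat. Sum_any (\<lambda>l::int.
        vscale (fls_nth (fls_nth R (d - int u)) l) (subst_sum g u (s - of_int l)))))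
    = fls_nth (fls_nth (R * shifted \<beta> m s g) d) 0"
proof -
  let ?S = "shifted \<beta> m s g"
  obtain N where N: "zbound g N" using laurent2_zbound[OF g] ..
  define T where "T u = (\<Sum>l::int. vscale (fls_nth (fls_nth R (d - int u)) l) (subst_sum g u (s - of_int l)))" for u
  have T: "mcoeff \<beta> m (T u) = fls_nth (fls_nth R (d - int u) * fls_nth ?S (int u)) 0" for u
  proof -
    let ?f = "fls_nth R (d - int u)" and ?h = "fls_nth ?S (int u)"
    define A where "A = {fls_subdegree ?f..max (\<lceil>s\<rceil> + int u - 2 * N) (- fls_subdegree ?h)}"
    have "T u = (\<Sum>l\<in>A. vscale (fls_nth ?f l) (subst_sum g u (s - of_int l)))"
      unfolding T_def
    proof (rule Sum_any_superset)
      fix l assume "l \<notin> A"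
      then consider "l < fls_subdegree ?f" | "\<lceil>s\<rceil> + int u - 2 * N < l" by (auto simp: A_def)
      then show "vscale (fls_nth ?f l) (subst_sum g u (s - of_int l)) = 0"
      proof cases
        case 2
        then have "of_int (\<lceil>s\<rceil> + int u - 2 * N) < (of_int l :: rat)" by (simp only: of_int_less_iff)
        then have "of_int \<lceil>s\<rceil> + of_nat u - of_int (2 * N) < (of_int l :: rat)" by simp
        with le_of_int_ceiling[of s] have "s - of_int l < of_int (2 * N) - of_nat u" by linarith
        then show ?thesis by (simp add: subst_sum_bound[OF N])
      qed simp
    qed (simp add: A_def)
    then have "mcoeff \<beta> m (T u) = (\<Sum>l\<in>A. fls_nth ?f l * fls_nth ?h (0 - l))"
      by (simp add: mcoeff_sum mcoeff_scale shifted_nth[OF g])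
    also have "\<dots> = fls_nth (?f * ?h) 0"
      by (rule fls_times_nth_superset[symmetric]) (auto simp: A_def)
    finally show ?thesis .
  qed
  have S0: "fls_subdegree ?S \<ge> 0"
    by (simp add: shifted_def fls_subdegree_fls_to_fps)
  define U where "U = {..nat (d - fls_subdegree R)}"
  have "Sum_any T = sum T U"
  proof (rule Sum_any_superset)
    fix u assume "u \<notin> U"
    then have "d - int u < fls_subdegree R" by (auto simp: U_def)
    then have "fls_nth R (d - int u) = 0" by simp
    then show "T u = 0" by (simp add: T_def)
  qed (simp add: U_def)
  then have "mcoeff \<beta> m (Sum_any T) = fls_nth (\<Sum>u\<in>U. fls_nth R (d - int u) * fls_nth ?S (int u)) 0"
    by (simp add: mcoeff_sum T fls_nth_sum)
  also have "(\<Sum>u\<in>U. fls_nth R (d - int u) * fls_nth ?S (int u)) = (\<Sum>i\<in>(\<lambda>u. d - int u) ` U. fls_nth R i * fls_nth ?S (d - i))"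
    by (subst sum.reindex) (auto simp: inj_on_def)
  also have "\<dots> = fls_nth (R * ?S) d"
  proof (rule fls_times_nth_superset[symmetric])
    show "{fls_subdegree R..d - fls_subdegree ?S} \<subseteq> (\<lambda>u. d - int u) ` U"
    proof
      fix i assume "i \<in> {fls_subdegree R..d - fls_subdegree ?S}"
      then have "i = d - int (nat (d - i))" "nat (d - i) \<in> U" using S0 by (auto simp: U_def)
      then show "i \<in> (\<lambda>u. d - int u) ` U" by blast
    qed
  qed (simp add: U_def)
  finally show ?thesis by (simp add: T_def[abs_def])
qed

text \<open>For two clearing polynomials \<open>f\<close> and \<open>p\<close>, multiplying \<open>p a(z\<^sub>1) b(z\<^sub>2)\<close> by \<open>f\<close> or \<open>f a(z\<^sub>1) b(z\<^sub>2)\<close> by \<open>p\<close> gives the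
  same series, so the two quotients agree. In this form the products can be computed with any clearing
  polynomial.\<close>

theorem mcoeff_nth_prod:
  assumes f: "qc_poly f a b"
  shows "mcoeff \<beta> m (nth_prod a r b v s)
    = fls_nth (fls_nth (inverse (poly_shift f) * shifted \<beta> m s (poly_prod f a b v)) (- r - 1)) 0"
proof -
  define p where "p = (SOME p. qc_poly p a b)"
  have p: "qc_poly p a b" unfolding p_def using f by (rule someI)
  let ?g = "\<lambda>r s. a (b v s) r"
  have L: "poly_prod p a b v \<in> laurent2" "poly_prod f a b v \<in> laurent2" and nz: "poly_shift p \<noteq> 0" "poly_shift f \<noteq> 0"
    using p f poly_shift_nonzero by (auto simp: qc_poly_def)
  have "pmul f (poly_prod p a b v) = pmul p (poly_prod f a b v)"
    unfolding poly_prod_pmul by (rule pmul_commute)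
  then have "poly_shift f * shifted \<beta> m s (poly_prod p a b v) = poly_shift p * shifted \<beta> m s (poly_prod f a b v)"
    using shifted_pmul[OF L(1), of \<beta> m s f] shifted_pmul[OF L(2), of \<beta> m s p] by simp
  then have "inverse (poly_shift p) * shifted \<beta> m s (poly_prod p a b v) = inverse (poly_shift f) * shifted \<beta> m s (poly_prod f a b v)"
    using nz by (simp add: field_simps)
  moreover have "mcoeff \<beta> m (nth_prod a r b v s) = fls_nth (fls_nth (inverse (poly_shift p) * shifted \<beta> m s (poly_prod p a b v)) (- r - 1)) 0"
    unfolding nth_prod_def Let_def p_def[symmetric] by (rule mcoeff_nth_prod_expansion[OF L(1)])
  ultimately show ?thesis by simp
qed

lemma nth_prod_add:
  assumes lin: "\<And>s. V_linear (\<lambda>v. a v s)" and f: "qc_poly f a b1" "qc_poly f a b2"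
  shows "qc_poly f a (b1 + b2)" "nth_prod a r (b1 + b2) = nth_prod a r b1 + nth_prod a r b2"
proof -
  have eq: "poly_prod f a (b1 + b2) v = (\<lambda>r s. poly_prod f a b1 v r s + poly_prod f a b2 v r s)" for v
    unfolding poly_prod_pmul pmul_add[symmetric] by (simp add: module_hom.add[OF lin])
  show qc: "qc_poly f a (b1 + b2)" using f unfolding qc_poly_def eq by (auto intro: laurent2_add)
  show "nth_prod a r (b1 + b2) = nth_prod a r b1 + nth_prod a r b2"
  proof (intro ext, rule mcoeff_eqI)
    fix v s \<beta> m
    have "poly_prod f a b1 v \<in> laurent2" "poly_prod f a b2 v \<in> laurent2" using f by (auto simp: qc_poly_def)
    then show "mcoeff \<beta> m (nth_prod a r (b1 + b2) v s) = mcoeff \<beta> m ((nth_prod a r b1 + nth_prod a r b2) v s)"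
      by (simp add: mcoeff_nth_prod[OF qc] mcoeff_nth_prod[OF f(1)] mcoeff_nth_prod[OF f(2)] mcoeff_add eq shifted_add distrib_left)
  qed
qed

lemma nth_prod_scale:
  assumes lin: "\<And>s. V_linear (\<lambda>v. a v s)" and f: "qc_poly f a b"
  shows "qc_poly f a (oscale c b)" "nth_prod a r (oscale c b) = oscale c (nth_prod a r b)"
proof -
  have eq: "poly_prod f a (oscale c b) v = (\<lambda>r s. vscale c (poly_prod f a b v r s))" for v
    unfolding poly_prod_pmul pmul_scale[symmetric] by (simp add: oscale_def module_hom.scale[OF lin])
  show qc: "qc_poly f a (oscale c b)" using f unfolding qc_poly_def eq by (auto intro: laurent2_scale)
  show "nth_prod a r (oscale c b) = oscale c (nth_prod a r b)"
  proof (intro ext, rule mcoeff_eqI)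
    fix v s \<beta> m
    have L: "poly_prod f a b v \<in> laurent2" using f by (auto simp: qc_poly_def)
    show "mcoeff \<beta> m (nth_prod a r (oscale c b) v s) = mcoeff \<beta> m (oscale c (nth_prod a r b) v s)"
      unfolding mcoeff_nth_prod[OF qc] eq shifted_scale[OF L] mult.left_commute[of "inverse (poly_shift f)"] by (simp add: oscale_def mcoeff_scale mcoeff_nth_prod[OF f])
  qed
qed

subsection \<open>A simple pole\<close>

definition pole_poly :: "scal \<Rightarrow> scal poly poly" where
  "pole_poly c = [:[:0, - c:], 1:]"

lemma pmul_pole_poly: "pmul (pole_poly c) g r s = g (r - 1) s - vscale c (g r (s - 1))"
  by (cases "c = 0") (simp_all add: pmul_def pole_poly_def)

lemma poly_shift_pole_poly: "poly_shift (pole_poly c) = fls_X + fls_const (fls_const (1 - c) * fls_X)"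
  by (intro fls_eqI)
    (simp add: poly_shift_def pole_poly_def map_poly_pCons fps_of_poly_pCons fls_times_fps_to_fls algebra_simps flip: fls_plus_const)

text \<open>Here \<open>p(z\<^sub>0 + z, z) = z\<^sub>0 + (1 - c) z\<close>, which is \<open>z\<^sub>0\<close> for \<open>c = 1\<close>, and otherwise has an inverse in
  nonnegative powers of \<open>z\<^sub>0\<close>, so that there is no residue.\<close>

theorem nth_prod_pole:
  assumes "qc_poly (pole_poly c) a b"
  shows "nth_prod a 0 b v s = (if c = 1 then subst_sum (poly_prod (pole_poly c) a b v) 0 s else 0)"
proof (rule mcoeff_eqI)
  fix \<beta> m
  let ?g = "poly_prod (pole_poly c) a b v"
  have L: "?g \<in> laurent2" using assms by (simp add: qc_poly_def)
  show "mcoeff \<beta> m (nth_prod a 0 b v s) = mcoeff \<beta> m (if c = 1 then subst_sum ?g 0 s else 0)"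
  proof (cases "c = 1")
    case True
    have "inverse (fls_X :: scal fls fls) * h = fls_shift 1 h" for h
      by (simp add: fls_inverse_X fls_X_inv_times_conv_shift)
    then have "mcoeff \<beta> m (nth_prod a 0 b v s) = mcoeff \<beta> m (subst_sum ?g 0 s)"
      by (simp add: mcoeff_nth_prod[OF assms] poly_shift_pole_poly True shifted_nth[OF L[unfolded True]])
    with True show ?thesis by simp
  next
    case False
    have nz: "fls_const (1 - c) * fls_X \<noteq> (0 :: scal fls)" using False by (simp add: fls_const_nonzero)
    have "fls_subdegree (poly_shift (pole_poly c)) = 0"
      using nz by (intro fls_subdegree_eqI) (simp_all add: poly_shift_pole_poly)
    then have "fls_subdegree (inverse (poly_shift (pole_poly c)) * shifted \<beta> m s ?g) \<ge> 0"
      by (intro fls_mult_subdegree_ge_0) (simp_all add: shifted_def fls_subdegree_fls_to_fps)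
    then show ?thesis using False by (simp add: mcoeff_nth_prod[OF assms])
  qed
qed

section \<open>Vertex operators and their operator product expansion\<close>

lemma form_add_right: "form \<gamma> (\<beta> + \<delta>) = form \<gamma> \<beta> + form \<gamma> \<delta>"
  and form_add_left: "form (\<gamma> + \<beta>) \<delta> = form \<gamma> \<delta> + form \<beta> \<delta>"
  by (simp_all add: form_def algebra_simps sum.distrib add_divide_distrib diff_divide_distrib sum_subtractf)

lemma form_0 [simp]: "form \<gamma> 0 = 0" "form 0 \<gamma> = 0"
  by (simp_all add: form_def)

lemma form_denominator: "of_nat (CARD('n) + 1) * form \<gamma> (\<beta> :: 'n::{finite,linorder} wgt) \<in> \<int>"
proof -
  have "of_nat (CARD('n) + 1) * form \<gamma> \<beta> = (\<Sum>i\<in>UNIV. \<Sum>j\<in>UNIV. of_int (\<gamma> i * \<beta> j * (int (min (idx i) (idx j)) * (int (CARD('n) + 1) - int (max (idx i) (idx j))))))"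
    unfolding form_def sum_distrib_left by (intro sum.cong refl) (simp add: field_simps)
  also have "\<dots> \<in> \<int>" by (intro Ints_sum Ints_of_int)
  finally show ?thesis .
qed

definition int_form :: "'n::{finite,linorder} wgt \<Rightarrow> bool" where
  "int_form \<gamma> \<longleftrightarrow> (\<forall>\<beta>. form \<gamma> \<beta> \<in> \<int>)"

text \<open>The vertex operator \<open>vop C A \<gamma> \<chi>\<close> is the product of \<open>exp (\<Sum> C k r a\<^sub>k\<^sup>*(-r) z\<^sup>r)\<close>,
  \<open>exp (\<Sum> A k r a\<^sub>k(r) z\<^sup>-\<^sup>r)\<close>, \<open>e\<^sup>\<gamma> z\<^sup>\<partial>\<^sup>\<gamma>\<close> and the operator that multiplies \<open>K(1) \<otimes> e\<^sup>\<beta>\<close> by \<open>\<chi> \<beta>\<close>; \<open>vop1\<close> is its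
  restriction to \<open>K(1) \<otimes> e\<^sup>\<beta>\<close>. This class of operators contains all generating operators and is preserved,
  up to scalars, by the products.\<close>

definition vop1 where
  "vop1 C A \<gamma> \<chi> \<beta> p s = (if s - form \<gamma> \<beta> \<in> \<int>
     then vscale (\<chi> \<beta> * of_int (eps \<gamma> \<beta>)) (osc C A \<lfloor>s - form \<gamma> \<beta>\<rfloor> (single (\<gamma> + \<beta>) p)) else 0)"

definition vop :: "('n::{finite,linorder} \<Rightarrow> nat \<Rightarrow> scal) \<Rightarrow> ('n \<Rightarrow> nat \<Rightarrow> scal) \<Rightarrow> 'n wgt \<Rightarrow> ('n wgt \<Rightarrow> scal) \<Rightarrow> 'n oper" where
  "vop C A \<gamma> \<chi> v s = (\<Sum>\<beta>\<in>keys v. vop1 C A \<gamma> \<chi> \<beta> (lookup v \<beta>) s)"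

lemma vop1_add: "vop1 C A \<gamma> \<chi> \<beta> (p + q) s = vop1 C A \<gamma> \<chi> \<beta> p s + vop1 C A \<gamma> \<chi> \<beta> q s"
  by (simp add: vop1_def single_add module_hom.add[OF osc_linear] V.scale_right_distrib)

lemma vop1_scale: "vop1 C A \<gamma> \<chi> \<beta> (kconst c * p) s = vscale c (vop1 C A \<gamma> \<chi> \<beta> p s)"
  unfolding vop1_def vscale_single[symmetric] module_hom.scale[OF osc_linear] by (simp add: mult.commute)

lemma vop1_0: "vop1 C A \<gamma> \<chi> \<beta> 0 s = 0"
  using vop1_scale[of C A \<gamma> \<chi> \<beta> 0 0 s] by simp

lemma vop_linear [simp, intro]: "V_linear (\<lambda>v. vop C A \<gamma> \<chi> v s)"
  unfolding vop_def by (rule V_linear_wext) (fact vop1_add vop1_scale)+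

lemma vop_single: "vop C A \<gamma> \<chi> (single \<beta> p) s = vop1 C A \<gamma> \<chi> \<beta> p s"
  unfolding vop_def by (rule sum_keys_single) (rule vop1_0)

lemma vop1_weight: "vop1 C A \<gamma> \<chi> \<beta> p s = single (\<gamma> + \<beta>) (lookup (vop1 C A \<gamma> \<chi> \<beta> p s) (\<gamma> + \<beta>))"
proof (cases "s - form \<gamma> \<beta> \<in> \<int>")
  case True
  show ?thesis
    unfolding vop1_def if_P[OF True] by (subst (1 2) osc_single) (simp add: vscale_single)
qed (simp add: vop1_def)

lemma vop_cong:
  assumes "\<And>k r. r > 0 \<Longrightarrow> C' k r = C k r" "\<And>k r. r > 0 \<Longrightarrow> A' k r = A k r" "\<And>\<beta>. \<chi>' \<beta> = \<chi> \<beta>"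
  shows "vop C' A' \<gamma> \<chi>' = vop C A \<gamma> \<chi>"
proof -
  have "osc C' A' = osc C A" by (intro ext osc_cong) (fact assms)+
  moreover have "\<chi>' = \<chi>" by (intro ext) (fact assms)
  ultimately show ?thesis by (intro ext) (simp only: vop_def vop1_def)
qed

lemma vop_osc:
  "vop C A \<gamma> \<chi> (osc C' A' l (single \<delta> p)) r = (if r - form \<gamma> \<delta> \<in> \<int>
     then vscale (\<chi> \<delta> * of_int (eps \<gamma> \<delta>)) (osc C A \<lfloor>r - form \<gamma> \<delta>\<rfloor> (osc C' A' l (single (\<gamma> + \<delta>) p))) else 0)"
proof -
  define p' where "p' = lookup (osc C' A' l (single \<delta> p)) \<delta>"
  have "osc C' A' l (single \<delta> p) = single \<delta> p'" unfolding p'_def by (rule osc_single)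
  moreover have "single (\<gamma> + \<delta>) p' = osc C' A' l (single (\<gamma> + \<delta>) p)"
    using osc_wshift[of C' A' l \<gamma> \<delta> p] calculation by (simp add: wshift_single)
  ultimately show ?thesis by (simp add: vop_single vop1_def)
qed

lemma scale_arg_vop:
  assumes "int_form \<gamma>"
  shows "scale_arg h (vop C A \<gamma> \<chi>) = vop (\<lambda>k r. Q h ^ r * C k r) (\<lambda>k r. A k r / Q h ^ r) \<gamma> (\<lambda>\<beta>. \<chi> \<beta> * Q (h * \<lfloor>form \<gamma> \<beta>\<rfloor>))"
proof (intro ext)
  fix v s
  show "scale_arg h (vop C A \<gamma> \<chi>) v s = vop (\<lambda>k r. Q h ^ r * C k r) (\<lambda>k r. A k r / Q h ^ r) \<gamma> (\<lambda>\<beta>. \<chi> \<beta> * Q (h * \<lfloor>form \<gamma> \<beta>\<rfloor>)) v s"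
    unfolding scale_arg_def
  proof (rule V_linear_eqI[OF V_linear_scaled[OF vop_linear] vop_linear])
    fix \<beta> p
    from assms obtain f where f: "form \<gamma> \<beta> = of_int f" by (auto simp: int_form_def elim: Ints_cases)
    show "vscale (qh powi (h * \<lfloor>s\<rfloor>)) (vop C A \<gamma> \<chi> (single \<beta> p) s) = vop (\<lambda>k r. Q h ^ r * C k r) (\<lambda>k r. A k r / Q h ^ r) \<gamma> (\<lambda>\<beta>. \<chi> \<beta> * Q (h * \<lfloor>form \<gamma> \<beta>\<rfloor>)) (single \<beta> p) s"
    proof (cases "s - form \<gamma> \<beta> \<in> \<int>")
      case True
      then obtain k where "s - form \<gamma> \<beta> = of_int k" by (auto elim: Ints_cases)
      then have s: "s = of_int (f + k)" using f by simp
      have "osc (\<lambda>k r. Q h ^ r * C k r) (\<lambda>k r. A k r / Q h ^ r) k w = vscale (Q h powi k) (osc C A k w)" for w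
        by (rule osc_scale) simp_all
      moreover have "Q (h * (f + k)) = Q (h * f) * Q h powi k"
        by (simp add: Q_def power_int_mult power_int_add distrib_left)
      ultimately show ?thesis
        by (simp add: vop_single vop1_def s f mult_ac flip: Q_def)
    qed (simp add: vop_single vop1_def)
  qed
qed

subsection \<open>Normally ordered products in two variables\<close>

text \<open>The normally ordered product of two vertex operators as a series in \<open>z\<^sub>1\<close> and \<open>z\<^sub>2\<close>.\<close>

definition nop1 where
  "nop1 C1 A1 \<gamma>1 C2 A2 \<gamma>2 \<chi> \<beta> p r s = (if r - form \<gamma>1 \<beta> \<in> \<int> \<and> s - form \<gamma>2 \<beta> \<in> \<int>
     then vscale (\<chi> \<beta> * of_int (eps (\<gamma>1 + \<gamma>2) \<beta>))
       (osc2 C1 A1 C2 A2 \<lfloor>r - form \<gamma>1 \<beta>\<rfloor> \<lfloor>s - form \<gamma>2 \<beta>\<rfloor> (single (\<gamma>1 + \<gamma>2 + \<beta>) p)) else 0)"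

definition nop where
  "nop C1 A1 \<gamma>1 C2 A2 \<gamma>2 \<chi> v r s = (\<Sum>\<beta>\<in>keys v. nop1 C1 A1 \<gamma>1 C2 A2 \<gamma>2 \<chi> \<beta> (lookup v \<beta>) r s)"

lemma nop1_add: "nop1 C1 A1 \<gamma>1 C2 A2 \<gamma>2 \<chi> \<beta> (p + q) r s = nop1 C1 A1 \<gamma>1 C2 A2 \<gamma>2 \<chi> \<beta> p r s + nop1 C1 A1 \<gamma>1 C2 A2 \<gamma>2 \<chi> \<beta> q r s"
  by (simp add: nop1_def single_add module_hom.add[OF osc2_linear] V.scale_right_distrib)

lemma nop1_scale: "nop1 C1 A1 \<gamma>1 C2 A2 \<gamma>2 \<chi> \<beta> (kconst c * p) r s = vscale c (nop1 C1 A1 \<gamma>1 C2 A2 \<gamma>2 \<chi> \<beta> p r s)"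
  unfolding nop1_def vscale_single[symmetric] module_hom.scale[OF osc2_linear] by (simp add: mult.commute)

lemma nop_linear: "V_linear (\<lambda>v. nop C1 A1 \<gamma>1 C2 A2 \<gamma>2 \<chi> v r s)"
  unfolding nop_def by (rule V_linear_wext) (fact nop1_add nop1_scale)+

lemma nop_single: "nop C1 A1 \<gamma>1 C2 A2 \<gamma>2 \<chi> (single \<beta> p) r s = nop1 C1 A1 \<gamma>1 C2 A2 \<gamma>2 \<chi> \<beta> p r s"
  unfolding nop_def using nop1_scale[of C1 A1 \<gamma>1 C2 A2 \<gamma>2 \<chi> \<beta> 0 0 r s] by (intro sum_keys_single) simp

lemma nop1_laurent2:
  fixes \<gamma>1 :: "'n::{finite,linorder} wgt"
  assumes "int_form \<gamma>1"
  shows "nop1 C1 A1 \<gamma>1 C2 A2 \<gamma>2 \<chi> \<beta> p \<in> laurent2"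
proof -
  define d where "d = vdeg (single (\<gamma>1 + \<gamma>2 + \<beta>) p)"
  show ?thesis
  proof (rule laurent2I[where N = "min (form \<gamma>1 \<beta>) (form \<gamma>2 \<beta>) - of_int d"])
    fix r s assume nz: "nop1 C1 A1 \<gamma>1 C2 A2 \<gamma>2 \<chi> \<beta> p r s \<noteq> 0"
    then have "r - form \<gamma>1 \<beta> \<in> \<int>" "s - form \<gamma>2 \<beta> \<in> \<int>" by (auto simp: nop1_def split: if_splits)
    then obtain k l where kl: "r - form \<gamma>1 \<beta> = of_int k" "s - form \<gamma>2 \<beta> = of_int l" by (auto elim!: Ints_cases)
    then have "osc2 C1 A1 C2 A2 k l (single (\<gamma>1 + \<gamma>2 + \<beta>) p) \<noteq> 0" using nz by (auto simp: nop1_def)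
    then have "- d \<le> k" "- d \<le> l" using osc2_eq_0 unfolding d_def by (meson not_le)+
    then have b: "- of_int d \<le> (of_int k :: rat)" "- of_int d \<le> (of_int l :: rat)" by (simp_all flip: of_int_minus)
    have rs: "r = form \<gamma>1 \<beta> + of_int k" "s = form \<gamma>2 \<beta> + of_int l" using kl by simp_all
    have "r \<in> \<int>" using assms unfolding rs int_form_def by (intro Ints_add Ints_of_int) blast
    moreover have "of_nat (CARD('n) + 1) * form \<gamma>2 \<beta> + of_int (int (CARD('n) + 1) * l) \<in> \<int>"
      by (intro Ints_add Ints_of_int form_denominator)
    then have "of_nat (CARD('n) + 1) * s \<in> \<int>" unfolding rs by (simp add: algebra_simps)
    ultimately show "r \<in> \<int> \<and> of_nat (CARD('n) + 1) * s \<in> \<int> \<and> min (form \<gamma>1 \<beta>) (form \<gamma>2 \<beta>) - of_int d \<le> r \<and> min (form \<gamma>1 \<beta>) (form \<gamma>2 \<beta>) - of_int d \<le> s"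
      using b unfolding rs by (auto simp: min_def)
  qed
qed

lemma nop_laurent2:
  assumes "int_form \<gamma>1"
  shows "nop C1 A1 \<gamma>1 C2 A2 \<gamma>2 \<chi> v \<in> laurent2"
proof -
  have "nop C1 A1 \<gamma>1 C2 A2 \<gamma>2 \<chi> v = (\<lambda>r s. \<Sum>\<beta>\<in>keys v. nop1 C1 A1 \<gamma>1 C2 A2 \<gamma>2 \<chi> \<beta> (lookup v \<beta>) r s)"
    by (intro ext) (simp add: nop_def)
  moreover have "(\<lambda>r s. \<Sum>\<beta>\<in>keys v. nop1 C1 A1 \<gamma>1 C2 A2 \<gamma>2 \<chi> \<beta> (lookup v \<beta>) r s) \<in> laurent2"
    by (intro laurent2_sum nop1_laurent2 assms)
  ultimately show ?thesis by simp
qed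

lemma subst_sum_shift0:
  "subst_sum (\<lambda>r s. g (r - of_int i) (s - of_int j)) 0 s = subst_sum g 0 (s - of_int i - of_int j)"
  unfolding subst_sum_def
  by (rule Sum_any.reindex_cong[of "\<lambda>k. k + i"]) (auto simp: fun_eq_iff algebra_simps bij_def inj_def intro!: surjI[of _ "\<lambda>k. k - i"])

lemma nop_diagonal:
  assumes "int_form \<gamma>1"
  shows "subst_sum (nop C1 A1 \<gamma>1 C2 A2 \<gamma>2 \<chi> v) 0 s = vop (\<lambda>k r. C1 k r + C2 k r) (\<lambda>k r. A1 k r + A2 k r) (\<gamma>1 + \<gamma>2) \<chi> v s"
proof -
  let ?C = "\<lambda>k r. C1 k r + C2 k r" and ?A = "\<lambda>k r. A1 k r + A2 k r"
  have 1: "subst_sum (nop1 C1 A1 \<gamma>1 C2 A2 \<gamma>2 \<chi> \<beta> p) 0 s = vop1 ?C ?A (\<gamma>1 + \<gamma>2) \<chi> \<beta> p s" for \<beta> p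
  proof -
    let ?w = "single (\<gamma>1 + \<gamma>2 + \<beta>) p"
    from assms obtain a where a: "form \<gamma>1 \<beta> = of_int a" by (auto simp: int_form_def elim: Ints_cases)
    show ?thesis
    proof (cases "s - form \<gamma>2 \<beta> \<in> \<int>")
      case True
      then obtain l where l: "s - form \<gamma>2 \<beta> = of_int l" by (auto elim: Ints_cases)
      define m where "m = l - a"
      have sm: "s - form (\<gamma>1 + \<gamma>2) \<beta> = of_int m" using l a by (simp add: form_add_left m_def)
      have e: "nop1 C1 A1 \<gamma>1 C2 A2 \<gamma>2 \<chi> \<beta> p (of_int k) (s - of_int k + of_nat 0)
        = vscale (\<chi> \<beta> * of_int (eps (\<gamma>1 + \<gamma>2) \<beta>)) (osc2 C1 A1 C2 A2 (k - a) (m - (k - a)) ?w)" for k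
      proof -
        have "s - of_int k + of_nat 0 - form \<gamma>2 \<beta> = of_int (m - (k - a))" using l by (simp add: m_def)
        moreover have "of_int k - form \<gamma>1 \<beta> = of_int (k - a)" by (simp add: a)
        ultimately show ?thesis unfolding nop1_def by (simp only: Ints_of_int floor_of_int simp_thms if_True)
      qed
      define K where "K = {- vdeg ?w..m + vdeg ?w}"
      have "subst_sum (nop1 C1 A1 \<gamma>1 C2 A2 \<gamma>2 \<chi> \<beta> p) 0 s = (\<Sum>k\<in>(\<lambda>k. k + a) ` K. vscale (\<chi> \<beta> * of_int (eps (\<gamma>1 + \<gamma>2) \<beta>)) (osc2 C1 A1 C2 A2 (k - a) (m - (k - a)) ?w))"
        unfolding subst_sum_def e
      proof (simp only: gbinomial_0 cst_1 V.scale_one, rule Sum_any_superset)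
        fix k assume "k \<notin> (\<lambda>k. k + a) ` K"
        then have "k - a \<notin> K" by (metis diff_add_cancel image_eqI)
        then have "k - a < - vdeg ?w \<or> m - (k - a) < - vdeg ?w" by (auto simp: K_def)
        from osc2_eq_0[OF this] show "vscale (\<chi> \<beta> * of_int (eps (\<gamma>1 + \<gamma>2) \<beta>)) (osc2 C1 A1 C2 A2 (k - a) (m - (k - a)) ?w) = 0" by simp
      qed (simp add: K_def)
      also have "\<dots> = vscale (\<chi> \<beta> * of_int (eps (\<gamma>1 + \<gamma>2) \<beta>)) (\<Sum>k\<in>K. osc2 C1 A1 C2 A2 k (m - k) ?w)"
        by (subst sum.reindex) (auto simp: V.scale_sum_right inj_on_def)
      also have "(\<Sum>k\<in>K. osc2 C1 A1 C2 A2 k (m - k) ?w) = osc ?C ?A m ?w"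
        by (rule osc2_diagonal) (simp_all add: K_def)
      finally show ?thesis unfolding vop1_def sm by (simp only: Ints_of_int floor_of_int if_True)
    next
      case False
      have "s - form (\<gamma>1 + \<gamma>2) \<beta> \<notin> \<int>"
      proof
        assume "s - form (\<gamma>1 + \<gamma>2) \<beta> \<in> \<int>"
        then have "s - form (\<gamma>1 + \<gamma>2) \<beta> + of_int a \<in> \<int>" by (rule Ints_add) simp
        with False a show False by (simp add: form_add_left)
      qed
      moreover have "s - of_int k - form \<gamma>2 \<beta> \<notin> \<int>" for k
      proof
        assume "s - of_int k - form \<gamma>2 \<beta> \<in> \<int>"
        then have "s - of_int k - form \<gamma>2 \<beta> + of_int k \<in> \<int>" by (rule Ints_add) simp
        with False show False by simp
      qed
      ultimately show ?thesis by (simp add: subst_sum_def vop1_def nop1_def)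
    qed
  qed
  have "nop C1 A1 \<gamma>1 C2 A2 \<gamma>2 \<chi> v = (\<lambda>r s. \<Sum>\<beta>\<in>keys v. nop1 C1 A1 \<gamma>1 C2 A2 \<gamma>2 \<chi> \<beta> (lookup v \<beta>) r s)"
    by (intro ext) (simp add: nop_def)
  then show ?thesis by (simp add: subst_sum_sum nop1_laurent2[OF assms] 1 vop_def)
qed

text \<open>The operator product expansion. Besides the contraction of the oscillators, commuting \<open>e\<^sup>\<gamma>\<^sup>2\<close> to the left
  past \<open>z\<^sub>1\<^sup>\<partial>\<close> and \<open>\<chi>1\<close> gives \<open>z\<^sub>1\<^sup>g\<close> and \<open>\<chi>1 \<gamma>2\<close>, and the cocycle gives \<open>eps \<gamma>1 \<gamma>2\<close>.\<close>

lemma vop_vop_pole: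
  assumes pair: "\<And>r. r > 0 \<Longrightarrow> pairing A1 C2 r = c ^ r - c' ^ r"
    and \<chi>1: "\<And>\<beta> \<delta>. \<chi>1 (\<beta> + \<delta>) = \<chi>1 \<beta> * \<chi>1 \<delta>"
    and g: "form \<gamma>1 \<gamma>2 = of_int g"
  shows "vop C1 A1 \<gamma>1 \<chi>1 (vop C2 A2 \<gamma>2 \<chi>2 v s) (r - 1) - vscale c (vop C1 A1 \<gamma>1 \<chi>1 (vop C2 A2 \<gamma>2 \<chi>2 v (s - 1)) r)
    = vscale (of_int (eps \<gamma>1 \<gamma>2) * \<chi>1 \<gamma>2)
       (nop C1 A1 \<gamma>1 C2 A2 \<gamma>2 (\<lambda>\<beta>. \<chi>1 \<beta> * \<chi>2 \<beta>) v (r - of_int (g + 1)) s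
        - vscale c' (nop C1 A1 \<gamma>1 C2 A2 \<gamma>2 (\<lambda>\<beta>. \<chi>1 \<beta> * \<chi>2 \<beta>) v (r - of_int g) (s - 1)))"
    (is "?L v = ?R v")
proof (rule V_linear_eqI[of ?L ?R])
  show "V_linear ?L" by (intro V_linear_diff V_linear_scaled V_linear_comp[OF vop_linear] vop_linear)
  show "V_linear ?R" by (intro V_linear_diff V_linear_scaled nop_linear)
  fix \<beta> and p :: "'a K1"
  let ?w = "single (\<gamma>1 + (\<gamma>2 + \<beta>)) p"
  show "?L (single \<beta> p) = ?R (single \<beta> p)"
  proof (cases "s - form \<gamma>2 \<beta> \<in> \<int> \<and> r - form \<gamma>1 \<beta> \<in> \<int>")
    case True
    then obtain l k where l: "s - form \<gamma>2 \<beta> = of_int l" and k': "r - form \<gamma>1 \<beta> = of_int (k + g)"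
      by (metis Ints_cases diff_add_cancel)
    define K where "K = \<chi>2 \<beta> * of_int (eps \<gamma>2 \<beta>) * (\<chi>1 (\<gamma>2 + \<beta>) * of_int (eps \<gamma>1 (\<gamma>2 + \<beta>)))"
    have K: "K = of_int (eps \<gamma>1 \<gamma>2) * \<chi>1 \<gamma>2 * (\<chi>1 \<beta> * \<chi>2 \<beta> * of_int (eps (\<gamma>1 + \<gamma>2) \<beta>))"
    proof -
      have "(of_int (eps \<gamma>1 (\<gamma>2 + \<beta>)) * of_int (eps \<gamma>2 \<beta>) :: scal) = of_int (eps \<gamma>1 \<gamma>2) * of_int (eps (\<gamma>1 + \<gamma>2) \<beta>)"
        using eps_assoc[of \<gamma>1 \<gamma>2 \<beta>] by (simp flip: of_int_mult)
      then show ?thesis unfolding K_def \<chi>1 by (simp add: mult_ac)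
    qed
    have comp: "vop C1 A1 \<gamma>1 \<chi>1 (vop C2 A2 \<gamma>2 \<chi>2 (single \<beta> p) s') r' = vscale K (osc C1 A1 kk (osc C2 A2 ll ?w))"
      if "s' - form \<gamma>2 \<beta> = of_int ll" "r' - form \<gamma>1 (\<gamma>2 + \<beta>) = of_int kk" for s' r' kk ll
      using that by (simp add: vop_single vop1_def module_hom.scale[OF vop_linear] vop_osc K_def mult.commute)
    have k: "r - form \<gamma>1 (\<gamma>2 + \<beta>) = of_int k" using k' g by (simp add: form_add_right)
    have "?L (single \<beta> p) = vscale K (osc C1 A1 (k - 1) (osc C2 A2 l ?w) - vscale c (osc C1 A1 k (osc C2 A2 (l - 1) ?w)))"
      using comp[of s l "r - 1" "k - 1"] comp[of "s - 1" "l - 1" r k] l k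
      by (simp add: V.scale_right_diff_distrib mult.commute algebra_simps)
    also have "\<dots> = vscale K (osc2 C1 A1 C2 A2 (k - 1) l ?w - vscale c' (osc2 C1 A1 C2 A2 k (l - 1) ?w))"
      by (simp only: osc_osc_pole[OF pair])
    also have "\<dots> = ?R (single \<beta> p)"
    proof -
      have nn: "nop C1 A1 \<gamma>1 C2 A2 \<gamma>2 (\<lambda>\<beta>. \<chi>1 \<beta> * \<chi>2 \<beta>) (single \<beta> p) r' s' = vscale (\<chi>1 \<beta> * \<chi>2 \<beta> * of_int (eps (\<gamma>1 + \<gamma>2) \<beta>)) (osc2 C1 A1 C2 A2 kk ll ?w)"
        if "s' - form \<gamma>2 \<beta> = of_int ll" "r' - form \<gamma>1 \<beta> = of_int kk" for s' r' kk ll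
        using that by (simp add: nop_single nop1_def add.assoc)
      show ?thesis
        using nn[of s l "r - of_int (g + 1)" "k - 1"] nn[of "s - 1" "l - 1" "r - of_int g" k] l k'
        unfolding K by (simp add: V.scale_right_diff_distrib mult_ac algebra_simps)
    qed
    finally show ?thesis .
  next
    case False
    have I: "x - of_int j \<in> \<int> \<longleftrightarrow> x \<in> \<int>" for x :: rat and j
      by (metis Ints_add Ints_diff Ints_of_int diff_add_cancel)
    have I1: "s - 1 - form \<gamma>2 \<beta> \<in> \<int> \<longleftrightarrow> s - form \<gamma>2 \<beta> \<in> \<int>"
      using I[of "s - form \<gamma>2 \<beta>" 1] by (simp add: algebra_simps)
    have I2: "r - of_int j - form \<gamma>1 \<beta> \<in> \<int> \<longleftrightarrow> r - form \<gamma>1 \<beta> \<in> \<int>" for j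
      using I[of "r - form \<gamma>1 \<beta>" j] by (simp add: algebra_simps)
    have I3: "r - of_int j - form \<gamma>1 (\<gamma>2 + \<beta>) \<in> \<int> \<longleftrightarrow> r - form \<gamma>1 \<beta> \<in> \<int>" for j
      using I[of "r - form \<gamma>1 \<beta>" "j + g"] by (simp add: form_add_right g algebra_simps)
    have "vop C1 A1 \<gamma>1 \<chi>1 (vop C2 A2 \<gamma>2 \<chi>2 (single \<beta> p) s) (r - 1) = 0"
      using False I3[of 1] by (auto simp: vop_single vop1_def module_hom.scale[OF vop_linear] module_hom.zero[OF vop_linear] vop_osc)
    moreover have "vop C1 A1 \<gamma>1 \<chi>1 (vop C2 A2 \<gamma>2 \<chi>2 (single \<beta> p) (s - 1)) r = 0"
      using False I3[of 0] I1 by (auto simp: vop_single vop1_def module_hom.scale[OF vop_linear] module_hom.zero[OF vop_linear] vop_osc)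
    moreover have "nop C1 A1 \<gamma>1 C2 A2 \<gamma>2 (\<lambda>\<beta>. \<chi>1 \<beta> * \<chi>2 \<beta>) (single \<beta> p) (r - of_int (g + 1)) s = 0"
      "nop C1 A1 \<gamma>1 C2 A2 \<gamma>2 (\<lambda>\<beta>. \<chi>1 \<beta> * \<chi>2 \<beta>) (single \<beta> p) (r - of_int g) (s - 1) = 0"
      using False I2[of "g + 1"] I2[of g] I1 by (auto simp: nop_single nop1_def)
    ultimately show ?thesis by simp
  qed
qed

text \<open>For \<open>c = 1\<close> the zeroth product is the residue at \<open>z\<^sub>1 = z\<^sub>2\<close> of the expansion above.\<close>

theorem
  assumes pair: "\<And>r. r > 0 \<Longrightarrow> pairing A1 C2 r = c ^ r - c' ^ r"
    and \<chi>1: "\<And>\<beta> \<delta>. \<chi>1 (\<beta> + \<delta>) = \<chi>1 \<beta> * \<chi>1 \<delta>"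
    and \<gamma>1: "int_form \<gamma>1" and g: "form \<gamma>1 \<gamma>2 = of_int g"
  shows qc_poly_vop_vop: "qc_poly (pole_poly c) (vop C1 A1 \<gamma>1 \<chi>1) (vop C2 A2 \<gamma>2 \<chi>2)"
    and nth_prod_vop_vop: "nth_prod (vop C1 A1 \<gamma>1 \<chi>1) 0 (vop C2 A2 \<gamma>2 \<chi>2) v s
      = (if c = 1 then vscale (of_int (eps \<gamma>1 \<gamma>2) * \<chi>1 \<gamma>2 * (1 - c'))
          (vop (\<lambda>k r. C1 k r + C2 k r) (\<lambda>k r. A1 k r + A2 k r) (\<gamma>1 + \<gamma>2) (\<lambda>\<beta>. \<chi>1 \<beta> * \<chi>2 \<beta>) v (s - of_int (g + 1)))
         else 0)"
proof -
  let ?n = "nop C1 A1 \<gamma>1 C2 A2 \<gamma>2 (\<lambda>\<beta>. \<chi>1 \<beta> * \<chi>2 \<beta>)"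
  let ?K = "of_int (eps \<gamma>1 \<gamma>2) * \<chi>1 \<gamma>2"
  have pp: "poly_prod (pole_poly c) (vop C1 A1 \<gamma>1 \<chi>1) (vop C2 A2 \<gamma>2 \<chi>2) v
    = (\<lambda>r s. vscale ?K (?n v (r - of_int (g + 1)) (s - of_int 0)) + vscale (- ?K * c') (?n v (r - of_int g) (s - of_int 1)))" for v
    unfolding poly_prod_pmul
    by (intro ext, subst pmul_pole_poly, subst vop_vop_pole[OF pair \<chi>1 g]) (simp_all add: V.scale_right_diff_distrib)
  note sh = laurent2_shift[OF nop_laurent2[OF \<gamma>1]]
  show qc: "qc_poly (pole_poly c) (vop C1 A1 \<gamma>1 \<chi>1) (vop C2 A2 \<gamma>2 \<chi>2)"
    unfolding qc_poly_def pp by (intro conjI allI laurent2_add laurent2_scale sh) (simp add: pole_poly_def)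
  have "subst_sum (poly_prod (pole_poly c) (vop C1 A1 \<gamma>1 \<chi>1) (vop C2 A2 \<gamma>2 \<chi>2) v) 0 s
     = vscale (?K * (1 - c')) (vop (\<lambda>k r. C1 k r + C2 k r) (\<lambda>k r. A1 k r + A2 k r) (\<gamma>1 + \<gamma>2) (\<lambda>\<beta>. \<chi>1 \<beta> * \<chi>2 \<beta>) v (s - of_int (g + 1)))"
    unfolding pp subst_sum_add[OF laurent2_scale[OF sh] laurent2_scale[OF sh]] subst_sum_scale[OF sh] subst_sum_shift0 nop_diagonal[OF \<gamma>1]
    by (simp add: algebra_simps)
  then show "nth_prod (vop C1 A1 \<gamma>1 \<chi>1) 0 (vop C2 A2 \<gamma>2 \<chi>2) v s
      = (if c = 1 then vscale (?K * (1 - c'))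
          (vop (\<lambda>k r. C1 k r + C2 k r) (\<lambda>k r. A1 k r + A2 k r) (\<gamma>1 + \<gamma>2) (\<lambda>\<beta>. \<chi>1 \<beta> * \<chi>2 \<beta>) v (s - of_int (g + 1)))
         else 0)"
    unfolding nth_prod_pole[OF qc] by (simp only:)
qed

subsection \<open>Weights\<close>

lemma osc_vacuum: "osc C A 0 (single \<gamma> 1) = single \<gamma> 1"
proof -
  have "Kdeg 0 (1 :: 'a K1)" by (simp add: Kdeg_def wdeg_def flip: single_one)
  then have "Vdeg 0 (single \<gamma> (1 :: 'a K1))" by (simp add: Vdeg_def lookup_single when_def)
  from osc_eq[OF this order_refl order_refl] show ?thesis by simp
qed

lemma eps_nonzero [simp]: "eps \<gamma> \<beta> \<noteq> 0"
  by (simp add: eps_def)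

text \<open>The image of the vacuum has a nonzero component, so a vertex operator has only one weight.\<close>

lemma vop_vacuum: "lookup (lookup (vop C A \<gamma> \<chi> (single 0 1) 0) \<gamma>) 0 = \<chi> 0 * of_int (eps \<gamma> 0)"
  unfolding vop_single vop1_def by (simp add: osc_vacuum vscale_single kconst_def del: single_one)

lemma vop_nonzero:
  assumes "\<chi> 0 \<noteq> 0"
  shows "vop C A \<gamma> \<chi> \<noteq> 0"
proof
  assume "vop C A \<gamma> \<chi> = 0"
  with vop_vacuum[of C A \<gamma> \<chi>] assms show False by simp
qed

lemma wt_vop:
  assumes "\<chi> 0 \<noteq> 0"
  shows "wt (vop C A \<gamma> \<chi>) = \<gamma>"
  unfolding wt_def
proof (rule the_equality)
  show "has_wt (vop C A \<gamma> \<chi>) \<gamma>"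
    unfolding has_wt_def vop_single by (subst vop1_weight) simp
next
  fix \<alpha> assume "has_wt (vop C A \<gamma> \<chi>) \<alpha>"
  then have "keys (vop C A \<gamma> \<chi> (single 0 1) 0) \<subseteq> {\<alpha> + 0}" unfolding has_wt_def by blast
  moreover have "lookup (vop C A \<gamma> \<chi> (single 0 1) 0) \<gamma> \<noteq> 0"
    using vop_vacuum[of C A \<gamma> \<chi>] assms by auto
  ultimately show "\<alpha> = \<gamma>" by (auto simp: in_keys_iff)
qed

lemma wt_part_vop: "wt_part (vop C A \<gamma> \<chi>) \<beta> = (if \<beta> = \<gamma> then vop C A \<gamma> \<chi> else 0)"
proof (intro ext)
  fix v s
  have L: "lookup (vop1 C A \<gamma> \<chi> \<delta> p s) (\<beta> + \<delta>) = (if \<beta> = \<gamma> then lookup (vop1 C A \<gamma> \<chi> \<delta> p s) (\<gamma> + \<delta>) else 0)" for \<delta> p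
    by (subst vop1_weight) (simp add: lookup_single when_def)
  have "wt_part (vop C A \<gamma> \<chi>) \<beta> v s = (\<Sum>\<delta>\<in>keys v. if \<beta> = \<gamma> then vop1 C A \<gamma> \<chi> \<delta> (lookup v \<delta>) s else 0)"
    unfolding wt_part_def vop_single
    by (intro sum.cong refl) (simp add: L flip: vop1_weight)
  then show "wt_part (vop C A \<gamma> \<chi>) \<beta> v s = (if \<beta> = \<gamma> then vop C A \<gamma> \<chi> else 0) v s"
    by (simp add: vop_def)
qed

lemma wt_part_add: "wt_part (b1 + b2) \<beta> = wt_part b1 \<beta> + wt_part b2 \<beta>"
  by (intro ext) (simp add: wt_part_def lookup_add single_add sum.distrib)

lemma wt_part_oscale: "wt_part (oscale c b) \<beta> = oscale c (wt_part b \<beta>)"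
  by (intro ext) (simp add: wt_part_def oscale_def lookup_vscale V.scale_sum_right vscale_single)

section \<open>The bullet product\<close>

interpretation O: vector_space oscale
  using module_oscale by (simp add: module_iff_vector_space)

lemma Sum_any_hom:
  assumes "finite {x. f x \<noteq> 0}" "h 0 = 0" "\<And>x y. h (x + y) = h x + h y"
  shows "h (Sum_any f) = Sum_any (\<lambda>x. h (f x))"
proof -
  have hs: "h (sum f A) = (\<Sum>x\<in>A. h (f x))" if "finite A" for A
    using that by (induction A rule: finite_induct) (simp_all add: assms)
  have "Sum_any (\<lambda>x. h (f x)) = (\<Sum>x\<in>{x. f x \<noteq> 0}. h (f x))"
    using assms(1,2) by (intro Sum_any_superset) auto
  then show ?thesis by (simp add: Sum_any.expand_set hs[OF assms(1)])
qed

text \<open>Conditions under which the product is linear in its second argument. The clearing polynomials \<open>P\<close> may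
  depend on the weight, since the product is defined by weight components, but not on \<open>b\<close>; so they serve for
  sums of such operators as well.\<close>

definition bulletable :: "('n::{finite,linorder} wgt \<Rightarrow> int \<Rightarrow> scal poly poly) \<Rightarrow> 'n oper \<Rightarrow> 'n oper \<Rightarrow> bool" where
  "bulletable P a b \<longleftrightarrow> finite {\<beta>. wt_part b \<beta> \<noteq> 0} \<and>
     (\<forall>\<beta> h. qc_poly (P \<beta> h) (scale_arg h a) (wt_part b \<beta>)) \<and>
     (\<forall>\<beta>. finite {h. nth_prod (scale_arg h a) 0 (wt_part b \<beta>) \<noteq> 0})"

lemma scale_arg_linear:
  assumes "\<And>s. V_linear (\<lambda>v. a v s)"
  shows "V_linear (\<lambda>v. scale_arg h a v s)"
  unfolding scale_arg_def by (intro V_linear_scaled assms)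

lemma bullet_term_nth_prod:
  "bullet_term m a b h = (\<lambda>v s. vscale ((1 / qh powi h) powi (m + 1) * qh powi h) (nth_prod (scale_arg h a) 0 b v (s + of_int (m + 1))))"
  by (simp add: bullet_term_def)

lemma
  assumes lin: "\<And>s. V_linear (\<lambda>v. a v s)" and 1: "bulletable P a b1" and 2: "bulletable P a b2"
  shows bulletable_add: "bulletable P a (b1 + b2)" and bullet_add: "a \<^sub>\<bullet> (b1 + b2) = (a \<^sub>\<bullet> b1) + (a \<^sub>\<bullet> b2)"
proof -
  let ?N = "\<lambda>b \<beta> h. nth_prod (scale_arg h a) 0 (wt_part b \<beta>)"
  let ?T = "\<lambda>b \<beta> h. bullet_term \<lfloor>form (wt a) \<beta>\<rfloor> a (wt_part b \<beta>) h"
  have qc: "qc_poly (P \<beta> h) (scale_arg h a) (wt_part b1 \<beta>)" "qc_poly (P \<beta> h) (scale_arg h a) (wt_part b2 \<beta>)" for \<beta> h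
    using 1 2 by (auto simp: bulletable_def)
  have N: "?N (b1 + b2) \<beta> h = ?N b1 \<beta> h + ?N b2 \<beta> h" for \<beta> h
    unfolding wt_part_add by (rule nth_prod_add(2)[OF scale_arg_linear[OF lin] qc])
  have fin: "finite {\<beta>. wt_part b1 \<beta> \<noteq> 0}" "finite {\<beta>. wt_part b2 \<beta> \<noteq> 0}"
    "finite {h. ?N b1 \<beta> h \<noteq> 0}" "finite {h. ?N b2 \<beta> h \<noteq> 0}" for \<beta> using 1 2 by (auto simp: bulletable_def)
  have T: "?T (b1 + b2) \<beta> h = ?T b1 \<beta> h + ?T b2 \<beta> h" for \<beta> h
    unfolding bullet_term_nth_prod N by (intro ext) (simp add: V.scale_right_distrib)
  have T0: "?T b \<beta> h = 0" if "?N b \<beta> h = 0" for b \<beta> h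
    unfolding bullet_term_nth_prod that by (intro ext) simp
  have fT: "finite {h. ?T b1 \<beta> h \<noteq> 0}" "finite {h. ?T b2 \<beta> h \<noteq> 0}" for \<beta>
    by (rule finite_subset[OF _ fin(3)[of \<beta>]], use T0 in blast) (rule finite_subset[OF _ fin(4)[of \<beta>]], use T0 in blast)
  have N0: "?N b \<beta> h = 0" if "qc_poly (P \<beta> h) (scale_arg h a) (wt_part b \<beta>)" "wt_part b \<beta> = 0" for b \<beta> h
    using nth_prod_scale(2)[OF scale_arg_linear[OF lin] that(1), where c = 0 and r = 0] that(2) by simp
  have fS: "finite {\<beta>. Sum_any (?T b1 \<beta>) \<noteq> 0}" "finite {\<beta>. Sum_any (?T b2 \<beta>) \<noteq> 0}"
  proof -
    have "Sum_any (?T b1 \<beta>) = 0" if "wt_part b1 \<beta> = 0" for \<beta>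
      using T0[OF N0[OF qc(1) that]] by simp
    moreover have "Sum_any (?T b2 \<beta>) = 0" if "wt_part b2 \<beta> = 0" for \<beta>
      using T0[OF N0[OF qc(2) that]] by simp
    ultimately have "{\<beta>. Sum_any (?T b1 \<beta>) \<noteq> 0} \<subseteq> {\<beta>. wt_part b1 \<beta> \<noteq> 0}" "{\<beta>. Sum_any (?T b2 \<beta>) \<noteq> 0} \<subseteq> {\<beta>. wt_part b2 \<beta> \<noteq> 0}"
      by blast+
    then show "finite {\<beta>. Sum_any (?T b1 \<beta>) \<noteq> 0}" "finite {\<beta>. Sum_any (?T b2 \<beta>) \<noteq> 0}"
      using fin(1,2) finite_subset by blast+
  qed
  show "a \<^sub>\<bullet> (b1 + b2) = (a \<^sub>\<bullet> b1) + (a \<^sub>\<bullet> b2)"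
    unfolding bullet_def T Sum_any.distrib[OF fT] Sum_any.distrib[OF fS] ..
  show "bulletable P a (b1 + b2)"
    unfolding bulletable_def
  proof (intro conjI allI)
    have "{\<beta>. wt_part (b1 + b2) \<beta> \<noteq> 0} \<subseteq> {\<beta>. wt_part b1 \<beta> \<noteq> 0} \<union> {\<beta>. wt_part b2 \<beta> \<noteq> 0}"
      by (auto simp: wt_part_add)
    then show "finite {\<beta>. wt_part (b1 + b2) \<beta> \<noteq> 0}" using fin(1,2) finite_subset by blast
    show "qc_poly (P \<beta> h) (scale_arg h a) (wt_part (b1 + b2) \<beta>)" for \<beta> h
      unfolding wt_part_add by (rule nth_prod_add(1)[OF scale_arg_linear[OF lin] qc])
    have "{h. ?N (b1 + b2) \<beta> h \<noteq> 0} \<subseteq> {h. ?N b1 \<beta> h \<noteq> 0} \<union> {h. ?N b2 \<beta> h \<noteq> 0}" for \<beta> by (auto simp: N)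
    then show "finite {h. ?N (b1 + b2) \<beta> h \<noteq> 0}" for \<beta> using fin(3,4)[of \<beta>] finite_subset by blast
  qed
qed

lemma
  assumes lin: "\<And>s. V_linear (\<lambda>v. a v s)" and 1: "bulletable P a b"
  shows bulletable_scale: "bulletable P a (oscale c b)" and bullet_scale: "a \<^sub>\<bullet> oscale c b = oscale c (a \<^sub>\<bullet> b)"
proof -
  let ?N = "\<lambda>b \<beta> h. nth_prod (scale_arg h a) 0 (wt_part b \<beta>)"
  let ?T = "\<lambda>b \<beta> h. bullet_term \<lfloor>form (wt a) \<beta>\<rfloor> a (wt_part b \<beta>) h"
  have qc: "qc_poly (P \<beta> h) (scale_arg h a) (wt_part b \<beta>)" for \<beta> h
    using 1 by (auto simp: bulletable_def)
  have N: "?N (oscale c b) \<beta> h = oscale c (?N b \<beta> h)" for \<beta> h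
    unfolding wt_part_oscale by (rule nth_prod_scale(2)[OF scale_arg_linear[OF lin] qc])
  have fin: "finite {\<beta>. wt_part b \<beta> \<noteq> 0}" "finite {h. ?N b \<beta> h \<noteq> 0}" for \<beta> using 1 by (auto simp: bulletable_def)
  have T: "?T (oscale c b) \<beta> h = oscale c (?T b \<beta> h)" for \<beta> h
    unfolding bullet_term_nth_prod N by (intro ext) (simp add: oscale_def mult.commute)
  have T0: "?T b \<beta> h = 0" if "?N b \<beta> h = 0" for \<beta> h
    unfolding bullet_term_nth_prod that by (intro ext) simp
  have fT: "finite {h. ?T b \<beta> h \<noteq> 0}" for \<beta>
    by (rule finite_subset[OF _ fin(2)[of \<beta>]], use T0 in blast)
  have fS: "finite {\<beta>. Sum_any (?T b \<beta>) \<noteq> 0}"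
  proof -
    have "Sum_any (?T b \<beta>) = 0" if "wt_part b \<beta> = 0" for \<beta>
    proof -
      have "?N b \<beta> h = 0" for h
        using nth_prod_scale(2)[OF scale_arg_linear[OF lin] qc[of \<beta> h], where c = 0 and r = 0] that by simp
      from T0[OF this] show ?thesis by simp
    qed
    then have "{\<beta>. Sum_any (?T b \<beta>) \<noteq> 0} \<subseteq> {\<beta>. wt_part b \<beta> \<noteq> 0}" by blast
    then show ?thesis using fin(1) finite_subset by blast
  qed
  show "a \<^sub>\<bullet> oscale c b = oscale c (a \<^sub>\<bullet> b)"
    unfolding bullet_def T
    by (simp add: Sum_any_hom[OF fT, of "oscale c"] Sum_any_hom[OF fS, of "oscale c"] O.scale_right_distrib)
  show "bulletable P a (oscale c b)"
    unfolding bulletable_def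
  proof (intro conjI allI)
    show "finite {\<beta>. wt_part (oscale c b) \<beta> \<noteq> 0}"
      by (rule finite_subset[OF _ fin(1)]) (auto simp: wt_part_oscale)
    show "qc_poly (P \<beta> h) (scale_arg h a) (wt_part (oscale c b) \<beta>)" for \<beta> h
      unfolding wt_part_oscale by (rule nth_prod_scale(1)[OF scale_arg_linear[OF lin] qc])
    show "finite {h. ?N (oscale c b) \<beta> h \<noteq> 0}" for \<beta>
      by (rule finite_subset[OF _ fin(2)[of \<beta>]]) (auto simp: N)
  qed
qed

lemma pairing_scaled:
  assumes "pairing A C r = c ^ r - c' ^ r"
  shows "pairing (\<lambda>k r. A k r / Q h ^ r) C r = (c / Q h) ^ r - (c' / Q h) ^ r"
proof -
  have "pairing (\<lambda>k r. A k r / Q h ^ r) C r = pairing A C r / Q h ^ r"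
    by (simp add: pairing_def sum_divide_distrib flip: times_divide_eq_left)
  then show ?thesis by (simp add: assms power_divide diff_divide_distrib)
qed

text \<open>The product of two vertex operators with contraction \<open>(z\<^sub>1 - c' z\<^sub>2) / (z\<^sub>1 - c z\<^sub>2)\<close>.\<close>

locale vop_pair =
  fixes C1 A1 :: "'n::{finite,linorder} \<Rightarrow> nat \<Rightarrow> scal" and \<gamma>1 :: "'n wgt" and \<chi>1 :: "'n wgt \<Rightarrow> scal"
    and C2 A2 :: "'n \<Rightarrow> nat \<Rightarrow> scal" and \<gamma>2 :: "'n wgt" and \<chi>2 :: "'n wgt \<Rightarrow> scal" and c c' :: scal
  assumes pair: "\<And>r. r > 0 \<Longrightarrow> pairing A1 C2 r = c ^ r - c' ^ r"
    and \<chi>1: "\<And>\<beta> \<delta>. \<chi>1 (\<beta> + \<delta>) = \<chi>1 \<beta> * \<chi>1 \<delta>" and \<chi>1_0: "\<chi>1 0 \<noteq> 0"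
    and \<gamma>1: "int_form \<gamma>1"
begin

text \<open>The exponents of \<open>z\<^sub>1\<close> in the product are shifted by this integer.\<close>

definition g where "g = \<lfloor>form \<gamma>1 \<gamma>2\<rfloor>"

abbreviation "a \<equiv> vop C1 A1 \<gamma>1 \<chi>1"
abbreviation "b \<equiv> vop C2 A2 \<gamma>2 \<chi>2"

text \<open>The normally ordered product at \<open>z\<^sub>1 = q\<^sup>h\<^sup>/\<^sup>2 z\<close>.\<close>

definition fused :: "int \<Rightarrow> 'n oper" where
  "fused h = vop (\<lambda>k r. Q h ^ r * C1 k r + C2 k r) (\<lambda>k r. A1 k r / Q h ^ r + A2 k r) (\<gamma>1 + \<gamma>2)
     (\<lambda>\<beta>. \<chi>1 \<beta> * Q (h * \<lfloor>form \<gamma>1 \<beta>\<rfloor>) * \<chi>2 \<beta>)"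

lemma form_int: "form \<gamma>1 \<beta> = of_int \<lfloor>form \<gamma>1 \<beta>\<rfloor>"
  using \<gamma>1 by (auto simp: int_form_def elim: Ints_cases)

lemma form_g: "form \<gamma>1 \<gamma>2 = of_int g"
  unfolding g_def by (rule form_int)

lemma
  shows qc_poly_scaled: "qc_poly (pole_poly (c / Q h)) (scale_arg h a) b"
    and nth_prod_scaled: "nth_prod (scale_arg h a) 0 b v s = (if c = Q h
      then vscale (of_int (eps \<gamma>1 \<gamma>2) * \<chi>1 \<gamma>2 * (1 - c' / c) * Q (h * g)) (fused h v (s - of_int (g + 1))) else 0)"
proof -
  let ?\<chi> = "\<lambda>\<beta>. \<chi>1 \<beta> * Q (h * \<lfloor>form \<gamma>1 \<beta>\<rfloor>)"
  have m: "?\<chi> (\<beta> + \<delta>) = ?\<chi> \<beta> * ?\<chi> \<delta>" for \<beta> \<delta>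
  proof -
    have "\<lfloor>form \<gamma>1 (\<beta> + \<delta>)\<rfloor> = \<lfloor>form \<gamma>1 \<beta>\<rfloor> + \<lfloor>form \<gamma>1 \<delta>\<rfloor>"
      unfolding form_add_right by (subst form_int) simp
    then show ?thesis by (simp add: \<chi>1 distrib_left Q_add)
  qed
  note pair' = pairing_scaled[OF pair]
  show "qc_poly (pole_poly (c / Q h)) (scale_arg h a) b"
    unfolding scale_arg_vop[OF \<gamma>1] by (rule qc_poly_vop_vop[OF pair' m \<gamma>1 form_g])
  show "nth_prod (scale_arg h a) 0 b v s = (if c = Q h
      then vscale (of_int (eps \<gamma>1 \<gamma>2) * \<chi>1 \<gamma>2 * (1 - c' / c) * Q (h * g)) (fused h v (s - of_int (g + 1))) else 0)"
  proof -
    have "c / Q h = 1 \<longleftrightarrow> c = Q h" by auto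
    then show ?thesis
      unfolding scale_arg_vop[OF \<gamma>1] fused_def
      by (subst nth_prod_vop_vop[where ?\<chi>1.0 = ?\<chi>, OF pair' m \<gamma>1 form_g]) (simp_all add: g_def)
  qed
qed

text \<open>Scaling the argument by \<open>q\<^sup>h\<^sup>/\<^sup>2\<close> moves the pole to \<open>z\<^sub>1 = c q\<^sup>-\<^sup>h\<^sup>/\<^sup>2 z\<close>, so only \<open>q\<^sup>h\<^sup>/\<^sup>2 = c\<close> contributes. The powers
  of \<open>z\<close> and \<open>q\<close> in the definition of the product cancel those of the residue.\<close>

lemma bullet_term_eq:
  "bullet_term g a b h = (if c = Q h then oscale (of_int (eps \<gamma>1 \<gamma>2) * \<chi>1 \<gamma>2 * (1 - c' / c)) (fused h) else 0)"
proof (intro ext)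
  fix v s
  let ?E = "of_int (eps \<gamma>1 \<gamma>2) * \<chi>1 \<gamma>2 * (1 - c' / c)" and ?X = "(1 / qh powi h) powi (g + 1) * qh powi h"
  have "(1 / qh powi h) powi (g + 1) = Q (- (h * (g + 1)))"
    by (simp only: Q_def power_int_minus power_int_mult inverse_eq_divide[symmetric] power_int_inverse)
  then have X: "?X * Q (h * g) = 1" by (simp add: Q_def[symmetric] Q_add[symmetric] algebra_simps)
  show "bullet_term g a b h v s = (if c = Q h then oscale ?E (fused h) else 0) v s"
  proof (cases "c = Q h")
    case True
    have "bullet_term g a b h v s = vscale ?X (vscale (?E * Q (h * g)) (fused h v (s + of_int (g + 1) - of_int (g + 1))))"
      unfolding bullet_term_def nth_prod_scaled if_P[OF True] ..
    also have "\<dots> = vscale (?E * (?X * Q (h * g))) (fused h v s)"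
      unfolding V.scale_scale add_diff_cancel_right' by (simp only: mult_ac)
    finally show ?thesis unfolding X if_P[OF True] oscale_def by (simp only: mult_1_right)
  qed (simp add: bullet_term_def nth_prod_scaled)
qed

lemma bullet_eq_Sum_any: "a \<^sub>\<bullet> b = Sum_any (bullet_term g a b)"
proof -
  have z: "bullet_term m a 0 h = 0" for m h
  proof -
    have "nth_prod (scale_arg h a) 0 (oscale 0 b) = oscale 0 (nth_prod (scale_arg h a) 0 b)"
      by (rule nth_prod_scale(2)[OF scale_arg_linear[OF vop_linear] qc_poly_scaled])
    then show ?thesis by (intro ext) (simp add: bullet_term_def)
  qed
  have "a \<^sub>\<bullet> b = Sum_any (\<lambda>\<beta>. if \<beta> = \<gamma>2 then Sum_any (bullet_term g a b) else 0)"
    unfolding bullet_def wt_vop[where \<chi> = \<chi>1, OF \<chi>1_0] wt_part_vop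
    by (rule arg_cong[where f = Sum_any]) (auto simp: g_def z)
  then show ?thesis by simp
qed

theorem bullet_pole:
  assumes "c = Q h"
  shows "a \<^sub>\<bullet> b = oscale (of_int (eps \<gamma>1 \<gamma>2) * \<chi>1 \<gamma>2 * (1 - c' / c)) (fused h)"
proof -
  have "Q h = Q h' \<longleftrightarrow> h' = h" for h' by auto
  then show ?thesis
    unfolding bullet_eq_Sum_any bullet_term_eq[abs_def] assms by simp
qed

theorem bullet_no_pole: "c = 0 \<Longrightarrow> a \<^sub>\<bullet> b = 0"
  unfolding bullet_eq_Sum_any bullet_term_eq[abs_def] using Q_nonzero by (auto simp: eq_commute[of 0])

lemma bulletable_vop:
  assumes "\<And>h. P \<gamma>2 h = pole_poly (c / Q h)" and nz: "\<And>\<beta> h. P \<beta> h \<noteq> 0"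
  shows "bulletable P a b"
  unfolding bulletable_def
proof (intro conjI allI)
  show "finite {\<beta>. wt_part b \<beta> \<noteq> 0}" by (rule finite_subset[of _ "{\<gamma>2}"]) (auto simp: wt_part_vop)
  have 0: "qc_poly p (scale_arg h a) 0" if "p \<noteq> 0" for p h
  proof -
    have "poly_prod p (scale_arg h a) 0 v = (\<lambda>r s. 0)" for v
      by (intro ext) (simp add: poly_prod_def module_hom.zero[OF scale_arg_linear[OF vop_linear]])
    then show ?thesis using that by (simp add: qc_poly_def laurent2_0)
  qed
  show "qc_poly (P \<beta> h) (scale_arg h a) (wt_part b \<beta>)" for \<beta> h
    using assms qc_poly_scaled 0 by (auto simp: wt_part_vop)
  show "finite {h. nth_prod (scale_arg h a) 0 (wt_part b \<beta>) \<noteq> 0}" for \<beta>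
  proof (cases "\<beta> = \<gamma>2")
    case True
    have "{h. nth_prod (scale_arg h a) 0 b \<noteq> 0} \<subseteq> {h. c = Q h}"
      by (auto simp: fun_eq_iff nth_prod_scaled split: if_splits)
    moreover have "finite {h. c = Q h}"
      by (cases "\<exists>h. c = Q h") auto
    ultimately show ?thesis using True by (simp add: wt_part_vop finite_subset)
  next
    case False
    have "nth_prod (scale_arg h a) 0 (oscale 0 b) = oscale 0 (nth_prod (scale_arg h a) 0 b)" for h
      by (rule nth_prod_scale(2)[OF scale_arg_linear[OF vop_linear] qc_poly_scaled])
    with False show ?thesis by (simp add: wt_part_vop)
  qed
qed

end

section \<open>The generating operators as vertex operators\<close>

lemma qh_powi: "qh powi e = Q e" by (simp add: Q_def)

lemma qq_diff: "qq - qq powi (- 1) = Q 2 - Q (- 2)"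
proof -
  have "qq powi (- 1) = Q (- 2)" using qq_powi[of "- 1"] by simp
  then show ?thesis by (simp only: qq_Q)
qed

lemma V_linear_emul: "V_linear (emul \<gamma>)"
  unfolding emul_def
  by (rule V_linear_wext) (simp_all add: distrib_left single_add vscale_single mult.left_commute)

lemma kconst_of_int: "kconst (of_int e) = of_int e"
  by (simp add: kconst_def)

lemma emul_single: "emul \<gamma> (single \<beta> p) = vscale (of_int (eps \<gamma> \<beta>)) (single (\<gamma> + \<beta>) p)"
  by (simp add: emul_def vscale_single kconst_of_int)

lemma V_linear_sgn_del: "V_linear (sgn_del m \<gamma>)"
  unfolding sgn_del_def
  by (rule V_linear_wext) (simp_all add: distrib_left single_add vscale_single mult.left_commute)

lemma V_linear_K_op: "V_linear (K_op s j)"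
  unfolding K_op_def
  by (rule V_linear_wext) (simp_all add: distrib_left single_add vscale_single mult.left_commute)

lemma K_op_single: "K_op s j (single \<beta> p) = vscale (Q (2 * (s * \<beta> j))) (single \<beta> p)"
  by (simp add: K_op_def vscale_single qq_powi)

lemma sgn_del_single: "sgn_del m \<gamma> (single \<beta> p) = vscale (cst (exp (\<i> * of_real pi * of_rat (of_int m * form \<gamma> \<beta>)))) (single \<beta> p)"
  by (simp add: sgn_del_def vscale_single)

lemma Nats_iff: "s \<in> \<nat> \<longleftrightarrow> s \<in> \<int> \<and> 0 \<le> (s :: rat)"
proof
  assume "s \<in> \<nat>"
  then obtain n where "s = of_nat n" by (rule Nats_cases)
  then show "s \<in> \<int> \<and> 0 \<le> s" by simp
next
  assume "s \<in> \<int> \<and> 0 \<le> s"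
  then obtain k where "s = of_int k" "0 \<le> k" by (auto elim: Ints_cases)
  then have "s = of_nat (nat k)" by simp
  then show "s \<in> \<nat>" by simp
qed

context
  fixes cc :: "nat \<Rightarrow> scal" and a :: "int \<Rightarrow> 'n::{finite,linorder} V \<Rightarrow> 'n V"
  assumes lin: "\<And>l. V_linear (a l)"
begin

lemma exp_cre_ce:
  assumes C: "\<And>r v. r > 0 \<Longrightarrow> vscale (cc r) (a (- int r) v) = cre C r v"
  shows "exp_cre cc a v s = (if s \<in> \<int> then ce C \<lfloor>s\<rfloor> v else 0)"
proof -
  let ?h = "\<lambda>r w. vscale (cc r) (a (- int r) w)"
  have co: "comm_ops ?h"
    by (intro comm_ops.intro V_linear_scaled lin) (simp add: C cre_commute)
  have i: "iexp ?h m w = ce C m w" for m w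
    by (rule cre.iexp_cong[OF co C])
  have *: "opexp ?h (nat m) w = ce C m w" if "0 \<le> m" for m w
    using i[of m w] that unfolding iexp_def[of ?h] by simp
  show ?thesis
  proof (cases "s \<in> \<int>")
    case True
    then obtain k where k: "s = of_int k" by (auto elim: Ints_cases)
    show ?thesis unfolding exp_cre_def Nats_iff k using *[of k v] by (cases "k < 0") simp_all
  qed (simp add: exp_cre_def Nats_iff)
qed

lemma exp_ann_an:
  assumes A: "\<And>r v. r > 0 \<Longrightarrow> vscale (cc r) (a (int r) v) = ann A r v"
  shows "exp_ann cc a v s = (if s \<in> \<int> then an A (- \<lfloor>s\<rfloor>) v else 0)"
proof -
  let ?h = "\<lambda>r w. vscale (cc r) (a (int r) w)"
  have co: "comm_ops ?h"
    by (intro comm_ops.intro V_linear_scaled lin) (simp add: A ann_commute)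
  have i: "iexp ?h m w = an A m w" for m w
    by (rule ann.iexp_cong[OF co A])
  have *: "opexp ?h (nat m) w = an A m w" if "0 \<le> m" for m w
    using i[of m w] that unfolding iexp_def[of ?h] by simp
  show ?thesis
  proof (cases "s \<in> \<int>")
    case True
    then obtain k where k: "s = of_int k" by (auto elim: Ints_cases)
    have ks: "- (of_int k :: rat) = of_int (- k)" by simp
    have "of_int (- k) \<in> (\<nat> :: rat set) \<longleftrightarrow> k \<le> 0"
      unfolding Nats_iff by (simp only: Ints_of_int of_int_0_le_iff) simp
    then show ?thesis unfolding exp_ann_def k ks floor_of_int using *[of "- k" v]
      by (cases "k \<le> 0") (simp_all only: if_True if_False Ints_of_int neg_0_le_iff_le, simp)
  next
    case False
    then have "- s \<notin> \<nat>" unfolding Nats_iff using Ints_minus[of "- s"] by auto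
    with False show ?thesis by (simp add: exp_ann_def)
  qed
qed

end

lemma Sum_any_sum:
  assumes "finite F" "\<And>x. x \<in> F \<Longrightarrow> finite {r. f x r \<noteq> 0}"
  shows "Sum_any (\<lambda>r. \<Sum>x\<in>F. f x r) = (\<Sum>x\<in>F. Sum_any (f x))"
  using assms
proof (induction F rule: finite_induct)
  case (insert x F)
  have "{r. (\<Sum>x\<in>F. f x r) \<noteq> 0} \<subseteq> (\<Union>x\<in>F. {r. f x r \<noteq> 0})"
    by (auto dest: sum.not_neutral_contains_not_neutral)
  then have "finite {r. (\<Sum>x\<in>F. f x r) \<noteq> 0}"
    by (rule finite_subset) (use insert in auto)
  with insert show ?case by (simp add: Sum_any.distrib)
qed simp

text \<open>The pattern shared by the definitions of \<open>x\<^sub>j\<^sup>\<plusminus>\<close> and \<open>Y\<^sub>i\<close>.\<close>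

lemma ocomp_vop:
  fixes \<gamma> :: "'n::{finite,linorder} wgt"
  assumes lin: "\<And>l. V_linear (a l)"
    and C: "\<And>r v. r > 0 \<Longrightarrow> vscale (cc r) (a (- int r) v) = cre C r v"
    and A: "\<And>r v. r > 0 \<Longrightarrow> vscale (ca r) (a (int r) v) = ann A r v"
    and L: "\<And>v t. L v t = (\<Sum>\<beta>\<in>{\<beta> \<in> keys v. form \<gamma> \<beta> = t}. vscale (\<chi> \<beta> * of_int (eps \<gamma> \<beta>)) (single (\<gamma> + \<beta>) (lookup v \<beta>)))"
  shows "exp_cre cc a \<star> exp_ann ca a \<star> L = vop C A \<gamma> \<chi>"
proof (intro ext)
  fix v s
  define M where "M \<beta> = vscale (\<chi> \<beta> * of_int (eps \<gamma> \<beta>)) (single (\<gamma> + \<beta>) (lookup v \<beta>))" for \<beta>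
  have L': "L v t = (\<Sum>\<beta>\<in>keys v. if form \<gamma> \<beta> = t then M \<beta> else 0)" for t
    unfolding L M_def by (simp add: sum.inter_filter)
  have ann_eq: "(exp_ann ca a \<star> L) v s = (\<Sum>\<beta>\<in>keys v. if s - form \<gamma> \<beta> \<in> \<int> then an A (- \<lfloor>s - form \<gamma> \<beta>\<rfloor>) (M \<beta>) else 0)" for s
  proof -
    let ?e = "\<lambda>w r. if r \<in> \<int> then an A (- \<lfloor>r\<rfloor>) w else 0"
    have e: "exp_ann ca a w r = ?e w r" for w r by (rule exp_ann_an[OF lin A])
    have "(exp_ann ca a \<star> L) v s = Sum_any (\<lambda>r. \<Sum>\<beta>\<in>keys v. if s - form \<gamma> \<beta> = r then ?e (M \<beta>) r else 0)"
      unfolding ocomp_def e L'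
      by (rule arg_cong[where f = Sum_any]) (auto simp: fun_eq_iff module_hom.sum[OF ann.iexp_linear] intro!: sum.cong sum.neutral)
    also have "\<dots> = (\<Sum>\<beta>\<in>keys v. Sum_any (\<lambda>r. if s - form \<gamma> \<beta> = r then ?e (M \<beta>) r else 0))"
      by (rule Sum_any_sum) auto
    finally show ?thesis by simp
  qed
  have fin: "Sum_any (\<lambda>r. if r \<in> \<int> then if s - r - form \<gamma> \<beta> \<in> \<int> then ce C \<lfloor>r\<rfloor> (an A (- \<lfloor>s - r - form \<gamma> \<beta>\<rfloor>) w) else 0 else 0)
      = (if s - form \<gamma> \<beta> \<in> \<int> then osc C A \<lfloor>s - form \<gamma> \<beta>\<rfloor> w else 0)"
    and fin': "finite {r. (if r \<in> \<int> then if s - r - form \<gamma> \<beta> \<in> \<int> then ce C \<lfloor>r\<rfloor> (an A (- \<lfloor>s - r - form \<gamma> \<beta>\<rfloor>) w) else 0 else 0) \<noteq> 0}" for w \<beta>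
  proof -
    let ?t = "\<lambda>r. if r \<in> \<int> then if s - r - form \<gamma> \<beta> \<in> \<int> then ce C \<lfloor>r\<rfloor> (an A (- \<lfloor>s - r - form \<gamma> \<beta>\<rfloor>) w) else 0 else 0"
    have "Sum_any ?t = (if s - form \<gamma> \<beta> \<in> \<int> then osc C A \<lfloor>s - form \<gamma> \<beta>\<rfloor> w else 0) \<and> finite {r. ?t r \<noteq> 0}"
    proof (cases "s - form \<gamma> \<beta> \<in> \<int>")
      case True
      then obtain k where k: "s - form \<gamma> \<beta> = of_int k" by (auto elim: Ints_cases)
      have t: "?t (of_int m) = ce C m (an A (m - k) w)" for m
      proof -
        have "s - of_int m - form \<gamma> \<beta> = of_int (k - m)" using k by simp
        then show ?thesis by (simp only: Ints_of_int floor_of_int if_True minus_diff_eq)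
      qed
      let ?A = "of_int ` {k..k + vdeg w}"
      have z: "?t r = 0" if "r \<notin> ?A" for r
      proof (cases "r \<in> \<int>")
        case True
        then obtain m where m: "r = of_int m" by (auto elim: Ints_cases)
        with that have "m - k < 0 \<or> m - k > vdeg w" by auto
        then show ?thesis unfolding m t using an_eq_0[OF vdeg, of w "m - k" A] by auto
      qed simp
      have "Sum_any ?t = (\<Sum>r\<in>?A. ?t r)" by (rule Sum_any_superset) (use z in auto)
      also have "\<dots> = (\<Sum>m\<in>{k..k + vdeg w}. ?t (of_int m))"
        by (subst sum.reindex) (auto simp: inj_on_def)
      also have "\<dots> = (\<Sum>m\<in>{k..k + vdeg w}. ce C m (an A (m - k) w))"
        unfolding t ..
      also have "\<dots> = (\<Sum>p\<in>{0..vdeg w}. ce C (k + p) (an A p w))"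
        by (rule sum.reindex_bij_witness[of _ "\<lambda>p. k + p" "\<lambda>m. m - k"]) auto
      finally have "Sum_any ?t = osc C A k w" by (simp add: osc_def)
      moreover have "finite {r. ?t r \<noteq> 0}" by (rule finite_subset[of _ ?A]) (use z in blast, simp)
      ultimately show ?thesis by (simp only: k Ints_of_int floor_of_int if_True)
    next
      case False
      have "?t r = 0" for r
      proof (cases "r \<in> \<int>")
        case True
        have "s - r - form \<gamma> \<beta> \<notin> \<int>"
        proof
          assume "s - r - form \<gamma> \<beta> \<in> \<int>"
          then have "s - r - form \<gamma> \<beta> + r \<in> \<int>" using True by (rule Ints_add)
          with False show False by simp
        qed
        then show ?thesis by simp
      qed simp
      with False show ?thesis by simp
    qed
    then show "Sum_any ?t = (if s - form \<gamma> \<beta> \<in> \<int> then osc C A \<lfloor>s - form \<gamma> \<beta>\<rfloor> w else 0)" "finite {r. ?t r \<noteq> 0}" by blast+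
  qed
  let ?T = "\<lambda>\<beta> r. if r \<in> \<int> then if s - r - form \<gamma> \<beta> \<in> \<int> then ce C \<lfloor>r\<rfloor> (an A (- \<lfloor>s - r - form \<gamma> \<beta>\<rfloor>) (M \<beta>)) else 0 else 0"
  have "(exp_cre cc a \<star> exp_ann ca a \<star> L) v s = Sum_any (\<lambda>r. exp_cre cc a ((exp_ann ca a \<star> L) v (s - r)) r)"
    by (simp add: ocomp_def)
  also have "\<dots> = Sum_any (\<lambda>r. \<Sum>\<beta>\<in>keys v. ?T \<beta> r)"
  proof -
    have e: "exp_cre cc a w r = (if r \<in> \<int> then ce C \<lfloor>r\<rfloor> w else 0)" for w r by (rule exp_cre_ce[OF lin C])
    show ?thesis unfolding e ann_eq
      by (rule arg_cong[where f = Sum_any]) (auto simp: fun_eq_iff module_hom.sum[OF cre.iexp_linear] intro!: sum.cong)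
  qed
  also have "\<dots> = (\<Sum>\<beta>\<in>keys v. Sum_any (?T \<beta>))"
    by (rule Sum_any_sum) (simp_all only: finite_keys fin')
  also have "\<dots> = vop C A \<gamma> \<chi> v s"
    unfolding vop_def vop1_def fin by (intro sum.cong refl) (simp add: M_def module_hom.scale[OF osc_linear])
  finally show "(exp_cre cc a \<star> exp_ann ca a \<star> L) v s = vop C A \<gamma> \<chi> v s" .
qed

lemma emul_z_del: "emul \<gamma> (z_del \<gamma>' v t) = (\<Sum>\<beta>\<in>{\<beta> \<in> keys v. form \<gamma>' \<beta> = t}. vscale (of_int (eps \<gamma> \<beta>)) (single (\<gamma> + \<beta>) (lookup v \<beta>)))"
  unfolding z_del_def module_hom.sum[OF V_linear_emul] emul_single ..

text \<open>The coefficient of \<open>a\<^sub>k\<^sup>*(-r)\<close> in \<open>a\<^sub>j(-r)\<close>.\<close>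

definition qfrac :: "'n::{finite,linorder} \<Rightarrow> 'n \<Rightarrow> nat \<Rightarrow> scal" where
  "qfrac k j r = qint (cartan (idx k) (idx j) * int r) / qint (int r)"

lemma heis_cre_dual: "r > 0 \<Longrightarrow> vscale c (heis j (- int r) v) = cre (\<lambda>k r'. if r' = r then c * qfrac k j r else 0) r v"
  by (simp add: heis_eq_dual cre_def qfrac_def V.scale_sum_right)

text \<open>Coefficients of the creation part (\<open>xC\<close>) and the annihilation part (\<open>xA\<close>) of \<open>x\<^sub>j\<^sup>\<plusminus>(z)\<close>.\<close>

definition xC :: "int \<Rightarrow> 'n::{finite,linorder} \<Rightarrow> 'n \<Rightarrow> nat \<Rightarrow> scal" where
  "xC s j k r = of_int s * Q (- s * int r) / qint (int r) * qfrac k j r"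

definition xA :: "int \<Rightarrow> 'n::{finite,linorder} \<Rightarrow> 'n \<Rightarrow> nat \<Rightarrow> scal" where
  "xA s j k r = (if k = j then - of_int s * Q (- s * int r) / qint (int r) else 0)"

lemma ann_delta: "ann (\<lambda>k r. if k = j then c r else 0) r v = vscale (c r) (heis j (int r) v)"
  by (simp add: ann_def if_distrib[of "\<lambda>c. vscale c _"] cong: if_cong)

lemma cre_delta: "cre (\<lambda>k r. if k = j then c r else 0) r v = vscale (c r) (heis_dual j (- int r) v)"
  by (simp add: cre_def if_distrib[of "\<lambda>c. vscale c _"] cong: if_cong)

lemma cre_cong: "(\<And>k. C k r = C' k r) \<Longrightarrow> cre C r v = cre C' r v"
  by (simp add: cre_def)

lemma x_op_vop: "x_op s j = vop (xC s j) (xA s j) (\<lambda>k. s * alpha j k) (\<lambda>_. 1)"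
  unfolding x_op_def Let_def
proof (rule ocomp_vop)
  fix r :: nat and v :: "'a V"
  assume r: "r > 0"
  show "vscale (of_int s * (qh powi (- s * int r) / qint (int r))) (heis j (- int r) v) = cre (xC s j) r v"
    unfolding heis_cre_dual[OF r] by (rule cre_cong) (simp add: xC_def qh_powi)
  show "vscale (- of_int s * (qh powi (- s * int r) / qint (int r))) (heis j (int r) v) = ann (xA s j) r v"
    unfolding xA_def[abs_def] ann_delta by (simp add: qh_powi)
qed (simp_all add: emul_z_del)

lemma ce_trivial: "(\<And>k r. r > 0 \<Longrightarrow> C k r = 0) \<Longrightarrow> ce C m v = (if m = 0 then v else 0)"
  by (rule cre.iexp_zero) (simp add: cre_def)

lemma an_trivial: "(\<And>k r. r > 0 \<Longrightarrow> A k r = 0) \<Longrightarrow> an A m v = (if m = 0 then v else 0)"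
  by (rule ann.iexp_zero) (simp add: ann_def)

lemma osc_no_cre: "osc (\<lambda>k r. 0) A k v = an A (- k) v"
proof -
  have "osc (\<lambda>k r. 0) A k v = (\<Sum>p\<in>{0..vdeg v}. if p = - k then an A p v else 0)"
    unfolding osc_def by (intro sum.cong refl) (auto simp: ce_trivial)
  also have "\<dots> = an A (- k) v"
    using an_eq_0[OF vdeg, of v "- k" A] by (cases "- k < 0") (auto simp: not_le)
  finally show ?thesis .
qed

lemma osc_no_ann: "osc C (\<lambda>k r. 0) k v = ce C k v"
proof -
  have "osc C (\<lambda>k r. 0) k v = (\<Sum>p\<in>{0..vdeg v}. if p = 0 then ce C (k + p) v else 0)"
    unfolding osc_def by (intro sum.cong refl) (auto simp: an_trivial)
  then show ?thesis using vdeg_nonneg[of v] by simp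
qed

lemma eps_0_left [simp]: "eps 0 \<beta> = 1"
  by (simp add: eps_def eps_exp_def mcoord_def)

lemma an_single_weight: "an A m (single \<beta> p) = single \<beta> (lookup (an A m (single \<beta> p)) \<beta>)"
  using heis_commuting_an[OF heis_commuting_wproj, of \<beta> A m "single \<beta> p"] by (simp add: wproj_def)

lemma ce_single_weight: "ce C m (single \<beta> p) = single \<beta> (lookup (ce C m (single \<beta> p)) \<beta>)"
  using heis_commuting_ce[OF heis_commuting_wproj, of \<beta> C m "single \<beta> p"] by (simp add: wproj_def)

text \<open>Coefficients of the annihilation part of \<open>\<psi>\<^sub>j(z)\<close>.\<close>

definition pA :: "'n::{finite,linorder} \<Rightarrow> 'n \<Rightarrow> nat \<Rightarrow> scal" where
  "pA j k r = (if k = j then Q 2 - Q (- 2) else 0)"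

lemma psi_op_vop: "psi_op j = vop (\<lambda>k r. 0) (pA j) 0 (\<lambda>\<beta>. Q (2 * \<beta> j))"
proof (intro ext)
  fix v s
  have e: "exp_ann (\<lambda>r. qq - qq powi (- 1)) (heis j) v s = (if s \<in> \<int> then an (pA j) (- \<lfloor>s\<rfloor>) v else 0)" for v
    by (rule exp_ann_an[OF heis_linear]) (simp only: pA_def[abs_def] ann_delta qq_diff)
  have lin: "V_linear (\<lambda>v. psi_op j v s)"
    unfolding psi_op_def e by (intro V_linear_comp[OF V_linear_K_op] V_linear_if ann.iexp_linear V_linear_0)
  show "psi_op j v s = vop (\<lambda>k r. 0) (pA j) 0 (\<lambda>\<beta>. Q (2 * \<beta> j)) v s"
  proof (rule V_linear_eqI[OF lin vop_linear])
    fix \<beta> and p :: "'a K1"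
    show "psi_op j (single \<beta> p) s = vop (\<lambda>k r. 0) (pA j) 0 (\<lambda>\<beta>. Q (2 * \<beta> j)) (single \<beta> p) s"
      unfolding psi_op_def e vop_single vop1_def osc_no_cre
      by (subst (1 2) an_single_weight) (simp add: K_op_single module_hom.zero[OF V_linear_K_op])
  qed
qed

lemma phi_op_vop: "phi_op j = vop (\<lambda>k r. - (Q 2 - Q (- 2)) * qfrac k j r) (\<lambda>k r. 0) 0 (\<lambda>\<beta>. Q (- 2 * \<beta> j))"
proof (intro ext)
  fix v s
  let ?C = "\<lambda>k r. - (Q 2 - Q (- 2)) * qfrac k j r"
  have e: "exp_cre (\<lambda>r. - (qq - qq powi (- 1))) (heis j) v s = (if s \<in> \<int> then ce ?C \<lfloor>s\<rfloor> v else 0)" for v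
  proof (rule exp_cre_ce[OF heis_linear])
    fix r :: nat and v assume r: "r > 0"
    show "vscale (- (qq - qq powi (- 1))) (heis j (- int r) v) = cre ?C r v"
      unfolding heis_cre_dual[OF r] by (rule cre_cong) (simp only: qq_diff if_True refl)
  qed
  have lin: "V_linear (\<lambda>v. phi_op j v s)"
    unfolding phi_op_def e by (intro V_linear_comp[OF V_linear_K_op] V_linear_if cre.iexp_linear V_linear_0)
  show "phi_op j v s = vop ?C (\<lambda>k r. 0) 0 (\<lambda>\<beta>. Q (- 2 * \<beta> j)) v s"
  proof (rule V_linear_eqI[OF lin vop_linear])
    fix \<beta> and p :: "'a K1"
    show "phi_op j (single \<beta> p) s = vop ?C (\<lambda>k r. 0) 0 (\<lambda>\<beta>. Q (- 2 * \<beta> j)) (single \<beta> p) s"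
      unfolding phi_op_def e vop_single vop1_def osc_no_ann
      by (subst (1 2) ce_single_weight) (simp add: K_op_single module_hom.zero[OF V_linear_K_op])
  qed
qed

text \<open>The sign operator \<open>(-1)\<^sup>m\<^sup>\<partial>\<close> in the definition of \<open>Y\<^sub>i(z)\<close>.\<close>

definition \<chi>Y :: "'n::{finite,linorder} \<Rightarrow> 'n wgt \<Rightarrow> scal" where
  "\<chi>Y i \<beta> = cst (exp (\<i> * of_real pi * of_rat (of_int (if i = last_idx then 0 else int (idx i)) * form (lam last_idx) \<beta>)))"

lemma Y_op_vop: "Y_op i = vop (\<lambda>k r. if k = i then Q (int r) / qint (int r) else 0)
    (\<lambda>k r. - (Q (int r) / qint (int r)) * dual_coeff i k (int r)) (lam i) (\<chi>Y i)"
  unfolding Y_op_def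
proof (rule ocomp_vop)
  fix r :: nat and v :: "'a V"
  assume r: "r > 0"
  show "vscale (qh powi int r / qint (int r)) (heis_dual i (- int r) v) = cre (\<lambda>k r. if k = i then Q (int r) / qint (int r) else 0) r v"
    unfolding cre_delta qh_powi ..
  show "vscale (- (qh powi int r / qint (int r))) (heis_dual i (int r) v) = ann (\<lambda>k r. - (Q (int r) / qint (int r)) * dual_coeff i k (int r)) r v"
    unfolding ann_def heis_dual_def V.scale_sum_right qh_powi V.scale_scale ..
next
  fix v :: "'a V" and t
  show "emul (lam i) (sgn_del (if i = last_idx then 0 else int (idx i)) (lam last_idx) (z_del (lam i) v t))
    = (\<Sum>\<beta>\<in>{\<beta> \<in> keys v. form (lam i) \<beta> = t}. vscale (\<chi>Y i \<beta> * of_int (eps (lam i) \<beta>)) (single (lam i + \<beta>) (lookup v \<beta>)))"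
    unfolding z_del_def module_hom.sum[OF V_linear_sgn_del] sgn_del_single module_hom.sum[OF V_linear_emul]
      module_hom.scale[OF V_linear_emul] emul_single V.scale_scale \<chi>Y_def ..
qed (rule heis_dual_linear)

section \<open>Configurations\<close>

text \<open>The module \<open>L(\<lambda>\<^sub>i)\<close> is the \<open>i\<close>-th exterior power of the vector representation. Its basis consists of the
  \<open>i\<close>-element subsets of \<open>{1, \<dots>, n + 1}\<close>, viewed as configurations of \<open>i\<close> particles on \<open>n + 1\<close> sites;
  \<open>f\<^sub>j\<close> moves a particle from site \<open>j\<close> to site \<open>j + 1\<close>.\<close>

definition cnt :: "nat set \<Rightarrow> nat \<Rightarrow> nat" where
  "cnt S p = card (S \<inter> {..<p})"

definition hop :: "nat \<Rightarrow> nat \<Rightarrow> nat set \<Rightarrow> nat set" where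
  "hop a b S = insert b (S - {a})"

definition configs :: "nat \<Rightarrow> nat \<Rightarrow> nat set set" where
  "configs N i = {S. S \<subseteq> {1..N} \<and> card S = i}"

lemma configs_finite: "S \<in> configs N i \<Longrightarrow> finite S"
  by (auto simp: configs_def intro: finite_subset)

lemma finite_configs: "finite (configs N i)"
  by (rule finite_subset[of _ "Pow {1..N}"]) (auto simp: configs_def)

lemma cnt_Suc: "cnt S (Suc p) = cnt S p + (if p \<in> S then 1 else 0)"
proof -
  have "S \<inter> {..<Suc p} = (if p \<in> S then insert p (S \<inter> {..<p}) else S \<inter> {..<p})"
    by (auto simp: less_Suc_eq)
  then show ?thesis by (simp add: cnt_def)
qed

lemma hop_inverse: "a \<in> S \<Longrightarrow> b \<notin> S \<Longrightarrow> hop b a (hop a b S) = S"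
  by (auto simp: hop_def)

lemma hop_mem: "a \<noteq> b \<Longrightarrow> x \<in> hop a b S \<longleftrightarrow> x = b \<or> x \<in> S \<and> x \<noteq> a"
  by (auto simp: hop_def)

lemma hop_configs:
  assumes "S \<in> configs N i" "a \<in> S" "b \<notin> S" "b \<in> {1..N}"
  shows "hop a b S \<in> configs N i"
proof -
  have "finite S" using assms(1) by (rule configs_finite)
  moreover have "card S = i" "S \<subseteq> {1..N}" using assms(1) by (auto simp: configs_def)
  moreover have "card S > 0" using \<open>finite S\<close> assms(2) by (auto simp: card_gt_0_iff)
  ultimately show ?thesis using assms by (auto simp: configs_def hop_def card_insert_if)
qed

lemma cnt_hop:
  assumes "j \<in> S" "Suc j \<notin> S"
  shows "cnt (hop j (Suc j) S) p + (if p = Suc j then 1 else 0) = cnt S p"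
proof (cases p "Suc j" rule: linorder_cases)
  case less
  then have "hop j (Suc j) S \<inter> {..<p} = S \<inter> {..<p}" by (auto simp: hop_def)
  with less show ?thesis by (simp add: cnt_def)
next
  case equal
  have "hop j (Suc j) S \<inter> {..<j} = S \<inter> {..<j}" by (auto simp: hop_def)
  then show ?thesis using equal assms by (simp add: cnt_Suc hop_mem) (simp add: cnt_def)
next
  case greater
  have "S \<inter> {..<p} = insert j (S \<inter> {..<p} - {j})" using assms greater by auto
  moreover have "hop j (Suc j) S \<inter> {..<p} = insert (Suc j) (S \<inter> {..<p} - {j})" using greater by (auto simp: hop_def)
  moreover have "card (insert j (S \<inter> {..<p} - {j})) = card (insert (Suc j) (S \<inter> {..<p} - {j}))"
    using assms by (subst (1 2) card_insert_disjoint) auto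
  ultimately show ?thesis using greater by (simp add: cnt_def)
qed

text \<open>The bounds for the number \<open>k\<close> of particles below \<open>j\<close> when exactly one of the sites \<open>j\<close> and \<open>j + 1\<close> is occupied.\<close>

definition valid :: "nat \<Rightarrow> nat \<Rightarrow> nat \<Rightarrow> nat \<Rightarrow> bool" where
  "valid N i j k \<longleftrightarrow> k < i \<and> k < j \<and> i + j \<le> k + N"

text \<open>Counting the particles on the sites below \<open>j\<close>, on \<open>j\<close> and \<open>j + 1\<close>, and above.\<close>

lemma valid_cnt:
  assumes S: "S \<in> configs N i" and j: "1 \<le> j" "j < N" and one: "j \<in> S \<longleftrightarrow> Suc j \<notin> S"
  shows "valid N i j (cnt S j)"
proof -
  have sub: "S \<subseteq> {1..N}" and card: "card S = i"
    using S by (simp_all add: configs_def)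
  have fin: "finite S" using S by (rule configs_finite)
  have "cnt S j \<le> card {1..<j}" unfolding cnt_def using sub by (intro card_mono) auto
  then have 1: "cnt S j < j" using j by simp
  let ?U = "S \<inter> {Suc (Suc j)..N}"
  have "S = S \<inter> {..<Suc (Suc j)} \<union> ?U" using sub by auto
  from arg_cong[where f = card, OF this] have "i = card (S \<inter> {..<Suc (Suc j)} \<union> ?U)" by (simp only: card)
  also have "\<dots> = cnt S (Suc (Suc j)) + card ?U"
    unfolding cnt_def using fin by (intro card_Un_disjoint) auto
  finally have "i = cnt S (Suc (Suc j)) + card ?U" .
  moreover have "cnt S (Suc (Suc j)) = cnt S j + 1" using one by (simp add: cnt_Suc)
  moreover have "card ?U \<le> card {Suc (Suc j)..N}" by (intro card_mono) auto
  ultimately have "cnt S j < i" "i + j \<le> cnt S j + N" using j by auto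
  with 1 show ?thesis by (simp add: valid_def)
qed

section \<open>The vertex operators obtained from \<open>Y\<^sub>i\<close>\<close>

definition mu :: "nat set \<Rightarrow> 'n::{finite,linorder} wgt" where
  "mu S = (\<lambda>j. (if idx j \<in> S then 1 else 0) - (if Suc (idx j) \<in> S then 1 else 0))"

text \<open>The \<open>(k + 1)\<close>-st particle passes from \<open>j\<close> to \<open>j + 1\<close> by a factor \<open>x\<^sub>j\<^sup>-\<close> at the point \<open>q\<^sup>m z\<close>, where \<open>m\<close> is
  the height \<open>height i j k\<close>. In the Young diagram that corresponds to a configuration this is, up to a shift, the
  distance of a box from the corner.\<close>

definition height :: "nat \<Rightarrow> nat \<Rightarrow> nat \<Rightarrow> int" where
  "height i j k = int i + int j - 1 - 2 * int k"

text \<open>The contribution of a particle at site \<open>p\<close> to the creation part.\<close>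

definition theta :: "nat \<Rightarrow> nat set \<Rightarrow> nat \<Rightarrow> nat \<Rightarrow> scal" where
  "theta i S p r = (if p \<in> S then Q ((2 * height i p (cnt S p) - 1) * int r) else 0)"

text \<open>The indices of the particles that have passed from \<open>j\<close> to \<open>j + 1\<close>, starting from the configuration \<open>{1..i}\<close>: there
  were \<open>min i j\<close> particles on the sites up to \<open>j\<close>, and those with the largest indices left first.\<close>

definition past :: "nat \<Rightarrow> nat set \<Rightarrow> nat \<Rightarrow> nat set" where
  "past i S j = {cnt S (Suc j)..<min i j}"

type_synonym 'n mult = "'n \<Rightarrow> nat \<Rightarrow> nat"

text \<open>The operator \<open>R i S n\<close> is the normally ordered product of \<open>Y\<^sub>i(z)\<close>, of one factor \<open>x\<^sub>j\<^sup>-(q\<^sup>m z)\<close> for each passage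
  of a particle from \<open>j\<close> to \<open>j + 1\<close> at height \<open>m\<close>, and of \<open>n j k\<close> factors \<open>\<psi>\<^sub>j(q\<^sup>m\<^sup>+\<^sup>1\<^sup>/\<^sup>2 z)\<close> with \<open>m = height i j k\<close>.
  In the annihilation part \<open>RA\<close> and in the scalar part \<open>Rexp\<close> the contributions of the passages are summed
  up, while in the creation part \<open>RC\<close> they telescope to a sum over the present particles.\<close>

definition RC :: "nat \<Rightarrow> nat set \<Rightarrow> 'n::{finite,linorder} \<Rightarrow> nat \<Rightarrow> scal" where
  "RC i S k r = (theta i S (idx k) r - Q (2 * int r) * theta i S (Suc (idx k)) r) / qint (int r)"

definition RA :: "'n::{finite,linorder} \<Rightarrow> nat set \<Rightarrow> 'n mult \<Rightarrow> 'n \<Rightarrow> nat \<Rightarrow> scal" where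
  "RA i S n j r = - (Q (int r) / qint (int r)) * dual_coeff i j (int r)
     + Q (int r) / qint (int r) * (\<Sum>k\<in>past (idx i) S (idx j). Q (- 2 * height (idx i) (idx j) k * int r))
     + (Q 2 - Q (- 2)) * (\<Sum>k<idx i. of_nat (n j k) * Q (- (2 * height (idx i) (idx j) k + 1) * int r))"

definition Rexp :: "'n::{finite,linorder} \<Rightarrow> nat set \<Rightarrow> 'n mult \<Rightarrow> 'n \<Rightarrow> int" where
  "Rexp i S n j = (\<Sum>k<idx i. int (n j k)) - (\<Sum>k\<in>past (idx i) S (idx j). height (idx i) (idx j) k)"

definition Rchi :: "'n::{finite,linorder} \<Rightarrow> nat set \<Rightarrow> 'n mult \<Rightarrow> 'n wgt \<Rightarrow> scal" where
  "Rchi i S n \<beta> = \<chi>Y i \<beta> * Q (2 * (\<Sum>j\<in>UNIV. \<beta> j * Rexp i S n j))"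

definition R :: "'n::{finite,linorder} \<Rightarrow> nat set \<Rightarrow> 'n mult \<Rightarrow> 'n oper" where
  "R i S n = vop (RC (idx i) S) (RA i S n) (mu S) (Rchi i S n)"

definition bump :: "'n \<Rightarrow> nat \<Rightarrow> 'n mult \<Rightarrow> 'n mult" where
  "bump j k n = n(j := (n j)(k := Suc (n j k)))"

subsection \<open>The highest weight operator\<close>

lemma cnt_interval: "cnt {Suc 0..m} p = min m (p - 1)"
proof -
  have "{Suc 0..m} \<inter> {..<p} = {1..min m (p - 1)}" by auto
  then show ?thesis by (simp add: cnt_def)
qed

lemma mu_top: "mu {1..idx i} = lam i"
  by (auto simp: mu_def lam_def fun_eq_iff idx_ge1 simp flip: idx_inject) (use idx_ge1 in \<open>auto simp: Suc_le_eq\<close>)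

lemma R_top: "R i {1..idx i} (\<lambda>_ _. 0) = Y_op i"
  unfolding R_def Y_op_vop mu_top
proof (rule vop_cong)
  fix k :: 'a and r :: nat assume r: "r > 0"
  have p: "past (idx i) {1..idx i} (idx k) = {}" by (auto simp: past_def cnt_interval)
  then show "RA i {1..idx i} (\<lambda>_ _. 0) k r = - (Q (int r) / qint (int r)) * dual_coeff i k (int r)"
    by (simp add: RA_def)
  have "theta (idx i) {1..idx i} (idx k) r - Q (2 * int r) * theta (idx i) {1..idx i} (Suc (idx k)) r = (if k = i then Q (int r) else 0)"
  proof (cases "idx k" "idx i" rule: linorder_cases)
    case less
    then have ne: "k \<noteq> i" and mins: "min (idx i) (idx k - 1) = idx k - 1" "min (idx i) (idx k) = idx k" by auto
    show ?thesis using less ne mins idx_ge1[of k]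
      by (simp add: theta_def cnt_interval height_def Suc_le_eq of_nat_diff flip: Q_add) (simp add: algebra_simps)
  next
    case equal
    then show ?thesis using idx_ge1[of k]
      by (simp add: theta_def cnt_interval height_def min_def of_nat_diff)
  next
    case greater
    then have ne: "k \<noteq> i" by auto
    with greater show ?thesis by (simp add: theta_def)
  qed
  then show "RC (idx i) {1..idx i} k r = (if k = i then Q (int r) / qint (int r) else 0)"
    by (simp add: RC_def)
next
  fix \<beta> :: "'a wgt"
  have "past (idx i) {1..idx i} (idx k) = {}" for k :: 'a by (auto simp: past_def cnt_interval)
  then show "Rchi i {1..idx i} (\<lambda>_ _. 0) \<beta> = \<chi>Y i \<beta>" by (simp add: Rchi_def Rexp_def)
qed

subsection \<open>Contractions\<close>

lemma pairing_xA:
  assumes "r > 0"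
  shows "pairing (xA s j) (RC i S) r = - of_int s * Q (- s * int r) * (theta i S (idx j) r - Q (2 * int r) * theta i S (Suc (idx j)) r)"
proof -
  have "(\<Sum>k\<in>UNIV. xA s j k r * RC i S k r) = (\<Sum>k\<in>UNIV. if k = j then - of_int s * Q (- s * int r) / qint (int r) * RC i S k r else 0)"
    by (intro sum.cong refl) (simp add: xA_def)
  then show ?thesis using assms by (simp add: pairing_def RC_def power2_eq_square)
qed

lemma pairing_pA:
  assumes "r > 0"
  shows "pairing (pA j) (RC i S) r = (Q (2 * int r) - Q (- 2 * int r)) * (theta i S (idx j) r - Q (2 * int r) * theta i S (Suc (idx j)) r)"
proof -
  have "(\<Sum>k\<in>UNIV. pA j k r * RC i S k r) = (\<Sum>k\<in>UNIV. if k = j then (Q 2 - Q (- 2)) * RC i S k r else 0)"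
    by (intro sum.cong refl) (simp add: pA_def)
  then have "pairing (pA j) (RC i S) r = ((Q 2 - Q (- 2)) * qint (int r)) * (theta i S (idx j) r - Q (2 * int r) * theta i S (Suc (idx j)) r)"
    using assms by (simp add: pairing_def RC_def power2_eq_square)
  then show ?thesis unfolding q_diff_qint .
qed

lemma Q_pow_if: "r > 0 \<Longrightarrow> (if b then Q e else 0) ^ r = (if b then Q (e * int r) else 0)"
  by (simp add: Q_power)

text \<open>The contractions of \<open>x\<^sub>j\<^sup>-(z\<^sub>1)\<close>, \<open>x\<^sub>j\<^sup>+(z\<^sub>1)\<close> and \<open>\<psi>\<^sub>j(z\<^sub>1)\<close> with \<open>R i S n\<close> have one zero and one pole each,
  at the multiples of \<open>z\<^sub>2\<close> given here, where \<open>0\<close> means that there is none. For \<open>\<psi>\<^sub>j\<close> they cancel if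
  both sites are occupied, and they are absent if both sites are empty.\<close>

definition pole_f where "pole_f i S j = (if j \<in> S then Q (2 * height i j (cnt S j)) else 0)"
definition zero_f where "zero_f i S j = (if Suc j \<in> S then Q (2 * height i (Suc j) (cnt S (Suc j)) + 2) else 0)"
definition pole_e where "pole_e i S j = (if Suc j \<in> S then Q (2 * height i (Suc j) (cnt S (Suc j))) else 0)"
definition zero_e where "zero_e i S j = (if j \<in> S then Q (2 * height i j (cnt S j) - 2) else 0)"
definition pole_k where "pole_k i S j = (if j \<in> S \<longleftrightarrow> Suc j \<in> S then 0 else Q (2 * height i j (cnt S j) + 1))"
definition zero_k where "zero_k i S j = (if j \<in> S \<longleftrightarrow> Suc j \<in> S then 0 else if j \<in> S then Q (2 * height i j (cnt S j) - 3) else Q (2 * height i j (cnt S j) + 5))"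

lemma pairing_f:
  assumes "r > 0"
  shows "pairing (xA (- 1) j) (RC i S) r = pole_f i S (idx j) ^ r - zero_f i S (idx j) ^ r"
  unfolding pairing_xA[OF assms] pole_f_def zero_f_def Q_pow_if[OF assms] theta_def
  by (simp add: algebra_simps flip: Q_add)

lemma pairing_e:
  assumes "r > 0"
  shows "pairing (xA 1 j) (RC i S) r = pole_e i S (idx j) ^ r - zero_e i S (idx j) ^ r"
  unfolding pairing_xA[OF assms] pole_e_def zero_e_def Q_pow_if[OF assms] theta_def
  by (simp add: algebra_simps flip: Q_add)

lemma pairing_k:
  assumes "r > 0"
  shows "pairing (pA j) (RC i S) r = pole_k i S (idx j) ^ r - zero_k i S (idx j) ^ r"
  unfolding pairing_pA[OF assms] pole_k_def zero_k_def theta_def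
  using assms by (auto simp: Q_power height_def cnt_Suc algebra_simps zero_power simp flip: Q_add)

lemma pairing_phi: "pairing (\<lambda>k r. 0) C r = 0 ^ r - 0 ^ r"
  by (simp add: pairing_def)

subsection \<open>Integrality and multiplicativity\<close>

lemma form_sym: "form \<beta> \<gamma> = form \<gamma> \<beta>"
  unfolding form_def by (subst sum.swap) (simp add: mult.commute min.commute max.commute)

lemma form_alpha_left: "form (\<lambda>k. s * alpha j k) \<beta> = of_int (s * \<beta> j)"
proof -
  have "form (\<lambda>k. s * alpha j k) \<beta> = of_int s * form (alpha j) \<beta>"
    by (simp add: form_def sum_distrib_left mult_ac)
  then show ?thesis by (simp add: form_sym[of "alpha j"] form_alpha)
qed

lemma int_form_alpha: "int_form (\<lambda>k. s * alpha j k)"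
  by (simp add: int_form_def form_alpha_left)

lemma int_form_0: "int_form 0"
  by (simp add: int_form_def)

text \<open>Needed for the weight of a vertex operator to be well defined.\<close>

lemma \<chi>Y_0: "\<chi>Y i 0 \<noteq> 0"
  by (simp add: \<chi>Y_def)

lemma Rchi_0: "Rchi i S n 0 \<noteq> 0"
  by (simp add: Rchi_def \<chi>Y_0)

lemma mu_hop:
  fixes j :: "'n::{finite,linorder}"
  assumes mem: "idx j \<in> S" "Suc (idx j) \<notin> S"
  shows "mu (hop (idx j) (Suc (idx j)) S) = (\<lambda>k. - 1 * alpha j k) + mu S" (is "mu ?S' = _")
proof
  fix k' :: 'n
  consider "k' = j" | "idx k' = Suc (idx j)" | "idx j = Suc (idx k')"
    | "idx k' \<noteq> idx j" "idx k' \<noteq> Suc (idx j)" "Suc (idx k') \<noteq> idx j" by fastforce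
  then show "mu ?S' k' = ((\<lambda>k. - 1 * alpha j k) + mu S) k'"
  proof cases
    case 1
    then show ?thesis using mem by (simp add: mu_def hop_mem alpha_def cartan_def)
  next
    case 2
    then have "k' \<noteq> j" "Suc (idx k') \<noteq> idx j" by auto
    with 2 show ?thesis using mem by (simp add: mu_def hop_mem alpha_def cartan_def)
  next
    case 3
    then have "k' \<noteq> j" "idx k' \<noteq> Suc (idx j)" by auto
    with 3 show ?thesis using mem by (simp add: mu_def hop_mem alpha_def cartan_def)
  next
    case 4
    then show ?thesis by (simp add: mu_def hop_mem alpha_def cartan_def)
  qed
qed

subsection \<open>Moving a particle\<close>

lemma qint_double: "qint (2 * l) = qint l * (Q (2 * l) + Q (- 2 * l))"
proof -
  have "Q (2 * (2 * l)) - Q (- 2 * (2 * l)) = (Q (2 * l) - Q (- 2 * l)) * (Q (2 * l) + Q (- 2 * l))"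
    by (simp add: algebra_simps flip: Q_add)
  then show ?thesis unfolding qint_Q by simp
qed

lemma qfrac_cases:
  assumes "r > 0"
  shows "qfrac k j r = (if k = j then Q (2 * int r) + Q (- 2 * int r)
    else if idx k = Suc (idx j) \<or> idx j = Suc (idx k) then - 1 else 0)"
  using assms by (auto simp: qfrac_def cartan_def qint_double)

context
  fixes i j :: "'n::{finite,linorder}" and S :: "nat set" and k :: nat and m :: int
  assumes S: "S \<in> configs (CARD('n) + 1) (idx i)" and mem: "idx j \<in> S" "Suc (idx j) \<notin> S"
  defines "k \<equiv> cnt S (idx j)" and "m \<equiv> height (idx i) (idx j) k"
begin

abbreviation (input) "S' \<equiv> hop (idx j) (Suc (idx j)) S"

lemma valid_k: "valid (CARD('n) + 1) (idx i) (idx j) k"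
  unfolding k_def using idx_ge1[of j] idx_le[of j] mem by (intro valid_cnt[OF S]) auto

lemma cnt_hop_Suc: "cnt S' (Suc (idx j)) = k"
  using cnt_hop[OF mem, of "Suc (idx j)"] mem by (simp add: cnt_Suc k_def)

lemma cnt_hop_other: "p \<noteq> Suc (idx j) \<Longrightarrow> cnt S' p = cnt S p"
  using cnt_hop[OF mem, of p] by simp

lemma theta_hop:
  "theta (idx i) S (idx j) r = Q ((2 * m - 1) * int r)" "theta (idx i) S (Suc (idx j)) r = 0"
  "theta (idx i) S' (idx j) r = 0" "theta (idx i) S' (Suc (idx j)) r = Q ((2 * m + 1) * int r)"
  "p \<noteq> idx j \<Longrightarrow> p \<noteq> Suc (idx j) \<Longrightarrow> theta (idx i) S' p r = theta (idx i) S p r"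
proof -
  show "theta (idx i) S (idx j) r = Q ((2 * m - 1) * int r)" "theta (idx i) S (Suc (idx j)) r = 0"
    "theta (idx i) S' (idx j) r = 0"
    using mem by (simp_all add: theta_def m_def k_def hop_mem)
  have "2 * height (idx i) (Suc (idx j)) k - 1 = 2 * m + 1" by (simp add: m_def height_def)
  then show "theta (idx i) S' (Suc (idx j)) r = Q ((2 * m + 1) * int r)"
    unfolding theta_def cnt_hop_Suc by (simp add: hop_mem)
  show "p \<noteq> idx j \<Longrightarrow> p \<noteq> Suc (idx j) \<Longrightarrow> theta (idx i) S' p r = theta (idx i) S p r"
    by (simp add: theta_def hop_mem cnt_hop_other)
qed

text \<open>The new creation part differs by the one of \<open>x\<^sub>j\<^sup>-(q\<^sup>m z)\<close>. A particle influences only the coefficients of its two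
  neighbouring nodes, which gives the quantum Cartan matrix.\<close>

lemma RC_hop:
  assumes r: "r > 0"
  shows "RC (idx i) S' k' r = Q (2 * m) ^ r * xC (- 1) j k' r + RC (idx i) S k' r"
proof -
  have "theta (idx i) S' (idx k') r - Q (2 * int r) * theta (idx i) S' (Suc (idx k')) r
    = - Q ((2 * m + 1) * int r) * qfrac k' j r + (theta (idx i) S (idx k') r - Q (2 * int r) * theta (idx i) S (Suc (idx k')) r)"
  proof -
    consider "k' = j" | "idx k' = Suc (idx j)" | "idx j = Suc (idx k')"
      | "idx k' \<noteq> idx j" "idx k' \<noteq> Suc (idx j)" "Suc (idx k') \<noteq> idx j" by fastforce
    then show ?thesis
    proof cases
      case 1
      then show ?thesis by (simp add: qfrac_cases[OF r] theta_hop algebra_simps flip: Q_add)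
    next
      case 2
      then have "k' \<noteq> j" "Suc (idx k') \<noteq> idx j" "Suc (idx k') \<noteq> Suc (idx j)" by auto
      with 2 show ?thesis using theta_hop(5)[of "Suc (idx k')" r] theta_hop(2,4)[of r] by (simp add: qfrac_cases[OF r])
    next
      case 3
      then have ne: "k' \<noteq> j" "idx k' \<noteq> idx j" "idx k' \<noteq> Suc (idx j)" by auto
      have "theta (idx i) S' (Suc (idx k')) r = 0" "theta (idx i) S (Suc (idx k')) r = Q ((2 * m - 1) * int r)"
        "theta (idx i) S' (idx k') r = theta (idx i) S (idx k') r"
        using theta_hop(1,3)[of r] theta_hop(5)[OF ne(2,3)] 3 by simp_all
      with 3 ne show ?thesis by (simp add: qfrac_cases[OF r] algebra_simps flip: Q_add)
    next
      case 4
      then have "k' \<noteq> j" by auto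
      with 4 show ?thesis using theta_hop(5)[of "idx k'" r] theta_hop(5)[of "Suc (idx k')" r] by (simp add: qfrac_cases[OF r])
    qed
  qed
  moreover have "Q (2 * m) ^ r * xC (- 1) j k' r = - Q ((2 * m + 1) * int r) * qfrac k' j r / qint (int r)"
  proof -
    have "Q (2 * m) ^ r * Q (int r) = Q ((2 * m + 1) * int r)" by (simp add: Q_power algebra_simps flip: Q_add)
    moreover have "Q (2 * m) ^ r * xC (- 1) j k' r = - (Q (2 * m) ^ r * Q (int r)) * qfrac k' j r / qint (int r)"
      by (simp add: xC_def)
    ultimately show ?thesis by simp
  qed
  ultimately show ?thesis unfolding RC_def by (simp only: add_divide_distrib)
qed

lemma past_hop: "past (idx i) S' j' = (if j' = idx j then insert k (past (idx i) S (idx j)) else past (idx i) S j')"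
  and k_notin_past: "k \<notin> past (idx i) S (idx j)"
proof -
  have S_Suc: "cnt S (Suc (idx j)) = Suc k" using mem by (simp add: cnt_Suc k_def)
  then show "k \<notin> past (idx i) S (idx j)" by (simp add: past_def)
  have "k < min (idx i) (idx j)" using valid_k by (auto simp: valid_def)
  then show "past (idx i) S' j' = (if j' = idx j then insert k (past (idx i) S (idx j)) else past (idx i) S j')"
    using cnt_hop_Suc cnt_hop_other[of "Suc j'"] S_Suc by (auto simp: past_def)
qed

lemma finite_past: "finite (past a S b)"
  by (simp add: past_def)

lemma RA_hop:
  assumes r: "r > 0"
  shows "RA i S' n k' r = xA (- 1) j k' r / Q (2 * m) ^ r + RA i S n k' r"
proof (cases "k' = j")
  case True
  have "Q (int r) / qint (int r) / Q (2 * m) ^ r = Q (int r) / qint (int r) * Q (- 2 * m * int r)"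
    by (simp add: Q_power Q_minus divide_inverse)
  then show ?thesis using True k_notin_past finite_past
    by (simp add: RA_def past_hop xA_def m_def[symmetric] distrib_left)
qed (simp add: RA_def past_hop xA_def)

lemma Rexp_hop: "Rexp i S' n k' = Rexp i S n k' - (if k' = j then m else 0)"
  using k_notin_past finite_past by (simp add: Rexp_def past_hop m_def[symmetric])

lemma Rchi_hop: "Rchi i S' n \<beta> = Q (- 2 * m * \<beta> j) * Rchi i S n \<beta>"
proof -
  have "(\<Sum>k'\<in>UNIV. \<beta> k' * Rexp i S' n k') = (\<Sum>k'\<in>UNIV. \<beta> k' * Rexp i S n k' - (if k' = j then m * \<beta> j else 0))"
    unfolding Rexp_hop by (intro sum.cong) (auto simp: algebra_simps)
  then have "(\<Sum>k'\<in>UNIV. \<beta> k' * Rexp i S' n k') = (\<Sum>k'\<in>UNIV. \<beta> k' * Rexp i S n k') - m * \<beta> j"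
    by (simp add: sum_subtractf)
  then show ?thesis unfolding Rchi_def by (simp add: algebra_simps flip: Q_add)
qed

end

lemma bump_sum:
  fixes f :: "nat \<Rightarrow> 'a::comm_semiring_1"
  assumes "k < I"
  shows "(\<Sum>k'<I. of_nat (bump j k n j' k') * f k') = (\<Sum>k'<I. of_nat (n j' k') * f k') + (if j' = j then f k else 0)"
proof -
  have "(\<Sum>k'<I. of_nat (bump j k n j' k') * f k') = (\<Sum>k'<I. of_nat (n j' k') * f k' + (if k' = k then if j' = j then f k else 0 else 0))"
    by (intro sum.cong refl) (auto simp: bump_def algebra_simps)
  then show ?thesis using assms by (simp add: sum.distrib)
qed

lemma RA_bump:
  assumes "k < idx i"
  shows "RA i S (bump j k n) k' r = RA i S n k' r + (if k' = j then (Q 2 - Q (- 2)) * Q (- (2 * height (idx i) (idx j) k + 1) * int r) else 0)"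
  unfolding RA_def bump_sum[OF assms] by (simp add: algebra_simps)

lemma Rexp_bump:
  assumes "k < idx i"
  shows "Rexp i S (bump j k n) k' = Rexp i S n k' + (if k' = j then 1 else 0)"
  using bump_sum[OF assms, of j n k' "\<lambda>_. 1 :: int"] by (simp add: Rexp_def)

lemma Rchi_bump:
  assumes "k < idx i"
  shows "Rchi i S (bump j k n) \<beta> = Q (2 * \<beta> j) * Rchi i S n \<beta>"
proof -
  have "(\<Sum>k'\<in>UNIV. \<beta> k' * Rexp i S (bump j k n) k') = (\<Sum>k'\<in>UNIV. \<beta> k' * Rexp i S n k' + (if k' = j then \<beta> j else 0))"
    unfolding Rexp_bump[OF assms] by (intro sum.cong) (auto simp: algebra_simps)
  then have "(\<Sum>k'\<in>UNIV. \<beta> k' * Rexp i S (bump j k n) k') = (\<Sum>k'\<in>UNIV. \<beta> k' * Rexp i S n k') + \<beta> j"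
    by (simp add: sum.distrib)
  then show ?thesis unfolding Rchi_def by (simp add: distrib_left Q_add mult_ac)
qed

subsection \<open>Signs\<close>

text \<open>The value of the cocycle that appears when \<open>x\<^sub>j\<^sup>-\<close> acts on an operator of the weight of \<open>S\<close>.\<close>

definition sg :: "'n::{finite,linorder} \<Rightarrow> nat set \<Rightarrow> int" where
  "sg j S = eps (\<lambda>k. - 1 * alpha j k) (mu S)"

lemma mcoord_uminus: "mcoord (\<lambda>k. - 1 * \<beta> k) p = - mcoord \<beta> p"
  by (simp add: mcoord_def sum_negf)

lemma eps_exp_uminus: "eps_exp (\<lambda>k. - 1 * \<gamma> k) \<beta> = - eps_exp \<gamma> \<beta>" "eps_exp \<gamma> (\<lambda>k. - 1 * \<beta> k) = - eps_exp \<gamma> \<beta>"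
  unfolding eps_exp_def mcoord_uminus by (simp_all add: sum_negf)

lemma eps_exp_add: "eps_exp (\<gamma> + \<delta>) \<beta> = eps_exp \<gamma> \<beta> + eps_exp \<delta> \<beta>" "eps_exp \<gamma> (\<beta> + \<delta>) = eps_exp \<gamma> \<beta> + eps_exp \<gamma> \<delta>"
  by (simp_all add: eps_exp_def mcoord_add sum.distrib algebra_simps)

text \<open>\<open>\<alpha>\<^sub>1\<close> is not one of the generators of the twisted group algebra, so its coordinates have to be computed.\<close>

lemma mcoord_alpha_1:
  assumes j: "idx (j :: 'n::{finite,linorder}) = 1" and p: "2 \<le> p" "p \<le> CARD('n) + 1"
  shows "mcoord (alpha j) p = (if p \<le> CARD('n) then - int p else int p)"
proof -
  let ?n = "CARD('n)"
  define g where "g i = (if i = 0 then 0 else int (p - i))" for i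
  have "(\<Sum>i\<in>UNIV. int (p - idx i) * alpha j i)
      = (\<Sum>i\<in>(UNIV :: 'n set). (\<lambda>i. of_int (cartan i (idx j)) * g i) (idx i))"
    by (intro sum.cong) (auto simp: g_def alpha_def)
  also have "\<dots> = (\<Sum>i=1..?n. of_int (cartan i (idx j)) * g i)"
    by (rule sum.reindex_bij_betw[OF bij_idx])
  also have "\<dots> = 2 * g (idx j) - g (idx j - 1) - g (idx j + 1)"
    using p idx_le[of j] j by (intro sum_cartan) (auto simp: g_def)
  also have "\<dots> = int p" using p by (simp add: g_def j of_nat_diff)
  finally show ?thesis by (simp add: mcoord_def)
qed

lemma eps_exp_alpha_left:
  fixes j :: "'n::{finite,linorder}"
  assumes j: "2 \<le> idx j"
  shows "eps_exp (alpha j) \<beta> = (if idx j = 2 then 0 else - mcoord \<beta> (idx j - 1))"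
proof -
  let ?n = "CARD('n)"
  have "eps_exp (alpha j) \<beta> = (\<Sum>k=2..?n + 1. if k = idx j then \<Sum>l\<in>{2..<idx j}. comm_exp ?n (idx j) l * mcoord \<beta> l else 0)"
    unfolding eps_exp_def by (intro sum.cong refl) (auto simp: mcoord_alpha[OF j])
  also have "\<dots> = (\<Sum>l\<in>{2..<idx j}. comm_exp ?n (idx j) l * mcoord \<beta> l)"
    using j idx_le[of j] by simp
  also have "\<dots> = (\<Sum>l\<in>{2..<idx j}. if l = idx j - 1 then - mcoord \<beta> l else 0)"
    using idx_le[of j] by (intro sum.cong refl) (auto simp: comm_exp_def cartan_def)
  finally show ?thesis using j by auto
qed

lemma eps_exp_alpha_1:
  fixes j :: "'n::{finite,linorder}"
  assumes j: "idx j = 1"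
  shows "eps_exp (alpha j) \<beta> = (\<Sum>l\<in>{2..<CARD('n) + 1}. int (Suc l) * mcoord \<beta> l)"
proof -
  let ?n = "CARD('n)"
  have "eps_exp (alpha j) \<beta> = (\<Sum>k=2..?n + 1. \<Sum>l\<in>{2..<k}. if l = k - 1 then int k * mcoord \<beta> l else 0)"
    unfolding eps_exp_def using j
    by (intro sum.cong refl) (auto simp: mcoord_alpha_1[OF j] comm_exp_def cartan_def)
  also have "\<dots> = (\<Sum>k=2..?n + 1. if 3 \<le> k then int k * mcoord \<beta> (k - 1) else 0)"
    by (intro sum.cong refl) auto
  also have "\<dots> = (\<Sum>k\<in>{3..?n + 1}. int k * mcoord \<beta> (k - 1))"
    by (intro sum.mono_neutral_cong_right) auto
  also have "\<dots> = (\<Sum>l\<in>{2..<?n + 1}. int (Suc l) * mcoord \<beta> l)"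
    by (rule sum.reindex_bij_witness[of _ Suc "\<lambda>k. k - 1"]) auto
  finally show ?thesis .
qed

text \<open>Therefore \<open>x\<^sub>j\<^sup>+\<close> undoes a move of \<open>x\<^sub>j\<^sup>-\<close> with the same sign.\<close>

lemma even_eps_exp_alpha_self: "even (eps_exp (alpha j) (alpha j))"
proof (cases "idx j = 1")
  case True
  have "even (int (Suc l) * mcoord (alpha j) l)" if "l \<in> {2..<CARD('a) + 1}" for l
    using that mcoord_alpha_1[OF True, of l] by auto
  then show ?thesis unfolding eps_exp_alpha_1[OF True] by (rule dvd_sum)
next
  case False
  then have j: "2 \<le> idx j" using idx_ge1[of j] by simp
  show ?thesis unfolding eps_exp_alpha_left[OF j] using mcoord_alpha[OF j, of "idx j - 1"] j idx_le[of j] by auto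
qed

lemma eps_exp_alpha_far_aux:
  fixes j k :: "'n::{finite,linorder}"
  assumes far: "idx j \<noteq> idx k" "idx j \<noteq> Suc (idx k)" "idx k \<noteq> Suc (idx j)" and lt: "idx j < idx k"
  shows "even (eps_exp (alpha j) (alpha k) - eps_exp (alpha k) (alpha j))"
proof -
  have k3: "3 \<le> idx k" using lt far idx_ge1[of j] by simp
  then have k: "2 \<le> idx k" by simp
  show ?thesis
  proof (cases "idx j = 1")
    case True
    have "eps_exp (alpha j) (alpha k) = (\<Sum>l\<in>{2..<CARD('n) + 1}. if l = idx k then int (Suc l) else 0)"
      unfolding eps_exp_alpha_1[OF True] by (intro sum.cong refl) (auto simp: mcoord_alpha[OF k])
    also have "\<dots> = int (Suc (idx k))" using k idx_le[of k] by simp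
    finally have 1: "eps_exp (alpha j) (alpha k) = int (Suc (idx k))" .
    have "eps_exp (alpha k) (alpha j) = int (idx k) - 1"
      unfolding eps_exp_alpha_left[OF k] using mcoord_alpha_1[OF True, of "idx k - 1"] k3 idx_le[of k] by (simp add: of_nat_diff)
    with 1 show ?thesis by simp
  next
    case False
    then have j: "2 \<le> idx j" using idx_ge1[of j] by simp
    show ?thesis unfolding eps_exp_alpha_left[OF j] eps_exp_alpha_left[OF k]
      using far mcoord_alpha[OF j, of "idx k - 1"] mcoord_alpha[OF k, of "idx j - 1"] idx_le[of j] idx_le[of k] j k by auto
  qed
qed

text \<open>For distant nodes \<open>e\<^sup>\<alpha>\<^sup>j\<close> and \<open>e\<^sup>\<alpha>\<^sup>k\<close> commute, also if one of them is \<open>e\<^sup>\<alpha>\<^sup>1\<close>.\<close>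

lemma eps_exp_alpha_far:
  fixes j k :: "'n::{finite,linorder}"
  assumes far: "idx j \<noteq> idx k" "idx j \<noteq> Suc (idx k)" "idx k \<noteq> Suc (idx j)"
  shows "even (eps_exp (alpha j) (alpha k) - eps_exp (alpha k) (alpha j))"
proof (cases "idx j < idx k")
  case False
  then have "idx k < idx j" using far(1) by linarith
  from eps_exp_alpha_far_aux[OF _ _ _ this] far show ?thesis by (auto simp: even_diff_iff)
qed (use eps_exp_alpha_far_aux far in blast)

lemma sg_cases: "sg j S = 1 \<or> sg j S = - 1"
  by (simp add: sg_def eps_def)

lemma sg_square: "sg j S * sg j S = 1"
  using sg_cases[of j S] by auto

lemma sg_far:
  fixes j k :: "'n::{finite,linorder}"
  assumes far: "idx j \<noteq> idx k" "idx j \<noteq> Suc (idx k)" "idx k \<noteq> Suc (idx j)"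
    and S: "idx j \<in> S" "Suc (idx j) \<notin> S" "idx k \<in> S" "Suc (idx k) \<notin> S"
  shows "sg j S * sg k (hop (idx j) (Suc (idx j)) S) = sg k S * sg j (hop (idx k) (Suc (idx k)) S)"
proof -
  have "even (eps_exp (alpha j) (alpha k) - eps_exp (alpha k) (alpha j))" by (rule eps_exp_alpha_far[OF far])
  then show ?thesis
    unfolding sg_def mu_hop[OF S(1,2)] mu_hop[OF S(3,4)] eps_def eps_exp_add eps_exp_uminus by auto
qed

lemma eps_alpha_hop:
  fixes j :: "'n::{finite,linorder}"
  assumes S: "idx j \<in> S" "Suc (idx j) \<notin> S"
  shows "eps (\<lambda>k. 1 * alpha j k) (mu (hop (idx j) (Suc (idx j)) S)) = sg j S"
  unfolding sg_def mu_hop[OF S] eps_def eps_exp_add eps_exp_uminus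
  using even_eps_exp_alpha_self[of j] by simp

subsection \<open>The action of the generators\<close>

lemma vop_eqI:
  assumes "\<gamma>' = \<gamma>" "\<And>k r. r > 0 \<Longrightarrow> C' k r = C k r" "\<And>k r. r > 0 \<Longrightarrow> A' k r = A k r" "\<And>\<beta>. \<chi>' \<beta> = \<chi> \<beta>"
  shows "vop C' A' \<gamma>' \<chi>' = vop C A \<gamma> \<chi>"
  unfolding assms(1) by (rule vop_cong) (fact assms)+

lemma vop_pair_f: "vop_pair (xA (- 1) j) (\<lambda>k. - 1 * alpha j k) (\<lambda>_. 1) (RC (idx i) S) (pole_f (idx i) S (idx j)) (zero_f (idx i) S (idx j))"
  using pairing_f int_form_alpha[of "- 1" j] by unfold_locales simp_all

lemma vop_pair_e: "vop_pair (xA 1 j) (\<lambda>k. 1 * alpha j k) (\<lambda>_. 1) (RC (idx i) S) (pole_e (idx i) S (idx j)) (zero_e (idx i) S (idx j))"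
  using pairing_e int_form_alpha[of 1 j] by unfold_locales simp_all

lemma vop_pair_k: "vop_pair (pA j) 0 (\<lambda>\<beta>. Q (2 * \<beta> j)) (RC (idx i) S) (pole_k (idx i) S (idx j)) (zero_k (idx i) S (idx j))"
  using pairing_k int_form_0 by unfold_locales (simp_all add: distrib_left Q_add)

lemma vop_pair_phi: "vop_pair (\<lambda>k r. 0) 0 (\<lambda>\<beta>. Q (- 2 * \<beta> j)) C 0 0"
  using pairing_phi int_form_0 by unfold_locales (simp_all add: algebra_simps flip: Q_add)

text \<open>\<open>\<phi>\<^sub>j\<close> has no annihilation part, hence no contraction and no pole.\<close>

theorem phi_R: "phi_op j \<^sub>\<bullet> R i S n = 0"
  unfolding phi_op_vop R_def by (rule vop_pair.bullet_no_pole[OF vop_pair_phi]) simp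

text \<open>If site \<open>j\<close> is empty there is no pole; if both sites are occupied the pole is cancelled by the zero.\<close>

theorem f_R:
  fixes i j :: "'n::{finite,linorder}"
  assumes S: "S \<in> configs (CARD('n) + 1) (idx i)"
  shows "x_op (- 1) j \<^sub>\<bullet> R i S n = (if idx j \<in> S \<and> Suc (idx j) \<notin> S
    then oscale (of_int (sg j S)) (R i (hop (idx j) (Suc (idx j)) S) n) else 0)"
proof -
  consider "idx j \<notin> S" | "idx j \<in> S" "Suc (idx j) \<in> S" | "idx j \<in> S" "Suc (idx j) \<notin> S" by blast
  then show ?thesis
  proof cases
    case 1
    then show ?thesis unfolding x_op_vop R_def
      by (subst vop_pair.bullet_no_pole[OF vop_pair_f]) (simp_all add: pole_f_def)
  next
    case 2
    have p: "pole_f (idx i) S (idx j) = Q (2 * height (idx i) (idx j) (cnt S (idx j)))" using 2 by (simp add: pole_f_def)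
    have "zero_f (idx i) S (idx j) = Q (2 * height (idx i) (idx j) (cnt S (idx j)))" using 2
      by (simp add: zero_f_def cnt_Suc height_def)
    with p 2 show ?thesis unfolding x_op_vop R_def
      by (subst vop_pair.bullet_pole[OF vop_pair_f p]) simp
  next
    case 3
    define m where "m = height (idx i) (idx j) (cnt S (idx j))"
    have p: "pole_f (idx i) S (idx j) = Q (2 * m)" "zero_f (idx i) S (idx j) = 0"
      using 3 by (simp_all add: pole_f_def zero_f_def m_def)
    have "vop_pair.fused (xC (- 1) j) (xA (- 1) j) (\<lambda>k. - 1 * alpha j k) (\<lambda>_. 1) (RC (idx i) S) (RA i S n) (mu S) (Rchi i S n) (2 * m)
      = R i (hop (idx j) (Suc (idx j)) S) n"
      unfolding vop_pair.fused_def[OF vop_pair_f] R_def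
      by (rule vop_eqI)
        (simp_all only: mu_hop[OF 3] RC_hop[OF S 3] RA_hop[OF S 3] Rchi_hop[OF S 3] m_def form_alpha_left floor_of_int, simp add: mult_ac)
    with 3 show ?thesis unfolding x_op_vop R_def[of i S]
      by (subst vop_pair.bullet_pole[OF vop_pair_f p(1)]) (simp add: p(2) sg_def)
  qed
qed

text \<open>The factor \<open>x\<^sub>j\<^sup>+\<close> meets the factor \<open>x\<^sub>j\<^sup>-(q\<^sup>m z)\<close> of the last passage at the point \<open>q\<^sup>m\<^sup>+\<^sup>1 z\<close>. Their creation
  parts and weights cancel, and their annihilation parts combine to that of \<open>\<psi>\<^sub>j(q\<^sup>m\<^sup>+\<^sup>1\<^sup>/\<^sup>2 z)\<close>.\<close>

theorem e_R:
  fixes i j :: "'n::{finite,linorder}"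
  assumes S: "S \<in> configs (CARD('n) + 1) (idx i)"
  shows "x_op 1 j \<^sub>\<bullet> R i S n = (if idx j \<notin> S \<and> Suc (idx j) \<in> S
    then oscale (of_int (sg j (hop (Suc (idx j)) (idx j) S))) (R i (hop (Suc (idx j)) (idx j) S) (bump j (cnt S (idx j)) n)) else 0)"
proof -
  consider "Suc (idx j) \<notin> S" | "idx j \<in> S" "Suc (idx j) \<in> S" | "idx j \<notin> S" "Suc (idx j) \<in> S" by blast
  then show ?thesis
  proof cases
    case 1
    then show ?thesis unfolding x_op_vop R_def
      by (subst vop_pair.bullet_no_pole[OF vop_pair_e]) (simp_all add: pole_e_def)
  next
    case 2
    have p: "pole_e (idx i) S (idx j) = Q (2 * height (idx i) (Suc (idx j)) (cnt S (Suc (idx j))))" using 2 by (simp add: pole_e_def)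
    have "zero_e (idx i) S (idx j) = Q (2 * height (idx i) (Suc (idx j)) (cnt S (Suc (idx j))))" using 2
      by (simp add: zero_e_def cnt_Suc height_def)
    with p 2 show ?thesis unfolding x_op_vop R_def
      by (subst vop_pair.bullet_pole[OF vop_pair_e p]) simp
  next
    case 3
    define T where "T = hop (Suc (idx j)) (idx j) S"
    have T: "T \<in> configs (CARD('n) + 1) (idx i)" unfolding T_def
      using 3 idx_ge1[of j] idx_le[of j] by (intro hop_configs[OF S]) auto
    have memT: "idx j \<in> T" "Suc (idx j) \<notin> T" using 3 by (auto simp: T_def hop_def)
    have ST: "S = hop (idx j) (Suc (idx j)) T" unfolding T_def using 3 by (simp add: hop_inverse)
    define k m where "k = cnt S (idx j)" and "m = height (idx i) (idx j) k"
    have kT: "cnt T (idx j) = k" unfolding k_def ST using cnt_hop[OF memT, of "idx j"] by simp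
    have k: "k < idx i" using valid_k[OF T memT] unfolding kT valid_def by simp
    have mT: "height (idx i) (idx j) (cnt T (idx j)) = m" by (simp add: kT m_def)
    have "height (idx i) (Suc (idx j)) (cnt S (Suc (idx j))) = m + 1"
      using 3 by (simp add: cnt_Suc m_def k_def height_def)
    then have p: "pole_e (idx i) S (idx j) = Q (2 * (m + 1))" "zero_e (idx i) S (idx j) = 0"
      using 3 by (simp_all add: pole_e_def zero_e_def)
    have "vop_pair.fused (xC 1 j) (xA 1 j) (\<lambda>k. 1 * alpha j k) (\<lambda>_. 1) (RC (idx i) S) (RA i S n) (mu S) (Rchi i S n) (2 * (m + 1))
      = R i T (bump j k n)"
      unfolding vop_pair.fused_def[OF vop_pair_e] R_def
    proof (rule vop_eqI)
      have "mu S = (\<lambda>k. - 1 * alpha j k) + mu T" unfolding ST by (rule mu_hop[OF memT])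
      then show "(\<lambda>k. 1 * alpha j k) + mu S = mu T" by (simp add: fun_eq_iff)
    next
      fix k' and r :: nat assume r: "r > 0"
      have "Q (2 * (m + 1)) ^ r * Q (- int r) = Q (2 * m) ^ r * Q (int r)"
        by (simp add: Q_power algebra_simps flip: Q_add)
      moreover have "RC (idx i) S k' r = Q (2 * m) ^ r * xC (- 1) j k' r + RC (idx i) T k' r"
        using RC_hop[OF T memT r, of k'] unfolding ST[symmetric] mT .
      ultimately show "Q (2 * (m + 1)) ^ r * xC 1 j k' r + RC (idx i) S k' r = RC (idx i) T k' r"
        by (simp add: xC_def)
    next
      fix k' and r :: nat assume r: "r > 0"
      have "RA i S n k' r = xA (- 1) j k' r / Q (2 * m) ^ r + RA i T n k' r"
        using RA_hop[OF T memT r, of n k'] unfolding ST[symmetric] mT .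
      moreover have "xA 1 j k' r / Q (2 * (m + 1)) ^ r + xA (- 1) j k' r / Q (2 * m) ^ r
        = (if k' = j then (Q 2 - Q (- 2)) * Q (- (2 * m + 1) * int r) else 0)"
      proof (cases "k' = j")
        case True
        have e: "Q (- int r) / Q (2 * (m + 1)) ^ r = Q (- (2 * m + 1) * int r) * Q (- 2 * int r)"
          "Q (int r) / Q (2 * m) ^ r = Q (- (2 * m + 1) * int r) * Q (2 * int r)"
          by (simp_all add: Q_power divide_eq_eq algebra_simps flip: Q_add)
        have "xA 1 j k' r / Q (2 * (m + 1)) ^ r + xA (- 1) j k' r / Q (2 * m) ^ r
          = (Q (int r) / Q (2 * m) ^ r - Q (- int r) / Q (2 * (m + 1)) ^ r) / qint (int r)"
          using True by (simp add: xA_def diff_divide_distrib mult.commute)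
        also have "\<dots> = Q (- (2 * m + 1) * int r) * (Q (2 * int r) - Q (- 2 * int r)) / qint (int r)"
          unfolding e by (simp only: right_diff_distrib)
        also have "\<dots> = (Q 2 - Q (- 2)) * Q (- (2 * m + 1) * int r)"
          unfolding q_diff_qint[symmetric] using r by simp
        finally show ?thesis using True by simp
      qed (simp add: xA_def)
      ultimately show "xA 1 j k' r / Q (2 * (m + 1)) ^ r + RA i S n k' r = RA i T (bump j k n) k' r"
        unfolding RA_bump[OF k] m_def[symmetric] by (simp only: add.assoc[symmetric]) (simp only: add.commute)
    next
      fix \<beta> :: "'n wgt"
      have "Rchi i S n \<beta> = Q (- 2 * m * \<beta> j) * Rchi i T n \<beta>"
        using Rchi_hop[OF T memT, of n \<beta>] unfolding ST[symmetric] mT .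
      moreover have "Q (2 * (m + 1) * \<lfloor>form (\<lambda>k. 1 * alpha j k) \<beta>\<rfloor>) * Q (- 2 * m * \<beta> j) = Q (2 * \<beta> j)"
        unfolding form_alpha_left floor_of_int by (simp add: algebra_simps flip: Q_add)
      ultimately show "1 * Q (2 * (m + 1) * \<lfloor>form (\<lambda>k. 1 * alpha j k) \<beta>\<rfloor>) * Rchi i S n \<beta> = Rchi i T (bump j k n) \<beta>"
        unfolding Rchi_bump[OF k] by (simp only: mult_1 mult.assoc[symmetric])
    qed
    then have "x_op 1 j \<^sub>\<bullet> R i S n = oscale (of_int (sg j T)) (R i T (bump j k n))"
      unfolding x_op_vop R_def[of i S]
      by (subst vop_pair.bullet_pole[OF vop_pair_e p(1)]) (simp add: p(2) eps_alpha_hop[OF memT, unfolded ST[symmetric], simplified])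
    with 3 show ?thesis unfolding T_def k_def by simp
  qed
qed

text \<open>The pole is again at height \<open>m + 1/2\<close>; the factor \<open>1 - c'/c\<close> gives \<open>\<plusminus>(q - q\<^sup>-\<^sup>1)\<close> up to a power of \<open>q\<close>, which is cancelled
  by the scalar part of \<open>\<psi>\<^sub>j\<close>.\<close>

theorem k_R:
  fixes i j :: "'n::{finite,linorder}"
  assumes S: "S \<in> configs (CARD('n) + 1) (idx i)"
  shows "psi_op j \<^sub>\<bullet> R i S n = oscale ((Q 2 - Q (- 2)) * of_int (mu S j)) (R i S (bump j (cnt S (idx j)) n))"
proof (cases "idx j \<in> S \<longleftrightarrow> Suc (idx j) \<in> S")
  case True
  then have "mu S j = 0" by (auto simp: mu_def)
  moreover have "psi_op j \<^sub>\<bullet> R i S n = 0" unfolding psi_op_vop R_def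
    by (rule vop_pair.bullet_no_pole[OF vop_pair_k]) (use True in \<open>auto simp: pole_k_def\<close>)
  ultimately show ?thesis by simp
next
  case False
  define k m where "k = cnt S (idx j)" and "m = height (idx i) (idx j) k"
  have "valid (CARD('n) + 1) (idx i) (idx j) k" unfolding k_def
    using False idx_ge1[of j] idx_le[of j] by (intro valid_cnt[OF S]) auto
  then have k: "k < idx i" by (simp add: valid_def)
  have p: "pole_k (idx i) S (idx j) = Q (2 * m + 1)" using False by (simp add: pole_k_def m_def k_def)
  have "vop_pair.fused (\<lambda>k r. 0) (pA j) 0 (\<lambda>\<beta>. Q (2 * \<beta> j)) (RC (idx i) S) (RA i S n) (mu S) (Rchi i S n) (2 * m + 1)
      = R i S (bump j k n)"
    unfolding vop_pair.fused_def[OF vop_pair_k] R_def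
  proof (rule vop_eqI)
    fix k' and r :: nat
    have "1 / Q (2 * m + 1) ^ r = Q (- (2 * m + 1) * int r)" unfolding Q_power mult_minus_left Q_minus ..
    moreover have "pA j k' r / Q (2 * m + 1) ^ r = (if k' = j then (Q 2 - Q (- 2)) * (1 / Q (2 * m + 1) ^ r) else 0)"
      by (simp add: pA_def)
    ultimately show "pA j k' r / Q (2 * m + 1) ^ r + RA i S n k' r = RA i S (bump j k n) k' r"
      unfolding RA_bump[OF k] m_def[symmetric] by (simp only: add.commute)
  qed (simp_all add: Rchi_bump[OF k])
  moreover have "Q (2 * mu S j) * (1 - zero_k (idx i) S (idx j) / Q (2 * m + 1)) = (Q 2 - Q (- 2)) * of_int (mu S j)"
  proof (cases "idx j \<in> S")
    case True
    then have mu: "mu S j = 1" and z: "zero_k (idx i) S (idx j) = Q (2 * m + 1) * Q (- 4)" using False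
      by (simp_all add: mu_def zero_k_def m_def k_def flip: Q_add)
    have "Q 2 * Q (- 4) = Q (- 2)" by (simp flip: Q_add)
    then show ?thesis unfolding mu z by (simp add: right_diff_distrib)
  next
    case F: False
    then have mu: "mu S j = - 1" and z: "zero_k (idx i) S (idx j) = Q (2 * m + 1) * Q 4" using False
      by (simp_all add: mu_def zero_k_def m_def k_def flip: Q_add)
    have "Q (- 2) * Q 4 = Q 2" by (simp flip: Q_add)
    then show ?thesis unfolding mu z by (simp add: right_diff_distrib)
  qed
  ultimately show ?thesis unfolding psi_op_vop R_def[of i S] k_def[symmetric]
    by (subst vop_pair.bullet_pole[OF vop_pair_k p]) (simp add: p)
qed

subsection \<open>Linear independence of the vertex operators\<close>

lemma sum_of_bool: "finite A \<Longrightarrow> (\<Sum>x\<in>A. of_bool (x \<in> S) :: int) = int (card (S \<inter> A))"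
  by (simp add: of_bool_def sum.If_cases Int_commute)

text \<open>The weight gives the differences of the occupation numbers of neighbouring sites, and the number of
  particles determines the rest.\<close>

lemma mu_inject:
  fixes S T :: "nat set"
  assumes S: "S \<in> configs (CARD('n::{finite,linorder}) + 1) i" and T: "T \<in> configs (CARD('n) + 1) i"
    and eq: "(mu S :: 'n wgt) = mu T"
  shows "S = T"
proof -
  \<comment> \<open>This difference is the same at all sites, and it sums up to zero.\<close>
  define d where "d p = (of_bool (p \<in> S) - of_bool (p \<in> T) :: int)" for p
  have step: "d (Suc p) = d p" if p: "1 \<le> p" "p \<le> CARD('n)" for p
  proof -
    obtain j :: 'n where j: "idx j = p" using p bij_idx[where 'n = 'n] unfolding bij_betw_def by (metis atLeastAtMost_iff imageE)
    show ?thesis using fun_cong[OF eq, of j] unfolding mu_def j by (simp add: d_def of_bool_def split: if_splits)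
  qed
  have const: "d (Suc p) = d 1" if "p \<le> CARD('n)" for p
    using that
  proof (induction p)
    case (Suc p)
    then show ?case using step[of "Suc p"] by simp
  qed simp
  have "(\<Sum>p\<in>{1..CARD('n) + 1}. d p) = int (card (S \<inter> {1..CARD('n) + 1})) - int (card (T \<inter> {1..CARD('n) + 1}))"
    unfolding d_def sum_subtractf by (simp only: sum_of_bool finite_atLeastAtMost)
  moreover have "S \<inter> {1..CARD('n) + 1} = S" "T \<inter> {1..CARD('n) + 1} = T" "card S = i" "card T = i"
    using S T by (auto simp: configs_def)
  ultimately have "(\<Sum>p\<in>{1..CARD('n) + 1}. d p) = 0" by (simp only: diff_self)
  moreover have "(\<Sum>p\<in>{1..CARD('n) + 1}. d p) = (\<Sum>p\<in>{1..CARD('n) + 1}. d 1)"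
  proof (intro sum.cong refl)
    fix p assume "p \<in> {1..CARD('n) + 1}"
    then show "d p = d 1" using const[of "p - 1"] by auto
  qed
  ultimately have "d 1 = 0" by simp
  have "d p = 0" for p
  proof (cases "1 \<le> p \<and> p \<le> CARD('n) + 1")
    case True
    then show ?thesis using const[of "p - 1"] \<open>d 1 = 0\<close> by auto
  next
    case False
    then show ?thesis using S T by (auto simp: d_def configs_def)
  qed
  then show ?thesis unfolding d_def by (auto simp: of_bool_def set_eq_iff split: if_splits; metis zero_neq_one diff_0_right diff_self zero_neq_neg_one diff_0)
qed

text \<open>To remove a vector \<open>a\<close> from a relation, apply \<open>op t - ev t a\<close> for an index \<open>t\<close> that separates \<open>a\<close> from the
  vector of interest.\<close>

context vector_space begin

lemma joint_eigenvectors_sum: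
  assumes "finite F"
    and lin: "\<And>t x y. op t (x + y) = op t x + op t y" "\<And>t a x. op t (a *s x) = a *s op t x"
    and ev: "\<And>t x. x \<in> F \<Longrightarrow> op t (v x) = ev t x *s v x"
    and nz: "\<And>x. x \<in> F \<Longrightarrow> v x \<noteq> 0"
    and sep: "\<And>x y. x \<in> F \<Longrightarrow> y \<in> F \<Longrightarrow> x \<noteq> y \<Longrightarrow> \<exists>t. ev t x \<noteq> ev t y"
    and zero: "(\<Sum>x\<in>F. c x *s v x) = 0" and x: "x \<in> F"
  shows "c x = 0"
  using assms
proof (induction F arbitrary: c x rule: finite_induct)
  case (insert a F)
  have op0: "op t 0 = 0" for t using insert.prems(2)[of t 0 0] by simp
  have ops: "op t (sum f A) = (\<Sum>x\<in>A. op t (f x))" if "finite A" for t f and A :: "'c set"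
    using that by (induction A rule: finite_induct) (simp_all add: op0 insert.prems(1))
  have rest: "c y = 0" if y: "y \<in> F" for y
  proof -
    have "a \<noteq> y" using insert.hyps(2) y by auto
    then obtain t where t: "ev t y \<noteq> ev t a" using insert.prems(5)[of a y] y by (metis insertCI)
    have "op t (\<Sum>x\<in>insert a F. c x *s v x) - ev t a *s (\<Sum>x\<in>insert a F. c x *s v x) = 0"
      unfolding insert.prems(6) by (simp add: op0)
    moreover have "op t (\<Sum>x\<in>insert a F. c x *s v x) = (\<Sum>x\<in>insert a F. (c x * ev t x) *s v x)"
      using insert.hyps(1) by (subst ops) (simp_all add: insert.prems(2,3))
    moreover have "ev t a *s (\<Sum>x\<in>insert a F. c x *s v x) = (\<Sum>x\<in>insert a F. (ev t a * c x) *s v x)"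
      by (simp add: scale_sum_right scale_right_distrib insert.hyps)
    ultimately have "(\<Sum>x\<in>insert a F. (c x * (ev t x - ev t a)) *s v x) = 0"
      by (simp add: algebra_simps flip: sum_subtractf)
    then have "(\<Sum>x\<in>F. (c x * (ev t x - ev t a)) *s v x) = 0"
      using insert.hyps by simp
    then have "c y * (ev t y - ev t a) = 0"
      using insert.prems(1-5) y by (intro insert.IH[of "\<lambda>x. c x * (ev t x - ev t a)" y]) auto
    with t show ?thesis by simp
  qed
  then have "c a *s v a = 0" using insert.prems(6) insert.hyps by simp
  then have "c a = 0" using insert.prems(4)[of a] by simp
  with rest insert.prems(7) show ?case by auto
qed simp

lemma joint_eigenvectors_independent:
  assumes lin: "\<And>t x y. op t (x + y) = op t x + op t y" "\<And>t a x. op t (a *s x) = a *s op t x"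
    and ev: "\<And>t x. x \<in> X \<Longrightarrow> op t (v x) = ev t x *s v x"
    and nz: "\<And>x. x \<in> X \<Longrightarrow> v x \<noteq> 0"
    and sep: "\<And>x y. x \<in> X \<Longrightarrow> y \<in> X \<Longrightarrow> x \<noteq> y \<Longrightarrow> \<exists>t. ev t x \<noteq> ev t y"
  shows "inj_on v X" "independent (v ` X)"
proof -
  show inj: "inj_on v X"
  proof (rule inj_onI, rule ccontr)
    fix x y assume xy: "x \<in> X" "y \<in> X" "v x = v y" "x \<noteq> y"
    then obtain t where "ev t x \<noteq> ev t y" using sep by blast
    moreover have "(ev t x - ev t y) *s v x = 0"
      using ev[OF xy(1), of t] ev[OF xy(2), of t] xy(3) by (auto simp: scale_left_diff_distrib)
    ultimately show False using nz[OF xy(1)] by simp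
  qed
  show "independent (v ` X)"
    unfolding independent_explicit_module
  proof (intro allI impI)
    fix T u w assume T: "finite T" "T \<subseteq> v ` X" and zero: "(\<Sum>w\<in>T. u w *s w) = 0" and w: "w \<in> T"
    obtain F where F: "F \<subseteq> X" "finite F" "T = v ` F" using T by (metis finite_subset_image)
    obtain x where x: "x \<in> F" "w = v x" using w F by auto
    have "(\<Sum>x\<in>F. u (v x) *s v x) = 0"
      using zero inj_on_subset[OF inj F(1)] unfolding F(3) by (simp add: sum.reindex)
    moreover have "\<exists>t. ev t x \<noteq> ev t y" if "x \<in> F" "y \<in> F" "x \<noteq> y" for x y using sep that F(1) by blast
    ultimately show "u w = 0"
      unfolding x(2) using x(1) F by (intro joint_eigenvectors_sum[of F op v ev "\<lambda>x. u (v x)" x]) (auto intro: ev lin dest: nz)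
  qed
qed

end

text \<open>The commutator with \<open>z a\<^sub>k\<^sup>*(-1)\<close>. It has the vertex operators as eigenvectors and reads off the coefficient
  of \<open>a\<^sub>k(1)\<close> in the annihilation part.\<close>

definition heis_comm :: "'n::{finite,linorder} \<Rightarrow> 'n oper \<Rightarrow> 'n oper" where
  "heis_comm k b = (\<lambda>v s. b (heis_dual k (- 1) v) (s - 1) - heis_dual k (- 1) (b v (s - 1)))"

lemma heis_commuting_dual: "heis_commuting g \<Longrightarrow> g (heis_dual k l v) = heis_dual k l (g v)"
  unfolding heis_dual_def by (simp add: module_hom.sum[OF heis_commuting_linear] module_hom.scale[OF heis_commuting_linear] heis_commuting_def)

lemma heis_dual_single: "heis_dual k l (single \<beta> p) = single \<beta> (lookup (heis_dual k l (single \<beta> p)) \<beta>)"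
  using heis_commuting_dual[OF heis_commuting_wproj, of \<beta> k l "single \<beta> p"] by (simp add: wproj_def)

lemma heis_comm_vop: "heis_comm k (vop C A \<gamma> \<chi>) = oscale (A k 1) (vop C A \<gamma> \<chi>)"
proof (intro ext)
  fix v s
  let ?L = "\<lambda>v. heis_comm k (vop C A \<gamma> \<chi>) v s" and ?R = "\<lambda>v. oscale (A k 1) (vop C A \<gamma> \<chi>) v s"
  show "?L v = ?R v"
  proof (rule V_linear_eqI[of ?L ?R])
    show "V_linear ?L" unfolding heis_comm_def
      by (intro V_linear_diff V_linear_comp[OF vop_linear heis_dual_linear] V_linear_comp[OF heis_dual_linear vop_linear])
    show "V_linear ?R" unfolding oscale_def by (intro V_linear_scaled vop_linear)
    fix \<beta> and p :: "'a K1"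
    define p' where "p' = lookup (heis_dual k (- 1) (single \<beta> p)) \<beta>"
    have p': "heis_dual k (- 1) (single \<beta> p) = single \<beta> p'" unfolding p'_def by (rule heis_dual_single)
    have p'': "single (\<gamma> + \<beta>) p' = heis_dual k (- 1) (single (\<gamma> + \<beta>) p)"
      using heis_commuting_dual[OF heis_commuting_wshift, of \<gamma> k "- 1" "single \<beta> p"] by (simp add: p' wshift_single)
    have int: "s - 1 - form \<gamma> \<beta> \<in> \<int> \<longleftrightarrow> s - form \<gamma> \<beta> \<in> \<int>"
    proof
      assume "s - 1 - form \<gamma> \<beta> \<in> \<int>"
      then have "s - 1 - form \<gamma> \<beta> + 1 \<in> \<int>" by (rule Ints_add) simp
      then show "s - form \<gamma> \<beta> \<in> \<int>" by simp
    next
      assume "s - form \<gamma> \<beta> \<in> \<int>"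
      then have "s - form \<gamma> \<beta> - 1 \<in> \<int>" by (rule Ints_diff) simp
      then show "s - 1 - form \<gamma> \<beta> \<in> \<int>" by (simp add: algebra_simps)
    qed
    show "?L (single \<beta> p) = ?R (single \<beta> p)"
    proof (cases "s - form \<gamma> \<beta> \<in> \<int>")
      case True
      then obtain l where l: "s - form \<gamma> \<beta> = of_int l" by (auto elim: Ints_cases)
      then have l1: "s - 1 - form \<gamma> \<beta> = of_int (l - 1)" by simp
      show ?thesis
        unfolding heis_comm_def oscale_def p' vop_single vop1_def l l1 p''
        by (simp add: osc_heis_dual module_hom.scale[OF heis_dual_linear] V.scale_right_distrib mult.commute)
    qed (simp add: heis_comm_def oscale_def p' vop_single vop1_def int module_hom.zero[OF heis_dual_linear])
  qed
qed

lemma heis_comm_add: "heis_comm k (x + y) = heis_comm k x + heis_comm k y"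
  by (intro ext) (simp add: heis_comm_def module_hom.add[OF heis_dual_linear])

lemma heis_comm_scale: "heis_comm k (oscale c x) = oscale c (heis_comm k x)"
  by (intro ext) (simp add: heis_comm_def oscale_def module_hom.scale[OF heis_dual_linear] V.scale_right_diff_distrib)

definition basis :: "'n::{finite,linorder} \<Rightarrow> (nat set \<times> 'n mult) set" where
  "basis i = configs (CARD('n) + 1) (idx i) \<times> {n. \<forall>j k. n j k \<noteq> 0 \<longrightarrow> valid (CARD('n) + 1) (idx i) (idx j) k}"

lemma R_nonzero: "R i S n \<noteq> 0"
  unfolding R_def by (rule vop_nonzero) (rule Rchi_0)

lemma RA_inject:
  assumes n: "(S, n) \<in> basis i" "(S, n') \<in> basis i" and eq: "\<And>j. RA i S n j 1 = RA i S n' j 1"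
  shows "n = n'"
proof (intro ext)
  fix j :: 'a and k
  define h where "h k = - (2 * height (idx i) (idx j) k + 1)" for k
  have inj: "inj_on h {..<idx i}" by (auto simp: inj_on_def h_def height_def)
  have "(Q 2 - Q (- 2)) * (\<Sum>k<idx i. of_nat (n j k) * Q (h k)) = (Q 2 - Q (- 2)) * (\<Sum>k<idx i. of_nat (n' j k) * Q (h k))"
    using eq[of j] by (simp add: RA_def h_def)
  then have "(\<Sum>k<idx i. of_nat (n j k) * Q (h k)) = (\<Sum>k<idx i. of_nat (n' j k) * Q (h k))"
    using q_diff_nonzero by simp
  then have "(\<Sum>k<idx i. of_int (int (n j k) - int (n' j k)) * Q (h k)) = 0"
    by (simp add: left_diff_distrib sum_subtractf)
  then have z: "(\<Sum>e\<in>h ` {..<idx i}. of_int ((\<lambda>k. int (n j k) - int (n' j k)) (inv_into {..<idx i} h e)) * Q e) = 0"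
    unfolding sum.reindex[OF inj] o_def by (simp only: inv_into_f_f[OF inj] cong: sum.cong)
  show "n j k = n' j k"
  proof (cases "k < idx i")
    case True
    then have "int (n j k) - int (n' j k) = 0"
      using Q_independent[OF _ z, of "h k"] by (simp add: inv_into_f_f[OF inj])
    then show ?thesis by simp
  next
    case False
    then have "\<not> valid (CARD('a) + 1) (idx i) (idx j) k" by (simp add: valid_def)
    then have "n j k = 0" "n' j k = 0" using n by (auto simp: basis_def)
    then show ?thesis by simp
  qed
qed

text \<open>The weight determines \<open>S\<close>. The annihilation coefficients with \<open>r = 1\<close> then determine \<open>n\<close>, because the
  powers of \<open>q\<close> at different heights are independent.\<close>

theorem R_independent:
  "inj_on (\<lambda>(S, n). R i S n) (basis i)" "O.independent ((\<lambda>(S, n). R i S n) ` basis i)"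
proof -
  let ?v = "\<lambda>(S, n). R i S n"
  define T where "T t = (case t of Inl \<beta> \<Rightarrow> (\<lambda>b. wt_part b \<beta>) | Inr k \<Rightarrow> heis_comm k)" for t :: "'a wgt + 'a"
  define ev where "ev t x = (case t of Inl \<beta> \<Rightarrow> (if \<beta> = mu (fst x) then 1 else 0) | Inr k \<Rightarrow> RA i (fst x) (snd x) k 1)" for t :: "'a wgt + 'a" and x
  have 1: "T t (x + y) = T t x + T t y" for t x y by (cases t) (simp_all add: T_def wt_part_add heis_comm_add)
  have 2: "T t (oscale a x) = oscale a (T t x)" for t a x by (cases t) (simp_all add: T_def wt_part_oscale heis_comm_scale)
  have 3: "T t (?v x) = oscale (ev t x) (?v x)" for t x
    by (cases t; cases x) (simp_all add: T_def ev_def R_def wt_part_vop heis_comm_vop)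
  have 4: "?v x \<noteq> 0" for x by (cases x) (simp add: R_nonzero)
  have 5: "\<exists>t. ev t x \<noteq> ev t y" if xy: "x \<in> basis i" "y \<in> basis i" "x \<noteq> y" for x y
  proof (cases "mu (fst x) = (mu (fst y) :: 'a wgt)")
    case False
    then have "ev (Inl (mu (fst x))) x \<noteq> ev (Inl (mu (fst x))) y" by (simp add: ev_def)
    then show ?thesis ..
  next
    case True
    then have S: "fst x = fst y" using xy by (intro mu_inject[where 'n = 'a]) (auto simp: basis_def)
    show ?thesis
    proof (rule ccontr)
      assume "\<nexists>t. ev t x \<noteq> ev t y"
      then have "ev (Inr j) x = ev (Inr j) y" for j by blast
      then have "RA i (fst x) (snd x) j 1 = RA i (fst x) (snd y) j 1" for j by (simp add: ev_def S)
      moreover have "(fst x, snd x) \<in> basis i" "(fst x, snd y) \<in> basis i"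
        using xy(1,2) by simp (use xy(2) in \<open>simp add: S\<close>)
      ultimately have "snd x = snd y" using RA_inject by blast
      with S xy(3) show False by (simp add: prod_eq_iff)
    qed
  qed
  show "inj_on ?v (basis i)"
    by (rule O.joint_eigenvectors_independent(1)[where op = T and v = ?v and X = "basis i" and ev = ev], rule 1, rule 2, rule 3, rule 4, rule 5)
  show "O.independent (?v ` basis i)"
    by (rule O.joint_eigenvectors_independent(2)[where op = T and v = ?v and X = "basis i" and ev = ev], rule 1, rule 2, rule 3, rule 4, rule 5)
qed

section \<open>Representations of the quantum group\<close>

lemma fconst_add: "fconst (a + b) = fconst a + fconst b"
  by (simp add: fconst_def single_add)

lemma fconst_mult: "fconst (a * b) = fconst a * fconst b"
  by (simp add: fconst_def mult_single)

lemma fconst_commute: "fconst c * x = x * fconst c"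
  by (rule additive_eqI[of "\<lambda>x. fconst c * x" "\<lambda>x. x * fconst c"])
    (simp_all add: distrib_left distrib_right fconst_def mult_single mult.commute)

lemma uq_const_add: "uq_const (a + b) = uq_const a + uq_const b"
  by transfer (simp add: fconst_add uq_rel_def uq_ideal.zero)

lemma uq_const_mult: "uq_const (a * b) = uq_const a * uq_const b"
  by transfer (simp add: fconst_mult uq_rel_def uq_ideal.zero)

lemma uq_const_1: "uq_const 1 = 1"
  by transfer (simp add: fconst_def uq_rel_def uq_ideal.zero)

lemma uq_const_0: "uq_const 0 = 0"
  using uq_const_add[of 0 0] by simp

lemma uq_const_commute: "uq_const c * x = x * uq_const c"
  by transfer (simp add: fconst_commute uq_rel_def uq_ideal.zero)

lemma uq_cases:
  obtains p where "u = abs_uq p"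
  using Quotient3_abs_rep[OF Quotient3_uq, of u] by metis

lemma uq_induct [case_names const gen add mult]:
  fixes u :: "'n::{finite,linorder} uq"
  assumes c: "\<And>c. P (uq_const c)" and g: "\<And>g. P (uq_gen g)"
    and a: "\<And>x y. P x \<Longrightarrow> P y \<Longrightarrow> P (x + y)" and m: "\<And>x y. P x \<Longrightarrow> P y \<Longrightarrow> P (x * y)"
  shows "P u"
proof -
  obtain p where u: "u = abs_uq p" by (rule uq_cases)
  have single: "P (abs_uq (single w c))" for w c
  proof (cases w)
    case (Word l)
    have "P (abs_uq (single (Word l) c))" for l
    proof (induction l)
      case Nil
      have "single (Word []) c = (fconst c :: 'n falg)" by (simp add: fconst_def zero_word_def)
      then show ?case using c[of c] by (simp add: uq_const.abs_eq)
    next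
      case (Cons g l)
      have "single (Word (g # l)) c = fgen g * single (Word l) c" by (simp add: fgen_def mult_single)
      then show ?case using m[OF g Cons] by (simp add: uq_gen.abs_eq times_uq.abs_eq)
    qed
    then show ?thesis by (simp add: Word)
  qed
  have "P (abs_uq (\<Sum>k\<in>A. single k (lookup p k)))" if "finite A" for A
    using that
  proof (induction A rule: finite_induct)
    case empty
    then show ?case using single[of 0 0] by simp
  next
    case (insert k A)
    then show ?case using a[OF single insert.IH] by (simp add: plus_uq.abs_eq)
  qed
  from this[of "keys p"] show ?thesis by (simp add: u flip: poly_mapping_decomp)
qed

text \<open>Operators for the generators on a vector space. In place of the Serre relations for adjacent nodes it is
  assumed that each of their terms vanishes, as is the case in minuscule modules.\<close>

locale minuscule_operators = vector_space sc for sc :: "scal \<Rightarrow> 'b::ab_group_add \<Rightarrow> 'b" +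
  fixes oper :: "'n::{finite,linorder} gen \<Rightarrow> 'b \<Rightarrow> 'b"
  assumes lin: "module_hom sc sc (oper g)"
    and KK: "oper (gK i) (oper (gK j) x) = oper (gK j) (oper (gK i) x)"
    and KKi: "oper (gK i) (oper (gKi i) x) = x" "oper (gKi i) (oper (gK i) x) = x"
    and KE: "oper (gK i) (oper (gE j) (oper (gKi i) x)) = sc (qq powi cartan (idx i) (idx j)) (oper (gE j) x)"
    and KF: "oper (gK i) (oper (gF j) (oper (gKi i) x)) = sc (qq powi (- cartan (idx i) (idx j))) (oper (gF j) x)"
    and EF_comm: "oper (gE i) (oper (gF j) x) - oper (gF j) (oper (gE i) x)
      = (if i = j then sc (1 / (qq - qq powi (- 1))) (oper (gK i) x - oper (gKi i) x) else 0)"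
    and square: "y = gE \<or> y = gF \<Longrightarrow> oper (y i) (oper (y i) x) = 0"
    and adjacent: "y = gE \<or> y = gF \<Longrightarrow> cartan (idx i) (idx j) = - 1 \<Longrightarrow> oper (y i) (oper (y j) (oper (y i) x)) = 0"
    and far: "y = gE \<or> y = gF \<Longrightarrow> cartan (idx i) (idx j) = 0 \<Longrightarrow> oper (y i) (oper (y j) x) = oper (y j) (oper (y i) x)"
begin

lemmas oper_add = module_hom.add[OF lin] and oper_scale = module_hom.scale[OF lin]
  and oper_zero [simp] = module_hom.zero[OF lin]

definition wact :: "'n gen word \<Rightarrow> 'b \<Rightarrow> 'b" where
  "wact w x = (case w of Word l \<Rightarrow> foldr oper l x)"

definition fact_on :: "'n falg \<Rightarrow> 'b \<Rightarrow> 'b" where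
  "fact_on p x = (\<Sum>w\<in>keys p. sc (lookup p w) (wact w x))"

lemma wact_add: "wact (v + w) x = wact v (wact w x)"
  by (cases v; cases w) (simp add: wact_def)

lemma wact_lin: "wact w (x + y) = wact w x + wact w y" "wact w (sc c x) = sc c (wact w x)"
proof -
  obtain l where w: "w = Word l" by (cases w)
  show "wact w (x + y) = wact w x + wact w y" "wact w (sc c x) = sc c (wact w x)"
    unfolding w wact_def by (induction l) (simp_all add: oper_add oper_scale)
qed

lemma fact_on_add: "fact_on (p + q) x = fact_on p x + fact_on q x"
  unfolding fact_on_def by (rule keys_sum_add) (simp_all add: scale_left_distrib)

lemma fact_on_single: "fact_on (single w c) x = sc c (wact w x)"
  unfolding fact_on_def by (rule sum_keys_single) simp

lemma fact_on_lin: "fact_on p (x + y) = fact_on p x + fact_on p y" "fact_on p (sc c x) = sc c (fact_on p x)"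
  by (simp_all add: fact_on_def wact_lin scale_right_distrib sum.distrib scale_sum_right mult.commute)

text \<open>Both factors enter additively, so it suffices to multiply words.\<close>

lemma fact_on_mult: "fact_on (p * q) x = fact_on p (fact_on q x)"
proof (rule additive_eqI[of "\<lambda>p. fact_on (p * q) x" "\<lambda>p. fact_on p (fact_on q x)"])
  fix v c
  show "fact_on (single v c * q) x = fact_on (single v c) (fact_on q x)"
    by (rule additive_eqI[of "\<lambda>q. fact_on (single v c * q) x" "\<lambda>q. fact_on (single v c) (fact_on q x)"])
      (simp_all add: distrib_left fact_on_add fact_on_lin mult_single fact_on_single wact_add wact_lin)
qed (simp_all add: distrib_right fact_on_add)

lemma fact_on_zero [simp]: "fact_on 0 x = 0" "fact_on p 0 = 0"
  using fact_on_add[of 0 0 x] fact_on_lin(1)[of p 0 0] by simp_all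

lemma fact_on_diff: "fact_on (p - q) x = fact_on p x - fact_on q x"
  using fact_on_add[of "p - q" q x] by (simp add: algebra_simps)

lemma fact_on_gen: "fact_on (fgen g) x = oper g x"
  by (simp add: fgen_def fact_on_single wact_def)

lemma fact_on_const: "fact_on (fconst c) x = sc c x"
  by (simp add: fconst_def fact_on_single wact_def zero_word_def)

lemma fact_on_one: "fact_on 1 x = x"
  using fact_on_const[of 1 x] by (simp add: fconst_def)

lemma fact_on_serre:
  assumes y: "y = gE \<or> y = gF" and ij: "i \<noteq> j"
  shows "fact_on (serre y i j) x = 0"
proof (cases "cartan (idx i) (idx j) = - 1")
  case True
  have "serre y i j = (\<Sum>s\<le>2. fconst ((- 1) ^ s * qfact 2 / (qfact s * qfact (2 - s)))
       * fgen (y i) ^ (2 - s) * fgen (y j) * fgen (y i) ^ s)"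
    by (simp add: serre_def Let_def True)
  also have "\<dots> = fconst (qfact 2 / qfact 0 / qfact 2) * fgen (y i) * fgen (y i) * fgen (y j)
     + fconst (- qfact 2 / qfact 1 / qfact 1) * fgen (y i) * fgen (y j) * fgen (y i)
     + fconst (qfact 2 / qfact 2 / qfact 0) * fgen (y j) * fgen (y i) * fgen (y i)"
    by (simp add: numeral_2_eq_2 mult.assoc)
  finally show ?thesis
    by (simp add: fact_on_add fact_on_mult fact_on_gen fact_on_const square[OF y] adjacent[OF y True] mult.assoc)
next
  case False
  with ij have c: "cartan (idx i) (idx j) = 0" by (auto simp: cartan_def)
  have "serre y i j = (\<Sum>s\<le>1. fconst ((- 1) ^ s * qfact 1 / (qfact s * qfact (1 - s)))
       * fgen (y i) ^ (1 - s) * fgen (y j) * fgen (y i) ^ s)"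
    by (simp add: serre_def Let_def c)
  also have "\<dots> = fconst 1 * fgen (y i) * fgen (y j) + fconst (- 1) * fgen (y j) * fgen (y i)"
    by (simp add: qfact_def)
  finally show ?thesis
    by (simp add: fact_on_add fact_on_mult fact_on_gen fact_on_const far[OF y c] mult.assoc)
qed

lemma fact_on_rel: "r \<in> uq_rels \<Longrightarrow> fact_on r x = 0"
proof (induction rule: uq_rels.induct)
  case (EF i j)
  show ?case
  proof (cases "i = j")
    case True
    then show ?thesis using EF_comm[of i j x] by (simp add: fact_on_diff fact_on_mult fact_on_gen fact_on_const)
  next
    case False
    then show ?thesis using EF_comm[of i j x] by (simp add: fact_on_diff fact_on_mult fact_on_gen)
  qed
qed (simp_all add: fact_on_diff fact_on_mult fact_on_gen fact_on_const fact_on_one fact_on_serre KK KKi KE KF mult.assoc)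

lemma fact_on_ideal: "p \<in> uq_ideal \<Longrightarrow> fact_on p x = 0"
  by (induction arbitrary: x rule: uq_ideal.induct) (simp_all add: fact_on_mult fact_on_rel fact_on_add)

definition uqact :: "'n uq \<Rightarrow> 'b \<Rightarrow> 'b" where
  "uqact u = fact_on (rep_uq u)"

lemma uqact_abs: "uqact (abs_uq p) = fact_on p"
proof
  fix x
  have "uq_rel (rep_uq (abs_uq p)) p"
    using Quotient3_rep_abs[OF Quotient3_uq] equivp_reflp[OF equivp_uq_rel] by blast
  then show "uqact (abs_uq p) x = fact_on p x"
    unfolding uqact_def uq_rel_def using fact_on_ideal[of "rep_uq (abs_uq p) - p" x] by (simp add: fact_on_diff)
qed

lemma uqact_gen: "uqact (uq_gen g) x = oper g x"
  by (simp add: uq_gen.abs_eq uqact_abs fact_on_gen)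

lemma uqact_const: "uqact (uq_const c) x = sc c x"
  by (simp add: uq_const.abs_eq uqact_abs fact_on_const)

lemma uqact_module: "uq_module uqact"
  unfolding uq_module_def
proof (intro conjI allI)
  fix u u' :: "'n uq" and x y
  show "uqact u (x + y) = uqact u x + uqact u y" by (simp add: uqact_def fact_on_lin)
  show "uqact (u + u') x = uqact u x + uqact u' x"
    by (rule uq_cases[of u], rule uq_cases[of u']) (simp add: plus_uq.abs_eq uqact_abs fact_on_add)
  show "uqact (u * u') x = uqact u (uqact u' x)"
    by (rule uq_cases[of u], rule uq_cases[of u']) (simp add: times_uq.abs_eq uqact_abs fact_on_mult)
  show "uqact 1 x = x" by (simp add: one_uq.abs_eq uqact_abs fact_on_one)
qed

end

section \<open>The fundamental modules\<close>

definition fscale :: "scal \<Rightarrow> ('x \<Rightarrow> scal) \<Rightarrow> 'x \<Rightarrow> scal" where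
  "fscale c f = (\<lambda>x. c * f x)"

interpretation FS: vector_space fscale
  by unfold_locales (auto simp: fscale_def fun_eq_iff algebra_simps)

text \<open>All exterior powers of the vector representation at once: the operators act on functions on sets of sites.
  The structure constants are chosen so that they agree with those in the action on the \<open>R i S n\<close>.\<close>

definition hsign :: "'n::{finite,linorder} \<Rightarrow> nat set \<Rightarrow> scal" where
  "hsign j S = of_int (sg j S)"

fun cop :: "'n::{finite,linorder} gen \<Rightarrow> (nat set \<Rightarrow> scal) \<Rightarrow> nat set \<Rightarrow> scal" where
  "cop (gE j) g S = (if idx j \<in> S \<and> Suc (idx j) \<notin> S
     then hsign j S * g (hop (idx j) (Suc (idx j)) S) else 0)"
| "cop (gF j) g S = (if Suc (idx j) \<in> S \<and> idx j \<notin> S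
     then hsign j (hop (Suc (idx j)) (idx j) S) * g (hop (Suc (idx j)) (idx j) S) else 0)"
| "cop (gK j) g S = Q (2 * mu S j) * g S"
| "cop (gKi j) g S = Q (- 2 * mu S j) * g S"

lemma hsign_square: "hsign j S * hsign j S = 1"
  using sg_square[of j S] by (simp add: hsign_def flip: of_int_mult)

lemma hop_configs_iff:
  fixes j :: "'n::{finite,linorder}"
  assumes "idx j \<in> S" "Suc (idx j) \<notin> S"
  shows "hop (idx j) (Suc (idx j)) S \<in> configs (CARD('n) + 1) m \<longleftrightarrow> S \<in> configs (CARD('n) + 1) m"
proof
  assume "hop (idx j) (Suc (idx j)) S \<in> configs (CARD('n) + 1) m"
  then have "hop (Suc (idx j)) (idx j) (hop (idx j) (Suc (idx j)) S) \<in> configs (CARD('n) + 1) m"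
    using idx_ge1[of j] idx_le[of j] by (rule_tac hop_configs) (auto simp: hop_mem)
  then show "S \<in> configs (CARD('n) + 1) m" using assms by (simp add: hop_inverse)
qed (use assms idx_ge1[of j] idx_le[of j] in \<open>auto intro!: hop_configs\<close>)

lemma hop_commute:
  assumes "a \<noteq> c" "a \<noteq> d" "b \<noteq> c" "b \<noteq> d"
  shows "hop a b (hop c d S) = hop c d (hop a b S)"
  using assms by (auto simp: hop_def)

lemma hsign_far:
  fixes j k :: "'n::{finite,linorder}"
  assumes far: "idx j \<noteq> idx k" "idx j \<noteq> Suc (idx k)" "idx k \<noteq> Suc (idx j)"
    and S: "idx j \<in> S" "Suc (idx j) \<notin> S" "idx k \<in> S" "Suc (idx k) \<notin> S"
  shows "hsign j S * hsign k (hop (idx j) (Suc (idx j)) S) = hsign k S * hsign j (hop (idx k) (Suc (idx k)) S)"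
  using sg_far[OF far S] unfolding hsign_def by (simp flip: of_int_mult)

lemma mu_hop_eq:
  fixes j k :: "'n::{finite,linorder}"
  assumes "idx j \<in> S" "Suc (idx j) \<notin> S"
  shows "mu (hop (idx j) (Suc (idx j)) S) k = mu S k - cartan (idx k) (idx j)"
  using fun_cong[OF mu_hop[OF assms], of k] by (simp add: alpha_def)

lemma mu_hop_back:
  fixes j k :: "'n::{finite,linorder}"
  assumes "idx j \<notin> S" "Suc (idx j) \<in> S"
  shows "mu (hop (Suc (idx j)) (idx j) S) k = mu S k + cartan (idx k) (idx j)"
  using mu_hop_eq[of j "hop (Suc (idx j)) (idx j) S" k] assms by (simp add: hop_inverse hop_mem)

lemma cartan_0_iff: "cartan a b = 0 \<longleftrightarrow> a \<noteq> b \<and> a \<noteq> Suc b \<and> b \<noteq> Suc a"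
  by (auto simp: cartan_def)

lemma cartan_m1_iff: "cartan a b = - 1 \<longleftrightarrow> a = Suc b \<or> b = Suc a"
  by (auto simp: cartan_def)

lemma mu_vanish: "idx j \<in> S \<longleftrightarrow> Suc (idx j) \<in> S \<Longrightarrow> mu S j = 0"
  by (simp add: mu_def)

lemma qq_div: "(Q (2 * a) - Q (- 2 * a)) / (qq - qq powi (- 1)) = qint a"
  by (simp add: qint_def qq_powi)

lemma cop_EF_diag: "cop (gE j) (cop (gF j) x) S - cop (gF j) (cop (gE j) x) S = qint (mu S j) * x S"
proof -
  consider "idx j \<in> S \<longleftrightarrow> Suc (idx j) \<in> S" | "idx j \<in> S" "Suc (idx j) \<notin> S" | "idx j \<notin> S" "Suc (idx j) \<in> S" by blast
  then show ?thesis
  proof cases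
    case 1
    then show ?thesis using mu_vanish[OF 1] by auto
  next
    case 2
    then have "mu S j = 1" by (simp add: mu_def)
    with 2 show ?thesis using hsign_square[of j S] by (simp add: hop_mem hop_inverse mult.assoc[symmetric])
  next
    case 3
    then have "mu S j = - 1" by (simp add: mu_def)
    with 3 show ?thesis using hsign_square[of j "hop (Suc (idx j)) (idx j) S"] by (simp add: hop_mem hop_inverse mult.assoc[symmetric])
  qed
qed

text \<open>If the moves overlap, both products vanish; otherwise the signs agree as for two moves in the same direction.\<close>

lemma cop_EF_off:
  assumes "j \<noteq> k"
  shows "cop (gE j) (cop (gF k) x) S = cop (gF k) (cop (gE j) x) S"
proof -
  have ne: "idx j \<noteq> idx k" using assms by simp
  show ?thesis
  proof (cases "idx j \<noteq> Suc (idx k) \<and> idx k \<noteq> Suc (idx j) \<and> idx j \<in> S \<and> Suc (idx j) \<notin> S \<and> Suc (idx k) \<in> S \<and> idx k \<notin> S")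
    case True
    define U where "U = hop (Suc (idx k)) (idx k) S"
    have U: "idx j \<in> U" "Suc (idx j) \<notin> U" "idx k \<in> U" "Suc (idx k) \<notin> U" using True ne by (auto simp: U_def hop_mem)
    have S: "S = hop (idx k) (Suc (idx k)) U" using True by (simp add: U_def hop_inverse)
    have T: "hop (Suc (idx k)) (idx k) (hop (idx j) (Suc (idx j)) S) = hop (idx j) (Suc (idx j)) U"
      using True ne unfolding U_def by (intro hop_commute) auto
    have "hsign j U * hsign k (hop (idx j) (Suc (idx j)) U) = hsign k U * hsign j S"
      unfolding S using True ne by (intro hsign_far U) auto
    then have "hsign j S * hsign k (hop (idx j) (Suc (idx j)) U) = hsign k U * hsign j U"
      using hsign_square[of j U] hsign_square[of k U] hsign_square[of k "hop (idx j) (Suc (idx j)) U"]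
        hsign_square[of j S] by algebra
    then show ?thesis using True U ne by (simp add: hop_mem T U_def[symmetric])
  qed (use ne in \<open>auto simp: hop_mem\<close>)
qed

lemma cop_far:
  assumes y: "y = gE \<or> y = gF" and c: "cartan (idx j) (idx k) = 0"
  shows "cop (y j) (cop (y k) x) S = cop (y k) (cop (y j) x) S"
proof (rule disjE[OF y])
  have far: "idx j \<noteq> idx k" "idx j \<noteq> Suc (idx k)" "idx k \<noteq> Suc (idx j)" using c by (auto simp: cartan_0_iff)
  let ?hj = "hop (idx j) (Suc (idx j))" and ?hk = "hop (idx k) (Suc (idx k))"
  {
    assume "y = gE"
    show ?thesis
    proof (cases "idx j \<in> S \<and> Suc (idx j) \<notin> S \<and> idx k \<in> S \<and> Suc (idx k) \<notin> S")
      case True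
      have "?hk (?hj S) = ?hj (?hk S)" using far by (intro hop_commute) auto
      then show ?thesis using \<open>y = gE\<close> True far hsign_far[OF far, of S]
        by (simp add: hop_mem)
    qed (use \<open>y = gE\<close> far in \<open>auto simp: hop_mem\<close>)
  next
    assume "y = gF"
    show ?thesis
    proof (cases "Suc (idx j) \<in> S \<and> idx j \<notin> S \<and> Suc (idx k) \<in> S \<and> idx k \<notin> S")
      case True
      define V where "V = hop (Suc (idx j)) (idx j) (hop (Suc (idx k)) (idx k) S)"
      have V': "hop (Suc (idx k)) (idx k) (hop (Suc (idx j)) (idx j) S) = V"
        unfolding V_def using far by (intro hop_commute) auto
      have V: "idx j \<in> V" "Suc (idx j) \<notin> V" "idx k \<in> V" "Suc (idx k) \<notin> V" using True far by (auto simp: V_def hop_mem)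
      have U: "hop (Suc (idx j)) (idx j) S = ?hk V" "hop (Suc (idx k)) (idx k) S = ?hj V"
        using True far by (simp_all add: V'[symmetric] hop_inverse hop_mem) (simp add: V' V_def hop_inverse hop_mem)
      show ?thesis using \<open>y = gF\<close> True far V hsign_far[OF far V]
        by (simp add: hop_mem U hop_inverse) (simp add: mult.assoc[symmetric] mult.commute)
    qed (use \<open>y = gF\<close> far in \<open>auto simp: hop_mem\<close>)
  }
qed

interpretation C: minuscule_operators fscale "cop"
proof unfold_locales
  fix g :: "'a gen" and x y :: "nat set \<Rightarrow> scal" and c
  show "cop g (x + y) = cop g x + cop g y"
    by (cases g) (auto simp: fun_eq_iff algebra_simps)
  show "cop g (fscale c x) = fscale c (cop g x)"
    by (cases g) (auto simp: fun_eq_iff fscale_def)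
next
  fix j k :: 'a and x :: "nat set \<Rightarrow> scal"
  show "cop (gK j) (cop (gK k) x) = cop (gK k) (cop (gK j) x)" by (simp add: fun_eq_iff)
  show "cop (gK j) (cop (gKi j) x) = x" "cop (gKi j) (cop (gK j) x) = x"
    by (simp_all add: fun_eq_iff mult.assoc[symmetric] flip: Q_add)
  show "cop (gK j) (cop (gE k) (cop (gKi j) x)) = fscale (qq powi cartan (idx j) (idx k)) (cop (gE k) x)"
  proof
    fix S
    show "cop (gK j) (cop (gE k) (cop (gKi j) x)) S = fscale (qq powi cartan (idx j) (idx k)) (cop (gE k) x) S"
    proof (cases "idx k \<in> S \<and> Suc (idx k) \<notin> S")
      case True
      have "Q (2 * mu S j) * (hsign k S * (Q (- 2 * mu (hop (idx k) (Suc (idx k)) S) j) * x (hop (idx k) (Suc (idx k)) S)))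
        = (Q (2 * mu S j) * Q (- 2 * mu (hop (idx k) (Suc (idx k)) S) j)) * (hsign k S * x (hop (idx k) (Suc (idx k)) S))"
        by (simp only: mult_ac)
      also have "Q (2 * mu S j) * Q (- 2 * mu (hop (idx k) (Suc (idx k)) S) j) = Q (2 * cartan (idx j) (idx k))"
        using True by (simp add: mu_hop_eq algebra_simps flip: Q_add)
      finally show ?thesis using True by (simp add: fscale_def qq_powi)
    qed (auto simp: fscale_def)
  qed
  show "cop (gK j) (cop (gF k) (cop (gKi j) x)) = fscale (qq powi (- cartan (idx j) (idx k))) (cop (gF k) x)"
  proof
    fix S
    let ?S = "hop (Suc (idx k)) (idx k) S"
    show "cop (gK j) (cop (gF k) (cop (gKi j) x)) S = fscale (qq powi (- cartan (idx j) (idx k))) (cop (gF k) x) S"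
    proof (cases "idx k \<notin> S \<and> Suc (idx k) \<in> S")
      case True
      have "Q (2 * mu S j) * (hsign k ?S * (Q (- 2 * mu ?S j) * x ?S))
        = (Q (2 * mu S j) * Q (- 2 * mu ?S j)) * (hsign k ?S * x ?S)"
        by (simp only: mult_ac)
      also have "Q (2 * mu S j) * Q (- 2 * mu ?S j) = Q (- 2 * cartan (idx j) (idx k))"
        using True by (simp add: mu_hop_back algebra_simps flip: Q_add)
      finally show ?thesis using True by (simp add: fscale_def qq_powi)
    qed (auto simp: fscale_def)
  qed
  show "cop (gE j) (cop (gF k) x) - cop (gF k) (cop (gE j) x)
      = (if j = k then fscale (1 / (qq - qq powi (- 1))) (cop (gK j) x - cop (gKi j) x) else 0)"
  proof (cases "j = k")
    case True
    have "(Q (2 * mu S k) * x S - Q (- 2 * mu S k) * x S) / (qq - qq powi (- 1)) = qint (mu S k) * x S" for S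
      unfolding qq_div[symmetric] by (simp add: left_diff_distrib)
    then show ?thesis using True cop_EF_diag[of k x] by (simp add: fun_eq_iff fscale_def)
  next
    case False
    then show ?thesis using cop_EF_off[OF False, of x] by (simp add: fun_eq_iff)
  qed
next
  fix y :: "'a \<Rightarrow> 'a gen" and j k :: 'a and x :: "nat set \<Rightarrow> scal"
  assume y: "y = gE \<or> y = gF"
  show "cop (y j) (cop (y j) x) = 0"
    using y by (auto simp: fun_eq_iff hop_mem)
  show "cartan (idx j) (idx k) = - 1 \<Longrightarrow> cop (y j) (cop (y k) (cop (y j) x)) = 0"
    using y unfolding cartan_m1_iff by (auto simp: fun_eq_iff hop_mem)
  assume c: "cartan (idx j) (idx k) = 0"
  show "cop (y j) (cop (y k) x) = cop (y k) (cop (y j) x)" by (rule ext) (rule cop_far[OF y c])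
qed

section \<open>Highest weight vectors\<close>

lemma uq_rel_rels: "x - y \<in> uq_rels \<Longrightarrow> uq_rel x y"
  using uq_ideal.rel[of "x - y" 1 1] by (simp add: uq_rel_def)

lemma uq_K_Ki: "uq_gen (gK i) * uq_gen (gKi i) = 1" "uq_gen (gKi i) * uq_gen (gK i) = 1"
  by (transfer; rule uq_rel_rels; rule uq_rels.intros)+

lemma uq_KF: "uq_gen (gK i) * uq_gen (gF j) = uq_const (Q (- 2 * cartan (idx i) (idx j))) * uq_gen (gF j) * uq_gen (gK i)"
proof -
  have "uq_gen (gK i) * uq_gen (gF j) * uq_gen (gKi i) = uq_const (qq powi (- cartan (idx i) (idx j))) * uq_gen (gF j)"
    by (transfer; rule uq_rel_rels; rule uq_rels.intros)
  then have "uq_gen (gK i) * uq_gen (gF j) * uq_gen (gKi i) * uq_gen (gK i)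
      = uq_const (qq powi (- cartan (idx i) (idx j))) * uq_gen (gF j) * uq_gen (gK i)" by simp
  then show ?thesis by (simp add: mult.assoc uq_K_Ki qq_powi)
qed

lemmas abs_eqs = uq_gen.abs_eq uq_const.abs_eq times_uq.abs_eq plus_uq.abs_eq minus_uq.abs_eq zero_uq.abs_eq

lemma uq_EF: "uq_gen (gE i) * uq_gen (gF j) = uq_gen (gF j) * uq_gen (gE i)
   + (if i = j then uq_const (1 / (qq - qq powi (- 1))) * (uq_gen (gK i) - uq_gen (gKi i)) else 0)"
  for i :: "'n::{finite,linorder}"
proof (cases "i = j")
  case True
  have "uq_rel (fgen (gE i) * fgen (gF i)) (fgen (gF i) * fgen (gE i)
     + fconst (1 / (qq - qq powi (- 1))) * (fgen (gK i) - fgen (gKi i)))"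
    using uq_rels.EF[of i i] unfolding if_P[OF refl] diff_diff_eq by (rule uq_rel_rels)
  then have "uq_gen (gE i) * uq_gen (gF i) = uq_gen (gF i) * uq_gen (gE i)
     + uq_const (1 / (qq - qq powi (- 1))) * (uq_gen (gK i) - uq_gen (gKi i))"
    unfolding abs_eqs uq.abs_eq_iff .
  with True show ?thesis by simp
next
  case False
  have "uq_rel (fgen (gE i) * fgen (gF j)) (fgen (gF j) * fgen (gE i) + 0)"
    using uq_rels.EF[of i j] unfolding if_not_P[OF False] diff_diff_eq by (rule uq_rel_rels)
  then have "uq_gen (gE i) * uq_gen (gF j) = uq_gen (gF j) * uq_gen (gE i) + 0"
    unfolding abs_eqs uq.abs_eq_iff .
  with False show ?thesis by simp
qed

definition fword :: "'n list \<Rightarrow> 'n::{finite,linorder} uq" where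
  "fword l = prod_list (map (\<lambda>j. uq_gen (gF j)) l)"

inductive_set lowering :: "'n::{finite,linorder} uq set" where
  zero: "0 \<in> lowering"
| word: "l \<noteq> [] \<Longrightarrow> uq_const c * fword l \<in> lowering"
| add: "f \<in> lowering \<Longrightarrow> g \<in> lowering \<Longrightarrow> f + g \<in> lowering"

text \<open>The torus element with these exponents satisfies \<open>K f\<^sub>j K\<^sup>-\<^sup>1 = q\<^sup>-\<^sup>2 f\<^sub>j\<close> for all \<open>j\<close>, so its eigenvalue on a word in the
  \<open>f\<^sub>j\<close> applied to a weight vector detects the length of the word.\<close>

definition grading :: "'n::{finite,linorder} \<Rightarrow> int" where
  "grading k = int (idx k) * (int CARD('n) + 1 - int (idx k))"

lemma grading_alpha: "(\<Sum>k\<in>UNIV. grading k * alpha j k) = 2" for j :: "'n::{finite,linorder}"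
proof -
  define g where "g k = int k * (int CARD('n) + 1 - int k)" for k
  have "(\<Sum>k\<in>UNIV. grading k * alpha j k) = (\<Sum>k\<in>(UNIV :: 'n set). (\<lambda>k. of_int (cartan k (idx j)) * g k) (idx k))"
    by (simp add: grading_def g_def alpha_def mult.commute)
  also have "\<dots> = (\<Sum>k=1..CARD('n). of_int (cartan k (idx j)) * g k)"
    by (rule sum.reindex_bij_betw[OF bij_idx])
  also have "\<dots> = 2 * g (idx j) - g (idx j - 1) - g (idx j + 1)"
    using idx_ge1[of j] idx_le[of j] by (intro sum_cartan) (auto simp: g_def)
  also have "\<dots> = 2" using idx_ge1[of j] by (simp add: g_def of_nat_diff algebra_simps)
  finally show ?thesis .
qed

text \<open>A polynomial in this torus element that kills the words of length \<open>1, \<dots>, h\<close> applied to a vector with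
  eigenvalue \<open>q\<^sup>s\<close>, but not this vector itself.\<close>

primrec annihilating :: "int \<Rightarrow> nat \<Rightarrow> 'n::{finite,linorder} uq" where
  "annihilating s 0 = 1"
| "annihilating s (Suc h) = (K_mon grading - uq_const (Q (2 * (s - 2 * int (Suc h))))) * annihilating s h"

locale uq_mod =
  fixes act :: "'n::{finite,linorder} uq \<Rightarrow> 'l::ab_group_add \<Rightarrow> 'l"
  assumes module: "uq_module act"
begin

lemma act_add: "act u (x + y) = act u x + act u y" and act_plus: "act (u + u') x = act u x + act u' x"
  and act_mult: "act (u * u') x = act u (act u' x)" and act_one [simp]: "act 1 x = x"
  using module unfolding uq_module_def by blast+

lemma act_0 [simp]: "act u 0 = 0" "act 0 x = 0"
  using act_add[of u 0 0] act_plus[of 0 0 x] by simp_all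

lemma act_minus: "act (u - u') x = act u x - act u' x"
  using act_plus[of "u - u'" u' x] by (simp add: algebra_simps)

definition scl where "scl c = act (uq_const c)"

lemma act_scl: "act u (scl c x) = scl c (act u x)"
  by (simp add: scl_def uq_const_commute flip: act_mult)

lemma scl_scl: "scl c (scl d x) = scl (c * d) x"
  by (simp add: scl_def uq_const_mult act_mult)

lemma scl_add: "scl c (x + y) = scl c x + scl c y" and scl_plus: "scl (c + d) x = scl c x + scl d x"
  by (simp_all add: scl_def uq_const_add act_add act_plus)

lemma scl_uminus: "scl (- 1) x = - x"
  using scl_plus[of 1 "- 1" x] by (simp add: scl_def uq_const_0 uq_const_1 eq_neg_iff_add_eq_0 add.commute)

lemma scl_1 [simp]: "scl 1 x = x" and scl_0 [simp]: "scl 0 x = 0"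
  and scl_zero [simp]: "scl c 0 = 0"
  by (simp_all add: scl_def uq_const_1 uq_const_0)

lemma act_const [simp]: "act (uq_const c) = scl c" by (simp add: scl_def)

lemma scl_eq_0: "scl c x = 0 \<Longrightarrow> c \<noteq> 0 \<Longrightarrow> x = 0"
  using scl_scl[of "1 / c" c x] by simp

definition wtv :: "'n wgt \<Rightarrow> 'l \<Rightarrow> bool" where
  "wtv \<beta> x \<longleftrightarrow> (\<forall>j. act (uq_gen (gK j)) x = scl (Q (2 * \<beta> j)) x \<and> act (uq_gen (gKi j)) x = scl (Q (- 2 * \<beta> j)) x)"

lemma wtvI:
  assumes "\<And>j. act (uq_gen (gK j)) x = scl (Q (2 * \<beta> j)) x"
  shows "wtv \<beta> x"
  unfolding wtv_def
proof (intro allI conjI)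
  fix j
  have "x = act (uq_gen (gKi j)) (act (uq_gen (gK j)) x)" by (simp add: uq_K_Ki flip: act_mult)
  then have "x = scl (Q (2 * \<beta> j)) (act (uq_gen (gKi j)) x)" unfolding assms act_scl .
  then have "scl (Q (- 2 * \<beta> j)) x = scl (Q (- 2 * \<beta> j)) (scl (Q (2 * \<beta> j)) (act (uq_gen (gKi j)) x))" by simp
  then show "act (uq_gen (gKi j)) x = scl (Q (- 2 * \<beta> j)) x" by (simp add: scl_scl flip: Q_add)
qed (rule assms)

lemma act_power: "act u x = scl a x \<Longrightarrow> act (u ^ m) x = scl (a ^ m) x"
  by (induction m) (simp_all add: act_mult act_scl scl_scl mult.commute)

lemma act_K_mon:
  assumes "wtv \<beta> x"
  shows "act (K_mon c) x = scl (Q (2 * (\<Sum>k\<in>UNIV. c k * \<beta> k))) x"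
proof -
  have K: "act (uq_gen (gK k)) x = scl (Q (2 * \<beta> k)) x" "act (uq_gen (gKi k)) x = scl (Q (- 2 * \<beta> k)) x" for k
    using assms unfolding wtv_def by blast+
  have "act (prod_list (map (\<lambda>k. if 0 \<le> c k then uq_gen (gK k) ^ nat (c k) else uq_gen (gKi k) ^ nat (- c k)) l)) x
    = scl (Q (2 * (\<Sum>k\<leftarrow>l. c k * \<beta> k))) x" for l
  proof (induction l)
    case (Cons k l)
    have "act (if 0 \<le> c k then uq_gen (gK k) ^ nat (c k) else uq_gen (gKi k) ^ nat (- c k)) x = scl (Q (2 * (c k * \<beta> k))) x"
      by (simp add: act_power[OF K(1)] act_power[OF K(2)] Q_power mult_ac)
    then show ?case by (simp add: act_mult Cons act_scl scl_scl distrib_left Q_add mult.commute)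
  qed simp
  then show ?thesis unfolding K_mon_def by (simp add: sum_list_distinct_conv_sum_set)
qed

definition hwv :: "'n wgt \<Rightarrow> 'l \<Rightarrow> bool" where
  "hwv \<Lambda> v \<longleftrightarrow> wtv \<Lambda> v \<and> (\<forall>j. act (uq_gen (gE j)) v = 0)"

lemma wtv_F:
  assumes "wtv \<beta> x"
  shows "wtv (\<lambda>k. \<beta> k - alpha j k) (act (uq_gen (gF j)) x)"
proof (rule wtvI)
  fix k
  have "act (uq_gen (gK k)) (act (uq_gen (gF j)) x) = act (uq_gen (gK k) * uq_gen (gF j)) x" by (simp add: act_mult)
  also have "\<dots> = scl (Q (- 2 * cartan (idx k) (idx j))) (act (uq_gen (gF j)) (act (uq_gen (gK k)) x))"
    unfolding uq_KF by (simp add: act_mult)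
  also have "act (uq_gen (gK k)) x = scl (Q (2 * \<beta> k)) x" using assms by (simp add: wtv_def)
  finally show "act (uq_gen (gK k)) (act (uq_gen (gF j)) x) = scl (Q (2 * (\<beta> k - alpha j k))) (act (uq_gen (gF j)) x)"
    by (simp add: act_scl scl_scl alpha_def algebra_simps flip: Q_add)
qed

lemma fword_weight:
  assumes "wtv \<Lambda> v"
  shows "\<exists>\<beta>. wtv \<beta> (act (fword l) v) \<and> (\<Sum>k\<in>UNIV. grading k * \<beta> k) = (\<Sum>k\<in>UNIV. grading k * \<Lambda> k) - 2 * int (length l)"
proof (induction l)
  case Nil
  then show ?case using assms by (intro exI[of _ \<Lambda>]) (simp add: fword_def)
next
  case (Cons j l)
  then obtain \<beta> where b: "wtv \<beta> (act (fword l) v)" "(\<Sum>k\<in>UNIV. grading k * \<beta> k) = (\<Sum>k\<in>UNIV. grading k * \<Lambda> k) - 2 * int (length l)"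
    by blast
  have "wtv (\<lambda>k. \<beta> k - alpha j k) (act (fword (j # l)) v)"
    using wtv_F[OF b(1), of j] by (simp add: fword_def act_mult)
  moreover have "(\<Sum>k\<in>UNIV. grading k * (\<beta> k - alpha j k)) = (\<Sum>k\<in>UNIV. grading k * \<Lambda> k) - 2 * int (length (j # l))"
    by (simp add: right_diff_distrib sum_subtractf b(2) grading_alpha)
  ultimately show ?case by blast
qed

lemma act_annihilating:
  assumes "act (K_mon grading) x = scl e x"
  shows "act (annihilating s h) x = scl (\<Prod>t=1..h. e - Q (2 * (s - 2 * int t))) x"
proof (induction h)
  case (Suc h)
  have "act (K_mon grading - uq_const d) x = scl (e - d) x" for d
    using scl_plus[of "e - d" d x] by (simp add: act_minus assms algebra_simps)
  then show ?case by (simp add: act_mult Suc act_scl scl_scl mult.commute)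
qed simp

lemma annihilating_lowering:
  assumes "wtv \<Lambda> v" "f \<in> lowering"
  shows "\<exists>h. \<forall>h'\<ge>h. act (annihilating (\<Sum>k\<in>UNIV. grading k * \<Lambda> k) h') (act f v) = 0"
  using assms(2)
proof induction
  case zero
  then show ?case by simp
next
  case (word l c)
  obtain \<beta> where b: "wtv \<beta> (act (fword l) v)" "(\<Sum>k\<in>UNIV. grading k * \<beta> k) = (\<Sum>k\<in>UNIV. grading k * \<Lambda> k) - 2 * int (length l)"
    using fword_weight[OF assms(1)] by blast
  have "act (annihilating (\<Sum>k\<in>UNIV. grading k * \<Lambda> k) h') (act (uq_const c * fword l) v) = 0" if "length l \<le> h'" for h'
  proof -
    have "(\<Prod>t=1..h'. Q (2 * ((\<Sum>k\<in>UNIV. grading k * \<Lambda> k) - 2 * int (length l))) - Q (2 * ((\<Sum>k\<in>UNIV. grading k * \<Lambda> k) - 2 * int t))) = 0"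
      using that word by (intro prod_zero) (auto simp: Suc_le_eq intro!: bexI[of _ "length l"])
    then show ?thesis
      unfolding act_mult act_const act_scl act_annihilating[OF act_K_mon[OF b(1)]] b(2) by (simp only: scl_0 scl_zero)
  qed
  then show ?case by blast
next
  case (add f g)
  then obtain h1 h2 where "\<forall>h'\<ge>h1. act (annihilating (\<Sum>k\<in>UNIV. grading k * \<Lambda> k) h') (act f v) = 0"
    "\<forall>h'\<ge>h2. act (annihilating (\<Sum>k\<in>UNIV. grading k * \<Lambda> k) h') (act g v) = 0" by blast
  then show ?case by (intro exI[of _ "max h1 h2"]) (simp add: act_plus act_add)
qed

text \<open>A polynomial in the torus element that kills the lower terms maps \<open>v\<close> to a nonzero multiple of itself.\<close>

lemma top_component:
  assumes v: "wtv \<Lambda> v" "v \<noteq> 0" and f: "f \<in> lowering" and z: "scl c v + act f v = 0"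
  shows "c = 0"
proof (rule ccontr)
  assume c: "c \<noteq> 0"
  define s where "s = (\<Sum>k\<in>UNIV. grading k * \<Lambda> k)"
  obtain h where "act (annihilating s h) (act f v) = 0"
    using annihilating_lowering[OF v(1) f] unfolding s_def by blast
  then have "act (annihilating s h) (scl c v) = 0"
    using arg_cong[OF z, of "act (annihilating s h)"] by (simp add: act_add)
  then have "scl (c * (\<Prod>t=1..h. Q (2 * s) - Q (2 * (s - 2 * int t)))) v = 0"
    by (simp add: act_scl act_annihilating[OF act_K_mon[OF v(1)]] scl_scl flip: s_def)
  moreover have "(\<Prod>t=1..h. Q (2 * s) - Q (2 * (s - 2 * int t))) \<noteq> 0" by auto
  ultimately show False using scl_eq_0 v(2) c by auto
qed

definition reach :: "'l \<Rightarrow> 'l set" where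
  "reach v = {scl c v + act f v | c f. f \<in> lowering}"

lemma reachE:
  assumes "x \<in> reach v"
  obtains c f where "f \<in> lowering" "x = scl c v + act f v"
  using assms by (auto simp: reach_def)

lemma reachI: "f \<in> lowering \<Longrightarrow> scl c v + act f v \<in> reach v"
  by (auto simp: reach_def)

lemma reach_add: "x \<in> reach v \<Longrightarrow> y \<in> reach v \<Longrightarrow> x + y \<in> reach v"
proof (elim reachE)
  fix c f d g assume "f \<in> lowering" "x = scl c v + act f v" "g \<in> lowering" "y = scl d v + act g v"
  then show "x + y \<in> reach v" using reachI[OF lowering.add[of f g], of "c + d" v]
    by (simp add: scl_plus act_plus add_ac)
qed

lemma lowering_scale: "f \<in> lowering \<Longrightarrow> uq_const c * f \<in> lowering"
proof (induction rule: lowering.induct)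
  case (word l d)
  then show ?case using lowering.word[of l "c * d"] by (simp add: uq_const_mult mult.assoc)
qed (auto simp: distrib_left intro: lowering.intros)

lemma reach_scl: "x \<in> reach v \<Longrightarrow> scl c x \<in> reach v"
proof (elim reachE)
  fix d f assume "f \<in> lowering" "x = scl d v + act f v"
  then show "scl c x \<in> reach v" using reachI[OF lowering_scale[of f c], of "c * d" v]
    by (simp add: scl_add scl_scl act_mult)
qed

lemma reach_diff: "x \<in> reach v \<Longrightarrow> y \<in> reach v \<Longrightarrow> x - y \<in> reach v"
proof -
  assume xy: "x \<in> reach v" "y \<in> reach v"
  then show "x - y \<in> reach v" using reach_add[OF xy(1) reach_scl[OF xy(2), of "- 1"]] by (simp add: scl_uminus)
qed

lemma reach_fword: "act (fword l) v \<in> reach v"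
proof (cases "l = []")
  case True
  then show ?thesis using reachI[OF lowering.zero, of 1 v] by (simp add: fword_def)
next
  case False
  then show ?thesis using reachI[OF lowering.word[of l 1], of 0 v] by (simp add: uq_const_1)
qed

lemma reach_closed:
  assumes "\<And>l. act u (act (fword l) v) \<in> reach v" "x \<in> reach v"
  shows "act u x \<in> reach v"
proof -
  have "act u (act f v) \<in> reach v" if "f \<in> lowering" for f
    using that
  proof induction
    case zero
    then show ?case using reachI[OF lowering.zero, of 0 v] by simp
  next
    case (word l c)
    then show ?case using reach_scl[OF assms(1)] by (simp add: act_mult act_scl)
  next
    case (add f g)
    then show ?case by (simp add: act_plus act_add reach_add)
  qed
  moreover have "act u v \<in> reach v" using assms(1)[of "[]"] by (simp add: fword_def)
  moreover obtain c f where "f \<in> lowering" "x = scl c v + act f v" using assms(2) by (rule reachE)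
  ultimately show ?thesis by (simp only: act_add act_scl) (intro reach_add reach_scl)
qed

text \<open>The span of \<open>v\<close> and of all words in the \<open>f\<^sub>j\<close> applied to \<open>v\<close> is stable under the generators: words are weight vectors,
  and \<open>e\<^sub>j\<close> can be moved to the right until it meets \<open>v\<close>.\<close>

lemma hw_span:
  assumes hw: "hwv \<Lambda> v"
  shows "act u v \<in> reach v"
proof -
  have wt: "wtv \<Lambda> v" and E: "act (uq_gen (gE j)) v = 0" for j using hw by (auto simp: hwv_def)
  have F: "act (uq_gen (gF j)) x \<in> reach v" if "x \<in> reach v" for j x
  proof (rule reach_closed[OF _ that])
    fix l show "act (uq_gen (gF j)) (act (fword l) v) \<in> reach v"
      using reach_fword[of "j # l" v] by (simp add: fword_def act_mult)
  qed
  have K: "act (uq_gen (gK j)) (act (fword l) v) \<in> reach v" "act (uq_gen (gKi j)) (act (fword l) v) \<in> reach v" for j l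
  proof -
    obtain \<beta> where b: "wtv \<beta> (act (fword l) v)" using fword_weight[OF wt, of l] by blast
    then have "act (uq_gen (gK j)) (act (fword l) v) = scl (Q (2 * \<beta> j)) (act (fword l) v)"
      "act (uq_gen (gKi j)) (act (fword l) v) = scl (Q (- 2 * \<beta> j)) (act (fword l) v)" unfolding wtv_def by blast+
    then show "act (uq_gen (gK j)) (act (fword l) v) \<in> reach v" "act (uq_gen (gKi j)) (act (fword l) v) \<in> reach v"
      by (simp_all only: reach_scl reach_fword)
  qed
  have EF: "act (uq_gen (gE j)) (act (fword l) v) \<in> reach v" for j l
  proof (induction l)
    case Nil
    then show ?case using E reachI[OF lowering.zero, of 0 v] by (simp add: fword_def)
  next
    case (Cons k l)
    let ?y = "act (fword l) v"
    have "act (uq_gen (gE j)) (act (fword (k # l)) v) = act (uq_gen (gE j) * uq_gen (gF k)) ?y"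
      by (simp add: fword_def act_mult)
    also have "\<dots> = act (uq_gen (gF k)) (act (uq_gen (gE j)) ?y)
       + (if j = k then scl (1 / (qq - qq powi (- 1))) (act (uq_gen (gK j)) ?y - act (uq_gen (gKi j)) ?y) else 0)"
      unfolding uq_EF by (simp add: act_plus act_mult act_minus)
    also have "\<dots> \<in> reach v"
      using reachI[OF lowering.zero, of 0 v] by (intro reach_add F Cons) (auto intro: reach_scl reach_diff K)
    finally show ?case .
  qed
  have "\<forall>x\<in>reach v. act u x \<in> reach v"
  proof (induction u rule: uq_induct)
    case (gen g)
    show ?case by (cases g) (auto intro: F reach_closed[OF K(1)] reach_closed[OF K(2)] reach_closed[OF EF])
  qed (auto simp: act_plus act_mult intro: reach_scl reach_add)
  moreover have "v \<in> reach v" using reach_fword[of "[]" v] by (simp add: fword_def)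
  ultimately show ?thesis by blast
qed

end

text \<open>Suppose that \<open>u\<close> kills \<open>v1\<close> but not \<open>v2\<close>. A multiple \<open>w * u\<close> then maps the highest weight vector \<open>(v1, v2)\<close> of the direct
  sum to \<open>(0, v2)\<close>. Writing this as \<open>c (v1, v2)\<close> plus lower terms, the first component shows \<open>c = 0\<close>, and the
  second one \<open>c = 1\<close>.\<close>

lemma annihilator_subset:
  fixes act1 :: "'n::{finite,linorder} uq \<Rightarrow> 'k::ab_group_add \<Rightarrow> 'k"
    and act2 :: "'n uq \<Rightarrow> 'l::ab_group_add \<Rightarrow> 'l"
  assumes m1: "uq_mod act1" and m2: "uq_mod act2"
    and hw1: "uq_mod.hwv act1 \<Lambda> v1" "v1 \<noteq> 0" and hw2: "uq_mod.hwv act2 \<Lambda> v2" "v2 \<noteq> 0"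
    and gen: "\<And>u. act2 u v2 \<noteq> 0 \<Longrightarrow> \<exists>w. act2 w (act2 u v2) = v2"
    and z: "act1 u v1 = 0"
  shows "act2 u v2 = 0"
proof (rule ccontr)
  assume nz: "act2 u v2 \<noteq> 0"
  obtain w where w: "act2 w (act2 u v2) = v2" using gen[OF nz] ..
  interpret m1: uq_mod act1 by (rule m1)
  interpret m2: uq_mod act2 by (rule m2)
  define act :: "'n uq \<Rightarrow> 'k \<times> 'l \<Rightarrow> 'k \<times> 'l" where "act u x = (act1 u (fst x), act2 u (snd x))" for u x
  interpret m: uq_mod act
    by unfold_locales (simp only: uq_module_def act_def prod_eq_iff fst_add snd_add prod.sel
      m1.act_add m2.act_add m1.act_plus m2.act_plus m1.act_mult m2.act_mult m1.act_one m2.act_one simp_thms)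
  have "m.hwv \<Lambda> (v1, v2)"
    using hw1(1) hw2(1) unfolding m.hwv_def m.wtv_def m1.hwv_def m1.wtv_def m2.hwv_def m2.wtv_def m.scl_def act_def
    by (simp add: zero_prod_def)
  then have "act (w * u) (v1, v2) \<in> m.reach (v1, v2)" by (rule m.hw_span)
  then obtain c f where f: "f \<in> lowering" and eq: "act (w * u) (v1, v2) = m.scl c (v1, v2) + act f (v1, v2)"
    by (rule m.reachE)
  have 1: "m1.scl c v1 + act1 f v1 = 0" and 2: "v2 = m2.scl c v2 + act2 f v2"
    using eq unfolding m.scl_def act_def by (simp_all add: m1.act_mult m2.act_mult z w)
  have "c = 0" by (rule m1.top_component[OF _ hw1(2) f 1, of \<Lambda>]) (use hw1(1) in \<open>simp add: m1.hwv_def\<close>)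
  with 2 \<open>c = 0\<close> have "m2.scl (- 1) v2 + act2 f v2 = 0" by (simp add: m2.scl_uminus)
  from m2.top_component[OF _ hw2(2) f this, of \<Lambda>] hw2(1) show False by (simp add: m2.hwv_def)
qed

lemma irr_hw_moduleD:
  assumes irr: "irr_hw_module act \<Lambda> v"
  shows "uq_mod act" "uq_mod.hwv act \<Lambda> v" "v \<noteq> 0" "act u v \<noteq> 0 \<Longrightarrow> \<exists>w. act w (act u v) = v"
proof -
  show m: "uq_mod act" and "v \<noteq> 0" using irr by (auto simp: irr_hw_module_def uq_mod_def)
  interpret m: uq_mod act by (rule m)
  show "m.hwv \<Lambda> v" unfolding m.hwv_def
    using irr by (auto simp: irr_hw_module_def qq_powi intro!: m.wtvI)
  assume nz: "act u v \<noteq> 0"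
  define S where "S = {act w (act u v) | w. True}"
  have "uq_submodule act S" unfolding uq_submodule_def
  proof (intro conjI ballI allI)
    show "0 \<in> S" using m.act_0(2)[of "act u v"] unfolding S_def by (metis (mono_tags, lifting) mem_Collect_eq)
    show "x + y \<in> S" if "x \<in> S" "y \<in> S" for x y using that unfolding S_def by (auto simp flip: m.act_plus)
    show "act u' x \<in> S" if xS: "x \<in> S" for u' x
    proof -
      obtain w where "x = act w (act u v)" using xS unfolding S_def by blast
      then have "act u' x = act (u' * w) (act u v)" by (simp add: m.act_mult)
      then show ?thesis unfolding S_def by blast
    qed
  qed
  moreover have "act u v \<in> S" unfolding S_def using m.act_one[of "act u v"] by (metis (mono_tags, lifting) mem_Collect_eq)
  ultimately have "S = UNIV" using irr nz by (auto simp: irr_hw_module_def)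
  then have "v \<in> S" by simp
  then obtain w where "v = act w (act u v)" unfolding S_def by blast
  from this[symmetric] show "\<exists>w. act w (act u v) = v" ..
qed

section \<open>The highest weight vector of a fundamental module\<close>

definition cact :: "'n::{finite,linorder} uq \<Rightarrow> (nat set \<Rightarrow> scal) \<Rightarrow> nat set \<Rightarrow> scal" where
  "cact = minuscule_operators.uqact fscale cop"

lemma cact_gen: "cact (uq_gen g) x = cop g x"
  unfolding cact_def by (rule C.uqact_gen)


interpretation C: uq_mod cact
  by unfold_locales (unfold cact_def, rule C.uqact_module)

lemma cact_scl: "uq_mod.scl cact c x = fscale c x"
  unfolding C.scl_def unfolding cact_def by (rule C.uqact_const)

definition ctop :: "'n::{finite,linorder} \<Rightarrow> nat set \<Rightarrow> scal" where
  "ctop i S = (if S = {1..idx i} then 1 else 0)"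

definition supported :: "'n::{finite,linorder} \<Rightarrow> (nat set \<Rightarrow> scal) \<Rightarrow> bool" where
  "supported i x \<longleftrightarrow> (\<forall>S. x S \<noteq> 0 \<longrightarrow> S \<in> configs (CARD('n) + 1) (idx i))"

lemma top_config: "{1..idx i} \<in> configs (CARD('n) + 1) (idx (i :: 'n::{finite,linorder}))"
  using idx_le[of i] by (auto simp: configs_def)

lemma ctop_nonzero: "ctop i \<noteq> 0"
  by (auto simp: ctop_def fun_eq_iff)

lemma ctop_hwv: "uq_mod.hwv cact (lam i) (ctop i)"
  unfolding C.hwv_def
proof (intro conjI allI C.wtvI)
  fix j
  show "cact (uq_gen (gK j)) (ctop i) = uq_mod.scl cact (Q (2 * lam i j)) (ctop i)"
    by (auto simp: fun_eq_iff cact_gen cact_scl fscale_def ctop_def mu_top[simplified])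
  have "hop (idx j) (Suc (idx j)) S \<noteq> {1..idx i}" if "idx j \<in> S" for S
  proof
    assume e: "hop (idx j) (Suc (idx j)) S = {1..idx i}"
    have "idx j \<notin> hop (idx j) (Suc (idx j)) S" "Suc (idx j) \<in> hop (idx j) (Suc (idx j)) S" by (auto simp: hop_def)
    then show False unfolding e using idx_ge1[of j] by simp
  qed
  then show "cact (uq_gen (gE j)) (ctop i) = 0"
    unfolding cact_gen by (intro ext) (simp add: ctop_def)
qed

lemma supported_cop: "supported i x \<Longrightarrow> supported i (cop g x)" for i :: "'n::{finite,linorder}" and g :: "'n gen"
proof (cases g)
  fix j assume x: "supported i x" and g: "g = gF j"
  show ?thesis unfolding supported_def g
  proof (intro allI impI)
    fix S assume "cop (gF j) x S \<noteq> 0"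
    then have S: "Suc (idx j) \<in> S" "idx j \<notin> S" "x (hop (Suc (idx j)) (idx j) S) \<noteq> 0" by (auto split: if_splits)
    then have "hop (Suc (idx j)) (idx j) S \<in> configs (CARD('n) + 1) (idx i)" using x by (simp add: supported_def)
    then show "S \<in> configs (CARD('n) + 1) (idx i)"
      using hop_configs_iff[of j "hop (Suc (idx j)) (idx j) S" "idx i"] S by (simp add: hop_inverse hop_mem)
  qed
next
  fix j assume x: "supported i x" and g: "g = gE j"
  show ?thesis unfolding supported_def g
  proof (intro allI impI)
    fix S assume "cop (gE j) x S \<noteq> 0"
    then have S: "idx j \<in> S" "Suc (idx j) \<notin> S" "x (hop (idx j) (Suc (idx j)) S) \<noteq> 0" by (auto split: if_splits)
    then have "hop (idx j) (Suc (idx j)) S \<in> configs (CARD('n) + 1) (idx i)" using x by (simp add: supported_def)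
    then show "S \<in> configs (CARD('n) + 1) (idx i)" unfolding hop_configs_iff[OF S(1,2)] .
  qed
qed (auto simp: supported_def)

lemma supported_cact: "supported i x \<Longrightarrow> supported i (cact u x)" for i :: "'n::{finite,linorder}" and u :: "'n uq"
proof (induction u arbitrary: x rule: uq_induct)
  case (add u u')
  then have "supported i (cact u x)" "supported i (cact u' x)" by auto
  then show ?case unfolding supported_def C.act_plus by (auto; metis add_0)
next
  case (const c)
  then show ?case unfolding C.act_const cact_scl by (simp add: supported_def fscale_def)
next
  case (gen g)
  then show ?case unfolding cact_gen by (rule supported_cop)
next
  case (mult u u')
  then show ?case unfolding C.act_mult by blast
qed

text \<open>The configuration without free sites below a particle is \<open>{1..i}\<close>.\<close>

lemma config_step:
  fixes i :: "'n::{finite,linorder}"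
  assumes S: "S \<in> configs (CARD('n) + 1) (idx i)" and ne: "S \<noteq> {1..idx i}"
  obtains j :: 'n where "idx j \<notin> S" "Suc (idx j) \<in> S"
proof (cases "\<exists>p. 1 \<le> p \<and> p \<notin> S \<and> Suc p \<in> S")
  case True
  then obtain p where p: "1 \<le> p" "p \<notin> S" "Suc p \<in> S" by blast
  then have "p \<in> {1..CARD('n)}" using S by (auto simp: configs_def)
  then obtain j :: 'n where "p = idx j" using bij_idx[where 'n = 'n] unfolding bij_betw_def by blast
  then show ?thesis using p that by blast
next
  case False
  have down: "q \<in> S" if "q \<le> p" "1 \<le> q" "p \<in> S" for q p
    using that
  proof (induction rule: inc_induct)
    case (step m)
    then show ?case using False by (metis Suc_leD le_SucI)
  qed
  have fin: "finite S" using S by (rule configs_finite)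
  have "S \<noteq> {}" using S idx_ge1[of i] by (auto simp: configs_def)
  then have max: "Max S \<in> S" using fin by simp
  have "S = {1..Max S}"
  proof
    show "S \<subseteq> {1..Max S}" using S fin by (auto simp: configs_def)
    show "{1..Max S} \<subseteq> S" using down[OF _ _ max] by auto
  qed
  moreover from this have "card S = Max S" by (metis card_atLeastAtMost diff_Suc_1)
  ultimately have "S = {1..idx i}" using S by (simp add: configs_def)
  with ne show ?thesis by blast
qed

lemma sum_hop:
  assumes "finite S" "a \<in> S" "b \<notin> S"
  shows "\<Sum>(hop a b S) + a = \<Sum>S + (b :: nat)"
  using assms by (simp add: hop_def sum.remove[OF assms(1,2)])

text \<open>As long as \<open>x\<close> involves a configuration other than \<open>{1..i}\<close>, some \<open>e\<^sub>j\<close> moves one of its particles down without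
  killing \<open>x\<close>. This lowers the bound \<open>m\<close> for the sum of the positions.\<close>

lemma raise_to_top:
  fixes i :: "'n::{finite,linorder}"
  assumes "supported i x" "x \<noteq> 0" "\<And>S. x S \<noteq> 0 \<Longrightarrow> \<Sum>S \<le> m"
  shows "\<exists>w :: 'n uq. cact w x = ctop i"
  using assms
proof (induction m arbitrary: x)
  case (0 x)
  obtain S where S: "x S \<noteq> 0" using "0.prems"(2) by (auto simp: fun_eq_iff)
  then have c: "S \<in> configs (CARD('n) + 1) (idx i)" "\<Sum>S = 0" using 0 by (auto simp: supported_def)
  then have "S = {} \<or> S = {0}" using configs_finite[OF c(1)] by (auto simp: sum_eq_0_iff)
  then show ?case using c idx_ge1[of i] by (auto simp: configs_def)
next
  case (Suc m x)
  show ?case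
  proof (cases "\<exists>S. x S \<noteq> 0 \<and> S \<noteq> {1..idx i}")
    case True
    then obtain S where S: "x S \<noteq> 0" "S \<noteq> {1..idx i}" by blast
    then have c: "S \<in> configs (CARD('n) + 1) (idx i)" using Suc.prems(1) by (simp add: supported_def)
    from config_step[OF c S(2)] obtain j :: 'n where j: "idx j \<notin> S" "Suc (idx j) \<in> S" .
    let ?y = "cop (gE j) x"
    have "hsign j T \<noteq> 0" for T using hsign_square[of j T] by auto
    then have nz: "?y (hop (Suc (idx j)) (idx j) S) \<noteq> 0" using j S(1) by (simp add: hop_mem hop_inverse)
    have "?y \<noteq> 0"
    proof
      assume "?y = 0"
      from fun_cong[OF this, of "hop (Suc (idx j)) (idx j) S"] nz show False by simp
    qed
    moreover have "\<Sum>T \<le> m" if "?y T \<noteq> 0" for T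
    proof -
      from that have T: "idx j \<in> T" "Suc (idx j) \<notin> T" "x (hop (idx j) (Suc (idx j)) T) \<noteq> 0" by (auto split: if_splits)
      have "finite T" using supported_cop[OF Suc.prems(1), of "gE j"] that by (auto simp: supported_def intro: configs_finite)
      from sum_hop[OF this T(1,2)] Suc.prems(3)[OF T(3)] show ?thesis by simp
    qed
    ultimately obtain w :: "'n uq" where "cact w ?y = ctop i" using Suc.IH[OF supported_cop[OF Suc.prems(1), of "gE j"]] by blast
    then have "cact (w * uq_gen (gE j)) x = ctop i" by (simp add: C.act_mult cact_gen)
    then show ?thesis by blast
  next
    case False
    then have "x {1..idx i} \<noteq> 0" using Suc.prems(2) by (auto simp: fun_eq_iff)
    then have "cact (uq_const (1 / x {1..idx i})) x = ctop i"
      using False by (auto simp: cact_scl fscale_def ctop_def fun_eq_iff)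
    then show ?thesis by blast
  qed
qed

lemma ctop_generated:
  fixes i :: "'n::{finite,linorder}" and u :: "'n uq"
  assumes "cact u (ctop i) \<noteq> 0"
  shows "\<exists>w :: 'n uq. cact w (cact u (ctop i)) = ctop i"
proof (rule raise_to_top)
  let ?x = "cact u (ctop i)" and ?C = "configs (CARD('n) + 1) (idx i)"
  show x: "supported i ?x" by (rule supported_cact) (use top_config[of i] in \<open>auto simp: supported_def ctop_def\<close>)
  show "\<Sum>S \<le> Max (Sum ` ?C)" if "?x S \<noteq> 0" for S
    using x that finite_configs by (intro Max_ge) (auto simp: supported_def)
qed (rule assms)

text \<open>Both modules are generated by any of their nonzero vectors of the form \<open>u v\<close>, so the preceding comparison
  applies in both directions.\<close>

theorem annihilators_equal:
  assumes "irr_hw_module act (lam i) v"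
  shows "act u v = 0 \<longleftrightarrow> cact u (ctop i) = 0"
proof
  note irr = irr_hw_moduleD[OF assms]
  have c: "uq_mod cact" by (rule C.uq_mod_axioms)
  show "act u v = 0 \<Longrightarrow> cact u (ctop i) = 0"
    by (rule annihilator_subset[OF irr(1) c irr(2,3) ctop_hwv ctop_nonzero ctop_generated])
  show "cact u (ctop i) = 0 \<Longrightarrow> act u v = 0"
    by (rule annihilator_subset[OF c irr(1) ctop_hwv ctop_nonzero irr(2,3,4)])
qed

section \<open>The deformed fundamental modules\<close>

lemma finite_below: "finite {a. \<forall>k. a k \<le> (m :: 'n::finite \<Rightarrow> nat) k}"
proof -
  have "{a. \<forall>k. a k \<le> m k} = PiE UNIV (\<lambda>k. {..m k})" by (auto simp: PiE_def Pi_def)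
  then show ?thesis by (simp add: finite_PiE)
qed

context uq_mod
begin

lemma act_sum: "act u (sum f A) = (\<Sum>a\<in>A. act u (f a))" and act_sum_left: "act (sum g A) x = (\<Sum>a\<in>A. act (g a) x)"
  by (induction A rule: infinite_finite_induct) (simp_all add: act_add act_plus)

lemma ps_conv_const_left:
  fixes f :: "('n, 'l) ps"
  shows "ps_conv act (ps_const u) f = (\<lambda>m. act u (f m))"
proof
  fix m
  have "ps_conv act (ps_const u) f m = (\<Sum>a\<in>{\<lambda>_. 0}. act (ps_const u a) (f (\<lambda>k. m k - a k)))"
    unfolding ps_conv_def by (rule sum.mono_neutral_right[OF finite_below]) (auto simp: ps_const_def)
  then show "ps_conv act (ps_const u) f m = act u (f m)" by (simp add: ps_const_def)
qed

lemma ps_conv_const_right: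
  fixes u :: "('n, 'n uq) ps"
  shows "ps_conv act u (ps_const v) = (\<lambda>m. act (u m) v)"
proof
  fix m
  have "ps_conv act u (ps_const v) m = (\<Sum>a\<in>{m}. act (u a) (ps_const v (\<lambda>k. m k - a k)))"
    unfolding ps_conv_def
  proof (rule sum.mono_neutral_right[OF finite_below])
    show "\<forall>a\<in>{a. \<forall>k. a k \<le> m k} - {m}. act (u a) (ps_const v (\<lambda>k. m k - a k)) = 0"
      by (auto simp: ps_const_def) (metis diff_is_0_eq' le_antisym diffs0_imp_equal ext)
  qed simp
  then show "ps_conv act u (ps_const v) m = act (u m) v" by (simp add: ps_const_def)
qed

lemma ps_conv_add: "ps_conv act u (f + g) = ps_conv act u f + ps_conv act u g"
  and ps_conv_plus: "ps_conv act (u + u') f = ps_conv act u f + ps_conv act u' f"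
  by (intro ext; simp add: ps_conv_def act_add act_plus sum.distrib)+

lemma ps_conv_mult:
  fixes u u' :: "('n, 'n uq) ps"
  shows "ps_conv act (ps_mult u u') f = ps_conv act u (ps_conv act u' f)"
proof
  fix m
  let ?D = "\<lambda>m :: 'n \<Rightarrow> nat. {a. \<forall>k. a k \<le> m k}"
  have "ps_conv act (ps_mult u u') f m = (\<Sum>a\<in>?D m. \<Sum>b\<in>?D a. act (u b) (act (u' (\<lambda>k. a k - b k)) (f (\<lambda>k. m k - a k))))"
    by (simp add: ps_conv_def act_sum_left act_mult)
  also have "\<dots> = (\<Sum>(a, b)\<in>(SIGMA a:?D m. ?D a). act (u b) (act (u' (\<lambda>k. a k - b k)) (f (\<lambda>k. m k - a k))))"
    by (simp add: sum.Sigma finite_below)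
  also have "\<dots> = (\<Sum>(b, c)\<in>(SIGMA b:?D m. ?D (\<lambda>k. m k - b k)). act (u b) (act (u' c) (f (\<lambda>k. m k - b k - c k))))"
  proof (rule sum.reindex_bij_witness[where i = "\<lambda>(b, c). (\<lambda>k. b k + c k, b)" and j = "\<lambda>(a, b). (b, \<lambda>k. a k - b k)"], goal_cases)
    case (1 x)
    then show ?case by (auto simp: fun_eq_iff)
  next
    case (2 x)
    then show ?case by (auto intro: order_trans diff_le_mono)
  next
    case (3 x)
    then show ?case by (auto simp: fun_eq_iff)
  next
    case (4 x)
    then show ?case by (auto simp: le_diff_conv2 add.commute le_diff_conv2)
  next
    case (5 x)
    then show ?case by (auto simp: fun_eq_iff)
  qed
  also have "\<dots> = (\<Sum>b\<in>?D m. \<Sum>c\<in>?D (\<lambda>k. m k - b k). act (u b) (act (u' c) (f (\<lambda>k. m k - b k - c k))))"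
    by (simp add: sum.Sigma finite_below)
  also have "\<dots> = ps_conv act u (ps_conv act u' f) m" by (simp add: ps_conv_def act_sum)
  finally show "ps_conv act (ps_mult u u') f m = ps_conv act u (ps_conv act u' f) m" .
qed

end

lemma sum_fun_apply: "(\<Sum>x\<in>A. f x) T = (\<Sum>x\<in>A. f x T)"
  by (induction A rule: infinite_finite_induct) simp_all

definition pscale :: "scal \<Rightarrow> ('m \<Rightarrow> nat set \<Rightarrow> scal) \<Rightarrow> 'm \<Rightarrow> nat set \<Rightarrow> scal" where
  "pscale c f = (\<lambda>m. fscale c (f m))"

interpretation PS: vector_space pscale
  by unfold_locales (auto simp: pscale_def fscale_def fun_eq_iff algebra_simps)

text \<open>The series \<open>exp (\<Sum>\<^sub>j y\<^sub>j z\<^sub>j)\<close> times a basis vector.\<close>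

definition expvec :: "nat set \<Rightarrow> ('n::{finite,linorder} \<Rightarrow> scal) \<Rightarrow> ('n \<Rightarrow> nat) \<Rightarrow> nat set \<Rightarrow> scal" where
  "expvec S y = (\<lambda>m T. if T = S then \<Prod>j\<in>UNIV. y j ^ m j / fact (m j) else 0)"

lemma exp_binomial:
  "((a :: 'a::field_char_0) + b) ^ n / fact n = (\<Sum>t\<le>n. (a ^ t / fact t) * (b ^ (n - t) / fact (n - t)))"
  unfolding binomial_ring sum_divide_distrib
  by (rule sum.cong[OF refl]) (simp add: binomial_fact)

lemma cst_inverse_fact: "cst (1 / fact k) = 1 / fact k"
proof -
  have "cst (1 / fact k) * cst (of_nat (fact k)) = 1"
    by (simp flip: cst_mult)
  then show ?thesis unfolding cst_of_nat by (simp add: field_simps)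
qed

text \<open>The eigenvalue of \<open>M\<^sub>j\<close> on the basis vector of \<open>S\<close> is \<open>q\<^sup>e\<close> for this \<open>e\<close>.\<close>

definition mexp :: "'n::{finite,linorder} \<Rightarrow> nat set \<Rightarrow> int" where
  "mexp j S = (\<Sum>k\<in>UNIV. M_exp j k * mu S k) - (int CARD('n) + 1) ^ 2"

definition meig :: "int \<Rightarrow> scal" where "meig e = Q (2 * e) - Q (- 2 * e)"

lemma wtv_support:
  assumes "\<And>T. T \<noteq> S \<Longrightarrow> x T = 0"
  shows "uq_mod.wtv cact (mu S) x"
proof (rule C.wtvI)
  fix j
  show "cact (uq_gen (gK j)) x = uq_mod.scl cact (Q (2 * mu S j)) x"
    unfolding cact_gen cact_scl by (rule ext, rename_tac T, case_tac "T = S") (simp_all add: fscale_def assms)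
qed

lemma cact_M:
  fixes j :: "'n::{finite,linorder}"
  assumes "\<And>T. T \<noteq> S \<Longrightarrow> x T = 0"
  shows "cact (M_el 1 j - M_el (- 1) j) x = uq_mod.scl (cact :: 'n uq \<Rightarrow> _) (meig (mexp j S)) x"
proof -
  have w: "uq_mod.wtv cact (mu S) x" using assms by (rule wtv_support)
  have "cact (M_el s j) x = uq_mod.scl (cact :: 'n uq \<Rightarrow> _) (Q (2 * (s * mexp j S))) x" for s
  proof -
    have "cact (M_el s j) x = uq_mod.scl (cact :: 'n uq \<Rightarrow> _) (Q (2 * (- s * (int CARD('n) + 1) ^ 2)) * Q (2 * (\<Sum>k\<in>UNIV. (s * M_exp j k) * mu S k))) x"
      unfolding M_el_def C.act_mult C.act_const C.act_K_mon[OF w] C.scl_scl qq_powi ..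
    also have "Q (2 * (- s * (int CARD('n) + 1) ^ 2)) * Q (2 * (\<Sum>k\<in>UNIV. (s * M_exp j k) * mu S k)) = Q (2 * (s * mexp j S))"
      by (simp add: mexp_def algebra_simps sum_distrib_left flip: Q_add)
    finally show ?thesis .
  qed
  from this[of 1] this[of "- 1"] show ?thesis
    unfolding C.act_minus meig_def cact_scl by (simp add: fscale_def fun_eq_iff algebra_simps)
qed

lemma expvec_supp: "T \<noteq> S \<Longrightarrow> expvec S y m T = 0"
  by (simp add: expvec_def)

text \<open>On the basis vector of \<open>S\<close> the element \<open>M\<^sub>j - M\<^sub>j\<^sup>-\<^sup>1\<close> is a scalar, so \<open>w\<^sub>j\<close> is the exponential of a multiple of \<open>z\<^sub>j\<close>.\<close>

lemma w_el_expvec: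
  fixes i j :: "'n::{finite,linorder}"
  shows "ps_conv cact (w_el j) (expvec S y) = expvec S (y(j := y j + meig (mexp j S)))"
proof
  fix m :: "'n \<Rightarrow> nat"
  let ?Y = "meig (mexp j S)" and ?c = "\<lambda>t a. if a = j then t else (0 :: nat)"
  have M: "cact (w_el j (?c t)) x = fscale (?Y ^ t / fact t) x" if "\<And>T. T \<noteq> S \<Longrightarrow> x T = 0" for t x
  proof -
    have "w_el j (?c t) = uq_const (cst (1 / fact t)) * (M_el 1 j - M_el (- 1) j) ^ t" by (simp add: w_el_def)
    then show ?thesis
      by (simp only: C.act_mult C.act_const C.act_power[OF cact_M[OF that]] C.scl_scl cst_inverse_fact) (simp add: cact_scl)
  qed
  have "ps_conv cact (w_el j) (expvec S y) m = (\<Sum>a\<in>?c ` {..m j}. cact (w_el j a) (expvec S y (\<lambda>k. m k - a k)))"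
    unfolding ps_conv_def
  proof (rule sum.mono_neutral_right[OF finite_below])
    show "?c ` {..m j} \<subseteq> {a. \<forall>k. a k \<le> m k}" by auto
    show "\<forall>a\<in>{a. \<forall>k. a k \<le> m k} - ?c ` {..m j}. cact (w_el j a) (expvec S y (\<lambda>k. m k - a k)) = 0"
    proof
      fix a assume a: "a \<in> {a. \<forall>k. a k \<le> m k} - ?c ` {..m j}"
      have "\<not> (\<forall>k. k \<noteq> j \<longrightarrow> a k = 0)"
      proof
        assume "\<forall>k. k \<noteq> j \<longrightarrow> a k = 0"
        then have "a = ?c (a j)" by auto
        with a show False by blast
      qed
      then have "w_el j a = 0" unfolding w_el_def by (rule if_not_P)
      then show "cact (w_el j a) (expvec S y (\<lambda>k. m k - a k)) = 0" by simp
    qed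
  qed
  also have "\<dots> = (\<Sum>t\<le>m j. cact (w_el j (?c t)) (expvec S y (\<lambda>k. m k - ?c t k)))"
    by (subst sum.reindex) (auto simp: inj_on_def fun_eq_iff split: if_splits)
  also have "\<dots> = (\<Sum>t\<le>m j. fscale (?Y ^ t / fact t) (expvec S y (\<lambda>k. m k - ?c t k)))"
    by (rule sum.cong[OF refl]) (rule M, rule expvec_supp)
  also have "\<dots> = expvec S (y(j := y j + ?Y)) m"
  proof
    fix T
    let ?r = "\<Prod>k\<in>UNIV - {j}. y k ^ m k / fact (m k)"
    have 1: "expvec S y (\<lambda>k. m k - ?c t k) S = (y j ^ (m j - t) / fact (m j - t)) * ?r" for t
      unfolding expvec_def if_P[OF refl] by (subst prod.remove[of _ j]) (auto intro!: prod.cong)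
    have 2: "expvec S (y(j := y j + ?Y)) m S = ((?Y + y j) ^ m j / fact (m j)) * ?r"
      unfolding expvec_def if_P[OF refl] by (subst prod.remove[of _ j]) (auto intro!: prod.cong simp: add.commute)
    show "(\<Sum>t\<le>m j. fscale (?Y ^ t / fact t) (expvec S y (\<lambda>k. m k - ?c t k))) T = expvec S (y(j := y j + ?Y)) m T"
    proof (cases "T = S")
      case True
      show ?thesis unfolding True 2 exp_binomial sum_distrib_right
        by (subst sum_fun_apply) (simp add: fscale_def 1 mult_ac)
    next
      case False
      then show ?thesis by (subst sum_fun_apply) (simp add: fscale_def expvec_supp)
    qed
  qed
  finally show "ps_conv cact (w_el j) (expvec S y) m = expvec S (y(j := y j + ?Y)) m" .
qed

lemma f_bar_expvec:
  "ps_conv cact (f_bar j) (expvec S y) = (if idx j \<in> S \<and> Suc (idx j) \<notin> S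
     then pscale (hsign j S) (expvec (hop (idx j) (Suc (idx j)) S) y) else 0)"
proof (intro ext)
  fix m T
  have eq: "hop (Suc (idx j)) (idx j) T = S \<longleftrightarrow> idx j \<in> S \<and> Suc (idx j) \<notin> S \<and> T = hop (idx j) (Suc (idx j)) S"
    if "Suc (idx j) \<in> T" "idx j \<notin> T"
    using that by (auto simp: hop_inverse hop_mem)
  show "ps_conv cact (f_bar j) (expvec S y) m T = (if idx j \<in> S \<and> Suc (idx j) \<notin> S
     then pscale (hsign j S) (expvec (hop (idx j) (Suc (idx j)) S) y) else 0) m T"
    unfolding f_bar_def C.ps_conv_const_left cact_gen
    by (cases "Suc (idx j) \<in> T \<and> idx j \<notin> T") (auto simp: pscale_def fscale_def expvec_def eq hop_mem hop_inverse)
qed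

lemma E_expvec:
  "(\<lambda>m. cact (uq_gen (gE j)) (expvec S y m)) = (if idx j \<notin> S \<and> Suc (idx j) \<in> S
     then pscale (hsign j (hop (Suc (idx j)) (idx j) S)) (expvec (hop (Suc (idx j)) (idx j) S) y) else 0)"
proof (intro ext)
  fix m T
  have eq: "hop (idx j) (Suc (idx j)) T = S \<longleftrightarrow> idx j \<notin> S \<and> Suc (idx j) \<in> S \<and> T = hop (Suc (idx j)) (idx j) S"
    if "idx j \<in> T" "Suc (idx j) \<notin> T"
    using that by (auto simp: hop_inverse hop_mem)
  show "cact (uq_gen (gE j)) (expvec S y m) T = (if idx j \<notin> S \<and> Suc (idx j) \<in> S
     then pscale (hsign j (hop (Suc (idx j)) (idx j) S)) (expvec (hop (Suc (idx j)) (idx j) S) y) else 0) m T"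
    unfolding cact_gen
    by (cases "idx j \<in> T \<and> Suc (idx j) \<notin> T") (auto simp: pscale_def fscale_def expvec_def eq hop_mem hop_inverse)
qed

lemma e_bar_expvec:
  "ps_conv cact (e_bar j) (expvec S y) = (if idx j \<notin> S \<and> Suc (idx j) \<in> S
     then pscale (hsign j (hop (Suc (idx j)) (idx j) S))
       (expvec (hop (Suc (idx j)) (idx j) S) (y(j := y j + meig (mexp j S)))) else 0)"
  unfolding e_bar_def C.ps_conv_mult w_el_expvec C.ps_conv_const_left E_expvec ..

lemma k_bar_expvec:
  "ps_conv cact (k_bar j) (expvec S y) = pscale (meig (mu S j)) (expvec S (y(j := y j + meig (mexp j S))))"
  unfolding k_bar_def C.ps_conv_mult w_el_expvec C.ps_conv_const_left C.act_minus cact_gen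
  by (intro ext) (simp add: pscale_def fscale_def expvec_def meig_def algebra_simps)

subsection \<open>The eigenvalues of the torus elements\<close>

lemma summation_by_parts:
  fixes L s :: "nat \<Rightarrow> int"
  assumes "L 0 = 0" "L (Suc n) = 0"
  shows "(\<Sum>k=1..n. L k * (s k - s (Suc k))) = (\<Sum>k=1..Suc n. (L k - L (k - 1)) * s k)"
proof -
  have "(\<Sum>k=1..m. L k * (s k - s (Suc k))) = (\<Sum>k=1..m. (L k - L (k - 1)) * s k) - L m * s (Suc m)" for m
    by (induction m) (simp_all add: assms(1) algebra_simps)
  from this[of n] show ?thesis using assms(2) by simp
qed

lemma cnt_sum:
  assumes "0 \<notin> S"
  shows "(\<Sum>k=1..p. if k \<in> S then 1 else (0 :: int)) = int (cnt S (Suc p))"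
  by (induction p) (simp_all add: cnt_Suc, use assms in \<open>simp add: cnt_def\<close>)

text \<open>Summation by parts: the differences of consecutive exponents of \<open>L\<^sub>p\<close> are \<open>n + 1 - p\<close> up to \<open>p\<close> and \<open>-p\<close> afterwards.\<close>

lemma L_exp_mu:
  fixes i :: "'n::{finite,linorder}"
  assumes S: "S \<in> configs (CARD('n) + 1) (idx i)" and p: "p \<le> CARD('n) + 1"
  shows "(\<Sum>k\<in>(UNIV :: 'n set). L_exp p k * mu S k)
    = (int CARD('n) + 1) * int (cnt S (Suc p)) - int p * int (idx i)"
proof -
  let ?n = "CARD('n)"
  let ?s = "\<lambda>k. if k \<in> S then 1 else (0 :: int)"
  define L where "L k = (if k \<le> p then int k * (int ?n + 1 - int p) else int p * (int ?n + 1 - int k))" for k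
  have S0: "0 \<notin> S" using S by (auto simp: configs_def)
  have "(\<Sum>k\<in>(UNIV :: 'n set). L_exp p k * mu S k) = (\<Sum>k\<in>(UNIV :: 'n set). (\<lambda>k. L k * (?s k - ?s (Suc k))) (idx k))"
    by (simp add: L_exp_def L_def mu_def)
  also have "\<dots> = (\<Sum>k=1..?n. L k * (?s k - ?s (Suc k)))"
    by (rule sum.reindex_bij_betw[OF bij_idx])
  also have "\<dots> = (\<Sum>k=1..Suc ?n. (L k - L (k - 1)) * ?s k)"
    using p by (intro summation_by_parts) (auto simp: L_def)
  also have "\<dots> = (\<Sum>k=1..Suc ?n. (int ?n + 1) * (if k \<le> p then ?s k else 0) - int p * ?s k)"
  proof (rule sum.cong[OF refl])
    fix k assume k: "k \<in> {1..Suc ?n}"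
    have "L k - L (k - 1) = (if k \<le> p then int ?n + 1 else 0) - int p"
    proof (cases "k \<le> p")
      case False
      then have "k = Suc p \<or> \<not> k - 1 \<le> p" by auto
      with False k show ?thesis by (auto simp: L_def of_nat_diff algebra_simps)
    qed (use k in \<open>auto simp: L_def of_nat_diff algebra_simps\<close>)
    then show "(L k - L (k - 1)) * ?s k = (int ?n + 1) * (if k \<le> p then ?s k else 0) - int p * ?s k" by auto
  qed
  also have "\<dots> = (int ?n + 1) * (\<Sum>k=1..Suc ?n. if k \<le> p then ?s k else 0) - int p * (\<Sum>k=1..Suc ?n. ?s k)"
    by (simp only: sum_subtractf sum_distrib_left)
  also have "(\<Sum>k=1..Suc ?n. if k \<le> p then ?s k else 0) = (\<Sum>k=1..p. ?s k)"
    using p by (intro sum.mono_neutral_cong_right) auto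
  also have "\<dots> = int (cnt S (Suc p))" by (rule cnt_sum[OF S0])
  also have "(\<Sum>k=1..Suc ?n. ?s k) = int (cnt S (Suc (Suc ?n)))" by (rule cnt_sum[OF S0])
  also have "cnt S (Suc (Suc ?n)) = idx i"
  proof -
    have "S \<inter> {..<Suc (Suc ?n)} = S" using S by (auto simp: configs_def)
    then show ?thesis using S by (simp add: cnt_def configs_def)
  qed
  finally show ?thesis .
qed

text \<open>The exponent for a configuration with exactly one particle on the sites \<open>j\<close> and \<open>j + 1\<close> and \<open>k\<close> particles below.\<close>

definition yexp :: "'n::{finite,linorder} \<Rightarrow> 'n \<Rightarrow> nat \<Rightarrow> int" where
  "yexp i j k = (if idx j = 1 \<or> idx j = CARD('n) then 0
     else (int CARD('n) + 1) * (2 * int k + 1) - 2 * int (idx i) * int (idx j)) - (int CARD('n) + 1) ^ 2"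

lemma mexp_yexp:
  fixes i j :: "'n::{finite,linorder}"
  assumes S: "S \<in> configs (CARD('n) + 1) (idx i)" and one: "idx j \<in> S \<longleftrightarrow> Suc (idx j) \<notin> S"
  shows "mexp j S = yexp i j (cnt S (idx j))"
proof (cases "idx j = 1 \<or> idx j = CARD('n)")
  case False
  have p: "1 < idx j" "idx j < CARD('n)" using False idx_ge1[of j] idx_le[of j] by auto
  have "(\<Sum>k\<in>UNIV. M_exp j k * mu S k) = (\<Sum>k\<in>(UNIV :: 'n set). L_exp (idx j - 1) k * mu S k) + (\<Sum>k\<in>(UNIV :: 'n set). L_exp (idx j + 1) k * mu S k)"
    using False by (simp add: M_exp_def distrib_right sum.distrib)
  also have "\<dots> = (int CARD('n) + 1) * (int (cnt S (idx j)) + int (cnt S (Suc (Suc (idx j))))) - 2 * int (idx i) * int (idx j)"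
    using p by (subst (1 2) L_exp_mu[OF S]) (auto simp: algebra_simps of_nat_diff)
  also have "cnt S (Suc (Suc (idx j))) = cnt S (idx j) + 1" using one by (simp add: cnt_Suc)
  finally show ?thesis using False by (simp add: mexp_def yexp_def)
qed (auto simp: mexp_def yexp_def M_exp_def)

definition yval :: "'n::{finite,linorder} \<Rightarrow> 'n mult \<Rightarrow> 'n \<Rightarrow> scal" where
  "yval i n j = (\<Sum>k<idx i. of_nat (n j k) * meig (yexp i j k))"

lemma yval_bump:
  assumes "k < idx i"
  shows "yval i (bump j k n) = (yval i n)(j := yval i n j + meig (yexp i j k))"
proof
  fix j'
  show "yval i (bump j k n) j' = ((yval i n)(j := yval i n j + meig (yexp i j k))) j'"
  proof (cases "j' = j")
    case True
    have "(\<Sum>l<idx i. of_nat (bump j k n j l) * meig (yexp i j l))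
      = (\<Sum>l<idx i. of_nat (n j l) * meig (yexp i j l) + (if l = k then meig (yexp i j k) else 0))"
      by (rule sum.cong[OF refl]) (auto simp: bump_def algebra_simps)
    then show ?thesis using True assms by (simp add: yval_def sum.distrib)
  qed (simp add: yval_def bump_def)
qed

text \<open>The counterpart of \<open>R i S n\<close>.\<close>

definition model :: "'n::{finite,linorder} \<Rightarrow> nat set \<Rightarrow> 'n mult \<Rightarrow> ('n \<Rightarrow> nat) \<Rightarrow> nat set \<Rightarrow> scal" where
  "model i S n = expvec S (yval i n)"

lemma cnt_less:
  fixes i j :: "'n::{finite,linorder}"
  assumes "S \<in> configs (CARD('n) + 1) (idx i)" "idx j \<in> S \<longleftrightarrow> Suc (idx j) \<notin> S"
  shows "cnt S (idx j) < idx i"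
  using valid_cnt[OF assms(1) _ _ assms(2)] idx_ge1[of j] idx_le[of j] by (auto simp: valid_def)

text \<open>These are the formulas for the products with the \<open>R i S n\<close>.\<close>

theorem
  fixes i j :: "'n::{finite,linorder}"
  assumes S: "S \<in> configs (CARD('n) + 1) (idx i)"
  shows f_model: "ps_conv cact (f_bar j) (model i S n) = (if idx j \<in> S \<and> Suc (idx j) \<notin> S
      then pscale (of_int (sg j S)) (model i (hop (idx j) (Suc (idx j)) S) n) else 0)"
    and e_model: "ps_conv cact (e_bar j) (model i S n) = (if idx j \<notin> S \<and> Suc (idx j) \<in> S
      then pscale (of_int (sg j (hop (Suc (idx j)) (idx j) S))) (model i (hop (Suc (idx j)) (idx j) S) (bump j (cnt S (idx j)) n)) else 0)"
    and k_model: "ps_conv cact (k_bar j) (model i S n)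
      = pscale ((Q 2 - Q (- 2)) * of_int (mu S j)) (model i S (bump j (cnt S (idx j)) n))"
proof -
  show "ps_conv cact (f_bar j) (model i S n) = (if idx j \<in> S \<and> Suc (idx j) \<notin> S
      then pscale (of_int (sg j S)) (model i (hop (idx j) (Suc (idx j)) S) n) else 0)"
    using S unfolding model_def f_bar_expvec by (simp add: hsign_def)
  have bump: "yval i (bump j (cnt S (idx j)) n) = (yval i n)(j := yval i n j + meig (mexp j S))"
    if one: "idx j \<in> S \<longleftrightarrow> Suc (idx j) \<notin> S"
    unfolding yval_bump[OF cnt_less[OF S one]] mexp_yexp[OF S one] ..
  show "ps_conv cact (e_bar j) (model i S n) = (if idx j \<notin> S \<and> Suc (idx j) \<in> S
      then pscale (of_int (sg j (hop (Suc (idx j)) (idx j) S))) (model i (hop (Suc (idx j)) (idx j) S) (bump j (cnt S (idx j)) n)) else 0)"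
  proof (cases "idx j \<notin> S \<and> Suc (idx j) \<in> S")
    case True
    then have "hop (Suc (idx j)) (idx j) S \<in> configs (CARD('n) + 1) (idx i)"
      using idx_ge1[of j] idx_le[of j] by (intro hop_configs[OF S]) auto
    with True show ?thesis unfolding model_def e_bar_expvec using bump by (simp add: hsign_def)
  next
    case False
    show ?thesis unfolding model_def e_bar_expvec if_not_P[OF False] ..
  qed
  show "ps_conv cact (k_bar j) (model i S n)
      = pscale ((Q 2 - Q (- 2)) * of_int (mu S j)) (model i S (bump j (cnt S (idx j)) n))"
  proof (cases "idx j \<in> S \<longleftrightarrow> Suc (idx j) \<in> S")
    case True
    then show ?thesis unfolding model_def k_bar_expvec using mu_vanish[OF True] by (simp add: meig_def)
  next
    case False
    then have "mu S j = 1 \<or> mu S j = - 1" by (auto simp: mu_def)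
    then have "meig (mu S j) = (Q 2 - Q (- 2)) * of_int (mu S j)" by (auto simp: meig_def)
    then show ?thesis unfolding model_def k_bar_expvec using bump False by simp
  qed
qed

subsection \<open>Linear independence of the deformed basis\<close>

lemma Q_independent_family:
  assumes "finite I" "inj_on h I" "(\<Sum>x\<in>I. of_int (c x) * Q (h x)) = 0" "x \<in> I"
  shows "c x = 0"
proof -
  have z: "(\<Sum>e\<in>h ` I. of_int ((\<lambda>e. c (inv_into I h e)) e) * Q e) = 0"
    unfolding sum.reindex[OF assms(2)] o_def using assms(3) by (simp only: inv_into_f_f[OF assms(2)] cong: sum.cong)
  from Q_independent[OF _ z, of "h x"] assms show ?thesis by (simp add: inv_into_f_f[OF assms(2)])
qed

text \<open>At the two ends of the diagram there is only one possible number of particles below.\<close>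

lemma valid_end:
  fixes i j :: "'n::{finite,linorder}"
  assumes "valid (CARD('n) + 1) (idx i) (idx j) k" "valid (CARD('n) + 1) (idx i) (idx j) l"
    and "idx j = 1 \<or> idx j = CARD('n)"
  shows "k = l"
  using assms unfolding valid_def by auto

lemma yexp_inj:
  fixes i j :: "'n::{finite,linorder}"
  assumes "valid (CARD('n) + 1) (idx i) (idx j) k" "valid (CARD('n) + 1) (idx i) (idx j) l"
    and "yexp i j k = yexp i j l"
  shows "k = l"
proof (cases "idx j = 1 \<or> idx j = CARD('n)")
  case True
  then show ?thesis using valid_end assms by blast
next
  case False
  then have "(int CARD('n) + 1) * (2 * int k + 1) = (int CARD('n) + 1) * (2 * int l + 1)"
    using assms(3) by (simp add: yexp_def)
  then show ?thesis by simp
qed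

text \<open>With \<open>N = n + 1\<close>, this follows from \<open>(k + 1)\<^sup>2 \<le> i j\<close> and \<open>2 N (k + 1) \<le> N\<^sup>2 + (k + 1)\<^sup>2\<close>.\<close>

lemma yexp_neg:
  fixes i j :: "'n::{finite,linorder}"
  assumes v: "valid (CARD('n) + 1) (idx i) (idx j) k"
  shows "yexp i j k < 0"
proof -
  define N where "N = int CARD('n) + 1"
  have N: "N > 0" by (simp add: N_def)
  define P where "P = int (idx i) * int (idx j)"
  have "(int k + 1) * (int k + 1) \<le> P"
    unfolding P_def using v by (intro mult_mono) (auto simp: valid_def)
  moreover have "0 \<le> (N - (int k + 1)) * (N - (int k + 1))" by simp
  moreover have "0 \<le> P" by (simp add: P_def)
  ultimately have "N * (2 * int k + 1) - 2 * P - N ^ 2 < 0"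
    using N unfolding power2_eq_square distrib_left distrib_right left_diff_distrib right_diff_distrib
    by (simp add: algebra_simps)
  then show ?thesis using N by (simp add: yexp_def P_def mult.assoc flip: N_def)
qed

lemma yval_inject:
  fixes i :: "'n::{finite,linorder}"
  assumes n: "\<And>j k. n j k \<noteq> 0 \<Longrightarrow> valid (CARD('n) + 1) (idx i) (idx j) k"
    and n': "\<And>j k. n' j k \<noteq> 0 \<Longrightarrow> valid (CARD('n) + 1) (idx i) (idx j) k"
    and eq: "yval i n = yval i n'"
  shows "n = n'"
proof (intro ext)
  fix j :: 'n and k
  define V where "V = {k. valid (CARD('n) + 1) (idx i) (idx j) k}"
  have V: "V \<subseteq> {..<idx i}" "finite V" by (auto simp: V_def valid_def intro: finite_subset[of _ "{..<idx i}"])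
  define d where "d k = int (n j k) - int (n' j k)" for k
  have "(\<Sum>k<idx i. of_int (d k) * meig (yexp i j k)) = 0"
    using fun_cong[OF eq, of j] by (simp add: yval_def d_def left_diff_distrib sum_subtractf)
  also have "(\<Sum>k<idx i. of_int (d k) * meig (yexp i j k)) = (\<Sum>k\<in>V. of_int (d k) * meig (yexp i j k))"
  proof (rule sum.mono_neutral_right)
    show "\<forall>k\<in>{..<idx i} - V. of_int (d k) * meig (yexp i j k) = 0"
    proof
      fix k assume "k \<in> {..<idx i} - V"
      then have "n j k = 0" "n' j k = 0" using n n' by (auto simp: V_def)
      then show "of_int (d k) * meig (yexp i j k) = 0" by (simp add: d_def)
    qed
  qed (use V in auto)
  also have "\<dots> = (\<Sum>k\<in>V. of_int (d k) * Q (2 * yexp i j k)) + (\<Sum>k\<in>V. of_int (- d k) * Q (- 2 * yexp i j k))"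
    by (simp add: meig_def right_diff_distrib sum_subtractf sum_negf)
  also have "\<dots> = (\<Sum>x\<in>V <+> V. of_int (case x of Inl k \<Rightarrow> d k | Inr k \<Rightarrow> - d k)
      * Q (case x of Inl k \<Rightarrow> 2 * yexp i j k | Inr k \<Rightarrow> - 2 * yexp i j k))"
    by (simp add: sum.Plus V)
  finally have z: "(\<Sum>x\<in>V <+> V. of_int (case x of Inl k \<Rightarrow> d k | Inr k \<Rightarrow> - d k)
      * Q (case x of Inl k \<Rightarrow> 2 * yexp i j k | Inr k \<Rightarrow> - 2 * yexp i j k)) = 0" by simp
  \<comment> \<open>The exponents \<open>2 e\<close> are negative and the exponents \<open>- 2 e\<close> are positive, so no two of them coincide.\<close>
  have inj: "inj_on (\<lambda>x. case x of Inl k \<Rightarrow> 2 * yexp i j k | Inr k \<Rightarrow> - 2 * yexp i j k) (V <+> V)"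
  proof (rule inj_onI)
    fix x y assume xy: "x \<in> V <+> V" "y \<in> V <+> V"
      "(case x of Inl k \<Rightarrow> 2 * yexp i j k | Inr k \<Rightarrow> - 2 * yexp i j k) = (case y of Inl k \<Rightarrow> 2 * yexp i j k | Inr k \<Rightarrow> - 2 * yexp i j k)"
    have neg: "yexp i j k < 0" if "k \<in> V" for k using yexp_neg that by (auto simp: V_def)
    have inj: "k = l" if "k \<in> V" "l \<in> V" "yexp i j k = yexp i j l" for k l using yexp_inj that by (auto simp: V_def)
    from xy show "x = y" by (auto elim!: PlusE dest: neg intro: inj) (drule neg, drule neg, simp)+
  qed
  show "n j k = n' j k"
  proof (cases "k \<in> V")
    case True
    have "d k = 0" using Q_independent_family[OF _ inj z, of "Inl k"] V True by auto
    then show ?thesis by (simp add: d_def)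
  next
    case False
    then have "n j k = 0" "n' j k = 0" using n n' by (auto simp: V_def)
    then show ?thesis by simp
  qed
qed

text \<open>The partial derivative by \<open>z\<^sub>j\<close>.\<close>

definition pderiv_ps :: "'n \<Rightarrow> (('n \<Rightarrow> nat) \<Rightarrow> nat set \<Rightarrow> scal) \<Rightarrow> ('n \<Rightarrow> nat) \<Rightarrow> nat set \<Rightarrow> scal" where
  "pderiv_ps j f = (\<lambda>m T. of_nat (Suc (m j)) * f (m(j := Suc (m j))) T)"

lemma pderiv_expvec: "pderiv_ps j (expvec S y) = pscale (y j) (expvec S y)"
proof (intro ext)
  fix m T
  let ?r = "\<Prod>k\<in>UNIV - {j}. y k ^ m k / fact (m k)"
  have "expvec S y (m(j := Suc (m j))) S = (y j ^ Suc (m j) / fact (Suc (m j))) * ?r"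
    unfolding expvec_def if_P[OF refl] by (subst prod.remove[of _ j]) (auto intro!: prod.cong)
  moreover have "expvec S y m S = (y j ^ m j / fact (m j)) * ?r"
    unfolding expvec_def if_P[OF refl] by (subst prod.remove[of _ j]) auto
  moreover have "of_nat (Suc (m j)) * ((y j ^ Suc (m j) / fact (Suc (m j))) * ?r) = y j * ((y j ^ m j / fact (m j)) * ?r)"
    by (simp del: of_nat_Suc add: divide_simps)
  ultimately show "pderiv_ps j (expvec S y) m T = pscale (y j) (expvec S y) m T"
    by (cases "T = S") (simp_all add: pderiv_ps_def pscale_def fscale_def expvec_supp del: of_nat_Suc)
qed

text \<open>The components at a configuration and the partial derivatives separate these vectors.\<close>

theorem model_independent:
  fixes i :: "'n::{finite,linorder}"
  shows "inj_on (\<lambda>(S, n). model i S n) (basis i)" "PS.independent ((\<lambda>(S, n). model i S n) ` basis i)"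
proof -
  let ?v = "\<lambda>(S, n). model i S n"
  define T where "T t = (case t of Inl S \<Rightarrow> (\<lambda>f m T. if T = S then f m T else 0) | Inr k \<Rightarrow> pderiv_ps k)"
    for t :: "nat set + 'n"
  define ev where "ev t x = (case t of Inl S \<Rightarrow> (if S = fst x then 1 else 0) | Inr k \<Rightarrow> yval i (snd x) k)"
    for t :: "nat set + 'n" and x
  have 1: "T t (x + y) = T t x + T t y" for t x y
    by (cases t) (auto simp: T_def pderiv_ps_def fun_eq_iff distrib_left)
  have 2: "T t (pscale a x) = pscale a (T t x)" for t a x
    by (cases t) (auto simp: T_def pderiv_ps_def pscale_def fscale_def fun_eq_iff mult.left_commute)
  have 3: "T t (?v x) = pscale (ev t x) (?v x)" for t x
  proof (cases t)
    case (Inl S)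
    then show ?thesis
      by (cases x) (simp add: T_def ev_def model_def expvec_def pscale_def fscale_def fun_eq_iff)
  qed (cases x; simp add: T_def ev_def model_def pderiv_expvec)
  have 4: "?v x \<noteq> 0" for x
  proof
    obtain S n where x: "x = (S, n)" by (cases x)
    assume "?v x = 0"
    then have "model i S n (\<lambda>_. 0) S = 0" by (simp add: x)
    then show False by (simp add: model_def expvec_def)
  qed
  have 5: "\<exists>t. ev t x \<noteq> ev t y" if xy: "x \<in> basis i" "y \<in> basis i" "x \<noteq> y" for x y
  proof (rule ccontr)
    assume "\<nexists>t. ev t x \<noteq> ev t y"
    then have eq: "ev t x = ev t y" for t by blast
    from eq[of "Inl (fst x)"] have S: "fst x = fst y" by (simp add: ev_def split: if_splits)
    have "snd x = snd y"
    proof (rule yval_inject)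
      show "yval i (snd x) = yval i (snd y)" using eq[of "Inr j" for j] by (auto simp: ev_def)
    qed (use xy in \<open>auto simp: basis_def\<close>)
    with S xy(3) show False by (simp add: prod_eq_iff)
  qed
  show "inj_on ?v (basis i)"
    by (rule PS.joint_eigenvectors_independent(1)[where op = T and v = ?v and X = "basis i" and ev = ev], rule 1, rule 2, rule 3, rule 4, rule 5)
  show "PS.independent (?v ` basis i)"
    by (rule PS.joint_eigenvectors_independent(2)[where op = T and v = ?v and X = "basis i" and ev = ev], rule 1, rule 2, rule 3, rule 4, rule 5)
qed

section \<open>Comparison of the two models\<close>

interpretation PO: vector_space_pair pscale oscale ..

definition mspan :: "'n::{finite,linorder} \<Rightarrow> (('n \<Rightarrow> nat) \<Rightarrow> nat set \<Rightarrow> scal) set" where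
  "mspan i = PS.span ((\<lambda>(S, n). model i S n) ` basis i)"

definition compare :: "'n::{finite,linorder} \<Rightarrow> (('n \<Rightarrow> nat) \<Rightarrow> nat set \<Rightarrow> scal) \<Rightarrow> 'n oper" where
  "compare i = (SOME T. Vector_Spaces.linear pscale oscale T \<and> (\<forall>(S, n)\<in>basis i. T (model i S n) = R i S n))"

lemma compare_exists:
  "Vector_Spaces.linear pscale oscale (compare i) \<and> (\<forall>(S, n)\<in>basis i. compare i (model i S n) = R i S n)"
proof -
  define f where "f b = (case inv_into (basis i) (\<lambda>(S, n). model i S n) b of (S, n) \<Rightarrow> R i S n)" for b
  obtain T where T: "Vector_Spaces.linear pscale oscale T" "\<forall>x\<in>(\<lambda>(S, n). model i S n) ` basis i. T x = f x"
    using PO.linear_independent_extend[OF model_independent(2)] by blast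
  have "T (model i S n) = R i S n" if "(S, n) \<in> basis i" for S n
  proof -
    have "T (model i S n) = f (model i S n)" using T(2) that by force
    moreover have "inv_into (basis i) (\<lambda>(S, n). model i S n) (model i S n) = (S, n)"
      using inv_into_f_f[OF model_independent(1) that] by simp
    ultimately show ?thesis by (simp add: f_def)
  qed
  with T(1) have "\<exists>T. Vector_Spaces.linear pscale oscale T \<and> (\<forall>(S, n)\<in>basis i. T (model i S n) = R i S n)" by blast
  from someI_ex[OF this] show ?thesis unfolding compare_def[symmetric] .
qed

lemma compare_linear: "Vector_Spaces.linear pscale oscale (compare i)"
  and compare_model: "(S, n) \<in> basis i \<Longrightarrow> compare i (model i S n) = R i S n"
  using compare_exists[of i] by auto

lemma compare_add: "compare i (f + g) = compare i f + compare i g"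
  and compare_scale: "compare i (pscale c f) = oscale c (compare i f)"
  and compare_0 [simp]: "compare i 0 = 0"
  using Vector_Spaces.linear.axioms(3)[OF compare_linear, of i] PO.linear_0[OF compare_linear]
  by (auto simp: module_hom_axioms_def PO.linear_add[OF compare_linear] PO.linear_scale[OF compare_linear])

lemma compare_inj: "inj_on (compare i) (mspan i)"
proof -
  have im: "compare i ` (\<lambda>(S, n). model i S n) ` basis i = (\<lambda>(S, n). R i S n) ` basis i"
    unfolding image_image by (rule image_cong[OF refl]) (auto simp: compare_model)
  have "O.independent (compare i ` (\<lambda>(S, n). model i S n) ` basis i)"
    unfolding im by (rule R_independent(2))
  moreover have "inj_on (compare i) ((\<lambda>(S, n). model i S n) ` basis i)"
  proof (rule inj_onI, clarify)
    fix S n S' n' assume a: "(S, n) \<in> basis i" "(S', n') \<in> basis i" "compare i (model i S n) = compare i (model i S' n')"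
    then have "(S, n) = (S', n')" using inj_onD[OF R_independent(1), of i "(S, n)" "(S', n')"] by (simp add: compare_model)
    then show "model i S n = model i S' n'" by simp
  qed
  ultimately show ?thesis unfolding mspan_def
    using PO.linear_inj_on_span_iff_independent_image[OF compare_linear] by blast
qed

lemma mspan_closed: "0 \<in> mspan i" "f \<in> mspan i \<Longrightarrow> g \<in> mspan i \<Longrightarrow> f + g \<in> mspan i" "f \<in> mspan i \<Longrightarrow> pscale c f \<in> mspan i"
  by (simp_all add: mspan_def PS.span_zero PS.span_add PS.span_scale)

lemma model_mspan: "(S, n) \<in> basis i \<Longrightarrow> model i S n \<in> mspan i"
  unfolding mspan_def by (rule PS.span_base) force

text \<open>The weight determines the configuration, and the pole does not depend on \<open>n\<close>; so one polynomial clears the poles of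
  the products with all \<open>R i S n\<close> of a given weight.\<close>

definition clearing :: "'n::{finite,linorder} \<Rightarrow> (nat set \<Rightarrow> scal) \<Rightarrow> 'n wgt \<Rightarrow> int \<Rightarrow> scal poly poly" where
  "clearing i pole \<beta> h = pole_poly (pole (SOME S. S \<in> configs (CARD('n) + 1) (idx i) \<and> mu S = \<beta>) / Q h)"

lemma clearing_mu:
  fixes i :: "'n::{finite,linorder}"
  assumes S: "S \<in> configs (CARD('n) + 1) (idx i)"
  shows "clearing i pole (mu S) h = pole_poly (pole S / Q h)"
proof -
  have "(SOME T. T \<in> configs (CARD('n) + 1) (idx i) \<and> mu T = (mu S :: 'n wgt)) = S"
    using S mu_inject[OF _ S] by (intro some_equality) auto
  then show ?thesis by (simp add: clearing_def)
qed

lemma clearing_nonzero: "clearing i pole \<beta> h \<noteq> 0"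
  by (simp add: clearing_def pole_poly_def)

lemma bulletable_R:
  fixes i :: "'n::{finite,linorder}"
  assumes S: "S \<in> configs (CARD('n) + 1) (idx i)"
  shows "bulletable (clearing i (\<lambda>S. pole_f (idx i) S (idx j))) (x_op (- 1) j) (R i S n)"
    "bulletable (clearing i (\<lambda>S. pole_e (idx i) S (idx j))) (x_op 1 j) (R i S n)"
    "bulletable (clearing i (\<lambda>S. pole_k (idx i) S (idx j))) (psi_op j) (R i S n)"
    "bulletable (clearing i (\<lambda>S. 0)) (phi_op j) (R i S n)"
  unfolding x_op_vop psi_op_vop phi_op_vop R_def
  by (rule vop_pair.bulletable_vop[OF vop_pair_f] vop_pair.bulletable_vop[OF vop_pair_e]
      vop_pair.bulletable_vop[OF vop_pair_k] vop_pair.bulletable_vop[OF vop_pair_phi];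
      simp only: clearing_mu[OF S] clearing_nonzero not_False_eq_True simp_thms)+

lemma top_basis: "({1..idx i}, \<lambda>_ _. 0) \<in> basis i"
  using top_config[of i] by (simp add: basis_def)

lemma basis_config: "(S, n) \<in> basis (i :: 'n::{finite,linorder}) \<Longrightarrow> S \<in> configs (CARD('n) + 1) (idx i)"
  by (simp add: basis_def)

text \<open>An identity between the two actions extends from the bases to their spans. The bullet product is linear only
  under the conditions of \<open>bulletable\<close>, which are therefore carried through the induction.\<close>

lemma intertwining:
  fixes i :: "'n::{finite,linorder}"
  assumes lin: "\<And>s. V_linear (\<lambda>v. a v s)"
    and F: "\<And>f g. F (f + g) = F f + F g" "\<And>c f. F (pscale c f) = pscale c (F f)"
    and step: "\<And>S n. (S, n) \<in> basis i \<Longrightarrow> F (model i S n) \<in> mspan i \<and> compare i (F (model i S n)) = a \<^sub>\<bullet> R i S n"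
    and b: "\<And>S n. (S, n) \<in> basis i \<Longrightarrow> bulletable P a (R i S n)"
    and f: "f \<in> mspan i"
  shows "F f \<in> mspan i \<and> compare i (F f) = a \<^sub>\<bullet> compare i f \<and> bulletable P a (compare i f)"
  using f unfolding mspan_def[of i]
proof (induction rule: PS.span_induct_alt)
  case base
  have "F 0 = 0" using F(1)[of 0 0] by simp
  \<comment> \<open>Zero is written as a multiple of an operator for which these conditions are known.\<close>
  moreover have "bulletable P a (oscale 0 (R i {1..idx i} (\<lambda>_ _. 0)))" "a \<^sub>\<bullet> oscale 0 (R i {1..idx i} (\<lambda>_ _. 0)) = oscale 0 (a \<^sub>\<bullet> R i {1..idx i} (\<lambda>_ _. 0))"
    by (rule bulletable_scale[OF lin b[OF top_basis]], rule bullet_scale[OF lin b[OF top_basis]])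
  ultimately have "F 0 \<in> mspan i \<and> compare i (F 0) = a \<^sub>\<bullet> compare i 0 \<and> bulletable P a (compare i 0)"
    by (simp add: mspan_closed)
  then show ?case by (simp only: zero_fun_def mspan_def)
next
  case (step c x y)
  then obtain S n where x: "x = model i S n" and Sn: "(S, n) \<in> basis i" by auto
  note s = assms(4)[OF Sn]
  have y: "F y \<in> mspan i" "compare i (F y) = a \<^sub>\<bullet> compare i y" "bulletable P a (compare i y)"
    using step.IH unfolding mspan_def by auto
  have cx: "compare i (pscale c x + y) = oscale c (R i S n) + compare i y"
    by (simp add: compare_add compare_scale x compare_model[OF Sn])
  have bc: "bulletable P a (oscale c (R i S n))" by (rule bulletable_scale[OF lin b[OF Sn]])
  have "F (pscale c x + y) = pscale c (F x) + F y" by (simp add: F)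
  then have "F (pscale c x + y) \<in> mspan i"
    "compare i (F (pscale c x + y)) = oscale c (a \<^sub>\<bullet> R i S n) + (a \<^sub>\<bullet> compare i y)"
    using s y by (simp_all add: x mspan_closed compare_add compare_scale)
  then have "F (pscale c x + y) \<in> mspan i \<and> compare i (F (pscale c x + y)) = a \<^sub>\<bullet> compare i (pscale c x + y)
      \<and> bulletable P a (compare i (pscale c x + y))"
    unfolding cx bullet_add[OF lin bc y(3)] bullet_scale[OF lin b[OF Sn]]
    using bulletable_add[OF lin bc y(3)] by blast
  then show ?case by (simp only: plus_fun_def mspan_def)
qed

lemma ps_conv_scale:
  fixes u :: "('n::{finite,linorder}, 'n uq) ps"
  shows "ps_conv cact u (pscale c f) = pscale c (ps_conv cact u f)"
proof
  fix m
  have "cact x (fscale c y) = fscale c (cact x y)" for x :: "'n uq" and y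
    using C.act_scl[of x c y] unfolding cact_scl .
  then show "ps_conv cact u (pscale c f) m = pscale c (ps_conv cact u f) m"
    by (simp add: ps_conv_def pscale_def FS.scale_sum_right)
qed

lemma basis_hop:
  assumes "(S, n) \<in> basis i" "hop a b S \<in> configs (CARD('n::{finite,linorder}) + 1) (idx (i :: 'n))"
  shows "(hop a b S, n) \<in> basis i"
  using assms by (simp add: basis_def)

lemma basis_bump:
  fixes i j :: "'n::{finite,linorder}"
  assumes "(S, n) \<in> basis i" and one: "idx j \<in> T \<longleftrightarrow> Suc (idx j) \<notin> T" and T: "T \<in> configs (CARD('n) + 1) (idx i)"
  shows "(S, bump j (cnt T (idx j)) n) \<in> basis i"
proof -
  have "valid (CARD('n) + 1) (idx i) (idx j) (cnt T (idx j))"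
    using idx_ge1[of j] idx_le[of j] by (intro valid_cnt[OF T _ _ one]) auto
  then show ?thesis using assms(1) by (auto simp: basis_def bump_def)
qed

lemma x_op_linear: "V_linear (\<lambda>v. x_op s j v t)" and psi_op_linear: "V_linear (\<lambda>v. psi_op j v t)"
  and phi_op_linear: "V_linear (\<lambda>v. phi_op j v t)"
  unfolding x_op_vop psi_op_vop phi_op_vop by (rule vop_linear)+

theorem
  fixes i j :: "'n::{finite,linorder}"
  assumes f: "f \<in> mspan i"
  shows compare_f: "ps_conv cact (f_bar j) f \<in> mspan i" "compare i (ps_conv cact (f_bar j) f) = x_op (- 1) j \<^sub>\<bullet> compare i f"
    and compare_e: "ps_conv cact (e_bar j) f \<in> mspan i" "compare i (ps_conv cact (e_bar j) f) = x_op 1 j \<^sub>\<bullet> compare i f"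
    and compare_k: "ps_conv cact (k_bar j) f \<in> mspan i" "compare i (ps_conv cact (k_bar j) f) = psi_op j \<^sub>\<bullet> compare i f"
    and compare_phi: "phi_op j \<^sub>\<bullet> compare i f = 0"
proof -
  note lin = C.ps_conv_add ps_conv_scale
  have "ps_conv cact (f_bar j) f \<in> mspan i \<and> compare i (ps_conv cact (f_bar j) f) = x_op (- 1) j \<^sub>\<bullet> compare i f
    \<and> bulletable (clearing i (\<lambda>S. pole_f (idx i) S (idx j))) (x_op (- 1) j) (compare i f)"
  proof (rule intertwining[OF x_op_linear lin _ _ f])
    fix S and n :: "'n mult" assume Sn: "(S, n) \<in> basis i"
    note S = basis_config[OF Sn]
    show "bulletable (clearing i (\<lambda>S. pole_f (idx i) S (idx j))) (x_op (- 1) j) (R i S n)" by (rule bulletable_R(1)[OF S])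
    show "ps_conv cact (f_bar j) (model i S n) \<in> mspan i \<and> compare i (ps_conv cact (f_bar j) (model i S n)) = x_op (- 1) j \<^sub>\<bullet> R i S n"
    proof (cases "idx j \<in> S \<and> Suc (idx j) \<notin> S")
      case True
      then have "hop (idx j) (Suc (idx j)) S \<in> configs (CARD('n) + 1) (idx i)"
        using S hop_configs_iff by blast
      from basis_hop[OF Sn this] show ?thesis unfolding f_model[OF S] f_R[OF S] if_P[OF True]
        by (simp add: compare_scale compare_model mspan_closed model_mspan)
    next
      case False
      show ?thesis unfolding f_model[OF S] f_R[OF S] if_not_P[OF False] by (simp add: mspan_closed)
    qed
  qed
  then show "ps_conv cact (f_bar j) f \<in> mspan i" "compare i (ps_conv cact (f_bar j) f) = x_op (- 1) j \<^sub>\<bullet> compare i f" by blast+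
  have "ps_conv cact (e_bar j) f \<in> mspan i \<and> compare i (ps_conv cact (e_bar j) f) = x_op 1 j \<^sub>\<bullet> compare i f
    \<and> bulletable (clearing i (\<lambda>S. pole_e (idx i) S (idx j))) (x_op 1 j) (compare i f)"
  proof (rule intertwining[OF x_op_linear lin _ _ f])
    fix S and n :: "'n mult" assume Sn: "(S, n) \<in> basis i"
    note S = basis_config[OF Sn]
    show "bulletable (clearing i (\<lambda>S. pole_e (idx i) S (idx j))) (x_op 1 j) (R i S n)" by (rule bulletable_R(2)[OF S])
    show "ps_conv cact (e_bar j) (model i S n) \<in> mspan i \<and> compare i (ps_conv cact (e_bar j) (model i S n)) = x_op 1 j \<^sub>\<bullet> R i S n"
    proof (cases "idx j \<notin> S \<and> Suc (idx j) \<in> S")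
      case True
      then have "hop (Suc (idx j)) (idx j) S \<in> configs (CARD('n) + 1) (idx i)"
        using idx_ge1[of j] idx_le[of j] by (intro hop_configs[OF S]) auto
      from basis_hop[OF basis_bump[OF Sn _ S] this, of j] True show ?thesis unfolding e_model[OF S] e_R[OF S] if_P[OF True]
        by (simp add: compare_scale compare_model mspan_closed model_mspan)
    next
      case False
      show ?thesis unfolding e_model[OF S] e_R[OF S] if_not_P[OF False] by (simp add: mspan_closed)
    qed
  qed
  then show "ps_conv cact (e_bar j) f \<in> mspan i" "compare i (ps_conv cact (e_bar j) f) = x_op 1 j \<^sub>\<bullet> compare i f" by blast+
  have "ps_conv cact (k_bar j) f \<in> mspan i \<and> compare i (ps_conv cact (k_bar j) f) = psi_op j \<^sub>\<bullet> compare i f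
    \<and> bulletable (clearing i (\<lambda>S. pole_k (idx i) S (idx j))) (psi_op j) (compare i f)"
  proof (rule intertwining[OF psi_op_linear lin _ _ f])
    fix S and n :: "'n mult" assume Sn: "(S, n) \<in> basis i"
    note S = basis_config[OF Sn]
    show "bulletable (clearing i (\<lambda>S. pole_k (idx i) S (idx j))) (psi_op j) (R i S n)" by (rule bulletable_R(3)[OF S])
    show "ps_conv cact (k_bar j) (model i S n) \<in> mspan i \<and> compare i (ps_conv cact (k_bar j) (model i S n)) = psi_op j \<^sub>\<bullet> R i S n"
    proof (cases "idx j \<in> S \<longleftrightarrow> Suc (idx j) \<in> S")
      case True
      show ?thesis unfolding k_model[OF S] k_R[OF S] mu_vanish[OF True] by (simp add: mspan_closed)
    next
      case False
      then have "(S, bump j (cnt S (idx j)) n) \<in> basis i" using basis_bump[OF Sn _ S, of j] by blast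
      then show ?thesis unfolding k_model[OF S] k_R[OF S]
        by (simp add: compare_scale compare_model mspan_closed model_mspan)
    qed
  qed
  then show "ps_conv cact (k_bar j) f \<in> mspan i" "compare i (ps_conv cact (k_bar j) f) = psi_op j \<^sub>\<bullet> compare i f" by blast+
  have "0 \<in> mspan i \<and> compare i 0 = phi_op j \<^sub>\<bullet> compare i f \<and> bulletable (clearing i (\<lambda>S. 0)) (phi_op j) (compare i f)"
  proof (rule intertwining[OF phi_op_linear _ _ _ _ f, where F = "\<lambda>_. 0"])
    fix S and n :: "'n mult" assume Sn: "(S, n) \<in> basis i"
    show "bulletable (clearing i (\<lambda>S. 0)) (phi_op j) (R i S n)" by (rule bulletable_R(4)[OF basis_config[OF Sn]])
  qed (simp_all add: phi_R mspan_closed)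
  then show "phi_op j \<^sub>\<bullet> compare i f = 0" by simp
qed

section \<open>The isomorphism\<close>

lemma ps_const_ctop: "ps_const (ctop i) = model i {1..idx i} (\<lambda>_ _. 0)"
proof (intro ext)
  fix m :: "'a \<Rightarrow> nat" and T
  show "ps_const (ctop i) m T = model i {1..idx i} (\<lambda>_ _. 0) m T"
  proof (cases "\<forall>k. m k = 0")
    case False
    then obtain k where k: "m k \<noteq> 0" by blast
    then have "(\<Prod>j\<in>UNIV. 0 ^ m j / fact (m j)) = (0 :: scal)" by (intro prod_zero) (auto intro!: bexI[of _ k])
    then show ?thesis unfolding ps_const_def if_not_P[OF False] by (simp add: model_def expvec_def yval_def)
  qed (simp add: ps_const_def model_def expvec_def yval_def ctop_def)
qed

text \<open>The module \<open>L(\<lambda>\<^sub>i)\<^sub>z\<close> for the concrete realisation of \<open>L(\<lambda>\<^sub>i)\<close>.\<close>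

abbreviation cyclic :: "'n::{finite,linorder} \<Rightarrow> (('n \<Rightarrow> nat) \<Rightarrow> nat set \<Rightarrow> scal) set" where
  "cyclic i \<equiv> Lz cact (ctop i)"

lemma Uz_scalar:
  fixes i :: "'n::{finite,linorder}" and f :: "('n \<Rightarrow> nat) \<Rightarrow> nat set \<Rightarrow> scal"
  shows "ps_conv cact (ps_const (uq_const c) :: ('n, 'n uq) ps) f = pscale c f"
  by (simp add: C.ps_conv_const_left cact_scl pscale_def)

lemma Uz_invariant:
  assumes add: "\<And>f g. f \<in> X \<Longrightarrow> g \<in> X \<Longrightarrow> f + g \<in> X" and sc: "\<And>c f. f \<in> X \<Longrightarrow> pscale c f \<in> X"
    and gen: "\<And>j f. f \<in> X \<Longrightarrow> ps_conv cact (e_bar j) f \<in> X"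
      "\<And>j f. f \<in> X \<Longrightarrow> ps_conv cact (f_bar j) f \<in> X" "\<And>j f. f \<in> X \<Longrightarrow> ps_conv cact (k_bar j) f \<in> X"
    and u: "u \<in> Uz" and f: "f \<in> X"
  shows "ps_conv cact u f \<in> X"
  using u f
proof (induction arbitrary: f rule: Uz.induct)
  case (scalar c)
  then show ?case unfolding Uz_scalar by (rule sc)
next
  case (add u u')
  then show ?case unfolding C.ps_conv_plus by (intro assms(1)) auto
next
  case (mult u u')
  then show ?case unfolding C.ps_conv_mult by blast
qed (simp_all add: gen)

lemma Uz_mspan: "u \<in> Uz \<Longrightarrow> f \<in> mspan i \<Longrightarrow> ps_conv cact u f \<in> mspan i"
  by (rule Uz_invariant[where X = "mspan i"]) (simp_all add: mspan_closed compare_e compare_f compare_k)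

lemma cyclic_mspan: "cyclic i \<subseteq> mspan i"
  unfolding Lz_def using Uz_mspan[OF _ model_mspan[OF top_basis]] by (auto simp: ps_const_ctop)

lemma cyclicI: "u \<in> Uz \<Longrightarrow> ps_conv cact u (ps_const (ctop i)) \<in> cyclic i"
  by (auto simp: Lz_def)

lemma cyclic_closed:
  "u \<in> Uz \<Longrightarrow> f \<in> cyclic i \<Longrightarrow> ps_conv cact u f \<in> cyclic i"
  "f \<in> cyclic i \<Longrightarrow> g \<in> cyclic i \<Longrightarrow> f + g \<in> cyclic i" "pscale c (ps_const (ctop i)) \<in> cyclic i"
proof -
  show "pscale c (ps_const (ctop i)) \<in> cyclic i" using cyclicI[OF Uz.scalar[of c], of i] unfolding Uz_scalar .
qed (auto simp: Lz_def simp flip: C.ps_conv_mult C.ps_conv_plus intro: Uz.intros)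

lemma cyclic_scale: "f \<in> cyclic i \<Longrightarrow> pscale c f \<in> cyclic i"
  using cyclic_closed(1)[OF Uz.scalar[of c]] unfolding Uz_scalar .

lemma cyclic_top: "ps_const (ctop i) \<in> cyclic i" and cyclic_zero: "0 \<in> cyclic i"
  using cyclic_closed(3)[of 1 i] cyclic_closed(3)[of 0 i] by simp_all

text \<open>Iterated products are nested from the right, so each is zero, if a \<open>\<phi>\<^sub>j\<close> occurs, or the image
  of a monomial in the generators applied to the highest weight vector. Conversely the preimage of the iterated products is stable under the generators,
  hence its span is stable under the whole algebra.\<close>

theorem compare_image: "compare i ` cyclic i = Y_space i" for i :: "'n::{finite,linorder}"
proof
  have top: "compare i (ps_const (ctop i)) = Y_op i"
    unfolding ps_const_ctop compare_model[OF top_basis] by (rule R_top)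
  show "Y_space i \<subseteq> compare i ` cyclic i" unfolding Y_space_def
  proof (rule O.span_minimal)
    show "O.subspace (compare i ` cyclic i)"
      unfolding O.subspace_def
    proof (intro conjI ballI allI)
      show "0 \<in> compare i ` cyclic i" by (rule image_eqI[OF _ cyclic_zero]) simp
    qed (auto simp flip: compare_add compare_scale intro: cyclic_closed cyclic_scale)
    show "iter_prods i \<subseteq> compare i ` cyclic i"
    proof
      fix b assume "b \<in> iter_prods i"
      then show "b \<in> compare i ` cyclic i"
      proof induction
        case base
        show ?case unfolding top[symmetric] using cyclic_top by (rule imageI)
      next
        case (x_plus b j)
        then obtain f where f: "f \<in> cyclic i" "b = compare i f" by blast
        then have "x_op 1 j \<^sub>\<bullet> b = compare i (ps_conv cact (e_bar j) f)"
          using cyclic_mspan by (subst compare_e(2)) auto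
        then show ?case using cyclic_closed(1)[OF Uz.e f(1)] by blast
      next
        case (x_minus b j)
        then obtain f where f: "f \<in> cyclic i" "b = compare i f" by blast
        then have "x_op (- 1) j \<^sub>\<bullet> b = compare i (ps_conv cact (f_bar j) f)"
          using cyclic_mspan by (subst compare_f(2)) auto
        then show ?case using cyclic_closed(1)[OF Uz.f f(1)] by blast
      next
        case (psi b j)
        then obtain f where f: "f \<in> cyclic i" "b = compare i f" by blast
        then have "psi_op j \<^sub>\<bullet> b = compare i (ps_conv cact (k_bar j) f)"
          using cyclic_mspan by (subst compare_k(2)) auto
        then show ?case using cyclic_closed(1)[OF Uz.k f(1)] by blast
      next
        case (phi b j)
        then obtain f where f: "f \<in> cyclic i" "b = compare i f" by blast
        then have "phi_op j \<^sub>\<bullet> b = compare i 0"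
          using cyclic_mspan compare_phi[of f i j] by auto
        then show ?case using cyclic_zero by blast
      qed
    qed
  qed
  define J where "J = {f \<in> mspan i. compare i f \<in> iter_prods i}"
  have span_mem: "ps_conv cact u f \<in> PS.span J"
    if u: "\<And>f. f \<in> J \<Longrightarrow> ps_conv cact u f \<in> J" and f: "f \<in> PS.span J" for u :: "('n, 'n uq) ps" and f
    using f
  proof (induction rule: PS.span_induct_alt)
    case base
    have "ps_conv cact u 0 = 0" using C.ps_conv_add[of u 0 0] by simp
    then have "ps_conv cact u 0 \<in> PS.span J" using PS.span_zero[of J] by simp
    then show ?case by (simp only: zero_fun_def)
  next
    case (step c x y)
    then show ?case unfolding C.ps_conv_add ps_conv_scale
      by (intro PS.span_add PS.span_scale) (auto intro: u PS.span_base)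
  qed
  have gens: "ps_conv cact (e_bar j) f \<in> J" "ps_conv cact (f_bar j) f \<in> J" "ps_conv cact (k_bar j) f \<in> J"
    if "f \<in> J" for j f
    using that by (simp_all add: J_def compare_e compare_f compare_k iter_prods.intros)
  have J: "compare i f \<in> Y_space i" if "f \<in> PS.span J" for f
    using that
  proof (induction rule: PS.span_induct_alt)
    case base
    have "compare i 0 \<in> Y_space i" by (simp add: Y_space_def O.span_zero)
    then show ?case by (simp only: zero_fun_def)
  next
    case (step c x y)
    then show ?case unfolding compare_add compare_scale Y_space_def
      by (intro O.span_add O.span_scale) (auto simp: J_def intro: O.span_base)
  qed
  have "ps_const (ctop i) \<in> PS.span J"
    using model_mspan[OF top_basis[of i]] unfolding ps_const_ctop[symmetric]
    by (intro PS.span_base) (simp add: J_def top iter_prods.base)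
  then have "ps_conv cact u (ps_const (ctop i)) \<in> PS.span J" if "u \<in> Uz" for u
    by (intro Uz_invariant[where X = "PS.span J", OF _ _ _ _ _ that])
      (simp_all add: PS.span_add PS.span_scale span_mem gens)
  then show "compare i ` cyclic i \<subseteq> Y_space i" using J by (auto simp: Lz_def)
qed

lemma compare_bij: "bij_betw (compare i) (cyclic i) (Y_space i)"
  unfolding bij_betw_def using compare_image inj_on_subset[OF compare_inj cyclic_mspan] by blast

definition Yact :: "'n::{finite,linorder} \<Rightarrow> ('n, 'n uq) ps \<Rightarrow> 'n oper \<Rightarrow> 'n oper" where
  "Yact i u a = compare i (ps_conv cact u (inv_into (cyclic i) (compare i) a))"

lemma Yact_compare: "f \<in> cyclic i \<Longrightarrow> Yact i u (compare i f) = compare i (ps_conv cact u f)"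
  unfolding Yact_def using bij_betw_inv_into_left[OF compare_bij[of i], of f] by simp

lemma Yact_module: "uz_module oscale (Y_space i) (Yact i)" for i :: "'n::{finite,linorder}"
proof -
  have Y: "\<exists>f\<in>cyclic i. a = compare i f" if "a \<in> Y_space i" for a
    using that unfolding compare_image[symmetric] by blast
  have mem: "compare i f \<in> Y_space i" if "f \<in> cyclic i" for f
    using that unfolding compare_image[symmetric] by (rule imageI)
  show ?thesis unfolding uz_module_def
  proof (intro conjI ballI allI)
    show "O.subspace (Y_space i)" unfolding Y_space_def by (rule O.subspace_span)
  next
    fix u :: "('n, 'n uq) ps" and a assume "u \<in> Uz" "a \<in> Y_space i"
    then show "Yact i u a \<in> Y_space i" using Y[of a] by (auto simp: Yact_compare intro: mem[OF cyclic_closed(1)])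
  next
    fix u :: "('n, 'n uq) ps" and a b assume "u \<in> Uz" "a \<in> Y_space i" "b \<in> Y_space i"
    then obtain f g where fg: "f \<in> cyclic i" "a = compare i f" "g \<in> cyclic i" "b = compare i g" using Y by blast
    have "Yact i u (a + b) = compare i (ps_conv cact u (f + g))"
      unfolding fg compare_add[symmetric] by (rule Yact_compare[OF cyclic_closed(2)[OF fg(1,3)]])
    then show "Yact i u (a + b) = Yact i u a + Yact i u b"
      by (simp add: fg Yact_compare C.ps_conv_add compare_add)
  next
    fix u u' :: "('n, 'n uq) ps" and a assume u: "u \<in> Uz" "u' \<in> Uz" "a \<in> Y_space i"
    then obtain f where f: "f \<in> cyclic i" "a = compare i f" using Y by blast
    show "Yact i (u + u') a = Yact i u a + Yact i u' a"
      by (simp add: f Yact_compare C.ps_conv_plus compare_add)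
    show "Yact i (ps_mult u u') a = Yact i u (Yact i u' a)"
      by (simp add: f Yact_compare C.ps_conv_mult cyclic_closed(1)[OF u(2)])
  next
    fix c a assume "a \<in> Y_space i"
    then obtain f where f: "f \<in> cyclic i" "a = compare i f" using Y by blast
    show "Yact i (ps_const (uq_const c)) a = oscale c a"
      by (simp add: f Yact_compare Uz_scalar compare_scale)
  qed
qed

lemma Yact_generators:
  assumes "a \<in> Y_space i"
  shows "Yact i (e_bar j) a = x_op 1 j \<^sub>\<bullet> a" "Yact i (f_bar j) a = x_op (- 1) j \<^sub>\<bullet> a" "Yact i (k_bar j) a = psi_op j \<^sub>\<bullet> a"
proof -
  obtain f where f: "f \<in> cyclic i" "a = compare i f" using assms unfolding compare_image[symmetric] by blast
  then have "f \<in> mspan i" using cyclic_mspan by blast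
  then show "Yact i (e_bar j) a = x_op 1 j \<^sub>\<bullet> a" "Yact i (f_bar j) a = x_op (- 1) j \<^sub>\<bullet> a" "Yact i (k_bar j) a = psi_op j \<^sub>\<bullet> a"
    by (simp_all only: f(2) Yact_compare[OF f(1)] compare_e compare_f compare_k)
qed

text \<open>The generators determine a module structure.\<close>

lemma equivariant:
  assumes mod: "uz_module oscale (Y_space i) \<rho>"
    and gen: "\<And>j a. a \<in> Y_space i \<Longrightarrow> \<rho> (e_bar j) a = x_op 1 j \<^sub>\<bullet> a" "\<And>j a. a \<in> Y_space i \<Longrightarrow> \<rho> (f_bar j) a = x_op (- 1) j \<^sub>\<bullet> a"
      "\<And>j a. a \<in> Y_space i \<Longrightarrow> \<rho> (k_bar j) a = psi_op j \<^sub>\<bullet> a"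
    and u: "u \<in> Uz" and f: "f \<in> cyclic i"
  shows "compare i (ps_conv cact u f) = \<rho> u (compare i f)"
proof -
  have mem: "compare i f \<in> Y_space i" if "f \<in> cyclic i" for f
    using that unfolding compare_image[symmetric] by (rule imageI)
  have m: "f \<in> mspan i" if "f \<in> cyclic i" for f using that cyclic_mspan by blast
  show ?thesis using u f
  proof (induction arbitrary: f rule: Uz.induct)
    case (scalar c)
    then show ?case using mod mem by (simp add: Uz_scalar compare_scale uz_module_def)
  next
    case (e j)
    then show ?case by (simp add: compare_e m gen mem)
  next
    case (f j)
    then show ?case by (simp add: compare_f m gen mem)
  next
    case (k j)
    then show ?case by (simp add: compare_k m gen mem)
  next
    case (add u u')
    have "\<rho> (u + u') (compare i f) = \<rho> u (compare i f) + \<rho> u' (compare i f)"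
      using mod add.hyps mem[OF add.prems] unfolding uz_module_def by blast
    then have "compare i (ps_conv cact (u + u') f) = \<rho> (u + u') (compare i f)"
      unfolding C.ps_conv_plus compare_add add.IH(1)[OF add.prems] add.IH(2)[OF add.prems] by (rule sym)
    then show ?case by (simp only: plus_fun_def)
  next
    case (mult u u')
    have "\<rho> (ps_mult u u') (compare i f) = \<rho> u (\<rho> u' (compare i f))"
      using mod mult.hyps mem[OF mult.prems] unfolding uz_module_def by blast
    then show ?case
      unfolding C.ps_conv_mult mult.IH(1)[OF cyclic_closed(1)[OF mult.hyps(2) mult.prems]] mult.IH(2)[OF mult.prems]
      by (rule sym)
  qed
qed

text \<open>The map \<open>u v \<mapsto> u ctop\<close> is well defined and injective, because the coefficients of \<open>u\<close> can be compared separately and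
  the two annihilators agree.\<close>

lemma cyclic_isomorphism:
  fixes act :: "'n::{finite,linorder} uq \<Rightarrow> 'l::ab_group_add \<Rightarrow> 'l"
  assumes irr: "irr_hw_module act (lam i) v"
  shows "uz_isomorphic (Lz act v) (ps_conv act) (cyclic i) (ps_conv cact)"
proof -
  interpret m: uq_mod act by (rule irr_hw_moduleD(1)[OF irr])
  have key: "ps_conv act u (ps_const v) = ps_conv act u' (ps_const v)
    \<longleftrightarrow> ps_conv cact u (ps_const (ctop i)) = ps_conv cact u' (ps_const (ctop i))" for u u' :: "('n, 'n uq) ps"
  proof -
    have "act (u m) v = act (u' m) v \<longleftrightarrow> cact (u m) (ctop i) = cact (u' m) (ctop i)" for m
      using annihilators_equal[OF irr, of "u m - u' m"] by (simp add: m.act_minus C.act_minus)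
    then show ?thesis by (simp add: m.ps_conv_const_right C.ps_conv_const_right fun_eq_iff[of "\<lambda>m. act (u m) v"] fun_eq_iff[of "\<lambda>m. cact (u m) (ctop i)"])
  qed
  define \<theta> :: "('n, 'l) ps \<Rightarrow> ('n \<Rightarrow> nat) \<Rightarrow> nat set \<Rightarrow> scal" where "\<theta> g = ps_conv cact (SOME u. u \<in> Uz \<and> g = ps_conv act u (ps_const v)) (ps_const (ctop i))" for g
  have \<theta>: "\<theta> (ps_conv act u (ps_const v)) = ps_conv cact u (ps_const (ctop i))" if "u \<in> Uz" for u :: "('n, 'n uq) ps"
  proof -
    define w where "w = (SOME w. w \<in> Uz \<and> ps_conv act u (ps_const v) = ps_conv act w (ps_const v))"
    have "w \<in> Uz \<and> ps_conv act u (ps_const v) = ps_conv act w (ps_const v)"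
      unfolding w_def by (rule someI[of _ u]) (simp add: that)
    then show ?thesis unfolding \<theta>_def w_def[symmetric] using key[of u w] by simp
  qed
  show ?thesis unfolding uz_isomorphic_def
  proof (intro exI[of _ \<theta>] conjI ballI)
    show "bij_betw \<theta> (Lz act v) (cyclic i)"
    proof (rule bij_betw_imageI)
      show "inj_on \<theta> (Lz act v)"
        by (rule inj_onI) (auto simp: Lz_def \<theta> key)
      show "\<theta> ` Lz act v = cyclic i"
        by (auto simp: Lz_def \<theta> image_iff) (metis \<theta>)
    qed
  next
    fix x y assume "x \<in> Lz act v" "y \<in> Lz act v"
    then obtain u u' :: "('n, 'n uq) ps" where u: "u \<in> Uz" "u' \<in> Uz" "x = ps_conv act u (ps_const v)" "y = ps_conv act u' (ps_const v)"
      by (auto simp: Lz_def)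
    show "\<theta> (x + y) = \<theta> x + \<theta> y"
      unfolding u(3,4) m.ps_conv_plus[symmetric] \<theta>[OF Uz.add[OF u(1,2)]] \<theta>[OF u(1)] \<theta>[OF u(2)] by (rule C.ps_conv_plus)
  next
    fix u' :: "('n, 'n uq) ps" and x assume u': "u' \<in> Uz" and "x \<in> Lz act v"
    then obtain u :: "('n, 'n uq) ps" where u: "u \<in> Uz" "x = ps_conv act u (ps_const v)" by (auto simp: Lz_def)
    show "\<theta> (ps_conv act u' x) = ps_conv cact u' (\<theta> x)"
      unfolding u(2) m.ps_conv_mult[symmetric] \<theta>[OF Uz.mult[OF u' u(1)]] \<theta>[OF u(1)] by (rule C.ps_conv_mult)
  qed
qed

theorem theorem3p3:
  fixes i :: "'n::{finite,linorder}"
  shows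
    "(\<exists>\<rho>. uz_module oscale (Y_space i) \<rho> \<and>
        (\<forall>j. \<forall>a\<in>Y_space i.
           \<rho> (e_bar j) a = x_op 1 j \<^sub>\<bullet> a \<and>
           \<rho> (f_bar j) a = x_op (- 1) j \<^sub>\<bullet> a \<and>
           \<rho> (k_bar j) a = psi_op j \<^sub>\<bullet> a)) \<and>
     (\<forall>\<rho> (act :: 'n uq \<Rightarrow> 'l::ab_group_add \<Rightarrow> 'l) v.
        uz_module oscale (Y_space i) \<rho> \<longrightarrow>
        (\<forall>j. \<forall>a\<in>Y_space i.
           \<rho> (e_bar j) a = x_op 1 j \<^sub>\<bullet> a \<and>
           \<rho> (f_bar j) a = x_op (- 1) j \<^sub>\<bullet> a \<and>
           \<rho> (k_bar j) a = psi_op j \<^sub>\<bullet> a) \<longrightarrow>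
        irr_hw_module act (lam i) v \<longrightarrow>
        uz_isomorphic (Lz act v) (ps_conv act) (Y_space i) \<rho>)"
proof (intro conjI allI impI)
  show "\<exists>\<rho>. uz_module oscale (Y_space i) \<rho> \<and>
        (\<forall>j. \<forall>a\<in>Y_space i. \<rho> (e_bar j) a = x_op 1 j \<^sub>\<bullet> a \<and> \<rho> (f_bar j) a = x_op (- 1) j \<^sub>\<bullet> a \<and>
           \<rho> (k_bar j) a = psi_op j \<^sub>\<bullet> a)"
    using Yact_module[of i] Yact_generators[of _ i] by blast
next
  fix \<rho> and act :: "'n uq \<Rightarrow> 'l \<Rightarrow> 'l" and v
  assume mod: "uz_module oscale (Y_space i) \<rho>"
    and gen: "\<forall>j. \<forall>a\<in>Y_space i. \<rho> (e_bar j) a = x_op 1 j \<^sub>\<bullet> a \<and> \<rho> (f_bar j) a = x_op (- 1) j \<^sub>\<bullet> a \<and>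
           \<rho> (k_bar j) a = psi_op j \<^sub>\<bullet> a"
    and irr: "irr_hw_module act (lam i) v"
  obtain \<theta> where \<theta>: "bij_betw \<theta> (Lz act v) (cyclic i)"
    "\<forall>x\<in>Lz act v. \<forall>y\<in>Lz act v. \<theta> (x + y) = \<theta> x + \<theta> y"
    "\<forall>u\<in>Uz. \<forall>x\<in>Lz act v. \<theta> (ps_conv act u x) = ps_conv cact u (\<theta> x)"
    using cyclic_isomorphism[OF irr] unfolding uz_isomorphic_def by blast
  have mem: "\<theta> x \<in> cyclic i" if "x \<in> Lz act v" for x using bij_betwE[OF \<theta>(1)] that by blast
  show "uz_isomorphic (Lz act v) (ps_conv act) (Y_space i) \<rho>"
    unfolding uz_isomorphic_def
  proof (intro exI[of _ "compare i \<circ> \<theta>"] conjI ballI)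
    show "bij_betw (compare i \<circ> \<theta>) (Lz act v) (Y_space i)" by (rule bij_betw_trans[OF \<theta>(1) compare_bij])
  next
    fix x y assume "x \<in> Lz act v" "y \<in> Lz act v"
    then show "(compare i \<circ> \<theta>) (x + y) = (compare i \<circ> \<theta>) x + (compare i \<circ> \<theta>) y" using \<theta>(2) by (simp add: compare_add)
  next
    fix u :: "('n, 'n uq) ps" and x assume ux: "u \<in> Uz" "x \<in> Lz act v"
    then have "\<theta> (ps_conv act u x) = ps_conv cact u (\<theta> x)" using \<theta>(3) by blast
    then show "(compare i \<circ> \<theta>) (ps_conv act u x) = \<rho> u ((compare i \<circ> \<theta>) x)"
      using equivariant[OF mod _ _ _ ux(1) mem[OF ux(2)]] gen by simp
  qed
qed

end
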